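(* Let $d\ge2$, $0<\gamma\le\frac{4}{d+3}$, $n_0\in L^1(\mathbb{R}^d)$ with $n_0\ge0$, and let $n$ be the solution of $$\frac{\partial n}{\partial t}=\nabla\cdot(n\nabla p)\quad\text{in }(0,\infty)\times\mathbb{R}^d,\qquad p=n^\gamma,\qquad n(0,\cdot)=n_0.$$ Then the quantity $\max_x|\nabla n(t,x)|^2$ decreases in time. Moreover, if $\gamma<\frac4{d+3}$, then there exists a constant $C>0$ such that $$\max_x|\nabla n(t,x)|^2\le C\,t^{-1-\alpha d(2-\gamma)}\qquad\text{for all }t>0,$$ where $\alpha=\frac1{d\gamma+2}$.
   Context: The equation is equivalent to the porous medium equation $\partial_t n=\frac{\gamma}{\gamma+1}\Delta n^{\gamma+1}$. "The solution" is the unique nonnegative strong (continuous for $t>0$) solution of the Cauchy problem with initial datum $n_0$. The notation $\max_x$ denotes the (essential) supremum over $x\in\mathbb{R}^d$, possibly $+\infty$, and "decreases" means non-increasing. *)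

theory Defs
  imports "HOL-Analysis.Analysis" "HOL-Probability.Essential_Supremum"
begin

text \<open>\<^term>\<open>C_diff k f\<close>: the function \<^term>\<open>f\<close> is of class \<open>C\<^sup>k\<close> on the whole space.\<close>

primrec C_diff :: "nat \<Rightarrow> ('a::euclidean_space \<Rightarrow> real) \<Rightarrow> bool" where
  "C_diff 0 f \<longleftrightarrow> continuous_on UNIV f"
| "C_diff (Suc k) f \<longleftrightarrow>
     (\<forall>x. f differentiable (at x)) \<and> (\<forall>v. C_diff k (\<lambda>x. frechet_derivative f (at x) v))"

definition test_functions :: "'a::euclidean_space set \<Rightarrow> ('a \<Rightarrow> real) set" where
  "test_functions \<Omega> =
     {\<phi>. (\<forall>k. C_diff k \<phi>) \<and> (\<exists>K. compact K \<and> K \<subseteq> \<Omega> \<and> (\<forall>x. x \<notin> K \<longrightarrow> \<phi> x = 0))}"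

definition locally_integrable ::
  "'a::euclidean_space set \<Rightarrow> ('a \<Rightarrow> 'b::euclidean_space) \<Rightarrow> bool" where
  "locally_integrable \<Omega> u \<longleftrightarrow> (\<forall>K. compact K \<and> K \<subseteq> \<Omega> \<longrightarrow> set_integrable lborel K u)"

text \<open>\<^term>\<open>w\<close> is the weak derivative of \<^term>\<open>u\<close> on \<^term>\<open>\<Omega>\<close> in the direction \<^term>\<open>v\<close>.\<close>

definition weak_directional_derivative ::
  "'a::euclidean_space set \<Rightarrow> 'a \<Rightarrow> ('a \<Rightarrow> real) \<Rightarrow> ('a \<Rightarrow> real) \<Rightarrow> bool" where
  "weak_directional_derivative \<Omega> v u w \<longleftrightarrow>
     locally_integrable \<Omega> u \<and> locally_integrable \<Omega> w \<and>
     (\<forall>\<phi>\<in>test_functions \<Omega>.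
        (LINT x|lborel. u x * frechet_derivative \<phi> (at x) v) = - (LINT x|lborel. w x * \<phi> x))"

definition weak_gradient :: "('a::euclidean_space \<Rightarrow> real) \<Rightarrow> ('a \<Rightarrow> 'a) \<Rightarrow> bool" where
  "weak_gradient u g \<longleftrightarrow>
     locally_integrable UNIV g \<and>
     (\<forall>v. weak_directional_derivative UNIV v u (\<lambda>x. g x \<bullet> v))"

text \<open>
  The essential supremum of the squared norm of the gradient of \<^term>\<open>u\<close>. Weak gradients are unique
  almost everywhere, so the infimum only selects one; it is \<open>\<infinity>\<close> if the distributional
  gradient of \<^term>\<open>u\<close> is not a locally integrable function.
\<close>

definition max_grad_sq :: "('a::euclidean_space \<Rightarrow> real) \<Rightarrow> ereal" where
  "max_grad_sq u = (INF g\<in>{g. weak_gradient u g}. esssup lborel (\<lambda>x. ereal ((norm (g x))\<^sup>2)))"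

definition space_time :: "(real \<times> 'a::euclidean_space) set" where
  "space_time = {0<..} \<times> UNIV"

definition weak_time_derivative ::
  "(real \<times> 'a::euclidean_space \<Rightarrow> real) \<Rightarrow> (real \<times> 'a \<Rightarrow> real) \<Rightarrow> bool" where
  "weak_time_derivative u w \<longleftrightarrow> weak_directional_derivative space_time (1, 0) u w"

definition weak_spatial_gradient ::
  "(real \<times> 'a::euclidean_space \<Rightarrow> real) \<Rightarrow> (real \<times> 'a \<Rightarrow> 'a) \<Rightarrow> bool" where
  "weak_spatial_gradient u g \<longleftrightarrow>
     locally_integrable space_time g \<and>
     (\<forall>v. weak_directional_derivative space_time (0, v) u (\<lambda>z. g z \<bullet> v))"

text \<open>
  Divergence in the space variables only. The derivative of a test function \<open>\<phi>\<close> at \<^term>\<open>z\<close> applied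
  to the vector \<^term>\<open>(0, F z)\<close> is the inner product of \<^term>\<open>F z\<close> with the spatial gradient of \<open>\<phi>\<close>.
\<close>

definition weak_spatial_divergence ::
  "(real \<times> 'a::euclidean_space \<Rightarrow> 'a) \<Rightarrow> (real \<times> 'a \<Rightarrow> real) \<Rightarrow> bool" where
  "weak_spatial_divergence F w \<longleftrightarrow>
     locally_integrable space_time F \<and> locally_integrable space_time w \<and>
     (\<forall>\<phi>\<in>test_functions space_time.
        (LINT z|lborel. frechet_derivative \<phi> (at z) (0, F z)) = - (LINT z|lborel. w z * \<phi> z))"

text \<open>
  Nonnegative strong \<open>L\<^sup>1\<close> solutions, continuous for positive times, of the Cauchy problem
  \<open>\<partial>\<^sub>t n = \<nabla> \<cdot> (n \<nabla> p)\<close> with \<open>p = n\<^sup>\<gamma>\<close> and \<open>n(0) = n\<^sub>0\<close>: the solution is a continuous curve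
  in \<open>L\<^sup>1\<close> up to \<open>t = 0\<close>, both sides of the equation are locally integrable functions, and
  they agree almost everywhere. Besides, \<open>n\<^sup>\<gamma>\<^sup>+\<^sup>1\<close> is required to be in
  \<open>L\<^sup>1\<^sub>l\<^sub>o\<^sub>c((0,\<infinity>); L\<^sup>1)\<close>, as usual for the form
  \<open>\<partial>\<^sub>t n = \<gamma>/(\<gamma>+1) \<Delta> n\<^sup>\<gamma>\<^sup>+\<^sup>1\<close> of the equation.
\<close>

definition strong_solution ::
  "real \<Rightarrow> ('a::euclidean_space \<Rightarrow> real) \<Rightarrow> (real \<Rightarrow> 'a \<Rightarrow> real) \<Rightarrow> bool" where
  "strong_solution \<gamma> n\<^sub>0 n \<longleftrightarrow>
     (\<forall>t>0. \<forall>x. n t x \<ge> 0) \<and>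
     continuous_on space_time (\<lambda>(t, x). n t x) \<and>
     (\<forall>t\<ge>0. integrable lborel (n t)) \<and>
     (\<forall>t\<ge>0. ((\<lambda>s. LINT x|lborel. \<bar>n s x - n t x\<bar>) \<longlongrightarrow> 0) (at t within {0..})) \<and>
     (AE x in lborel. n 0 x = n\<^sub>0 x) \<and>
     (\<forall>a b. 0 < a \<and> a < b \<longrightarrow>
        set_integrable lborel ({a..b} \<times> UNIV) (\<lambda>(t, x). n t x powr (\<gamma> + 1))) \<and>
     (\<exists>grad_p dt_n div_flux.
        weak_spatial_gradient (\<lambda>(t, x). n t x powr \<gamma>) grad_p \<and>
        weak_time_derivative (\<lambda>(t, x). n t x) dt_n \<and>
        weak_spatial_divergence (\<lambda>(t, x). n t x *\<^sub>R grad_p (t, x)) div_flux \<and>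
        (AE z in lborel. z \<in> space_time \<longrightarrow> dt_n z = div_flux z))"

end

theory Submission
 imports Defs "HOL-Probability.Distributions"
begin

text \<open>
 Write \<open>v = n + \<delta>\<close> and consider the implicit Euler scheme for
 \<open>\<partial>\<^sub>t n = \<gamma>/(\<gamma>+1) \<Delta> n\<^bsup>\<gamma>+1\<^esup>\<close>. At a maximum of \<open>v x - v y - l \<bar>x - y\<bar>\<close>, moving
 both points along a common direction, at different speeds, bounds the difference of the second-order
 terms by a multiple of \<open>(v(x)\<^bsup>\<gamma>/2\<^esup> - v(y)\<^bsup>\<gamma>/2\<^esup>)\<^sup>2 (d - 1)\<close>. The first-order term
 \<open>\<gamma>\<^sup>2 v\<^bsup>\<gamma>-1\<^esup> \<bar>\<nabla>v\<bar>\<^sup>2\<close> absorbs it exactly if \<open>\<gamma> \<le> 4/(d+3)\<close>. Hence an Euler step does not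
 increase the Lipschitz constant \<open>l\<close>, and it decreases \<open>l\<close> at the rate
 \<open>c l\<^sup>3 (sup v)\<^bsup>\<gamma>-2\<^esup>\<close> if the inequality is strict; since \<open>sup n\<close> is bounded in terms of \<open>l\<close>
 and the mass, this is the rate of the theorem.

 Kato's inequality for \<open>(n - v)\<^sub>+\<close>, with \<open>n\<close> the strong solution and \<open>v\<close> an Euler iterate, and
 Kobayashi's recursion for \<open>\<integral>(n(t) - v\<^sub>k)\<^sub>+\<close> give convergence of the scheme to the solution in
 \<open>L\<^sup>1\<close>, and \<open>L\<^sup>1\<close> limits inherit the Lipschitz constant.
\<close>

section \<open>Differentiation under the integral\<close>

text \<open>The solution is only continuous and the equation degenerates at \<open>n = 0\<close>, so
  no classical maximum principle applies to \<open>n\<close> itself. The shift by \<delta> makes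
  every Euler step uniformly elliptic with C^2 solutions, and the implicit discretisation asks only
  for elliptic theory, here for one explicit positive kernel. The speeds of the two points are the
  square roots of the diffusion coefficients \<gamma> v^\<gamma> at them, so that the second
  variation contains exactly the difference of the second-order terms. Cauchy-Schwarz bounds the
  squared difference of the speeds by the drop of v^(\<gamma>-1), the quantity in the first-order
  term, and the ratio of the constants is (d-1) \<gamma> / (4 (1-\<gamma>)), at most 1 iff \<gamma>
  \<le> 4/(d+3). Shifted iterates are not integrable, which is why only the positive part of n - v
  is compared; equality of masses supplies the other half of the L^1 distance. For the rate, sup n
  is at most of order l^(d/(d+1)), so l decays at least like a solution of l' = - c l^(1+\<mu>) with
  \<mu> = (\<gamma> d + 2)/(d + 1), and l^2 like t^(-2/\<mu>).\<close>

abbreviation lborel_integral :: "('a::euclidean_space \<Rightarrow> 'b::{banach, second_countable_topology}) \<Rightarrow> 'b" (binder "\<integral>" 10) where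
 "lborel_integral f \<equiv> integral\<^sup>L lborel f"

text \<open>These names would otherwise refer to the Henstock--Kurzweil integral.\<close>

lemmas integrable_bound = Bochner_Integration.integrable_bound
 and integral_mono = Bochner_Integration.integral_mono
 and integral_nonneg = Bochner_Integration.integral_nonneg
 and integral_cong = Bochner_Integration.integral_cong
 and integral_sum = Bochner_Integration.integral_sum
 and integral_norm_bound_integral = Bochner_Integration.integral_norm_bound_integral
 and integral_mono' = Bochner_Integration.integral_mono'
 and integrable_divide = Bochner_Integration.integrable_divide
 and integral_diff = Bochner_Integration.integral_diff
 and integrable_diff = Bochner_Integration.integrable_diff

text \<open>Dominated convergence for the remainder quotient \<open>q v y\<close>: the mean value
  inequality on the ball bounds it by \<open>2 * D y\<close>. The limit is taken along sequences,
  because dominated convergence is a statement about sequences.\<close>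

lemma GDERIV_under_integral:
 fixes f :: "'a::euclidean_space \<Rightarrow> 'b \<Rightarrow> real"
 assumes e: "e > 0"
  and der: "\<And>x y. x \<in> ball x0 e \<Longrightarrow> y \<in> space M \<Longrightarrow> GDERIV (\<lambda>x. f x y) x :> f' x y"
  and int: "\<And>x. x \<in> ball x0 e \<Longrightarrow> integrable M (f x)"
  and meas: "f' x0 \<in> borel_measurable M"
  and intD: "integrable M D"
  and dom: "\<And>x y. x \<in> ball x0 e \<Longrightarrow> y \<in> space M \<Longrightarrow> norm (f' x y) \<le> D y"
 shows "integrable M (f' x0)" "GDERIV (\<lambda>x. \<integral>y. f x y \<partial>M) x0 :> (\<integral>y. f' x0 y \<partial>M)"
proof -
 have x0: "x0 \<in> ball x0 e" using e by simp
 show int': "integrable M (f' x0)"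
  by (rule integrable_bound[OF intD meas]) (use dom[OF x0] in \<open>auto intro!: AE_I2 intro: order_trans[OF _ abs_ge_self]\<close>)
 define q where "q v y = (f (x0 + v) y - f x0 y - v \<bullet> f' x0 y) / norm v" for v y
 have bnd: "\<bar>f (x0 + v) y - f x0 y\<bar> \<le> D y * norm v" if v: "v \<in> ball 0 e" and y: "y \<in> space M" for v y
 proof -
  have "norm (f (x0 + v) y - f x0 y) \<le> D y * norm (x0 + v - x0)"
  proof (rule differentiable_bound[of "ball x0 e"])
   show "((\<lambda>x. f x y) has_derivative (\<lambda>h. h \<bullet> f' x y)) (at x within ball x0 e)" if "x \<in> ball x0 e" for x
    using der[OF that y] by (auto simp: gderiv_def intro: has_derivative_at_withinI)
   show "onorm (\<lambda>h. h \<bullet> f' x y) \<le> D y" if "x \<in> ball x0 e" for x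
   proof (rule onorm_bound)
    show "0 \<le> D y" using dom[OF that y] norm_ge_zero order_trans by blast
    show "norm (h \<bullet> f' x y) \<le> D y * norm h" for h
     using Cauchy_Schwarz_ineq2[of h "f' x y"] dom[OF that y]
     by (smt (verit) mult.commute mult_left_mono norm_ge_zero real_norm_def)
   qed
  qed (use v x0 in \<open>auto simp: dist_norm\<close>)
  then show ?thesis by simp
 qed
 have lim: "((\<lambda>v. \<integral>y. q v y \<partial>M) \<longlongrightarrow> (\<integral>y. 0 \<partial>M)) (at 0 within ball 0 e)"
  unfolding tendsto_at_iff_sequentially comp_def
 proof (intro allI impI)
  fix X :: "nat \<Rightarrow> 'a" assume X: "\<forall>i. X i \<in> ball 0 e - {0}" and X0: "X \<longlonglongrightarrow> 0"
  show "(\<lambda>i. \<integral>y. q (X i) y \<partial>M) \<longlonglongrightarrow> (\<integral>y. 0 \<partial>M)"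
  proof (rule integral_dominated_convergence[where w = "\<lambda>y. 2 * D y"])
   show "AE y in M. (\<lambda>i. q (X i) y) \<longlonglongrightarrow> 0"
   proof (rule AE_I2)
    fix y assume y: "y \<in> space M"
    have "((\<lambda>v. norm (f (x0 + v) y - f x0 y - v \<bullet> f' x0 y) / norm v) \<longlongrightarrow> 0) (at 0)"
     using der[OF x0 y] unfolding gderiv_def has_derivative_at by simp
    then have "((\<lambda>v. norm (q v y)) \<longlongrightarrow> 0) (at 0)"
     by (simp add: q_def)
    then have "((\<lambda>v. q v y) \<longlongrightarrow> 0) (at 0)" by (rule tendsto_norm_zero_cancel)
    then show "(\<lambda>i. q (X i) y) \<longlonglongrightarrow> 0"
     using X X0 unfolding tendsto_at_iff_sequentially comp_def by blast
   qed
   show "AE y in M. norm (q (X i) y) \<le> 2 * D y" for i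
   proof (rule AE_I2)
    fix y assume y: "y \<in> space M"
    have Xi: "X i \<in> ball 0 e" "X i \<noteq> 0" using X by auto
    have "\<bar>X i \<bullet> f' x0 y\<bar> \<le> D y * norm (X i)"
     using Cauchy_Schwarz_ineq2[of "X i" "f' x0 y"] dom[OF x0 y]
     by (smt (verit) mult.commute mult_left_mono norm_ge_zero)
    with bnd[OF Xi(1) y] have "\<bar>f (x0 + X i) y - f x0 y - X i \<bullet> f' x0 y\<bar> \<le> 2 * D y * norm (X i)"
     by linarith
    then show "norm (q (X i) y) \<le> 2 * D y" using Xi(2) by (simp add: q_def field_simps)
   qed
   show "q (X i) \<in> borel_measurable M" for i
   proof -
    have "f (x0 + X i) \<in> borel_measurable M" "f x0 \<in> borel_measurable M"
     using int[of "x0 + X i"] int[OF x0] X by (auto simp: dist_norm)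
    then show ?thesis unfolding q_def[abs_def] using meas by measurable
   qed
  qed (use intD in auto)
 qed
 show "GDERIV (\<lambda>x. \<integral>y. f x y \<partial>M) x0 :> (\<integral>y. f' x0 y \<partial>M)"
  unfolding gderiv_def has_derivative_at
 proof (intro conjI)
  show "bounded_linear (\<lambda>h. h \<bullet> (\<integral>y. f' x0 y \<partial>M))" by (rule bounded_linear_inner_left)
  have "((\<lambda>v. \<integral>y. q v y \<partial>M) \<longlongrightarrow> 0) (at 0)"
   using lim at_within_open[of 0 "ball (0::'a) e"] e by simp
  then have "((\<lambda>v. norm (\<integral>y. q v y \<partial>M)) \<longlongrightarrow> 0) (at 0)" by (rule tendsto_norm_zero)
  moreover have "eventually (\<lambda>v. norm (\<integral>y. q v y \<partial>M) = norm ((\<integral>y. f (x0 + v) y \<partial>M) - (\<integral>y. f x0 y \<partial>M) - v \<bullet> (\<integral>y. f' x0 y \<partial>M)) / norm v) (at 0)"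
   unfolding eventually_at
  proof (intro exI[of _ e] conjI ballI impI e)
   fix v :: 'a assume v: "v \<noteq> 0 \<and> dist v 0 < e"
   then have i: "integrable M (f (x0 + v))" by (intro int) (simp add: dist_norm)
   show "norm (\<integral>y. q v y \<partial>M) = norm ((\<integral>y. f (x0 + v) y \<partial>M) - (\<integral>y. f x0 y \<partial>M) - v \<bullet> (\<integral>y. f' x0 y \<partial>M)) / norm v"
    unfolding q_def using i int[OF x0] int' by simp
  qed
  ultimately show "((\<lambda>v. norm ((\<integral>y. f (x0 + v) y \<partial>M) - (\<integral>y. f x0 y \<partial>M) - v \<bullet> (\<integral>y. f' x0 y \<partial>M)) / norm v) \<longlongrightarrow> 0) (at 0)"
   by (rule Lim_transform_eventually)
 qed
qed

lemma isCont_under_integral: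
 fixes f :: "'a::metric_space \<Rightarrow> 'b \<Rightarrow> 'c::{banach, second_countable_topology}"
 assumes e: "e > 0"
  and cont: "\<And>y. y \<in> space M \<Longrightarrow> isCont (\<lambda>x. f x y) x0"
  and meas: "\<And>x. x \<in> ball x0 e \<Longrightarrow> f x \<in> borel_measurable M"
  and intD: "integrable M D"
  and dom: "\<And>x y. x \<in> ball x0 e \<Longrightarrow> y \<in> space M \<Longrightarrow> norm (f x y) \<le> D y"
 shows "isCont (\<lambda>x. \<integral>y. f x y \<partial>M) x0"
proof -
 have "((\<lambda>x. \<integral>y. f x y \<partial>M) \<longlongrightarrow> (\<integral>y. f x0 y \<partial>M)) (at x0 within ball x0 e)"
  unfolding tendsto_at_iff_sequentially comp_def
 proof (intro allI impI)
  fix X :: "nat \<Rightarrow> 'a" assume X: "\<forall>i. X i \<in> ball x0 e - {x0}" and X0: "X \<longlonglongrightarrow> x0"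
  show "(\<lambda>i. \<integral>y. f (X i) y \<partial>M) \<longlonglongrightarrow> (\<integral>y. f x0 y \<partial>M)"
  proof (rule integral_dominated_convergence[where w = D])
   show "AE y in M. (\<lambda>i. f (X i) y) \<longlonglongrightarrow> f x0 y"
    using X X0 cont unfolding isCont_def tendsto_at_iff_sequentially comp_def by (intro AE_I2) blast
  qed (use X meas e dom intD in \<open>auto intro!: AE_I2\<close>)
 qed
 then show ?thesis using at_within_open[of x0 "ball x0 e"] e by (simp add: isCont_def)
qed

section \<open>Compactly supported integrands and affine changes of variables\<close>

lemma integrable_compact_support:
 fixes f :: "'a::euclidean_space \<Rightarrow> 'b::{banach, second_countable_topology}"
 assumes "continuous_on UNIV f" "compact K" "\<And>x. x \<notin> K \<Longrightarrow> f x = 0"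
 shows "integrable lborel f"
proof -
 have "integrable lborel (\<lambda>x. indicator K x *\<^sub>R f x)"
  by (rule borel_integrable_compact) (use assms continuous_on_subset[OF assms(1)] in auto)
 moreover have "(\<lambda>x. indicator K x *\<^sub>R f x) = f" using assms(3) by (auto simp: indicator_def)
 ultimately show ?thesis by simp
qed

lemma lborel_integrable_affine:
 fixes f :: "'a::euclidean_space \<Rightarrow> 'b::{banach, second_countable_topology}"
 assumes c: "c \<noteq> 0" and f: "integrable lborel f"
 shows "integrable lborel (\<lambda>x. f (t + c *\<^sub>R x))"
proof -
 have "integrable (density (distr lborel borel (\<lambda>x. t + c *\<^sub>R x)) (\<lambda>_. ennreal (\<bar>c\<bar> ^ DIM('a)))) f"
  using f lborel_affine[OF c, of t] by simp
 then have "integrable (distr lborel borel (\<lambda>x. t + c *\<^sub>R x)) (\<lambda>x. (\<bar>c\<bar> ^ DIM('a)) *\<^sub>R f x)"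
  by (subst (asm) integrable_density) (use f in auto)
 then have "integrable lborel (\<lambda>x. (\<bar>c\<bar> ^ DIM('a)) *\<^sub>R f (t + c *\<^sub>R x))"
  by (subst (asm) integrable_distr_eq) (use f in auto)
 from integrable_scaleR_right[OF this, of "inverse (\<bar>c\<bar> ^ DIM('a))"] show ?thesis using c by simp
qed

lemma lborel_integral_affine:
 fixes f :: "'a::euclidean_space \<Rightarrow> 'b::{banach, second_countable_topology}"
 assumes c: "c \<noteq> 0" and f: "f \<in> borel_measurable borel"
 shows "(\<integral>x. f x) = (\<bar>c\<bar> ^ DIM('a)) *\<^sub>R (\<integral>x. f (t + c *\<^sub>R x))"
proof -
 have "(\<integral>x. f x) = (\<integral>x. f x \<partial>density (distr lborel borel (\<lambda>x. t + c *\<^sub>R x)) (\<lambda>_. ennreal (\<bar>c\<bar> ^ DIM('a))))"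
  using lborel_affine[OF c, of t] by simp
 also have "\<dots> = (\<integral>x. (\<bar>c\<bar> ^ DIM('a)) *\<^sub>R f x \<partial>distr lborel borel (\<lambda>x. t + c *\<^sub>R x))"
  by (subst integral_density) (use f in auto)
 also have "\<dots> = (\<integral>x. (\<bar>c\<bar> ^ DIM('a)) *\<^sub>R f (t + c *\<^sub>R x))"
  by (subst integral_distr) (use f in auto)
 finally show ?thesis by simp
qed

lemmas integrable_translate = lborel_integrable_affine[of 1, simplified]
lemmas integral_translate = lborel_integral_affine[of 1, simplified, symmetric]

lemma integrable_reflect:
 fixes f :: "'a::euclidean_space \<Rightarrow> 'b::{banach, second_countable_topology}"
 shows "integrable lborel f \<Longrightarrow> integrable lborel (\<lambda>x. f (c - x))"
 using lborel_integrable_affine[of "-1" f c] by simp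

lemma integral_reflect:
 fixes f :: "'a::euclidean_space \<Rightarrow> 'b::{banach, second_countable_topology}"
 shows "f \<in> borel_measurable borel \<Longrightarrow> (\<integral>x. f (c - x)) = (\<integral>x. f x)"
 using lborel_integral_affine[of "-1" f c] by simp

text \<open>Translation invariance: the integral of \<open>F (x + t v)\<close> does not depend on \<open>t\<close>.\<close>

lemma integral_GDERIV_eq_0:
 fixes F :: "'a::euclidean_space \<Rightarrow> real"
 assumes der: "\<And>x. GDERIV F x :> G x"
  and cont: "continuous_on UNIV (\<lambda>x. v \<bullet> G x)"
  and K: "compact K" "\<And>x. x \<notin> K \<Longrightarrow> F x = 0"
 shows "integrable lborel (\<lambda>x. v \<bullet> G x)" "(\<integral>x. v \<bullet> G x) = 0"
proof -
 have zero: "v \<bullet> G x = 0" if "x \<notin> K" for x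
 proof -
  have "open (- K)" using K(1) compact_imp_closed open_Compl by blast
  moreover have "((\<lambda>x. 0::real) has_derivative (\<lambda>h. h \<bullet> (0::'a))) (at x)" by simp
  ultimately have "GDERIV F x :> 0" unfolding gderiv_def
   using has_derivative_transform_within_open[of "\<lambda>_. 0" "\<lambda>h. h \<bullet> (0::'a)" x UNIV "- K" F] that K(2) by simp
  then have "(\<lambda>h. h \<bullet> G x) = (\<lambda>h. h \<bullet> 0)" using der[of x] unfolding gderiv_def by (rule has_derivative_unique[rotated])
  from fun_cong[OF this, of v] show ?thesis by simp
 qed
 show intG: "integrable lborel (\<lambda>x. v \<bullet> G x)"
  by (rule integrable_compact_support[OF cont K(1) zero])
 have contF: "continuous_on UNIV F"
  using der unfolding gderiv_def by (meson continuous_at_imp_continuous_on has_derivative_continuous)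
 obtain B where B: "\<And>x. \<bar>v \<bullet> G x\<bar> \<le> B"
 proof -
  have "bounded ((\<lambda>x. v \<bullet> G x) ` K)"
   by (rule compact_imp_bounded[OF compact_continuous_image[OF _ K(1)]]) (use continuous_on_subset[OF cont] in auto)
  then obtain B where "\<And>x. x \<in> K \<Longrightarrow> \<bar>v \<bullet> G x\<bar> \<le> B" unfolding bounded_iff by auto
  then have "\<bar>v \<bullet> G x\<bar> \<le> max B 0" for x using zero[of x] by (cases "x \<in> K") (auto simp: le_max_iff_disj)
  then show ?thesis using that by blast
 qed
 \<comment> \<open>The supports of all translates with parameter in \<open>{-1..1}\<close> lie in
   this compact set, so \<open>B * indicator K'\<close> dominates the derivatives for every
   \<open>t\<close> in the unit ball.\<close>
 define K' where "K' = (\<lambda>(a, s). a - s *\<^sub>R v) ` (K \<times> {-1..1::real})"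
 have K': "compact K'" unfolding K'_def
  by (intro compact_continuous_image compact_Times K compact_Icc) (auto intro!: continuous_intros simp: case_prod_unfold)
 have "GDERIV (\<lambda>t::real. \<integral>x. F (t *\<^sub>R v + x)) 0 :> (\<integral>x. v \<bullet> G (0 *\<^sub>R v + x))"
 proof (rule GDERIV_under_integral(2)[where e = 1 and D = "\<lambda>x. B * indicator K' x"])
  fix t x assume t: "t \<in> ball (0::real) 1"
  show "GDERIV (\<lambda>t. F (t *\<^sub>R v + x)) t :> v \<bullet> G (t *\<^sub>R v + x)"
  proof -
   have "((\<lambda>t. F (t *\<^sub>R v + x)) has_derivative (\<lambda>h. (h *\<^sub>R v) \<bullet> G (t *\<^sub>R v + x))) (at t)"
    by (rule has_derivative_compose[where g = F, OF _ der[unfolded gderiv_def]]) (auto intro!: derivative_eq_intros)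
   then show ?thesis unfolding gderiv_def by (simp add: mult.commute)
  qed
  show "norm (v \<bullet> G (t *\<^sub>R v + x)) \<le> B * indicator K' x"
  proof (cases "t *\<^sub>R v + x \<in> K")
   case True
   have "x = (\<lambda>(a, s). a - s *\<^sub>R v) (t *\<^sub>R v + x, t)" by simp
   moreover have "(t *\<^sub>R v + x, t) \<in> K \<times> {-1..1}" using True t by (auto simp: dist_real_def)
   ultimately have "x \<in> K'" unfolding K'_def by (rule image_eqI)
   then show ?thesis using B by simp
  next
   case False
   have "0 \<le> B" using B[of 0] by linarith
   then show ?thesis using zero[OF False] by (simp add: indicator_def)
  qed
 next
  show "integrable lborel (\<lambda>x. F (t *\<^sub>R v + x))" for t
   by (rule integrable_translate[OF integrable_compact_support[OF contF K]])
  show "(\<lambda>x. v \<bullet> G (0 *\<^sub>R v + x)) \<in> borel_measurable lborel"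
   using intG by simp
  show "integrable lborel (\<lambda>x. B * indicator K' x)"
   using borel_integrable_compact[OF K', of "\<lambda>_. B"] by (simp add: mult.commute)
 qed simp
 then have "((\<lambda>t::real. \<integral>x. F x) has_real_derivative (\<integral>x. v \<bullet> G x)) (at 0)"
  using integral_translate[of F] contF by (simp add: borel_measurable_continuous_onI)
 then show "(\<integral>x. v \<bullet> G x) = 0"
  using DERIV_unique[OF _ DERIV_const] by blast
qed

section \<open>Mollification\<close>

text \<open>The denominators \<open>s ^ m\<close> make the family closed under differentiation up to
  linear combinations, so that smoothness of the bump function needs one derivative computation
  only.\<close>

definition flat_exp :: "nat \<Rightarrow> real \<Rightarrow> real" where
 "flat_exp m s = (if s > 0 then exp (- 1 / s) / s ^ m else 0)"

lemma flat_exp_nonneg: "0 \<le> flat_exp m s"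
 by (simp add: flat_exp_def)

lemma tendsto_flat_exp_0: "(flat_exp m \<longlongrightarrow> 0) (at 0)"
proof (rule filterlim_split_at_real)
 have "((\<lambda>x::real. x ^ m / exp x) \<longlongrightarrow> 0) at_top" by (rule tendsto_power_div_exp_0)
 then have "((\<lambda>s::real. inverse s ^ m / exp (inverse s)) \<longlongrightarrow> 0) (at_right 0)"
  by (rule filterlim_compose[OF _ filterlim_inverse_at_top_right])
 moreover have "eventually (\<lambda>s. inverse s ^ m / exp (inverse s) = flat_exp m s) (at_right 0)"
  using eventually_at_right_less[of "0::real"]
  by eventually_elim (simp add: flat_exp_def exp_minus field_simps)
 ultimately show "(flat_exp m \<longlongrightarrow> 0) (at_right 0)" by (rule Lim_transform_eventually)
 have "eventually (\<lambda>s. 0 = flat_exp m s) (at_left 0)"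
  unfolding eventually_at_filter by (auto simp: flat_exp_def)
 then show "(flat_exp m \<longlongrightarrow> 0) (at_left 0)" by (rule Lim_transform_eventually[OF tendsto_const])
qed

text \<open>Away from 0 this is calculus. At 0 the difference quotient of one member of the family
  is the next member, so the derivative there is the limit already found.\<close>

lemma DERIV_flat_exp:
 "(flat_exp m has_real_derivative (flat_exp (m + 2) s - real m * flat_exp (m + 1) s)) (at s)"
proof (cases s "0::real" rule: linorder_cases)
 case less
 have "((\<lambda>_. 0) has_real_derivative 0) (at s)" by simp
 moreover have "eventually (\<lambda>x. flat_exp m x = 0) (nhds s)"
  using eventually_nhds_in_open[of "{..<0}" s] less by (auto elim!: eventually_mono simp: flat_exp_def)
 ultimately show ?thesis using less
  by (subst DERIV_cong_ev[OF refl _ refl, where g = "\<lambda>_. 0"]) (auto simp: flat_exp_def)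
next
 case equal
 have "((\<lambda>h. flat_exp (Suc m) h) \<longlongrightarrow> 0) (at 0)" by (rule tendsto_flat_exp_0)
 moreover have "flat_exp (Suc m) h = flat_exp m h / h" if "h \<noteq> 0" for h using that
  by (simp add: flat_exp_def field_simps)
 ultimately have "((\<lambda>h. flat_exp m h / h) \<longlongrightarrow> 0) (at 0)"
  by (subst Lim_cong_within[OF refl refl refl, where g = "flat_exp (Suc m)"]) auto
 then show ?thesis using equal by (simp add: DERIV_def flat_exp_def)
next
 case greater
 have "((\<lambda>x. exp (- 1 / x) / x ^ m) has_real_derivative (flat_exp (m + 2) s - real m * flat_exp (m + 1) s)) (at s)"
  using greater
  by (auto intro!: derivative_eq_intros simp: flat_exp_def field_simps power2_eq_square power_Suc[symmetric] simp del: power_Suc)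
   (cases m; simp add: field_simps power2_eq_square)
 moreover have "eventually (\<lambda>x. flat_exp m x = exp (- 1 / x) / x ^ m) (nhds s)"
  using eventually_nhds_in_open[of "{0<..}" s] greater by (auto elim!: eventually_mono simp: flat_exp_def)
 ultimately show ?thesis
  by (subst DERIV_cong_ev[OF refl _ refl, where g = "\<lambda>x. exp (- 1 / x) / x ^ m"]) auto
qed

text \<open>A family of functions that contains a bump function and all its derivatives.\<close>

inductive bump_span :: "real \<Rightarrow> ('a::euclidean_space \<Rightarrow> real) \<Rightarrow> bool" for e where
 base: "bump_span e (\<lambda>x. flat_exp m (e\<^sup>2 - x \<bullet> x))"
| add: "bump_span e f \<Longrightarrow> bump_span e g \<Longrightarrow> bump_span e (\<lambda>x. f x + g x)"
| scale: "bump_span e f \<Longrightarrow> bump_span e (\<lambda>x. c * f x)"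
| inner_mult: "bump_span e f \<Longrightarrow> bump_span e (\<lambda>x. (w \<bullet> x) * f x)"

text \<open>The induction carries membership of all components of the gradient along with
  differentiability, which is the closure property that \<open>smoothI\<close> asks for.\<close>

lemma bump_span_GDERIV:
 assumes "bump_span e f"
 shows "\<exists>f'. (\<forall>x. GDERIV f x :> f' x) \<and> (\<forall>v. bump_span e (\<lambda>x. v \<bullet> f' x))"
 using assms
proof induction
 case (base m)
 let ?c = "\<lambda>x::'a. flat_exp (m + 2) (e\<^sup>2 - x \<bullet> x) - real m * flat_exp (m + 1) (e\<^sup>2 - x \<bullet> x)"
 have "GDERIV (\<lambda>x. flat_exp m (e\<^sup>2 - x \<bullet> x)) x :> ?c x *\<^sub>R ((-2) *\<^sub>R x)" for x :: 'a
 proof (rule GDERIV_DERIV_compose[OF _ DERIV_flat_exp])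
  show "GDERIV (\<lambda>x. e\<^sup>2 - x \<bullet> x) x :> (- 2) *\<^sub>R x"
   unfolding gderiv_def by (auto intro!: derivative_eq_intros simp: inner_commute)
 qed
 moreover have "bump_span e (\<lambda>x. v \<bullet> (?c x *\<^sub>R ((-2) *\<^sub>R x)))" for v :: 'a
 proof -
  have "bump_span e (\<lambda>x. (v \<bullet> x) * (((-2) * flat_exp (m + 2) (e\<^sup>2 - x \<bullet> x)) + (2 * real m) * flat_exp (m + 1) (e\<^sup>2 - x \<bullet> x)))"
   by (intro bump_span.intros)
  then show ?thesis by (simp add: algebra_simps)
 qed
 ultimately show ?case
  by (intro exI[of _ "\<lambda>x. ?c x *\<^sub>R ((-2) *\<^sub>R x)"] conjI allI)
next
 case (add f g)
 then obtain f' g' where "\<forall>x. GDERIV f x :> f' x" "\<forall>v. bump_span e (\<lambda>x. v \<bullet> f' x)"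
  "\<forall>x. GDERIV g x :> g' x" "\<forall>v. bump_span e (\<lambda>x. v \<bullet> g' x)" by blast
 then show ?case
  by (intro exI[of _ "\<lambda>x. f' x + g' x"]) (auto intro: GDERIV_add bump_span.add simp: inner_add_right)
next
 case (scale f c)
 then obtain f' where f': "\<forall>x. GDERIV f x :> f' x" "\<forall>v. bump_span e (\<lambda>x. v \<bullet> f' x)" by blast
 have "GDERIV (\<lambda>x. c * f x) x :> c *\<^sub>R f' x" for x
  using GDERIV_mult[OF GDERIV_const f'(1)[rule_format], of c x] by simp
 with f'(2) show ?case
  by (intro exI[of _ "\<lambda>x. c *\<^sub>R f' x"]) (auto intro: bump_span.scale)
next
 case (inner_mult f w)
 then obtain f' where f': "\<forall>x. GDERIV f x :> f' x" "\<forall>v. bump_span e (\<lambda>x. v \<bullet> f' x)" by blast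
 have w: "GDERIV (\<lambda>x. w \<bullet> x) x :> w" for x
  unfolding gderiv_def by (auto intro!: derivative_eq_intros simp: inner_commute)
 have "GDERIV (\<lambda>x. (w \<bullet> x) * f x) x :> (w \<bullet> x) *\<^sub>R f' x + f x *\<^sub>R w" for x
  by (rule GDERIV_mult[OF w f'(1)[rule_format]])
 moreover have "bump_span e (\<lambda>x. v \<bullet> ((w \<bullet> x) *\<^sub>R f' x + f x *\<^sub>R w))" for v
 proof -
  have "bump_span e (\<lambda>x. (w \<bullet> x) * (v \<bullet> f' x) + (v \<bullet> w) * f x)"
   using f'(2) inner_mult.hyps by (intro bump_span.add bump_span.inner_mult bump_span.scale) auto
  then show ?thesis by (simp add: inner_add_right mult.commute)
 qed
 ultimately show ?case
  by (intro exI[of _ "\<lambda>x. (w \<bullet> x) *\<^sub>R f' x + f x *\<^sub>R w"] conjI allI)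
qed

section \<open>Gradients, directional derivatives and smooth functions\<close>

abbreviation dird :: "'a::euclidean_space \<Rightarrow> ('a \<Rightarrow> real) \<Rightarrow> 'a \<Rightarrow> real" where
 "dird v f \<equiv> (\<lambda>x. frechet_derivative f (at x) v)"

definition grad :: "('a::euclidean_space \<Rightarrow> real) \<Rightarrow> 'a \<Rightarrow> 'a" where
 "grad f x = (\<Sum>b\<in>Basis. dird b f x *\<^sub>R b)"

lemma differentiable_GDERIV:
 assumes "f differentiable (at x)"
 shows "GDERIV f x :> grad f x"
proof -
 have d: "(f has_derivative frechet_derivative f (at x)) (at x)"
  using assms frechet_derivative_works by blast
 then have lin: "linear (frechet_derivative f (at x))"
  using has_derivative_bounded_linear bounded_linear.linear by blast
 have "frechet_derivative f (at x) h = h \<bullet> grad f x" for h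
 proof -
  have "frechet_derivative f (at x) (\<Sum>b\<in>Basis. (h \<bullet> b) *\<^sub>R b) = (\<Sum>b\<in>Basis. (h \<bullet> b) * dird b f x)"
   by (simp add: linear_sum[OF lin] linear_cmul[OF lin])
  then show ?thesis unfolding grad_def by (simp add: euclidean_representation inner_sum_right mult.commute)
 qed
 then show ?thesis using d unfolding gderiv_def by presburger
qed

lemma GDERIV_dird: "GDERIV f x :> D \<Longrightarrow> dird v f x = v \<bullet> D"
 unfolding gderiv_def using frechet_derivative_at by metis

lemma GDERIV_differentiable: "GDERIV f x :> D \<Longrightarrow> f differentiable (at x)"
 unfolding gderiv_def differentiable_def by blast

lemma GDERIV_unique:
 fixes f :: "'a::euclidean_space \<Rightarrow> real"
 assumes "GDERIV f x :> D" "GDERIV f x :> D'"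
 shows "D = D'"
proof -
 have "(D - D') \<bullet> (D - D') = 0"
  using GDERIV_dird[OF assms(1), of "D - D'"] GDERIV_dird[OF assms(2), of "D - D'"]
  by (subst inner_diff_right) simp
 then show ?thesis by simp
qed

lemma GDERIV_isCont: "GDERIV f x :> D \<Longrightarrow> isCont f x"
 unfolding gderiv_def by (rule has_derivative_continuous)

lemma dird_eq_grad: "f differentiable (at x) \<Longrightarrow> dird v f x = v \<bullet> grad f x"
 by (rule GDERIV_dird[OF differentiable_GDERIV])

definition smooth :: "('a::euclidean_space \<Rightarrow> real) \<Rightarrow> bool" where
 "smooth f \<longleftrightarrow> (\<forall>k. C_diff k f)"

lemma smooth_differentiable: "smooth f \<Longrightarrow> f differentiable (at x)"
 unfolding smooth_def using C_diff.simps(2)[of 0 f] by blast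

lemma smooth_dird: "smooth f \<Longrightarrow> smooth (dird v f)"
 unfolding smooth_def by (metis C_diff.simps(2))

lemma smooth_GDERIV: "smooth f \<Longrightarrow> GDERIV f x :> grad f x"
 by (intro differentiable_GDERIV smooth_differentiable)

lemma smooth_continuous: "smooth f \<Longrightarrow> continuous_on UNIV f"
 unfolding smooth_def using C_diff.simps(1)[of f] by blast

lemma smooth_grad_continuous: "smooth f \<Longrightarrow> continuous_on UNIV (grad f)"
 unfolding grad_def by (intro continuous_intros smooth_continuous smooth_dird)

text \<open>A coinduction principle: differentiability on a class that is stable under directional
  derivatives can be iterated, giving \<open>C_diff k\<close> by induction on \<open>k\<close> for
  all members at once.\<close>

lemma smoothI:
 assumes "P f" "\<And>f x. P f \<Longrightarrow> f differentiable (at x)" "\<And>f v. P f \<Longrightarrow> P (dird v f)"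
 shows "smooth f"
proof -
 have "C_diff k f" if "P f" for k f
  using that
 proof (induction k arbitrary: f)
  case 0
  then show ?case using assms(2)
   by (auto intro!: differentiable_imp_continuous_on simp: differentiable_on_def differentiable_at_withinI)
 qed (use assms(2,3) in auto)
 with assms(1) show ?thesis by (simp add: smooth_def)
qed

lemma bump_span_smooth:
 assumes "bump_span e f"
 shows "smooth f"
proof (rule smoothI[of "bump_span e", OF assms])
 fix f :: "'a \<Rightarrow> real" and x v :: 'a
 assume "bump_span e f"
 then obtain f' where f': "\<forall>x. GDERIV f x :> f' x" "\<forall>v. bump_span e (\<lambda>x. v \<bullet> f' x)"
  using bump_span_GDERIV by blast
 show "f differentiable at x" using f'(1) GDERIV_differentiable by blast
 have "dird v f = (\<lambda>x. v \<bullet> f' x)" using GDERIV_dird f'(1) by blast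
 then show "bump_span e (dird v f)" using f'(2) by simp
qed

lemma dird_zero_off:
 assumes "closed K" "\<And>x. x \<notin> K \<Longrightarrow> f x = 0" "x \<notin> K"
 shows "dird v f x = 0"
proof -
 have "((\<lambda>x. 0::real) has_derivative (\<lambda>h. 0)) (at x)" by simp
 then have "(f has_derivative (\<lambda>h. 0)) (at x)"
  using has_derivative_transform_within_open[of "\<lambda>_. 0" "\<lambda>h. 0" x UNIV "- K" f] assms by (simp add: open_Compl)
 then have "frechet_derivative f (at x) = (\<lambda>h. 0)" using frechet_derivative_at by metis
 then show ?thesis by simp
qed

section \<open>The standard mollifier\<close>

definition bump :: "real \<Rightarrow> 'a::euclidean_space \<Rightarrow> real" where
 "bump e x = flat_exp 0 (e\<^sup>2 - x \<bullet> x)"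

definition moll :: "real \<Rightarrow> 'a::euclidean_space \<Rightarrow> real" where
 "moll e x = (1 / (\<integral>x. bump e (x::'a))) * bump e x"

lemma bump_span_moll: "bump_span e (moll e)"
 unfolding moll_def[abs_def] bump_def[abs_def] by (intro bump_span.intros)

lemma moll_smooth: "smooth (moll e)"
 by (rule bump_span_smooth[OF bump_span_moll])

lemma bump_zero:
 fixes x :: "'a::euclidean_space"
 shows "e > 0 \<Longrightarrow> x \<notin> cball 0 e \<Longrightarrow> bump e x = 0"
 unfolding bump_def flat_exp_def dot_square_norm mem_cball dist_0_norm
 using power2_le_imp_le[of "norm x" e] by (smt (verit))

lemma moll_zero: "e > 0 \<Longrightarrow> x \<notin> cball 0 e \<Longrightarrow> moll e x = 0"
 using bump_zero[of e x] by (simp add: moll_def)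

lemma bump_continuous: "continuous_on UNIV (bump e)"
 unfolding bump_def by (intro smooth_continuous bump_span_smooth[of e] bump_span.base)

lemma integrable_bump: "e > 0 \<Longrightarrow> integrable lborel (bump e)"
 by (rule integrable_compact_support[OF bump_continuous compact_cball bump_zero])

lemma integral_bump_pos:
 assumes "e > 0"
 shows "0 < (\<integral>x. bump e (x::'a::euclidean_space))"
proof -
 have nn: "0 \<le> bump e x" for x :: 'a by (simp add: bump_def flat_exp_nonneg)
 have "(\<integral>x. bump e (x::'a)) \<noteq> 0"
 proof
  assume "(\<integral>x. bump e (x::'a)) = 0"
  then have "AE x in lborel. bump e (x::'a) = 0"
   using integral_nonneg_eq_0_iff_AE[OF integrable_bump[OF assms]] nn by auto
  moreover have "bump e x \<noteq> 0" if "x \<in> ball 0 e" for x :: 'a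
  proof -
   have "(norm x)\<^sup>2 < e\<^sup>2" using that by (intro power_strict_mono) auto
   then show ?thesis by (simp add: bump_def flat_exp_def dot_square_norm)
  qed
  ultimately have "AE x in lborel. (x::'a) \<notin> ball 0 e" by (auto elim!: eventually_mono)
  then have "emeasure lborel (ball (0::'a) e) = 0"
   by (subst (asm) AE_iff_measurable[of "ball 0 e"]) auto
  then show False using emeasure_lborel_ball_finite[of "0::'a" e] content_ball_pos[OF assms, of "0::'a"] by (simp add: measure_def)
 qed
 then show ?thesis using nn by (simp add: order_le_neq_trans)
qed

lemma moll_nonneg: "e > 0 \<Longrightarrow> 0 \<le> moll e (x::'a::euclidean_space)"
 using integral_bump_pos[of e, where ?'a = 'a] by (simp add: moll_def bump_def flat_exp_nonneg)

lemma moll_minus: "moll e (- x) = moll e x"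
 by (simp add: moll_def bump_def)

lemma integrable_moll: "e > 0 \<Longrightarrow> integrable lborel (moll e)"
 unfolding moll_def[abs_def] by (intro integrable_mult_right integrable_bump)

lemma integral_moll: "e > 0 \<Longrightarrow> (\<integral>x. moll e (x::'a::euclidean_space)) = 1"
 using integral_bump_pos[of e, where ?'a = 'a] by (simp add: moll_def)

section \<open>Convolution with a smooth compactly supported kernel\<close>

definition conv :: "('a::euclidean_space \<Rightarrow> real) \<Rightarrow> ('a \<Rightarrow> real) \<Rightarrow> 'a \<Rightarrow> real" where
 "conv \<kappa> F z = (\<integral>y. \<kappa> (z - y) * F y)"

definition smooth_cpt :: "('a::euclidean_space \<Rightarrow> real) \<Rightarrow> bool" where
 "smooth_cpt \<kappa> \<longleftrightarrow> smooth \<kappa> \<and> (\<exists>r. \<forall>x. x \<notin> cball 0 r \<longrightarrow> \<kappa> x = 0)"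

lemma smooth_cpt_moll: "e > 0 \<Longrightarrow> smooth_cpt (moll e)"
 unfolding smooth_cpt_def using moll_smooth moll_zero by blast

lemma smooth_cpt_dird: "smooth_cpt \<kappa> \<Longrightarrow> smooth_cpt (dird v \<kappa>)"
 unfolding smooth_cpt_def using smooth_dird dird_zero_off[of "cball 0 _" \<kappa>] by (metis closed_cball)

lemma bounded_compact_support:
 fixes f :: "'a::euclidean_space \<Rightarrow> 'b::real_normed_vector"
 assumes "continuous_on UNIV f" "compact K" "\<And>x. x \<notin> K \<Longrightarrow> f x = 0"
 shows "\<exists>B\<ge>0. \<forall>x. norm (f x) \<le> B"
proof -
 have "bounded (f ` K)"
  by (rule compact_imp_bounded[OF compact_continuous_image[OF continuous_on_subset[OF assms(1)] assms(2)]]) simp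
 then obtain B where "\<And>x. x \<in> K \<Longrightarrow> norm (f x) \<le> B" unfolding bounded_iff by auto
 then have "norm (f x) \<le> max B 0" for x using assms(3)[of x] by (cases "x \<in> K") (auto simp: le_max_iff_disj)
 then show ?thesis by (intro exI[of _ "max B 0"]) auto
qed

lemma smooth_cpt_bounded:
 assumes "smooth_cpt \<kappa>" shows "\<exists>B\<ge>0. \<forall>x. \<bar>\<kappa> x\<bar> \<le> B"
 using assms bounded_compact_support[of \<kappa> "cball 0 _"] unfolding smooth_cpt_def
 by (metis smooth_continuous compact_cball real_norm_def)

lemma smooth_cpt_borel: "smooth_cpt \<kappa> \<Longrightarrow> \<kappa> \<in> borel_measurable borel"
 unfolding smooth_cpt_def by (auto intro: borel_measurable_continuous_onI smooth_continuous)

text \<open>The derivative falls on the kernel, whose gradient is bounded; hence a multiple of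
  \<open>\<bar>F y\<bar>\<close> dominates and integrability of \<open>F\<close> suffices.\<close>

lemma conv_GDERIV:
 fixes \<kappa> F :: "'a::euclidean_space \<Rightarrow> real"
 assumes \<kappa>: "smooth_cpt \<kappa>" and F: "integrable lborel F"
 shows "GDERIV (conv \<kappa> F) z :> (\<integral>y. F y *\<^sub>R grad \<kappa> (z - y))"
  "integrable lborel (\<lambda>y. F y *\<^sub>R grad \<kappa> (z - y))"
  "integrable lborel (\<lambda>y. \<kappa> (z - y) * F y)"
proof -
 have sm: "smooth \<kappa>" using \<kappa> smooth_cpt_def by blast
 obtain B where B: "\<And>x. \<bar>\<kappa> x\<bar> \<le> B" using smooth_cpt_bounded[OF \<kappa>] by blast
 have "\<forall>b. \<exists>C. \<forall>x. \<bar>dird b \<kappa> x\<bar> \<le> C" using smooth_cpt_bounded[OF smooth_cpt_dird[OF \<kappa>]] by blast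
 then obtain C where C: "\<And>b x. \<bar>dird b \<kappa> x\<bar> \<le> C b" by metis
 have grad_bd: "norm (grad \<kappa> x) \<le> (\<Sum>b\<in>Basis. C b)" for x
  unfolding grad_def by (rule sum_norm_le) (simp add: C)
 have gm: "grad \<kappa> \<in> borel_measurable borel"
  by (rule borel_measurable_continuous_onI[OF smooth_grad_continuous[OF sm]])
 have Fm: "F \<in> borel_measurable borel" using borel_measurable_integrable[OF F] by simp
 note [measurable] = smooth_cpt_borel[OF \<kappa>] gm Fm
 have int: "integrable lborel (\<lambda>y. \<kappa> (z - y) * F y)" for z
 proof (rule integrable_bound[where f = "\<lambda>y. B * F y"])
  show "AE y in lborel. norm (\<kappa> (z - y) * F y) \<le> norm (B * F y)"
  proof (intro AE_I2)
   fix y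
   have "\<bar>\<kappa> (z - y)\<bar> * \<bar>F y\<bar> \<le> \<bar>B\<bar> * \<bar>F y\<bar>"
    using B[of "z - y"] by (intro mult_right_mono) auto
   then show "norm (\<kappa> (z - y) * F y) \<le> norm (B * F y)" by (simp add: abs_mult)
  qed
  show "integrable lborel (\<lambda>y. B * F y)" using F by (rule integrable_mult_right)
  show "(\<lambda>y. \<kappa> (z - y) * F y) \<in> borel_measurable lborel" by measurable
 qed
 then show "integrable lborel (\<lambda>y. \<kappa> (z - y) * F y)" .
 have der: "GDERIV (\<lambda>z. \<kappa> (z - y) * F y) z :> F y *\<^sub>R grad \<kappa> (z - y)" for z y
 proof -
  have "((\<lambda>z. \<kappa> (z - y)) has_derivative (\<lambda>h. h \<bullet> grad \<kappa> (z - y))) (at z)"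
   by (rule has_derivative_compose[where g = \<kappa> and f = "\<lambda>z. z - y" and f' = "\<lambda>h. h", OF _ smooth_GDERIV[OF sm, unfolded gderiv_def]])
    (auto intro!: derivative_eq_intros)
  then show ?thesis unfolding gderiv_def
   by (auto intro!: derivative_eq_intros simp: mult.commute)
 qed
 have dom: "norm (F y *\<^sub>R grad \<kappa> (x - y)) \<le> (\<Sum>b\<in>Basis. C b) * \<bar>F y\<bar>" for x y
  using mult_right_mono[OF grad_bd[of "x - y"], of "\<bar>F y\<bar>"] by (simp add: mult.commute)
 have mm: "(\<lambda>y. F y *\<^sub>R grad \<kappa> (z - y)) \<in> borel_measurable lborel" by measurable
 have D: "integrable lborel (\<lambda>y. (\<Sum>b\<in>Basis. C b) * \<bar>F y\<bar>)" using F by simp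
 note * = GDERIV_under_integral[where e = 1 and f' = "\<lambda>z y. F y *\<^sub>R grad \<kappa> (z - y)" and f = "\<lambda>z y. \<kappa> (z - y) * F y",
   OF zero_less_one der int mm D dom]
 show "integrable lborel (\<lambda>y. F y *\<^sub>R grad \<kappa> (z - y))" by (rule *(1))
 show "GDERIV (conv \<kappa> F) z :> (\<integral>y. F y *\<^sub>R grad \<kappa> (z - y))"
  unfolding conv_def[abs_def] by (rule *(2))
qed

lemma conv_dird:
 assumes \<kappa>: "smooth_cpt \<kappa>" and F: "integrable lborel F"
 shows "dird v (conv \<kappa> F) z = conv (dird v \<kappa>) F z"
proof -
 have d: "\<kappa> differentiable (at x)" for x using \<kappa> smooth_cpt_def smooth_differentiable by blast
 have "dird v (conv \<kappa> F) z = v \<bullet> (\<integral>y. F y *\<^sub>R grad \<kappa> (z - y))"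
  by (rule GDERIV_dird[OF conv_GDERIV(1)[OF \<kappa> F]])
 also have "\<dots> = (\<integral>y. v \<bullet> (F y *\<^sub>R grad \<kappa> (z - y)))"
  by (rule integral_inner_right[symmetric]) (use conv_GDERIV(2)[OF \<kappa> F] in auto)
 also have "\<dots> = conv (dird v \<kappa>) F z"
  unfolding conv_def by (rule integral_cong) (auto simp: dird_eq_grad[OF d])
 finally show ?thesis .
qed

text \<open>Derivatives of a convolution are convolutions with the derived kernel, so the
  convolutions of a fixed \<open>F\<close> with arbitrary kernels form a class as in
  \<open>smoothI\<close>.\<close>

lemma conv_smooth:
 assumes \<kappa>: "smooth_cpt \<kappa>" and F: "integrable lborel F"
 shows "smooth (conv \<kappa> F)"
proof (rule smoothI[where P = "\<lambda>g. \<exists>\<kappa>. smooth_cpt \<kappa> \<and> g = conv \<kappa> F"])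
 show "g differentiable at x" if "\<exists>\<kappa>. smooth_cpt \<kappa> \<and> g = conv \<kappa> F" for g x
  using that conv_GDERIV(1)[OF _ F] GDERIV_differentiable by blast
 show "\<exists>\<kappa>. smooth_cpt \<kappa> \<and> dird v g = conv \<kappa> F" if "\<exists>\<kappa>. smooth_cpt \<kappa> \<and> g = conv \<kappa> F" for g v
 proof -
  obtain \<kappa>' where k: "smooth_cpt \<kappa>'" "g = conv \<kappa>' F" using \<open>\<exists>\<kappa>. smooth_cpt \<kappa> \<and> g = conv \<kappa> F\<close> by blast
  have "dird v g = conv (dird v \<kappa>') F" unfolding k(2) by (rule ext) (rule conv_dird[OF k(1) F])
  then show ?thesis using smooth_cpt_dird[OF k(1), of v] by blast
 qed
qed (use \<kappa> in blast)

lemma integrable_times_pair: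
 fixes F :: "'a::euclidean_space \<Rightarrow> real" and G :: "'b::euclidean_space \<Rightarrow> real"
 assumes G: "integrable lborel G" and F: "integrable lborel F"
 shows "integrable (lborel \<Otimes>\<^sub>M lborel) (\<lambda>(z, y). G z * F y)"
proof (rule lborel_pair.Fubini_integrable)
 note [measurable] = borel_measurable_integrable[OF F] borel_measurable_integrable[OF G]
 show "(\<lambda>(z, y). G z * F y) \<in> borel_measurable (lborel \<Otimes>\<^sub>M lborel)" by measurable
 show "integrable lborel (\<lambda>z. \<integral>y. norm (case (z, y) of (z, y) \<Rightarrow> G z * F y))"
  using G by (simp add: abs_mult)
 show "AE z in lborel. integrable lborel (\<lambda>y. case (z, y) of (z, y) \<Rightarrow> G z * F y)"
  using F by simp
qed

text \<open>Fubini: the adjoint of a convolution is the convolution with the reflected kernel. This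
  is how mollifiers are moved from test functions to the functions tested.\<close>

lemma integral_conv_swap:
 fixes F G \<kappa> :: "'a::euclidean_space \<Rightarrow> real"
 assumes \<kappa>: "smooth_cpt \<kappa>" and F: "integrable lborel F" and G: "integrable lborel G"
 shows "(\<integral>z. G z * conv \<kappa> F z) = (\<integral>y. F y * conv (\<lambda>x. \<kappa> (- x)) G y)"
proof -
 obtain B where B: "B \<ge> 0" "\<And>x. \<bar>\<kappa> x\<bar> \<le> B" using smooth_cpt_bounded[OF \<kappa>] by blast
 note [measurable] = borel_measurable_integrable[OF F] borel_measurable_integrable[OF G] smooth_cpt_borel[OF \<kappa>]
 have "integrable (lborel \<Otimes>\<^sub>M lborel) (\<lambda>(z, y). \<kappa> (z - y) * (G z * F y))"
 proof (rule integrable_bound[where f = "\<lambda>(z, y). B * (G z * F y)"])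
  show "integrable (lborel \<Otimes>\<^sub>M lborel) (\<lambda>(z, y). B * (G z * F y))"
   using integrable_mult_right[OF integrable_times_pair[OF G F], of B] by (simp add: case_prod_unfold)
  show "(\<lambda>(z, y). \<kappa> (z - y) * (G z * F y)) \<in> borel_measurable (lborel \<Otimes>\<^sub>M lborel)" by measurable
  show "AE x in lborel \<Otimes>\<^sub>M lborel. norm (case x of (z, y) \<Rightarrow> \<kappa> (z - y) * (G z * F y)) \<le> norm (case x of (z, y) \<Rightarrow> B * (G z * F y))"
  proof (intro AE_I2)
   fix x :: "'a \<times> 'a"
   show "norm (case x of (z, y) \<Rightarrow> \<kappa> (z - y) * (G z * F y)) \<le> norm (case x of (z, y) \<Rightarrow> B * (G z * F y))"
    using mult_right_mono[OF B(2)[of "fst x - snd x"], of "\<bar>G (fst x) * F (snd x)\<bar>"] B(1)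
    by (simp add: case_prod_unfold abs_mult)
  qed
 qed
 then have "(\<integral>y. \<integral>z. \<kappa> (z - y) * (G z * F y)) = (\<integral>z. \<integral>y. \<kappa> (z - y) * (G z * F y))"
  by (rule lborel_pair.Fubini_integral)
 moreover have "(\<integral>y. \<kappa> (z - y) * (G z * F y)) = G z * conv \<kappa> F z" for z
  unfolding conv_def by (subst integral_mult_right_zero[symmetric]) (simp add: mult_ac)
 moreover have "(\<integral>z. \<kappa> (z - y) * (G z * F y)) = F y * conv (\<lambda>x. \<kappa> (- x)) G y" for y
  unfolding conv_def by (subst integral_mult_right_zero[symmetric]) (simp add: mult_ac)
 ultimately show ?thesis by simp
qed

text \<open>Differentiation exchanges even and odd functions. For the mollifier this supplies the
  sign when \<open>integral_conv_swap\<close> reflects its first or second derivatives.\<close>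

lemma dird_compose_minus:
 assumes "smooth \<kappa>" "\<And>x. \<kappa> (- x) = c * \<kappa> x"
 shows "dird v \<kappa> (- x) = - c * dird v \<kappa> x"
proof -
 have "((\<lambda>x. \<kappa> (- x)) has_derivative (\<lambda>h. (- h) \<bullet> grad \<kappa> (- x))) (at x)"
  by (rule has_derivative_compose[where g = \<kappa> and f = uminus and f' = uminus,
     OF _ smooth_GDERIV[OF assms(1), unfolded gderiv_def]]) (auto intro!: derivative_eq_intros)
 moreover have "((\<lambda>x. c * \<kappa> x) has_derivative (\<lambda>h. c * (h \<bullet> grad \<kappa> x))) (at x)"
  using smooth_GDERIV[OF assms(1), unfolded gderiv_def] by (auto intro!: derivative_eq_intros)
 ultimately have "(\<lambda>h. (- h) \<bullet> grad \<kappa> (- x)) = (\<lambda>h. c * (h \<bullet> grad \<kappa> x))"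
  unfolding assms(2) by (rule has_derivative_unique)
 from fun_cong[OF this, of v] show ?thesis
  using dird_eq_grad[OF smooth_differentiable[OF assms(1)], where v = v] by simp
qed

lemma dird_moll_minus: "dird v (moll e) (- x) = - dird v (moll e) x"
 using dird_compose_minus[OF moll_smooth, where c = 1] by (simp add: moll_minus)

lemma dird_dird_moll_minus: "dird v (dird v (moll e)) (- x) = dird v (dird v (moll e)) x"
 using dird_compose_minus[OF smooth_dird[OF moll_smooth], where c = "-1"] by (simp add: dird_moll_minus)

text \<open>The mollifier is a probability density supported in the ball of radius \<open>e\<close>,
  so the convolution is an average of values within \<eta> of \<open>c\<close>. The constant
  \<open>c\<close> is kept general; it is usually the value of another function at
  \<open>x\<close>.\<close>

lemma conv_moll_close:
 fixes u :: "'a::euclidean_space \<Rightarrow> real"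
 assumes e: "e > 0" and u: "integrable lborel u" and close: "\<And>y. y \<in> cball x e \<Longrightarrow> \<bar>u y - c\<bar> \<le> \<eta>"
 shows "\<bar>conv (moll e) u x - c\<bar> \<le> \<eta>"
proof -
 have m: "integrable lborel (\<lambda>y. moll e (x - y))" by (rule integrable_reflect[OF integrable_moll[OF e]])
 have m1: "(\<integral>y. moll e (x - y)) = 1"
  using integral_reflect[of "moll e" x, OF smooth_cpt_borel[OF smooth_cpt_moll[OF e]]]
   integral_moll[OF e, where ?'a = 'a] by (rule trans)
 have i: "integrable lborel (\<lambda>y. moll e (x - y) * u y)" by (rule conv_GDERIV(3)[OF smooth_cpt_moll[OF e] u])
 have "conv (moll e) u x - c = (\<integral>y. moll e (x - y) * u y - c * moll e (x - y))"
  unfolding conv_def using m1 m i by simp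
 also have "\<bar>\<dots>\<bar> \<le> (\<integral>y. \<eta> * moll e (x - y))"
 proof -
  have "\<bar>moll e (x - y) * u y - c * moll e (x - y)\<bar> \<le> \<eta> * moll e (x - y)" for y
  proof (cases "y \<in> cball x e")
   case True
   have "\<bar>moll e (x - y) * u y - c * moll e (x - y)\<bar> = \<bar>u y - c\<bar> * moll e (x - y)"
    using moll_nonneg[OF e, of "x - y"] abs_mult[of "u y - c" "moll e (x - y)"] by (simp add: algebra_simps)
   also have "\<dots> \<le> \<eta> * moll e (x - y)" using close[OF True] moll_nonneg[OF e] by (rule mult_right_mono)
   finally show ?thesis .
  next
   case False
   then have "moll e (x - y) = 0" by (intro moll_zero[OF e]) (auto simp: dist_norm norm_minus_commute)
   then show ?thesis by simp
  qed
  then have "norm (\<integral>y. moll e (x - y) * u y - c * moll e (x - y)) \<le> (\<integral>y. \<eta> * moll e (x - y))"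
   using m i by (intro integral_norm_bound_integral) auto
  then show ?thesis by simp
 qed
 also have "\<dots> = \<eta>" using m1 by simp
 finally show ?thesis .
qed

section \<open>Neighbourhoods of compact sets, restrictions and test functions\<close>

text \<open>The closed \<open>e\<close>-neighbourhood, written as a Minkowski sum so that its
  compactness is that of a sum of two compact sets.\<close>

definition fatten :: "real \<Rightarrow> 'a::euclidean_space set \<Rightarrow> 'a set" where
 "fatten e K = {x + y |x y. x \<in> K \<and> y \<in> cball 0 e}"

lemma compact_fatten: "compact K \<Longrightarrow> compact (fatten e K)"
 unfolding fatten_def by (rule compact_sums) auto

lemma cball_subset_fatten: "x \<in> K \<Longrightarrow> cball x e \<subseteq> fatten e K"
proof
 fix y assume "x \<in> K" "y \<in> cball x e"
 then show "y \<in> fatten e K"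
  unfolding fatten_def by (intro CollectI exI[of _ x] exI[of _ "y - x"]) (auto simp: dist_norm norm_minus_commute)
qed

lemma subset_fatten: "e \<ge> 0 \<Longrightarrow> K \<subseteq> fatten e K"
 using cball_subset_fatten[of _ K e] centre_in_cball by blast

lemma fatten_mono: "e \<le> e' \<Longrightarrow> fatten e K \<subseteq> fatten e' K"
 unfolding fatten_def by fastforce

lemma fatten_iff: "z \<in> fatten e K \<longleftrightarrow> (\<exists>x\<in>K. dist x z \<le> e)"
proof
 assume "\<exists>x\<in>K. dist x z \<le> e"
 then show "z \<in> fatten e K" using cball_subset_fatten by fastforce
qed (force simp: fatten_def dist_norm)

lemma fatten_subset_open:
 assumes "compact K" "open \<Omega>" "K \<subseteq> \<Omega>"
 obtains e where "e > 0" "fatten e K \<subseteq> \<Omega>"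
proof -
 obtain e where e: "e > 0" "(\<Union>x\<in>K. cball x e) \<subseteq> \<Omega>"
  by (rule compact_subset_open_imp_cball_epsilon_subset[OF assms])
 have "fatten e K \<subseteq> (\<Union>x\<in>K. cball x e)" by (auto simp: fatten_iff)
 with e that show ?thesis by blast
qed

lemma conv_zero_off:
 assumes e: "e > 0" and \<kappa>: "\<And>x. x \<notin> cball 0 e \<Longrightarrow> \<kappa> x = 0" and F: "\<And>x. x \<notin> K \<Longrightarrow> F x = 0"
  and z: "z \<notin> fatten e K"
 shows "conv \<kappa> F z = 0"
proof -
 have "\<kappa> (z - y) * F y = 0" for y
 proof (cases "y \<in> K")
  case True
  then have "z - y \<notin> cball 0 e" using z by (auto simp: fatten_iff dist_norm norm_minus_commute)
  then show ?thesis using \<kappa> by simp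
 qed (simp add: F)
 then show ?thesis unfolding conv_def by (simp only: Bochner_Integration.integral_zero)
qed

lemma continuous_on_UNIV_support:
 fixes f :: "'a::topological_space \<Rightarrow> 'b::real_normed_vector"
 assumes "open \<Omega>" "closed K" "K \<subseteq> \<Omega>" "continuous_on \<Omega> f" "\<And>x. x \<notin> K \<Longrightarrow> f x = 0"
 shows "continuous_on UNIV f"
proof -
 have "continuous_on (- K) f"
  using continuous_on_cong[of "- K" "- K" f "\<lambda>_. 0"] assms(5) by simp
 then have "continuous_on (\<Omega> \<union> - K) f"
  using assms by (intro continuous_on_open_Un) (auto simp: open_Compl)
 moreover have "\<Omega> \<union> - K = UNIV" using assms(3) by blast
 ultimately show ?thesis by simp
qed

lemma test_function_smooth: "\<phi> \<in> test_functions \<Omega> \<Longrightarrow> smooth \<phi>"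
 by (simp add: test_functions_def smooth_def)

lemma test_function_support:
 assumes "\<phi> \<in> test_functions \<Omega>"
 obtains K where "compact K" "K \<subseteq> \<Omega>" "\<And>x. x \<notin> K \<Longrightarrow> \<phi> x = 0"
 using assms by (auto simp: test_functions_def)

lemma test_functionI:
 "smooth \<phi> \<Longrightarrow> compact K \<Longrightarrow> K \<subseteq> \<Omega> \<Longrightarrow> (\<And>x. x \<notin> K \<Longrightarrow> \<phi> x = 0) \<Longrightarrow> \<phi> \<in> test_functions \<Omega>"
 by (auto simp: test_functions_def smooth_def)

text \<open>Cutting off to a compact set turns a locally integrable function into an integrable one,
  to which \<open>conv\<close> applies. Where it is tested the cut is invisible.\<close>

definition restr :: "'a set \<Rightarrow> ('a \<Rightarrow> real) \<Rightarrow> 'a \<Rightarrow> real" where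
 "restr K u x = indicator K x * u x"

lemma restr_simps: "x \<in> K \<Longrightarrow> restr K u x = u x" "x \<notin> K \<Longrightarrow> restr K u x = 0"
 by (auto simp: restr_def)

lemma integrable_restr: "locally_integrable \<Omega> u \<Longrightarrow> compact K \<Longrightarrow> K \<subseteq> \<Omega> \<Longrightarrow> integrable lborel (restr K u)"
 unfolding locally_integrable_def set_integrable_def restr_def[abs_def] by auto

lemma integral_restr:
 "(\<And>x. x \<notin> K \<Longrightarrow> \<phi> x = 0) \<Longrightarrow> (\<integral>x. restr K u x * \<phi> x) = (\<integral>x. u x * \<phi> x)"
 by (rule integral_cong) (auto simp: restr_def indicator_def)

lemma conv_moll_test_function:
 assumes F: "integrable lborel F" "compact K" "\<And>x. x \<notin> K \<Longrightarrow> F x = 0"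
  and e: "0 < e" "e \<le> e0" and sub: "fatten e0 K \<subseteq> \<Omega>"
 shows "conv (moll e) F \<in> test_functions \<Omega>"
proof (rule test_functionI[OF conv_smooth[OF smooth_cpt_moll[OF e(1)] F(1)] compact_fatten[OF F(2), of e]])
 show "fatten e K \<subseteq> \<Omega>" using fatten_mono[OF e(2)] sub by blast
 show "conv (moll e) F x = 0" if "x \<notin> fatten e K" for x
  using that by (intro conv_zero_off[OF e(1) moll_zero[OF e(1)] F(3)])
qed

section \<open>Weak derivatives under mollification\<close>

text \<open>Test with the mollification of \<open>F\<close> and move the mollifier to
  \<open>u\<close>: its derivative is odd, which cancels the minus sign of the weak formulation and
  leaves the classical derivative of the mollified \<open>u\<close>. \<open>F\<close> itself need
  not be smooth.\<close>

lemma weak_derivative_mollified: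
 assumes w: "weak_directional_derivative \<Omega> v u u'"
  and F: "integrable lborel F" "compact K" "\<And>x. x \<notin> K \<Longrightarrow> F x = 0"
  and e: "0 < e" "e \<le> e0" and sub: "fatten e0 K \<subseteq> \<Omega>"
 shows "(\<integral>y. F y * dird v (conv (moll e) (restr (fatten e0 K) u)) y)
  = (\<integral>z. restr (fatten e0 K) u' z * conv (moll e) F z)"
proof -
 let ?K = "fatten e0 K"
 have K: "compact ?K" by (rule compact_fatten[OF F(2)])
 have u: "integrable lborel (restr ?K u)" and u': "integrable lborel (restr ?K u')"
  using w unfolding weak_directional_derivative_def by (auto intro: integrable_restr[OF _ K sub])
 have \<kappa>: "smooth_cpt (moll e)" by (rule smooth_cpt_moll[OF e(1)])
 have zero: "conv (moll e) F x = 0" if "x \<notin> ?K" for x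
  using that fatten_mono[OF e(2), of K] by (intro conv_zero_off[OF e(1) moll_zero[OF e(1)] F(3)]) auto
 have zero': "dird v (conv (moll e) F) x = 0" if "x \<notin> ?K" for x
  by (rule dird_zero_off[OF compact_imp_closed[OF K] zero that])
 have "(\<integral>x. u x * dird v (conv (moll e) F) x) = - (\<integral>x. u' x * conv (moll e) F x)"
  using w conv_moll_test_function[OF F e sub] unfolding weak_directional_derivative_def by blast
 then have "(\<integral>x. restr ?K u x * dird v (conv (moll e) F) x) = - (\<integral>x. restr ?K u' x * conv (moll e) F x)"
  using integral_restr[of ?K "dird v (conv (moll e) F)" u] integral_restr[of ?K "conv (moll e) F" u'] zero zero' by simp
 moreover have "(\<integral>x. restr ?K u x * dird v (conv (moll e) F) x)
   = - (\<integral>y. F y * dird v (conv (moll e) (restr ?K u)) y)"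
  unfolding conv_dird[OF \<kappa> F(1)] conv_dird[OF \<kappa> u]
  by (subst integral_conv_swap[OF smooth_cpt_dird[OF \<kappa>] F(1) u])
   (simp add: dird_moll_minus conv_def)
 ultimately show ?thesis by simp
qed

lemma integral_uniform_limit:
 fixes G :: "'a::euclidean_space \<Rightarrow> real"
 assumes G: "integrable lborel G"
  and m: "\<And>k. F k \<in> borel_measurable borel" "f \<in> borel_measurable borel"
  and lim: "uniform_limit K F f sequentially"
  and G0: "\<And>x. x \<notin> K \<Longrightarrow> G x = 0"
  and i: "integrable lborel (\<lambda>x. G x * f x)"
 shows "(\<lambda>k. \<integral>x. G x * F k x) \<longlonglongrightarrow> (\<integral>x. G x * f x)"
proof (rule LIMSEQ_I)
 fix r :: real assume r: "0 < r"
 define c where "c = (\<integral>x. \<bar>G x\<bar>) + 1"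
 have "0 \<le> (\<integral>x. \<bar>G x\<bar>)" by (rule integral_nonneg) simp
 then have c: "c > 0" "(\<integral>x. \<bar>G x\<bar>) < c" unfolding c_def by linarith+
 have "\<forall>\<^sub>F k in sequentially. \<forall>x\<in>K. dist (F k x) (f x) < r / c" using uniform_limitD[OF lim, of "r / c"] r c by simp
 then obtain N where N: "\<And>k x. k \<ge> N \<Longrightarrow> x \<in> K \<Longrightarrow> \<bar>F k x - f x\<bar> \<le> r / c"
  unfolding eventually_sequentially dist_real_def using less_imp_le by metis
 note [measurable] = m borel_measurable_integrable[OF G]
 show "\<exists>N. \<forall>k\<ge>N. norm ((\<integral>x. G x * F k x) - (\<integral>x. G x * f x)) < r"
 proof (intro exI allI impI)
  fix k assume k: "k \<ge> N"
  have b: "\<bar>G x * (F k x - f x)\<bar> \<le> (r / c) * \<bar>G x\<bar>" for x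
  proof (cases "x \<in> K")
   case True
   from mult_left_mono[OF N[OF k True], of "\<bar>G x\<bar>"] show ?thesis by (simp add: abs_mult mult.commute)
  qed (use G0 in simp)
  have i2: "integrable lborel (\<lambda>x. G x * (F k x - f x))"
  proof (rule integrable_bound[where f = "\<lambda>x. (r / c) * \<bar>G x\<bar>"])
   show "AE x in lborel. norm (G x * (F k x - f x)) \<le> norm ((r / c) * \<bar>G x\<bar>)"
    using b r c by (intro AE_I2) (auto intro: order_trans[OF b])
  qed (use G in auto)
  have "(\<integral>x. G x * F k x) = (\<integral>x. G x * (F k x - f x) + G x * f x)"
   by (simp add: algebra_simps)
  also have "\<dots> = (\<integral>x. G x * (F k x - f x)) + (\<integral>x. G x * f x)"
   using i i2 by (rule Bochner_Integration.integral_add[rotated])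
  finally have "norm ((\<integral>x. G x * F k x) - (\<integral>x. G x * f x)) = norm (\<integral>x. G x * (F k x - f x))" by simp
  also have "\<dots> \<le> (\<integral>x. (r / c) * \<bar>G x\<bar>)"
   using b G i2 by (intro integral_norm_bound_integral) auto
  also have "\<dots> = (r / c) * (\<integral>x. \<bar>G x\<bar>)" by simp
  also have "\<dots> < (r / c) * c" using c r by (intro mult_strict_left_mono) auto
  also have "\<dots> = r" using c by simp
  finally show "norm ((\<integral>x. G x * F k x) - (\<integral>x. G x * f x)) < r" .
 qed
qed

lemma uniform_limit_compose_bounded:
 fixes H :: "real \<Rightarrow> real"
 assumes lim: "uniform_limit K g l F" and b: "bounded (l ` K)" and H: "continuous_on UNIV H"
 shows "uniform_limit K (\<lambda>n x. H (g n x)) (\<lambda>x. H (l x)) F"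
proof -
 obtain B where B: "\<And>x. x \<in> K \<Longrightarrow> \<bar>l x\<bar> \<le> B" using b unfolding bounded_iff by auto
 show ?thesis
 proof (rule uniform_limit_compose_uniformly_continuous_on[OF lim])
  show "uniformly_continuous_on {- B - 1..B + 1} H"
   by (rule compact_uniformly_continuous) (use continuous_on_subset[OF H] in auto)
  \<comment> \<open>Uniform convergence puts the values eventually within 1 of those of
    \<open>l\<close>, so a compact interval one unit larger contains them all, and there
    \<open>H\<close> is uniformly continuous.\<close>
  show "\<forall>\<^sub>F n in F. \<forall>x\<in>K. g n x \<in> {- B - 1..B + 1}"
   using uniform_limitD[OF lim zero_less_one]
  proof eventually_elim
   case (elim n)
   show ?case
   proof
    fix x assume "x \<in> K"
    with elim B[of x] have "\<bar>g n x - l x\<bar> < 1" "\<bar>l x\<bar> \<le> B" by (auto simp: dist_real_def)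
    then show "g n x \<in> {- B - 1..B + 1}" by auto
   qed
  qed
 qed auto
qed

lemma conv_moll_uniform_limit:
 fixes u :: "'a::euclidean_space \<Rightarrow> real"
 assumes K: "compact K" and e0: "e0 > 0" and u: "continuous_on (fatten e0 K) u"
  and e: "\<And>k. 0 < e k" "\<And>k. e k \<le> e0" "e \<longlonglongrightarrow> 0"
 shows "uniform_limit K (\<lambda>k. conv (moll (e k)) (restr (fatten e0 K) u)) u sequentially"
proof (rule uniform_limitI)
 fix r :: real assume r: "0 < r"
 have "uniformly_continuous_on (fatten e0 K) u"
  by (rule compact_uniformly_continuous[OF u compact_fatten[OF K]])
 then obtain d where d: "d > 0" "\<And>x x'. x \<in> fatten e0 K \<Longrightarrow> x' \<in> fatten e0 K \<Longrightarrow> dist x' x < d \<Longrightarrow> dist (u x') (u x) < r / 2"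
  unfolding uniformly_continuous_on_def using r by (meson half_gt_zero)
 have int: "integrable lborel (restr (fatten e0 K) u)"
  using borel_integrable_compact[OF compact_fatten[OF K] u] by (simp add: restr_def[abs_def])
 have "\<forall>\<^sub>F k in sequentially. e k < d" using order_tendstoD(2)[OF e(3) d(1)] .
 then show "\<forall>\<^sub>F k in sequentially. \<forall>x\<in>K. dist (conv (moll (e k)) (restr (fatten e0 K) u) x) (u x) < r"
 proof eventually_elim
  case (elim k)
  show ?case
  proof
   fix x assume x: "x \<in> K"
   have "\<bar>conv (moll (e k)) (restr (fatten e0 K) u) x - u x\<bar> \<le> r / 2"
   proof (rule conv_moll_close[OF e(1) int])
    fix y assume y: "y \<in> cball x (e k)"
    have "y \<in> fatten e0 K" using y x e(2)[of k] by (auto simp: fatten_iff intro!: bexI[of _ x])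
    moreover have "x \<in> fatten e0 K" using x subset_fatten[of e0 K] e0 by auto
    moreover have "dist y x < d" using y elim by (simp add: dist_commute)
    ultimately show "\<bar>restr (fatten e0 K) u y - u x\<bar> \<le> r / 2"
     using d(2)[of x y] by (simp add: restr_simps dist_real_def)
   qed
   then show "dist (conv (moll (e k)) (restr (fatten e0 K) u) x) (u x) < r" using r by (simp add: dist_real_def)
  qed
 qed
qed

text \<open>The test functions mollified here need only be continuous, hence composites of \<open>u\<close> are allowed.\<close>

lemma mollified_test_limit:
 fixes u' :: "'a::euclidean_space \<Rightarrow> real"
 assumes loc: "locally_integrable \<Omega> u'"
  and K: "compact K" and e0: "e0 > 0" and sub: "fatten e0 K \<subseteq> \<Omega>"
  and e: "\<And>k. 0 < e k" "\<And>k. e k \<le> e0" "e \<longlonglongrightarrow> 0"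
  and F: "\<And>k. integrable lborel (F k)" "\<And>k x. x \<notin> K \<Longrightarrow> F k x = 0"
  and f: "continuous_on UNIV f" "\<And>x. x \<notin> K \<Longrightarrow> f x = 0"
  and lim: "uniform_limit K F f sequentially"
 shows "(\<lambda>k. \<integral>z. restr (fatten e0 K) u' z * conv (moll (e k)) (F k) z) \<longlonglongrightarrow> (\<integral>y. u' y * f y)"
proof -
 let ?K = "fatten e0 K"
 have K': "compact ?K" by (rule compact_fatten[OF K])
 have u': "integrable lborel (restr ?K u')"
  by (rule integrable_restr[OF loc K' sub])
 have subK: "K \<subseteq> ?K" using subset_fatten[of e0 K] e0 by auto
 obtain B where B: "\<And>x. \<bar>f x\<bar> \<le> B" using bounded_compact_support[OF f(1) K f(2)] by auto
 have fb: "f \<in> borel_measurable borel" by (rule borel_measurable_continuous_onI[OF f(1)])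
 have ul: "uniform_limit ?K (\<lambda>k. conv (moll (e k)) (F k)) f sequentially"
 proof (rule uniform_limitI)
  fix r :: real assume r: "0 < r"
  have "uniformly_continuous_on (fatten e0 ?K) f"
   by (rule compact_uniformly_continuous[OF continuous_on_subset[OF f(1)] compact_fatten[OF K']]) simp
  then obtain d where d: "d > 0" "\<And>x x'. x \<in> fatten e0 ?K \<Longrightarrow> x' \<in> fatten e0 ?K \<Longrightarrow> dist x' x < d \<Longrightarrow> dist (f x') (f x) < r / 4"
   unfolding uniformly_continuous_on_def using r by (metis zero_less_divide_iff zero_less_numeral)
  have "\<forall>\<^sub>F k in sequentially. e k < d" using order_tendstoD(2)[OF e(3) d(1)] .
  moreover have "\<forall>\<^sub>F k in sequentially. \<forall>x\<in>K. dist (F k x) (f x) < r / 4"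
   using r by (intro uniform_limitD[OF lim]) auto
  ultimately show "\<forall>\<^sub>F k in sequentially. \<forall>x\<in>?K. dist (conv (moll (e k)) (F k) x) (f x) < r"
  proof eventually_elim
   case (elim k)
   show ?case
   proof
    fix x assume x: "x \<in> ?K"
    have "\<bar>conv (moll (e k)) (F k) x - f x\<bar> \<le> r / 2"
    proof (rule conv_moll_close[OF e(1) F(1)])
     fix y assume y: "y \<in> cball x (e k)"
     have "y \<in> fatten e0 ?K" using y x e(2)[of k] by (auto simp: fatten_iff[of y] intro!: bexI[of _ x])
     moreover have "x \<in> fatten e0 ?K" using x subset_fatten[of e0 ?K] e0 by auto
     moreover have "dist y x < d" using y elim by (simp add: dist_commute)
     ultimately have "\<bar>f y - f x\<bar> < r / 4" using d(2)[of x y] by (simp add: dist_real_def)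
     moreover have "\<bar>F k y - f y\<bar> < r / 4"
      using elim(2) F(2)[of y k] f(2)[of y] r by (cases "y \<in> K") (auto simp: dist_real_def)
     ultimately show "\<bar>F k y - f x\<bar> \<le> r / 2" by linarith
    qed
    then show "dist (conv (moll (e k)) (F k) x) (f x) < r" using r by (simp add: dist_real_def)
   qed
  qed
 qed
 have i: "integrable lborel (\<lambda>x. restr ?K u' x * f x)"
 proof (rule integrable_bound[where f = "\<lambda>x. B * restr ?K u' x"])
  show "AE x in lborel. norm (restr ?K u' x * f x) \<le> norm (B * restr ?K u' x)"
  proof (intro AE_I2)
   fix x
   have "\<bar>f x\<bar> * \<bar>restr ?K u' x\<bar> \<le> \<bar>B\<bar> * \<bar>restr ?K u' x\<bar>" using B[of x] by (intro mult_right_mono) auto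
   then show "norm (restr ?K u' x * f x) \<le> norm (B * restr ?K u' x)" by (simp add: abs_mult mult.commute)
  qed
  show "(\<lambda>x. restr ?K u' x * f x) \<in> borel_measurable lborel"
   using fb borel_measurable_integrable[OF u'] by simp
 qed (use u' in auto)
 have "(\<lambda>k. \<integral>z. restr ?K u' z * conv (moll (e k)) (F k) z) \<longlonglongrightarrow> (\<integral>x. restr ?K u' x * f x)"
 proof (rule integral_uniform_limit[OF u' _ fb ul _ i])
  show "conv (moll (e k)) (F k) \<in> borel_measurable borel" for k
   by (intro borel_measurable_continuous_onI smooth_continuous conv_smooth smooth_cpt_moll e(1) F(1))
 qed (simp add: restr_simps)
 moreover have "(\<integral>x. restr ?K u' x * f x) = (\<integral>x. u' x * f x)"
  using subK f(2) by (intro integral_restr) auto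
 ultimately show ?thesis by simp
qed

text \<open>The derivatives of the mollified \<open>u\<close> converge only weakly, so the limit is
  taken in their pairing with \<open>F k\<close>. Letting \<open>F k\<close> vary with
  \<open>k\<close>, uniformly convergent, is what nonlinear expressions in the mollified
  \<open>u\<close> require.\<close>

lemma weak_derivative_limit:
 fixes u :: "'a::euclidean_space \<Rightarrow> real"
 assumes w: "weak_directional_derivative \<Omega> v u u'"
  and K: "compact K" and e0: "e0 > 0" and sub: "fatten e0 K \<subseteq> \<Omega>"
  and e: "\<And>k. 0 < e k" "\<And>k. e k \<le> e0" "e \<longlonglongrightarrow> 0"
  and F: "\<And>k. integrable lborel (F k)" "\<And>k x. x \<notin> K \<Longrightarrow> F k x = 0"
  and f: "continuous_on UNIV f" "\<And>x. x \<notin> K \<Longrightarrow> f x = 0"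
  and lim: "uniform_limit K F f sequentially"
 shows "(\<lambda>k. \<integral>y. F k y * dird v (conv (moll (e k)) (restr (fatten e0 K) u)) y) \<longlonglongrightarrow> (\<integral>y. u' y * f y)"
proof -
 have "locally_integrable \<Omega> u'" using w unfolding weak_directional_derivative_def by blast
 from mollified_test_limit[OF this K e0 sub e F f lim] show ?thesis
  by (simp add: weak_derivative_mollified[OF w F(1) K F(2) e(1,2) sub])
qed

lemma mollifier_sequence:
 fixes e0 :: real assumes "e0 > 0"
 shows "0 < e0 / (real k + 1)" "e0 / (real k + 1) \<le> e0" "(\<lambda>k. e0 / (real k + 1)) \<longlonglongrightarrow> 0"
proof -
 show "0 < e0 / (real k + 1)" "e0 / (real k + 1) \<le> e0" using assms by (auto simp: field_simps)
 have "(\<lambda>k. e0 * (1 / real (Suc k))) \<longlonglongrightarrow> e0 * 0"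
  by (intro tendsto_mult tendsto_const) (rule LIMSEQ_Suc[OF lim_1_over_n])
 then show "(\<lambda>k. e0 / (real k + 1)) \<longlonglongrightarrow> 0" by (simp add: add.commute)
qed

lemma GDERIV_continuous_on: "(\<And>x. GDERIV f x :> Df x) \<Longrightarrow> continuous_on A f"
 by (meson GDERIV_isCont continuous_at_imp_continuous_on)

lemma GDERIV_zero_off:
 fixes f :: "'a::euclidean_space \<Rightarrow> real"
 assumes K: "closed K" "\<And>x. x \<notin> K \<Longrightarrow> f x = 0" "x \<notin> K" and D: "GDERIV f x :> D"
 shows "D = 0"
 using dird_zero_off[OF K, where v = D] GDERIV_dird[OF D, where v = D] by simp

lemma integrable_mult_bounded:
 fixes f g :: "'a \<Rightarrow> real"
 assumes f: "integrable M f" and g: "g \<in> borel_measurable M" and b: "\<And>x. \<bar>g x\<bar> \<le> B"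
 shows "integrable M (\<lambda>x. f x * g x)"
proof (rule integrable_bound[where f = "\<lambda>x. B * f x"])
 show "AE x in M. norm (f x * g x) \<le> norm (B * f x)"
 proof (intro AE_I2)
  fix x
  have "\<bar>g x\<bar> * \<bar>f x\<bar> \<le> \<bar>B\<bar> * \<bar>f x\<bar>" using b[of x] by (intro mult_right_mono) auto
  then show "norm (f x * g x) \<le> norm (B * f x)" by (simp add: abs_mult mult.commute)
 qed
 show "(\<lambda>x. f x * g x) \<in> borel_measurable M" using borel_measurable_integrable[OF f] g by (rule borel_measurable_times)
qed (use f in simp)

lemma compact_support_integral_limit:
 fixes G :: "'a::euclidean_space \<Rightarrow> real"
 assumes G: "continuous_on UNIV G" "\<And>x. x \<notin> K \<Longrightarrow> G x = 0" and K: "compact K"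
  and F: "\<And>k. continuous_on UNIV (F k)" and g: "continuous_on K g"
  and lim: "uniform_limit K F g sequentially"
 shows "(\<lambda>k. \<integral>x. G x * F k x) \<longlonglongrightarrow> (\<integral>x. G x * g x)"
proof -
 have eq: "G x * restr K g x = G x * g x" for x using G(2)[of x] by (cases "x \<in> K") (auto simp: restr_simps)
 have ir: "integrable lborel (restr K g)"
  using borel_integrable_compact[OF K g] by (simp add: restr_def[abs_def])
 obtain B where B: "\<And>x. \<bar>G x\<bar> \<le> B" using bounded_compact_support[OF G(1) K G(2)] by auto
 have "(\<lambda>k. \<integral>x. G x * F k x) \<longlonglongrightarrow> (\<integral>x. G x * restr K g x)"
 proof (rule integral_uniform_limit[OF _ _ _ _ G(2)])
  show "integrable lborel G" by (rule integrable_compact_support[OF G(1) K G(2)])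
  show "F k \<in> borel_measurable borel" for k by (rule borel_measurable_continuous_onI[OF F])
  show "restr K g \<in> borel_measurable borel" using borel_measurable_integrable[OF ir] by simp
  show "uniform_limit K F (restr K g) sequentially"
   by (rule uniform_limit_cong'[THEN iffD1, OF _ _ lim]) (auto simp: restr_simps)
  show "integrable lborel (\<lambda>x. G x * restr K g x)"
   using integrable_mult_bounded[OF ir, of G B] B borel_measurable_continuous_onI[OF G(1)] by (simp add: mult.commute)
 qed
 then show ?thesis unfolding eq .
qed

text \<open>Classical integration by parts for the mollifications of \<open>u\<close>, then passage
  to the limit. The function \<open>c\<close> is constant in direction \<open>v\<close>, so
  subtracting it leaves the derivative alone: in the time direction it may be any differentiable
  function of \<open>x\<close>, which is how a stationary comparison function enters.\<close>

lemma weak_chain_rule: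
 fixes u c \<zeta> :: "'a::euclidean_space \<Rightarrow> real" and H :: "real \<Rightarrow> real"
 assumes \<Omega>: "open \<Omega>" and u: "continuous_on \<Omega> u" and w: "weak_directional_derivative \<Omega> v u u'"
  and H: "\<And>a. (H has_real_derivative H' a) (at a)" "continuous_on UNIV H'"
  and c: "\<And>x. GDERIV c x :> Dc x" "\<And>x. v \<bullet> Dc x = 0"
  and \<zeta>: "\<And>x. GDERIV \<zeta> x :> D\<zeta> x" "continuous_on UNIV (\<lambda>x. v \<bullet> D\<zeta> x)"
  and K: "compact K" "K \<subseteq> \<Omega>" "\<And>x. x \<notin> K \<Longrightarrow> \<zeta> x = 0"
 shows "(\<integral>x. u' x * (\<zeta> x * H' (u x - c x))) = - (\<integral>x. (v \<bullet> D\<zeta> x) * H (u x - c x))"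
proof -
 obtain e0 where e0: "e0 > 0" and sub: "fatten e0 K \<subseteq> \<Omega>" by (rule fatten_subset_open[OF K(1) \<Omega> K(2)])
 define e where "e k = e0 / (real k + 1)" for k
 note e = mollifier_sequence[OF e0, folded e_def]
 have uK: "continuous_on (fatten e0 K) u" by (rule continuous_on_subset[OF u sub])
 have iU: "integrable lborel (restr (fatten e0 K) u)"
  using borel_integrable_compact[OF compact_fatten[OF K(1)] uK] by (simp add: restr_def[abs_def])
 define uk where "uk k = conv (moll (e k)) (restr (fatten e0 K) u)" for k
 have su: "smooth (uk k)" for k unfolding uk_def by (intro conv_smooth smooth_cpt_moll e iU)
 have ul: "uniform_limit K uk u sequentially" unfolding uk_def by (rule conv_moll_uniform_limit[OF K(1) e0 uK e])
 have cH: "continuous_on UNIV H" using H(1) by (auto intro!: GDERIV_continuous_on)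
 have cc: "continuous_on A c" and c\<zeta>: "continuous_on A \<zeta>" for A using c \<zeta> by (auto intro!: GDERIV_continuous_on)
 have bK: "bounded (g ` K)" if "continuous_on K g" for g :: "'a \<Rightarrow> real"
  using compact_continuous_image[OF that K(1)] by (rule compact_imp_bounded)
 have ulq: "uniform_limit K (\<lambda>k x. uk k x - c x) (\<lambda>x. u x - c x) sequentially"
  by (intro uniform_limit_minus ul uniform_limit_const)
 have cq: "continuous_on A (\<lambda>x. u x - c x)" if "A \<subseteq> \<Omega>" for A
  using continuous_on_subset[OF u that] by (intro continuous_intros cc)
 note ulH' = uniform_limit_compose_bounded[OF ulq bK[OF cq[OF K(2)]] H(2)]
 note ulH = uniform_limit_compose_bounded[OF ulq bK[OF cq[OF K(2)]] cH]
 have cqk: "continuous_on UNIV (\<lambda>x. uk k x - c x)" for k by (intro continuous_intros cc smooth_continuous su)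
 note cH'k = continuous_on_compose2[OF H(2) cqk subset_UNIV] and cHk = continuous_on_compose2[OF cH cqk subset_UNIV]
 have cH'q: "continuous_on A (\<lambda>x. H' (u x - c x))" if "A \<subseteq> \<Omega>" for A
  by (rule continuous_on_compose2[OF H(2) cq[OF that]]) auto
 have cHK: "continuous_on K (\<lambda>x. H (u x - c x))" by (rule continuous_on_compose2[OF cH cq[OF K(2)]]) auto
 have D0: "v \<bullet> D\<zeta> x = 0" if "x \<notin> K" for x
  using GDERIV_zero_off[OF compact_imp_closed[OF K(1)] K(3) that \<zeta>(1)] by simp
 \<comment> \<open>The factor containing \<open>H'\<close> depends on \<open>k\<close> but converges
   uniformly, which compensates for the merely weak convergence of the derivative.\<close>
 have L: "(\<lambda>k. \<integral>y. (\<zeta> y * H' (uk k y - c y)) * dird v (uk k) y) \<longlonglongrightarrow> (\<integral>y. u' y * (\<zeta> y * H' (u y - c y)))"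
  unfolding uk_def
 proof (rule weak_derivative_limit[OF w K(1) e0 sub e], fold uk_def)
  show "integrable lborel (\<lambda>x. \<zeta> x * H' (uk k x - c x))" for k
   by (rule integrable_compact_support[OF continuous_on_mult[OF c\<zeta> cH'k] K(1)]) (simp add: K(3))
  show "continuous_on UNIV (\<lambda>x. \<zeta> x * H' (u x - c x))"
   by (rule continuous_on_UNIV_support[OF \<Omega> compact_imp_closed[OF K(1)] K(2) continuous_on_mult[OF c\<zeta> cH'q]]) (simp_all add: K(3))
  show "uniform_limit K (\<lambda>k x. \<zeta> x * H' (uk k x - c x)) (\<lambda>x. \<zeta> x * H' (u x - c x)) sequentially"
   by (intro uniform_lim_mult uniform_limit_const ulH' bK c\<zeta> cH'q[OF K(2)])
 qed (simp_all add: K(3))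
 have R: "(\<lambda>k. \<integral>x. (v \<bullet> D\<zeta> x) * H (uk k x - c x)) \<longlonglongrightarrow> (\<integral>x. (v \<bullet> D\<zeta> x) * H (u x - c x))"
  by (rule compact_support_integral_limit[OF \<zeta>(2) D0 K(1) cHk cHK ulH])
 have "(\<integral>y. (\<zeta> y * H' (uk k y - c y)) * dird v (uk k) y) = - (\<integral>x. (v \<bullet> D\<zeta> x) * H (uk k x - c x))" for k
 proof -
  define q where "q x = uk k x - c x" for x
  define G where "G x = \<zeta> x *\<^sub>R (H' (q x) *\<^sub>R (grad (uk k) x - Dc x)) + H (q x) *\<^sub>R D\<zeta> x" for x
  have gq: "GDERIV q x :> grad (uk k) x - Dc x" for x unfolding q_def[abs_def] by (intro GDERIV_diff smooth_GDERIV su c)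
  have GX: "GDERIV (\<lambda>x. \<zeta> x * H (q x)) x :> G x" for x
   unfolding G_def by (intro GDERIV_mult \<zeta> GDERIV_DERIV_compose[OF gq H(1)])
  have BG: "v \<bullet> G x = (\<zeta> x * H' (q x)) * dird v (uk k) x + (v \<bullet> D\<zeta> x) * H (q x)" for x
   unfolding G_def by (simp add: inner_add_right inner_diff_right dird_eq_grad[OF smooth_differentiable[OF su]] c(2))
  have c1: "continuous_on UNIV (\<lambda>x. (\<zeta> x * H' (q x)) * dird v (uk k) x)"
   unfolding q_def by (intro continuous_intros c\<zeta> cH'k smooth_continuous smooth_dird su)
  have c2: "continuous_on UNIV (\<lambda>x. (v \<bullet> D\<zeta> x) * H (q x))" unfolding q_def by (intro continuous_on_mult \<zeta>(2) cHk)
  have "(\<integral>x. v \<bullet> G x) = 0"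
   by (rule integral_GDERIV_eq_0(2)[OF GX _ K(1)]) (use c1 c2 in \<open>auto simp: BG K(3) intro!: continuous_on_add\<close>)
  moreover have "integrable lborel (\<lambda>x. (\<zeta> x * H' (q x)) * dird v (uk k) x)" "integrable lborel (\<lambda>x. (v \<bullet> D\<zeta> x) * H (q x))"
   by (rule integrable_compact_support[OF c1 K(1)], simp add: K(3))
    (rule integrable_compact_support[OF c2 K(1)], simp add: D0)
  ultimately show ?thesis unfolding BG q_def by simp
 qed
 with L have "(\<lambda>k. - (\<integral>x. (v \<bullet> D\<zeta> x) * H (uk k x - c x))) \<longlonglongrightarrow> (\<integral>x. u' x * (\<zeta> x * H' (u x - c x)))" by simp
 from LIMSEQ_unique[OF this tendsto_minus[OF R]] show ?thesis .
qed

section \<open>Weak form of the equation\<close>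

lemma DERIV_powr_pos_part:
 fixes q :: real assumes q: "q > 1"
 shows "((\<lambda>s. max 0 s powr q) has_real_derivative q * max 0 s powr (q - 1)) (at s)"
proof (cases s "0::real" rule: linorder_cases)
 case less
 have "\<forall>\<^sub>F x in nhds s. max 0 x powr q = 0"
  using eventually_nhds_in_open[of "{..<0}" s] less by (auto elim!: eventually_mono)
 then show ?thesis using less
  by (subst DERIV_cong_ev[OF refl _ refl, where g = "\<lambda>_. 0"]) auto
next
 case equal
 have "((\<lambda>h::real. \<bar>h\<bar> powr (q - 1)) \<longlongrightarrow> \<bar>0\<bar> powr (q - 1)) (at 0)"
  by (intro tendsto_powr' tendsto_rabs tendsto_ident_at tendsto_const) (use q in auto)
 then have l: "((\<lambda>h::real. \<bar>h\<bar> powr (q - 1)) \<longlongrightarrow> 0) (at 0)" by simp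
 have "((\<lambda>h. max 0 h powr q / h) \<longlongrightarrow> 0) (at 0)"
 proof (rule Lim_null_comparison[OF _ l])
  have "norm (max 0 h powr q / h) \<le> \<bar>h\<bar> powr (q - 1)" for h :: real
   using powr_diff[of h q 1] by (cases h "0::real" rule: linorder_cases) auto
  then show "\<forall>\<^sub>F h in at 0. norm (max 0 h powr q / h) \<le> \<bar>h\<bar> powr (q - 1)" by (simp add: always_eventually)
 qed
 then show ?thesis using equal by (simp add: DERIV_def)
next
 case greater
 have "\<forall>\<^sub>F x in nhds s. max 0 x powr q = x powr q"
  using eventually_nhds_in_open[of "{0<..}" s] greater by (auto elim!: eventually_mono)
 then show ?thesis using greater
  by (subst DERIV_cong_ev[OF refl _ refl, where g = "\<lambda>x. x powr q"]) (auto intro!: derivative_eq_intros)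
qed

lemma continuous_on_powr_pos_part: "q > 0 \<Longrightarrow> continuous_on A (\<lambda>s::real. max 0 s powr q)"
 by (intro continuous_on_powr' continuous_intros) auto

definition \<Phi> :: "real \<Rightarrow> real \<Rightarrow> real" where
 "\<Phi> \<gamma> s = \<gamma> / (\<gamma> + 1) * s powr (\<gamma> + 1)"

definition slap :: "(real \<times> 'a::euclidean_space \<Rightarrow> real) \<Rightarrow> real \<times> 'a \<Rightarrow> real" where
 "slap \<phi> z = (\<Sum>b\<in>Basis. dird (0, b) (dird (0, b) \<phi>) z)"

lemma open_space_time: "open space_time"
 unfolding space_time_def by (intro open_Times) auto

lemma \<Phi>_mono: "\<gamma> > 0 \<Longrightarrow> 0 \<le> s \<Longrightarrow> s \<le> t \<Longrightarrow> \<Phi> \<gamma> s \<le> \<Phi> \<gamma> t"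
 unfolding \<Phi>_def by (intro mult_left_mono powr_mono2) auto

lemma \<Phi>_less_iff:
 assumes "\<gamma> > 0" "0 \<le> s" "0 \<le> t" shows "\<Phi> \<gamma> s < \<Phi> \<gamma> t \<longleftrightarrow> s < t"
proof
 assume "s < t"
 then show "\<Phi> \<gamma> s < \<Phi> \<gamma> t" unfolding \<Phi>_def using assms
  by (intro mult_strict_left_mono powr_less_mono2) auto
next
 assume "\<Phi> \<gamma> s < \<Phi> \<gamma> t"
 then show "s < t" using \<Phi>_mono[of \<gamma> t s] assms by force
qed

lemma \<Phi>_nonneg: "\<gamma> > 0 \<Longrightarrow> 0 \<le> \<Phi> \<gamma> s"
 by (simp add: \<Phi>_def)

definition joint :: "(real \<Rightarrow> 'a \<Rightarrow> real) \<Rightarrow> real \<times> 'a \<Rightarrow> real" where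
 "joint n = (\<lambda>(t, x). n t x)"

lemma joint_apply: "joint n z = n (fst z) (snd z)"
 by (simp add: joint_def case_prod_unfold)

lemma solution_nonneg: "strong_solution \<gamma> n\<^sub>0 n \<Longrightarrow> 0 < t \<Longrightarrow> 0 \<le> n t x"
 unfolding strong_solution_def by blast

lemma solution_integrable: "strong_solution \<gamma> n\<^sub>0 n \<Longrightarrow> 0 \<le> t \<Longrightarrow> integrable lborel (n t)"
 unfolding strong_solution_def by blast

lemma solution_L1_continuous:
 "strong_solution \<gamma> n\<^sub>0 n \<Longrightarrow> 0 \<le> t \<Longrightarrow> ((\<lambda>s. \<integral>x. \<bar>n s x - n t x\<bar>) \<longlongrightarrow> 0) (at t within {0..})"
 unfolding strong_solution_def by blast

lemma solution_continuous: "strong_solution \<gamma> n\<^sub>0 n \<Longrightarrow> continuous_on space_time (joint n)"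
 unfolding strong_solution_def joint_def by blast

text \<open>The definition of a solution provides a weak gradient of the pressure
  \<open>p = n powr \<gamma>\<close> only. Writing \<open>n\<close> as \<open>H' p\<close> and
  \<open>\<Phi> \<gamma> n\<close> as \<open>H p\<close> gives
  \<open>n \<nabla>p = \<nabla>(H p)\<close> by the chain rule, and a second integration by parts
  puts both derivatives on the test function.\<close>

lemma weak_pde:
 fixes n :: "real \<Rightarrow> 'a::euclidean_space \<Rightarrow> real"
 assumes g: "\<gamma> > 0" and sol: "strong_solution \<gamma> n\<^sub>0 n"
 obtains D where "weak_directional_derivative space_time (1, 0) (joint n) D"
  and "\<And>\<phi>. \<phi> \<in> test_functions space_time \<Longrightarrow>
   (\<integral>z. D z * \<phi> z) = (\<integral>z. \<Phi> \<gamma> (joint n z) * slap \<phi> z)"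
proof -
 let ?N = "\<lambda>(t, x). n t x"
 let ?p = "\<lambda>(t, x). n t x powr \<gamma>"
 note pos = solution_nonneg[OF sol]
 have cont: "continuous_on space_time ?N" using solution_continuous[OF sol] unfolding joint_def .
 obtain gp D dv where gp: "weak_spatial_gradient ?p gp" and D: "weak_time_derivative ?N D"
  and dv: "weak_spatial_divergence (\<lambda>(t, x). n t x *\<^sub>R gp (t, x)) dv"
  and ae: "AE z in lborel. z \<in> space_time \<longrightarrow> D z = dv z"
  using sol unfolding strong_solution_def by blast
 define F where "F = (\<lambda>(t, x). n t x *\<^sub>R gp (t, x))"
 have contp: "continuous_on space_time ?p"
 proof -
  have "continuous_on space_time (\<lambda>z. (?N z) powr \<gamma>)"
   by (intro continuous_on_powr' cont continuous_intros) (use pos g in \<open>auto simp: space_time_def\<close>)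
  then show ?thesis by (simp add: case_prod_unfold)
 qed
 \<comment> \<open>The potential \<Phi> as a function of the pressure. Since
   \<open>(\<gamma> + 1) / \<gamma> > 1\<close> it is C^1 also at \<open>p = 0\<close>; the positive
   part extends it to the whole line, as the chain rule demands.\<close>
 define H where "H s = \<gamma> / (\<gamma> + 1) * max 0 s powr ((\<gamma> + 1) / \<gamma>)" for s :: real
 define H' where "H' s = max 0 s powr (1 / \<gamma>)" for s :: real
 have q: "(\<gamma> + 1) / \<gamma> > 1" "(\<gamma> + 1) / \<gamma> - 1 = 1 / \<gamma>" using g by (auto simp: field_simps)
 have H: "(H has_real_derivative H' s) (at s)" for s
 proof -
  have "(H has_real_derivative \<gamma> / (\<gamma> + 1) * ((\<gamma> + 1) / \<gamma> * max 0 s powr ((\<gamma> + 1) / \<gamma> - 1))) (at s)"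
   unfolding H_def[abs_def] by (intro DERIV_cmult DERIV_powr_pos_part q)
  moreover have "\<gamma> / (\<gamma> + 1) * ((\<gamma> + 1) / \<gamma> * max 0 s powr ((\<gamma> + 1) / \<gamma> - 1)) = H' s"
  proof -
   have "\<gamma> / (\<gamma> + 1) * ((\<gamma> + 1) / \<gamma>) = 1" using g by simp
   then show ?thesis unfolding H'_def q(2) by (simp only: mult.assoc[symmetric] mult_1)
  qed
  ultimately show ?thesis by simp
 qed
 have H'c: "continuous_on UNIV H'" unfolding H'_def[abs_def] by (intro continuous_on_powr_pos_part) (use g in simp)
 have Hp: "H (?p z) = \<Phi> \<gamma> (?N z)" "H' (?p z) = ?N z" if "z \<in> space_time" for z
  using that pos[of "fst z" "snd z"] g
  by (auto simp: H_def H'_def \<Phi>_def powr_powr space_time_def powr_one)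
 show ?thesis
 proof (rule that)
  show "weak_directional_derivative space_time (1, 0) (joint n) D" using D unfolding weak_time_derivative_def joint_def .
  fix \<phi> :: "real \<times> 'a \<Rightarrow> real" assume \<phi>: "\<phi> \<in> test_functions space_time"
  obtain K where K: "compact K" "K \<subseteq> space_time" and \<phi>0: "\<And>z. z \<notin> K \<Longrightarrow> \<phi> z = 0"
   using test_function_support[OF \<phi>] by blast
  have sm: "smooth \<phi>" by (rule test_function_smooth[OF \<phi>])
  have d0: "dird v \<phi> z = 0" if "z \<notin> K" for v z by (rule dird_zero_off[OF compact_imp_closed[OF K(1)] \<phi>0 that])
  have dd0: "dird w (dird v \<phi>) z = 0" if "z \<notin> K" for v w z by (rule dird_zero_off[OF compact_imp_closed[OF K(1)] d0 that])
  have HpK: "H (?p z) * dird (0, b) (dird (0, b) \<phi>) z = \<Phi> \<gamma> (?N z) * dird (0, b) (dird (0, b) \<phi>) z" for z b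
  proof (cases "z \<in> K")
   case True
   then have "z \<in> space_time" using K(2) by blast
   from Hp(1)[OF this] show ?thesis by (simp only:)
  next
   case False
   from dd0[OF this] show ?thesis by (simp only: mult_zero_right)
  qed
  have "(\<integral>z. D z * \<phi> z) = (\<integral>z. dv z * \<phi> z)"
  proof -
   have Dm: "integrable lborel (restr K D)" and dm: "integrable lborel (restr K dv)"
    using D dv unfolding weak_time_derivative_def weak_directional_derivative_def weak_spatial_divergence_def
    by (auto intro: integrable_restr[OF _ K])
   have pm: "\<phi> \<in> borel_measurable borel" by (rule borel_measurable_continuous_onI[OF smooth_continuous[OF sm]])
   note [measurable] = borel_measurable_integrable[OF Dm] borel_measurable_integrable[OF dm] pm
   have "(\<integral>z. restr K D z * \<phi> z) = (\<integral>z. restr K dv z * \<phi> z)"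
   proof (rule integral_cong_AE)
    show "AE z in lborel. restr K D z * \<phi> z = restr K dv z * \<phi> z"
     using ae by eventually_elim (use K(2) in \<open>auto simp: restr_def indicator_def\<close>)
   qed measurable
   then show ?thesis using integral_restr[of K \<phi>, OF \<phi>0] by simp
  qed
  also have "\<dots> = - (\<integral>z. frechet_derivative \<phi> (at z) (0, F z))"
   using dv \<phi> unfolding weak_spatial_divergence_def F_def by auto
  also have "(\<integral>z. frechet_derivative \<phi> (at z) (0, F z)) = (\<integral>z. (\<Sum>b\<in>Basis. (F z \<bullet> b) * dird (0, b) \<phi> z))"
  proof (rule integral_cong[OF refl])
   fix z
   have "(0::real, F z) = (0, \<Sum>b\<in>Basis. (F z \<bullet> b) *\<^sub>R b)" by (simp add: euclidean_representation)
   also have "\<dots> = (\<Sum>b\<in>Basis. (F z \<bullet> b) *\<^sub>R (0, b))" by (simp add: prod_eq_iff fst_sum snd_sum)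
   finally have eq: "(0::real, F z) = (\<Sum>b\<in>Basis. (F z \<bullet> b) *\<^sub>R (0, b))" .
   have "frechet_derivative \<phi> (at z) (0, F z) = (0, F z) \<bullet> grad \<phi> z"
    by (rule dird_eq_grad[OF smooth_differentiable[OF sm]])
   also have "\<dots> = (\<Sum>b\<in>Basis. (F z \<bullet> b) * dird (0, b) \<phi> z)" unfolding eq
    by (simp only: inner_sum_left inner_scaleR_left dird_eq_grad[OF smooth_differentiable[OF sm]])
   finally show "frechet_derivative \<phi> (at z) (0, F z) = (\<Sum>b\<in>Basis. (F z \<bullet> b) * dird (0, b) \<phi> z)" .
  qed
  also have "\<dots> = (\<Sum>b\<in>Basis. \<integral>z. (F z \<bullet> b) * dird (0, b) \<phi> z)"
  proof (rule integral_sum)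
   fix b :: 'a assume b: "b \<in> Basis"
   have "integrable lborel (\<lambda>z. indicator K z *\<^sub>R F z)"
    using dv K unfolding weak_spatial_divergence_def locally_integrable_def set_integrable_def F_def by blast
   then have i: "integrable lborel (\<lambda>z. (indicator K z *\<^sub>R F z) \<bullet> b)" by (rule integrable_inner_left)
   obtain C where C: "\<And>z. \<bar>dird (0, b) \<phi> z\<bar> \<le> C"
    using bounded_compact_support[OF smooth_continuous[OF smooth_dird[OF sm]] K(1) d0]
    unfolding real_norm_def by blast
   have eq: "(F z \<bullet> b) * dird (0, b) \<phi> z = dird (0, b) \<phi> z * ((indicator K z *\<^sub>R F z) \<bullet> b)" for z
    using d0[of z] by (cases "z \<in> K") auto
   show "integrable lborel (\<lambda>z. (F z \<bullet> b) * dird (0, b) \<phi> z)"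
    unfolding eq
   proof (rule integrable_bound[where f = "\<lambda>z. C * ((indicator K z *\<^sub>R F z) \<bullet> b)"])
    show "AE z in lborel. norm (dird (0, b) \<phi> z * ((indicator K z *\<^sub>R F z) \<bullet> b)) \<le> norm (C * ((indicator K z *\<^sub>R F z) \<bullet> b))"
    proof (intro AE_I2)
     fix z
     have "\<bar>dird (0, b) \<phi> z\<bar> * \<bar>(indicator K z *\<^sub>R F z) \<bullet> b\<bar> \<le> \<bar>C\<bar> * \<bar>(indicator K z *\<^sub>R F z) \<bullet> b\<bar>"
      using C[of z] by (intro mult_right_mono) auto
     then show "norm (dird (0, b) \<phi> z * ((indicator K z *\<^sub>R F z) \<bullet> b)) \<le> norm (C * ((indicator K z *\<^sub>R F z) \<bullet> b))"
      by (simp only: real_norm_def abs_mult)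
    qed
    have "dird (0, b) \<phi> \<in> borel_measurable lborel"
     using borel_measurable_continuous_onI[OF smooth_continuous[OF smooth_dird[OF sm]]] by simp
    then show "(\<lambda>z. dird (0, b) \<phi> z * ((indicator K z *\<^sub>R F z) \<bullet> b)) \<in> borel_measurable lborel"
     using borel_measurable_integrable[OF i] by (rule borel_measurable_times)
   qed (use i in \<open>rule integrable_mult_right\<close>)
  qed
  also have "\<dots> = (\<Sum>b\<in>Basis. - (\<integral>z. \<Phi> \<gamma> (?N z) * dird (0, b) (dird (0, b) \<phi>) z))"
  proof (rule sum.cong[OF refl])
   fix b :: 'a assume b: "b \<in> Basis"
   have w: "weak_directional_derivative space_time (0, b) ?p (\<lambda>z. gp z \<bullet> b)"
    using gp unfolding weak_spatial_gradient_def by blast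
   have "(\<integral>z. H (?p z) * dird (0, b) (dird (0, b) \<phi>) z) = - (\<integral>z. (gp z \<bullet> b) * (H' (?p z) * dird (0, b) \<phi> z))"
    using weak_chain_rule[OF open_space_time contp w H H'c GDERIV_const[of 0] _ smooth_GDERIV[OF smooth_dird[OF sm]] _ K d0, of "(0, b)"]
    by (simp add: dird_eq_grad[OF smooth_differentiable[OF smooth_dird[OF sm]], symmetric] smooth_continuous smooth_dird sm mult.commute)
   moreover have "(\<integral>z. H (?p z) * dird (0, b) (dird (0, b) \<phi>) z) = (\<integral>z. \<Phi> \<gamma> (?N z) * dird (0, b) (dird (0, b) \<phi>) z)"
    by (rule integral_cong[OF refl HpK])
   moreover have "(\<integral>z. (gp z \<bullet> b) * (H' (?p z) * dird (0, b) \<phi> z)) = (\<integral>z. (F z \<bullet> b) * dird (0, b) \<phi> z)"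
   proof (rule integral_cong[OF refl])
    fix z
    show "(gp z \<bullet> b) * (H' (?p z) * dird (0, b) \<phi> z) = (F z \<bullet> b) * dird (0, b) \<phi> z"
    proof (cases "z \<in> K")
     case True
     then have "H' (?p z) = ?N z" using Hp(2) K(2) by blast
     then show ?thesis unfolding F_def by (simp add: case_prod_unfold)
    qed (simp add: d0)
   qed
   ultimately show "(\<integral>z. (F z \<bullet> b) * dird (0, b) \<phi> z) = - (\<integral>z. \<Phi> \<gamma> (?N z) * dird (0, b) (dird (0, b) \<phi>) z)"
    by simp
  qed
  also have "- (\<Sum>b\<in>Basis. - (\<integral>z. \<Phi> \<gamma> (?N z) * dird (0, b) (dird (0, b) \<phi>) z))
   = (\<Sum>b\<in>Basis. \<integral>z. \<Phi> \<gamma> (?N z) * dird (0, b) (dird (0, b) \<phi>) z)"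
   by (simp add: sum_negf)
  also have "\<dots> = (\<integral>z. (\<Sum>b\<in>Basis. \<Phi> \<gamma> (?N z) * dird (0, b) (dird (0, b) \<phi>) z))"
  proof (rule integral_sum[symmetric])
   fix b :: 'a
   have "continuous_on UNIV (\<lambda>z. H (?p z) * dird (0, b) (dird (0, b) \<phi>) z)"
   proof (rule continuous_on_UNIV_support[OF open_space_time compact_imp_closed[OF K(1)] K(2)])
    have "continuous_on UNIV H" using H by (meson DERIV_isCont continuous_at_imp_continuous_on)
    then show "continuous_on space_time (\<lambda>z. H (?p z) * dird (0, b) (dird (0, b) \<phi>) z)"
     by (intro continuous_intros continuous_on_compose2[OF _ contp, of UNIV H]
       continuous_on_subset[OF smooth_continuous[OF smooth_dird[OF smooth_dird[OF sm]]]]) auto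
   qed (simp add: dd0)
   then have "integrable lborel (\<lambda>z. H (?p z) * dird (0, b) (dird (0, b) \<phi>) z)"
    by (rule integrable_compact_support[OF _ K(1)]) (simp add: dd0)
   then show "integrable lborel (\<lambda>z. \<Phi> \<gamma> (?N z) * dird (0, b) (dird (0, b) \<phi>) z)" unfolding HpK .
  qed
  finally show "(\<integral>z. D z * \<phi> z) = (\<integral>z. \<Phi> \<gamma> (joint n z) * slap \<phi> z)"
   by (simp add: slap_def sum_distrib_left joint_def)
 qed
qed

section \<open>Kato's inequality\<close>

lemma conv_bounded:
 assumes \<kappa>: "smooth_cpt \<kappa>" and F: "integrable lborel F"
 shows "\<exists>B. \<forall>z. \<bar>conv \<kappa> F z\<bar> \<le> B"
proof -
 obtain C where C: "\<And>x. \<bar>\<kappa> x\<bar> \<le> C" using smooth_cpt_bounded[OF \<kappa>] by blast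
 have "\<bar>conv \<kappa> F z\<bar> \<le> (\<integral>y. C * \<bar>F y\<bar>)" for z
 proof -
  have "norm (\<integral>y. \<kappa> (z - y) * F y) \<le> (\<integral>y. C * \<bar>F y\<bar>)"
   by (intro integral_norm_bound_integral conv_GDERIV(3)[OF \<kappa> F])
    (use F C in \<open>auto simp: abs_mult intro!: mult_right_mono\<close>)
  then show ?thesis by (simp add: conv_def)
 qed
 then show ?thesis by blast
qed

lemma conv_dird_fun: "smooth_cpt \<kappa> \<Longrightarrow> integrable lborel F \<Longrightarrow> dird v (conv \<kappa> F) = conv (dird v \<kappa>) F"
 by (rule ext) (rule conv_dird)

text \<open>Counterpart of \<open>weak_derivative_mollified\<close> for the equation itself: the
  second derivatives of the mollifier are even, so the transfer of the mollifier to \<open>W\<close>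
  causes no sign.\<close>

lemma slap_mollified:
 fixes W D :: "real \<times> 'a::euclidean_space \<Rightarrow> real"
 assumes eq: "\<And>\<phi>. \<phi> \<in> test_functions \<Omega> \<Longrightarrow> (\<integral>z. D z * \<phi> z) = (\<integral>z. W z * slap \<phi> z)"
  and W: "locally_integrable \<Omega> W" and D: "locally_integrable \<Omega> D"
  and F: "integrable lborel F" "compact K" "\<And>x. x \<notin> K \<Longrightarrow> F x = 0"
  and e: "0 < e" "e \<le> e0" and sub: "fatten e0 K \<subseteq> \<Omega>"
 shows "(\<integral>y. F y * slap (conv (moll e) (restr (fatten e0 K) W)) y)
  = (\<integral>z. restr (fatten e0 K) D z * conv (moll e) F z)"
proof -
 let ?K = "fatten e0 K"
 have K: "compact ?K" by (rule compact_fatten[OF F(2)])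
 have W': "integrable lborel (restr ?K W)" and D': "integrable lborel (restr ?K D)"
  by (auto intro: integrable_restr[OF _ K sub] W D)
 have \<kappa>: "smooth_cpt (moll e)" by (rule smooth_cpt_moll[OF e(1)])
 have zero: "conv (moll e) F x = 0" if "x \<notin> ?K" for x
  using that fatten_mono[OF e(2), of K] by (intro conv_zero_off[OF e(1) moll_zero[OF e(1)] F(3)]) auto
 have "dird v (conv (moll e) F) x = 0" if "x \<notin> ?K" for v x
  by (rule dird_zero_off[OF compact_imp_closed[OF K] zero that])
 then have "dird v (dird v (conv (moll e) F)) x = 0" if "x \<notin> ?K" for v x
  by (rule dird_zero_off[OF compact_imp_closed[OF K] _ that])
 then have zero': "slap (conv (moll e) F) x = 0" if "x \<notin> ?K" for x
  using that unfolding slap_def by (intro sum.neutral) auto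
 define \<kappa>2 where "\<kappa>2 b = dird (0, b) (dird (0, b) (moll e :: real \<times> 'a \<Rightarrow> real))" for b :: 'a
 have k2: "smooth_cpt (\<kappa>2 b)" for b unfolding \<kappa>2_def by (intro smooth_cpt_dird \<kappa>)
 have s: "slap (conv (moll e) G) z = (\<Sum>b\<in>Basis. conv (\<kappa>2 b) G z)" if "integrable lborel G" for G z
  unfolding slap_def \<kappa>2_def conv_dird_fun[OF \<kappa> that] conv_dird[OF smooth_cpt_dird[OF \<kappa>] that] ..
 have i: "integrable lborel (\<lambda>y. A y * conv (\<kappa>2 b) G y)" if A: "integrable lborel A" and G: "integrable lborel G" for A G b
 proof -
  obtain B where "\<And>z. \<bar>conv (\<kappa>2 b) G z\<bar> \<le> B" using conv_bounded[OF k2 G] by blast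
  then show ?thesis using A
   by (intro integrable_mult_bounded) (auto intro!: borel_measurable_continuous_onI smooth_continuous conv_smooth k2 G)
 qed
 have "(\<integral>x. D x * conv (moll e) F x) = (\<integral>x. W x * slap (conv (moll e) F) x)"
  by (rule eq[OF conv_moll_test_function[OF F e sub]])
 then have "(\<integral>x. restr ?K D x * conv (moll e) F x) = (\<integral>x. restr ?K W x * slap (conv (moll e) F) x)"
  using integral_restr[of ?K "slap (conv (moll e) F)" W] integral_restr[of ?K "conv (moll e) F" D] zero zero' by simp
 also have "\<dots> = (\<Sum>b\<in>Basis. \<integral>x. restr ?K W x * conv (\<kappa>2 b) F x)"
  unfolding s[OF F(1)] sum_distrib_left by (intro integral_sum i W' F)
 also have "\<dots> = (\<Sum>b\<in>Basis. \<integral>y. F y * conv (\<kappa>2 b) (restr ?K W) y)"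
 proof (rule sum.cong[OF refl])
  fix b :: 'a
  have "(\<lambda>x. \<kappa>2 b (- x)) = \<kappa>2 b" unfolding \<kappa>2_def by (rule ext) (rule dird_dird_moll_minus)
  then show "(\<integral>x. restr ?K W x * conv (\<kappa>2 b) F x) = (\<integral>y. F y * conv (\<kappa>2 b) (restr ?K W) y)"
   using integral_conv_swap[OF k2 F(1) W', of b] by simp
 qed
 also have "\<dots> = (\<integral>y. F y * slap (conv (moll e) (restr ?K W)) y)"
  unfolding s[OF W'] sum_distrib_left by (intro integral_sum[symmetric] i W' F)
 finally show ?thesis by simp
qed

section \<open>Kato's inequality for smoothed signs\<close>

text \<open>Gradient and Hessian are carried as explicit functions: \<open>Hf b\<close> is the
  gradient of the partial derivative in direction \<open>b\<close>, so \<open>lap\<close> is a trace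
  and no derivative operator has to be iterated.\<close>

definition C2 :: "('a::euclidean_space \<Rightarrow> real) \<Rightarrow> ('a \<Rightarrow> 'a) \<Rightarrow> ('a \<Rightarrow> 'a \<Rightarrow> 'a) \<Rightarrow> bool" where
 "C2 f Df Hf \<longleftrightarrow> (\<forall>x. GDERIV f x :> Df x) \<and>
   (\<forall>b\<in>Basis. (\<forall>x. GDERIV (\<lambda>x. Df x \<bullet> b) x :> Hf b x) \<and> continuous_on UNIV (Hf b))"

definition lap :: "('a::euclidean_space \<Rightarrow> 'a \<Rightarrow> 'a) \<Rightarrow> 'a \<Rightarrow> real" where
 "lap Hf x = (\<Sum>b\<in>Basis. Hf b x \<bullet> b)"

lemma
 assumes "C2 f Df Hf"
 shows C2_GDERIV: "GDERIV f x :> Df x"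
  and C2_GDERIV2: "b \<in> Basis \<Longrightarrow> GDERIV (\<lambda>x. Df x \<bullet> b) x :> Hf b x"
  and C2_cont0: "continuous_on A f"
  and C2_cont1: "continuous_on A Df"
  and C2_cont2: "b \<in> Basis \<Longrightarrow> continuous_on A (Hf b)"
  and C2_cont_lap: "continuous_on A (lap Hf)"
proof -
 show 1: "\<And>x. GDERIV f x :> Df x" and 2: "\<And>b x. b \<in> Basis \<Longrightarrow> GDERIV (\<lambda>x. Df x \<bullet> b) x :> Hf b x"
  using assms by (auto simp: C2_def)
 show "continuous_on A f" by (rule GDERIV_continuous_on[OF 1])
 show 3: "b \<in> Basis \<Longrightarrow> continuous_on A (Hf b)" for b
  using assms continuous_on_subset[of UNIV "Hf b" A] by (auto simp: C2_def)
 show "continuous_on A Df"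
  by (subst continuous_on_componentwise) (auto intro: GDERIV_continuous_on[OF 2])
 show "continuous_on A (lap Hf)"
  unfolding lap_def by (intro continuous_intros 3)
qed

lemma C2_zero_off:
 assumes C: "C2 f Df Hf" and K: "closed K" "\<And>x. x \<notin> K \<Longrightarrow> f x = 0" "x \<notin> K"
 shows "Df x = 0" "b \<in> Basis \<Longrightarrow> Hf b x = 0" "lap Hf x = 0"
proof -
 have 1: "Df y = 0" if "y \<notin> K" for y by (rule GDERIV_zero_off[OF K(1,2) that C2_GDERIV[OF C]])
 show 2: "Hf b x = 0" if "b \<in> Basis" for b
  by (rule GDERIV_zero_off[OF K(1) _ K(3) C2_GDERIV2[OF C that]]) (simp add: 1)
 show "Df x = 0" "lap Hf x = 0" using 1[OF K(3)] 2 by (auto simp: lap_def)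
qed

lemma GDERIV_snd:
 fixes f :: "'a::euclidean_space \<Rightarrow> real" and z :: "real \<times> 'a"
 assumes "GDERIV f (snd z) :> D"
 shows "GDERIV (\<lambda>z. f (snd z)) z :> (0, D)"
 using has_derivative_compose[of snd snd z UNIV f, OF _ assms[unfolded gderiv_def]]
 unfolding gderiv_def by (simp add: inner_prod_def bounded_linear_imp_has_derivative bounded_linear_snd)

lemma GDERIV_fst:
 fixes f :: "real \<Rightarrow> real" and z :: "real \<times> 'a::euclidean_space"
 assumes "(f has_real_derivative d) (at (fst z))"
 shows "GDERIV (\<lambda>z. f (fst z)) z :> (d, 0)"
proof -
 have "(f has_derivative (\<lambda>h. h * d)) (at (fst z))" using assms by (simp add: has_field_derivative_def mult_commute_abs)
 from has_derivative_compose[of fst fst z UNIV f, OF _ this] show ?thesis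
  unfolding gderiv_def by (simp add: inner_prod_def bounded_linear_imp_has_derivative bounded_linear_fst)
qed

lemma continuous_on_fst_comp: "continuous_on UNIV f \<Longrightarrow> continuous_on A (\<lambda>z. f (fst z))"
 by (erule continuous_on_compose2) (auto intro: continuous_intros)

lemma continuous_on_snd_comp: "continuous_on UNIV f \<Longrightarrow> continuous_on A (\<lambda>z. f (snd z))"
 by (erule continuous_on_compose2) (auto intro: continuous_intros)

text \<open>The discarded term is \<open>\<integral> \<psi> \<zeta> p'(w - V) \<bar>\<nabla>(w - V)\<bar>\<^sup>2 \<ge> 0\<close>.\<close>

lemma kato_smooth:
 fixes w :: "real \<times> 'a::euclidean_space \<Rightarrow> real" and V \<zeta> :: "'a \<Rightarrow> real" and \<psi> p j :: "real \<Rightarrow> real"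
 assumes w: "smooth w" and V: "C2 V DV HV" and \<zeta>: "C2 \<zeta> D\<zeta> H\<zeta>"
  and \<psi>: "\<And>t. (\<psi> has_real_derivative \<psi>' t) (at t)"
  and Kt: "compact Kt" "\<And>t. t \<notin> Kt \<Longrightarrow> \<psi> t = 0" and Kx: "compact Kx" "\<And>x. x \<notin> Kx \<Longrightarrow> \<zeta> x = 0"
  and pos: "\<And>t. \<psi> t \<ge> 0" "\<And>x. \<zeta> x \<ge> 0"
  and j: "\<And>a. (j has_real_derivative p a) (at a)" and p: "\<And>a. (p has_real_derivative p' a) (at a)"
  and p': "continuous_on UNIV p'" "\<And>a. p' a \<ge> 0"
 shows "(\<integral>z. (\<zeta> (snd z) * \<psi> (fst z) * p (w z - V (snd z))) * slap w z)
  \<le> (\<integral>z. (\<zeta> (snd z) * \<psi> (fst z) * p (w z - V (snd z))) * lap HV (snd z))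
   + (\<integral>z. \<psi> (fst z) * j (w z - V (snd z)) * lap H\<zeta> (snd z))"
proof -
 define q where "q z = w z - V (snd z)" for z
 define Q where "Q z = \<zeta> (snd z) * \<psi> (fst z) * p (q z)" for z
 let ?K = "Kt \<times> Kx"
 have K: "compact ?K" by (intro compact_Times Kt Kx)
 have \<zeta>0: "\<And>x. x \<notin> Kx \<Longrightarrow> D\<zeta> x = 0" "\<And>b x. b \<in> Basis \<Longrightarrow> x \<notin> Kx \<Longrightarrow> H\<zeta> b x = 0" "\<And>x. x \<notin> Kx \<Longrightarrow> lap H\<zeta> x = 0"
  using C2_zero_off[OF \<zeta> compact_imp_closed[OF Kx(1)] Kx(2)] by auto
 have c\<psi>: "continuous_on UNIV \<psi>" and cj: "continuous_on UNIV j" and cp: "continuous_on UNIV p"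
  using \<psi> j p by (auto intro!: GDERIV_continuous_on)
 have cq: "continuous_on UNIV q" unfolding q_def[abs_def]
  by (intro continuous_intros smooth_continuous[OF w] continuous_on_snd_comp C2_cont0[OF V])
 have cQ: "continuous_on UNIV Q" unfolding Q_def[abs_def]
  by (intro continuous_intros continuous_on_snd_comp continuous_on_fst_comp C2_cont0[OF \<zeta>] c\<psi> continuous_on_compose2[OF cp cq]) auto
 have cJ: "continuous_on UNIV (\<lambda>z. \<psi> (fst z) * j (q z))"
  by (intro continuous_intros continuous_on_fst_comp c\<psi> continuous_on_compose2[OF cj cq]) auto
 have Q0: "Q z = 0" if "z \<notin> ?K" for z
  using that Kt(2) Kx(2) unfolding Q_def by (cases z) auto
 have iQ: "integrable lborel (\<lambda>z. Q z * g z)" if "continuous_on UNIV g" for g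
  by (rule integrable_compact_support[OF continuous_on_mult[OF cQ that] K]) (simp add: Q0)
 have iJ: "integrable lborel (\<lambda>z. (\<psi> (fst z) * j (q z)) * g (snd z))" if "continuous_on UNIV g" "\<And>x. x \<notin> Kx \<Longrightarrow> g x = 0" for g
 proof (rule integrable_compact_support[OF continuous_on_mult[OF cJ continuous_on_snd_comp[OF that(1)]] K])
  show "\<psi> (fst z) * j (q z) * g (snd z) = 0" if "z \<notin> ?K" for z
   using that Kt(2) \<open>\<And>x. x \<notin> Kx \<Longrightarrow> g x = 0\<close> by (cases z) auto
 qed
 have main: "(\<integral>z. Q z * dird (0, b) (dird (0, b) w) z)
   \<le> (\<integral>z. Q z * (HV b (snd z) \<bullet> b)) + (\<integral>z. \<psi> (fst z) * j (q z) * (H\<zeta> b (snd z) \<bullet> b))"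
  if b: "b \<in> Basis" for b
 proof -
  let ?B = "(0::real, b)"
  define qb where "qb z = dird ?B w z - DV (snd z) \<bullet> b" for z
  have gw: "GDERIV w z :> grad w z" "GDERIV (dird ?B w) z :> grad (dird ?B w) z" for z
   by (intro smooth_GDERIV smooth_dird w)+
  have Bw: "?B \<bullet> grad w z = dird ?B w z" "?B \<bullet> grad (dird ?B w) z = dird ?B (dird ?B w) z" for z
   by (auto intro!: dird_eq_grad[symmetric] smooth_differentiable smooth_dird w)
  have gq: "GDERIV q z :> grad w z - (0, DV (snd z))" for z
   unfolding q_def[abs_def] by (intro GDERIV_diff gw GDERIV_snd C2_GDERIV[OF V])
  have gqb: "GDERIV qb z :> grad (dird ?B w) z - (0, HV b (snd z))" for z
   unfolding qb_def[abs_def] by (intro GDERIV_diff gw GDERIV_snd[of "\<lambda>x. DV x \<bullet> b"] C2_GDERIV2[OF V b])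
  have cqb: "continuous_on UNIV qb" by (rule GDERIV_continuous_on[OF gqb])
  \<comment> \<open>The compactly supported field whose derivative in direction \<open>b\<close>
    integrates to zero. Subtracting \<open>j (q z) * (D\<zeta> \<bullet> b)\<close> makes the mixed
    terms with one derivative on \<zeta> and one on \<open>q\<close> cancel, so that only second
    derivatives of \<zeta> survive.\<close>
  define X where "X z = \<psi> (fst z) * (\<zeta> (snd z) * (p (q z) * qb z) - j (q z) * (D\<zeta> (snd z) \<bullet> b))" for z
  define G where "G z = \<psi> (fst z) *\<^sub>R (\<zeta> (snd z) *\<^sub>R (p (q z) *\<^sub>R (grad (dird ?B w) z - (0, HV b (snd z)))
     + qb z *\<^sub>R (p' (q z) *\<^sub>R (grad w z - (0, DV (snd z))))) + (p (q z) * qb z) *\<^sub>R (0, D\<zeta> (snd z))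
    - (j (q z) *\<^sub>R (0, H\<zeta> b (snd z)) + (D\<zeta> (snd z) \<bullet> b) *\<^sub>R (p (q z) *\<^sub>R (grad w z - (0, DV (snd z))))))
   + (\<zeta> (snd z) * (p (q z) * qb z) - j (q z) * (D\<zeta> (snd z) \<bullet> b)) *\<^sub>R (\<psi>' (fst z), 0)" for z
  have GX: "GDERIV X z :> G z" for z
   unfolding X_def[abs_def] G_def
   by (intro GDERIV_mult GDERIV_diff GDERIV_fst[OF \<psi>] GDERIV_snd C2_GDERIV[OF \<zeta>] C2_GDERIV2[OF \<zeta> b]
     GDERIV_DERIV_compose[OF gq p] GDERIV_DERIV_compose[OF gq j] gqb GDERIV_snd[of "\<lambda>x. D\<zeta> x \<bullet> b"])
  define R where "R z = (\<psi> (fst z) * \<zeta> (snd z)) * (p' (q z) * (qb z)\<^sup>2)" for z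
  have BG: "?B \<bullet> G z = Q z * dird ?B (dird ?B w) z - Q z * (HV b (snd z) \<bullet> b) + R z
    - \<psi> (fst z) * j (q z) * (H\<zeta> b (snd z) \<bullet> b)" for z
  proof -
   have "?B \<bullet> (grad w z - (0, DV (snd z))) = qb z"
    "?B \<bullet> (grad (dird ?B w) z - (0, HV b (snd z))) = dird ?B (dird ?B w) z - HV b (snd z) \<bullet> b"
    "?B \<bullet> (0, D\<zeta> (snd z)) = D\<zeta> (snd z) \<bullet> b" "?B \<bullet> (0, H\<zeta> b (snd z)) = H\<zeta> b (snd z) \<bullet> b" "?B \<bullet> (\<psi>' (fst z), 0) = 0"
    by (simp_all add: inner_diff_right Bw qb_def inner_commute[of b])
   then show ?thesis unfolding G_def Q_def R_def
    by (simp only: inner_add_right inner_diff_right inner_scaleR_right) (simp add: algebra_simps power2_eq_square)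
  qed
  have cR: "continuous_on UNIV R" unfolding R_def[abs_def]
   by (intro continuous_intros continuous_on_snd_comp continuous_on_fst_comp C2_cont0[OF \<zeta>] c\<psi>
     continuous_on_compose2[OF p'(1) cq] cqb) auto
  have iR: "integrable lborel R"
   by (rule integrable_compact_support[OF cR K]) (use Kt(2) Kx(2) in \<open>force simp: R_def\<close>)
  have i1: "integrable lborel (\<lambda>z. Q z * dird ?B (dird ?B w) z)"
   by (intro iQ smooth_continuous smooth_dird w)
  have i2: "integrable lborel (\<lambda>z. Q z * (HV b (snd z) \<bullet> b))"
   by (intro iQ continuous_intros continuous_on_snd_comp C2_cont2[OF V b])
  have i3: "integrable lborel (\<lambda>z. \<psi> (fst z) * j (q z) * (H\<zeta> b (snd z) \<bullet> b))"
   by (rule iJ[of "\<lambda>x. H\<zeta> b x \<bullet> b"]) (auto intro!: continuous_intros C2_cont2[OF \<zeta> b] simp: \<zeta>0(2)[OF b])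
  have "(\<integral>z. ?B \<bullet> G z) = 0"
  proof (rule integral_GDERIV_eq_0(2)[OF GX _ K])
   show "continuous_on UNIV (\<lambda>z. ?B \<bullet> G z)" unfolding BG
    by (intro continuous_intros cQ cR smooth_continuous smooth_dird w cJ continuous_on_snd_comp C2_cont2[OF V b] C2_cont2[OF \<zeta> b])
   show "X z = 0" if "z \<notin> ?K" for z using that Kt(2) Kx(2) \<zeta>0(1) unfolding X_def by (cases z) auto
  qed
  then have "(\<integral>z. Q z * dird ?B (dird ?B w) z) - (\<integral>z. Q z * (HV b (snd z) \<bullet> b)) + (\<integral>z. R z)
    - (\<integral>z. \<psi> (fst z) * j (q z) * (H\<zeta> b (snd z) \<bullet> b)) = 0"
   unfolding BG using i1 i2 i3 iR by simp
  moreover have "(\<integral>z. R z) \<ge> 0"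
   unfolding R_def using pos p'(2) by (intro integral_nonneg mult_nonneg_nonneg) auto
  ultimately show ?thesis by linarith
 qed
 have "(\<integral>z. Q z * slap w z) = (\<Sum>b\<in>Basis. \<integral>z. Q z * dird (0, b) (dird (0, b) w) z)"
  unfolding slap_def sum_distrib_left by (intro integral_sum iQ smooth_continuous smooth_dird w)
 also have "\<dots> \<le> (\<Sum>b\<in>Basis. (\<integral>z. Q z * (HV b (snd z) \<bullet> b)) + (\<integral>z. \<psi> (fst z) * j (q z) * (H\<zeta> b (snd z) \<bullet> b)))"
  by (rule sum_mono[OF main])
 also have "\<dots> = (\<integral>z. Q z * lap HV (snd z)) + (\<integral>z. \<psi> (fst z) * j (q z) * lap H\<zeta> (snd z))"
 proof -
  have "(\<integral>z. Q z * lap HV (snd z)) = (\<Sum>b\<in>Basis. \<integral>z. Q z * (HV b (snd z) \<bullet> b))"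
   unfolding lap_def sum_distrib_left
   by (intro integral_sum iQ continuous_intros continuous_on_snd_comp C2_cont2[OF V])
  moreover have "(\<integral>z. \<psi> (fst z) * j (q z) * lap H\<zeta> (snd z)) = (\<Sum>b\<in>Basis. \<integral>z. \<psi> (fst z) * j (q z) * (H\<zeta> b (snd z) \<bullet> b))"
   unfolding lap_def sum_distrib_left
   by (intro integral_sum iJ[of "\<lambda>x. H\<zeta> _ x \<bullet> _"] continuous_intros C2_cont2[OF \<zeta>]) (auto simp: \<zeta>0)
  ultimately show ?thesis by (simp add: sum.distrib)
 qed
 finally show ?thesis unfolding Q_def q_def .
qed

text \<open>\<open>W\<close> is only continuous, so \<open>kato_smooth\<close> is applied to its
  mollifications. The equation enters through \<open>slap_mollified\<close>, with a test function
  that itself contains the mollified \<open>W\<close>.\<close>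

lemma kato_space:
 fixes W D :: "real \<times> 'a::euclidean_space \<Rightarrow> real" and V \<zeta> :: "'a \<Rightarrow> real" and \<psi> p j :: "real \<Rightarrow> real"
 assumes W: "continuous_on space_time W" and D: "locally_integrable space_time D"
  and eq: "\<And>\<phi>. \<phi> \<in> test_functions space_time \<Longrightarrow> (\<integral>z. D z * \<phi> z) = (\<integral>z. W z * slap \<phi> z)"
  and V: "C2 V DV HV" and \<zeta>: "C2 \<zeta> D\<zeta> H\<zeta>"
  and \<psi>: "\<And>t. (\<psi> has_real_derivative \<psi>' t) (at t)"
  and Kt: "compact Kt" "\<And>t. t \<notin> Kt \<Longrightarrow> \<psi> t = 0" "Kt \<subseteq> {0<..}" and Kx: "compact Kx" "\<And>x. x \<notin> Kx \<Longrightarrow> \<zeta> x = 0"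
  and pos: "\<And>t. \<psi> t \<ge> 0" "\<And>x. \<zeta> x \<ge> 0"
  and j: "\<And>a. (j has_real_derivative p a) (at a)" and p: "\<And>a. (p has_real_derivative p' a) (at a)"
  and p': "continuous_on UNIV p'" "\<And>a. p' a \<ge> 0"
 shows "(\<integral>z. D z * (\<zeta> (snd z) * \<psi> (fst z) * p (W z - V (snd z))))
  \<le> (\<integral>z. (\<zeta> (snd z) * \<psi> (fst z) * p (W z - V (snd z))) * lap HV (snd z))
   + (\<integral>z. \<psi> (fst z) * j (W z - V (snd z)) * lap H\<zeta> (snd z))"
proof -
 let ?K = "Kt \<times> Kx"
 have K: "compact ?K" by (intro compact_Times Kt Kx)
 have Ksub: "?K \<subseteq> space_time" using Kt(3) by (auto simp: space_time_def)
 obtain e0 where e0: "e0 > 0" and sub: "fatten e0 ?K \<subseteq> space_time" by (rule fatten_subset_open[OF K open_space_time Ksub])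
 define e where "e k = e0 / (real k + 1)" for k
 note e = mollifier_sequence[OF e0, folded e_def]
 have WK: "continuous_on (fatten e0 ?K) W" "continuous_on ?K W"
  using continuous_on_subset[OF W] sub Ksub by auto
 have iW: "integrable lborel (restr (fatten e0 ?K) W)"
  using borel_integrable_compact[OF compact_fatten[OF K] WK(1)] by (simp add: restr_def[abs_def])
 have lW: "locally_integrable space_time W"
  unfolding locally_integrable_def set_integrable_def
  by (intro allI impI borel_integrable_compact continuous_on_subset[OF W]) auto
 define w where "w k = conv (moll (e k)) (restr (fatten e0 ?K) W)" for k
 have sw: "smooth (w k)" for k unfolding w_def by (intro conv_smooth smooth_cpt_moll e iW)
 have ul: "uniform_limit ?K w W sequentially" unfolding w_def by (rule conv_moll_uniform_limit[OF K e0 WK(1) e])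
 have c\<psi>: "continuous_on UNIV \<psi>" and cj: "continuous_on UNIV j" and cp: "continuous_on UNIV p"
  using \<psi> j p by (auto intro!: GDERIV_continuous_on)
 have cV: "continuous_on A (\<lambda>z. V (snd z))" for A :: "(real \<times> 'a) set" by (rule continuous_on_snd_comp[OF C2_cont0[OF V]])
 have bK: "bounded (g ` ?K)" if "continuous_on ?K g" for g :: "real \<times> 'a \<Rightarrow> real"
  using compact_continuous_image[OF that K] by (rule compact_imp_bounded)
 have ulq: "uniform_limit ?K (\<lambda>k z. w k z - V (snd z)) (\<lambda>z. W z - V (snd z)) sequentially"
  by (intro uniform_limit_minus ul uniform_limit_const)
 have cqK: "continuous_on A (\<lambda>z. W z - V (snd z))" if "A \<subseteq> space_time" for A
  using continuous_on_subset[OF W that] by (intro continuous_intros cV)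
 have ulp: "uniform_limit ?K (\<lambda>k z. p (w k z - V (snd z))) (\<lambda>z. p (W z - V (snd z))) sequentially"
  by (rule uniform_limit_compose_bounded[OF ulq bK[OF cqK[OF Ksub]] cp])
 have ulj: "uniform_limit ?K (\<lambda>k z. j (w k z - V (snd z))) (\<lambda>z. j (W z - V (snd z))) sequentially"
  by (rule uniform_limit_compose_bounded[OF ulq bK[OF cqK[OF Ksub]] cj])
 have cqk: "continuous_on UNIV (\<lambda>z. w k z - V (snd z))" for k
  by (intro continuous_intros cV smooth_continuous sw)
 note cpk = continuous_on_compose2[OF cp cqk subset_UNIV] and cjk = continuous_on_compose2[OF cj cqk subset_UNIV]
 have cpK: "continuous_on A (\<lambda>z. p (W z - V (snd z)))" if "A \<subseteq> space_time" for A
  by (rule continuous_on_compose2[OF cp cqK[OF that]]) auto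
 have cjK: "continuous_on ?K (\<lambda>z. j (W z - V (snd z)))"
  by (rule continuous_on_compose2[OF cj cqK[OF Ksub]]) auto
 define Z where "Z z = \<zeta> (snd z) * \<psi> (fst z)" for z
 have cZ: "continuous_on A Z" for A unfolding Z_def[abs_def]
  by (intro continuous_intros continuous_on_snd_comp continuous_on_fst_comp C2_cont0[OF \<zeta>] c\<psi>)
 have Z0: "Z z = 0" if "z \<notin> ?K" for z using that Kt(2) Kx(2) unfolding Z_def by (cases z) auto
 have "(\<lambda>k. \<integral>z. restr (fatten e0 ?K) D z * conv (moll (e k)) (\<lambda>z. Z z * p (w k z - V (snd z))) z)
   \<longlonglongrightarrow> (\<integral>z. D z * (Z z * p (W z - V (snd z))))"
 proof (rule mollified_test_limit[OF D K e0 sub e])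
  show "integrable lborel (\<lambda>z. Z z * p (w k z - V (snd z)))" for k
   by (rule integrable_compact_support[OF continuous_on_mult[OF cZ cpk] K]) (simp add: Z0)
  show "continuous_on UNIV (\<lambda>z. Z z * p (W z - V (snd z)))"
   by (rule continuous_on_UNIV_support[OF open_space_time compact_imp_closed[OF K] Ksub continuous_on_mult[OF cZ cpK]])
    (simp_all add: Z0)
  show "uniform_limit ?K (\<lambda>k z. Z z * p (w k z - V (snd z))) (\<lambda>z. Z z * p (W z - V (snd z))) sequentially"
   by (intro uniform_lim_mult uniform_limit_const ulp bK cZ cpK[OF Ksub])
 qed (simp_all add: Z0)
 moreover have "(\<integral>z. restr (fatten e0 ?K) D z * conv (moll (e k)) (\<lambda>z. Z z * p (w k z - V (snd z))) z)
   = (\<integral>y. (Z y * p (w k y - V (snd y))) * slap (w k) y)" for k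
  unfolding w_def
  by (rule slap_mollified[OF eq lW D _ K _ e(1,2) sub, symmetric])
   (simp_all add: Z0 w_def[symmetric] integrable_compact_support[OF continuous_on_mult[OF cZ cpk] K])
 ultimately have L: "(\<lambda>k. \<integral>y. (Z y * p (w k y - V (snd y))) * slap (w k) y)
   \<longlonglongrightarrow> (\<integral>z. D z * (Z z * p (W z - V (snd z))))" by simp
 have R1: "(\<lambda>k. \<integral>z. (Z z * lap HV (snd z)) * p (w k z - V (snd z)))
   \<longlonglongrightarrow> (\<integral>z. (Z z * lap HV (snd z)) * p (W z - V (snd z)))"
  by (rule compact_support_integral_limit[OF _ _ K cpk cpK[OF Ksub] ulp])
   (auto intro!: continuous_intros cZ continuous_on_snd_comp C2_cont_lap[OF V] simp: Z0)
 have R2: "(\<lambda>k. \<integral>z. (\<psi> (fst z) * lap H\<zeta> (snd z)) * j (w k z - V (snd z)))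
   \<longlonglongrightarrow> (\<integral>z. (\<psi> (fst z) * lap H\<zeta> (snd z)) * j (W z - V (snd z)))"
 proof (rule compact_support_integral_limit[OF _ _ K cjk cjK ulj])
  show "continuous_on UNIV (\<lambda>z. \<psi> (fst z) * lap H\<zeta> (snd z))"
   by (intro continuous_intros continuous_on_snd_comp continuous_on_fst_comp C2_cont_lap[OF \<zeta>] c\<psi>)
  show "\<psi> (fst z) * lap H\<zeta> (snd z) = 0" if "z \<notin> ?K" for z
   using that Kt(2) C2_zero_off(3)[OF \<zeta> compact_imp_closed[OF Kx(1)] Kx(2)] by (cases z) auto
 qed
 have le: "(\<integral>y. (Z y * p (w k y - V (snd y))) * slap (w k) y)
   \<le> (\<integral>z. (Z z * lap HV (snd z)) * p (w k z - V (snd z))) + (\<integral>z. (\<psi> (fst z) * lap H\<zeta> (snd z)) * j (w k z - V (snd z)))" for k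
  using kato_smooth[OF sw V \<zeta> \<psi> Kt(1,2) Kx pos j p p', of k] by (simp add: Z_def mult_ac)
 have "(\<integral>z. D z * (Z z * p (W z - V (snd z))))
  \<le> (\<integral>z. (Z z * lap HV (snd z)) * p (W z - V (snd z))) + (\<integral>z. (\<psi> (fst z) * lap H\<zeta> (snd z)) * j (W z - V (snd z)))"
  by (rule LIMSEQ_le[OF L tendsto_add[OF R1 R2]]) (use le in auto)
 then show ?thesis by (simp add: Z_def mult_ac)
qed

text \<open>The chain rule in the time direction, where \<open>v\<close> counts as a constant. Its
  argument is \<open>N - v\<close>, while that of \<open>kato_space\<close> is a difference of
  potentials; the two are reconciled only in the limit of sharp signs.\<close>

lemma kato_time:
 fixes N D :: "real \<times> 'a::euclidean_space \<Rightarrow> real" and v \<zeta> :: "'a \<Rightarrow> real" and \<psi> p j :: "real \<Rightarrow> real"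
 assumes N: "continuous_on space_time N" and wd: "weak_directional_derivative space_time (1, 0) N D"
  and v: "C2 v Dv Hv" and \<zeta>: "C2 \<zeta> D\<zeta> H\<zeta>"
  and \<psi>: "\<And>t. (\<psi> has_real_derivative \<psi>' t) (at t)" "continuous_on UNIV \<psi>'"
  and Kt: "compact Kt" "\<And>t. t \<notin> Kt \<Longrightarrow> \<psi> t = 0" "Kt \<subseteq> {0<..}" and Kx: "compact Kx" "\<And>x. x \<notin> Kx \<Longrightarrow> \<zeta> x = 0"
  and j: "\<And>a. (j has_real_derivative p a) (at a)" and p: "continuous_on UNIV p"
 shows "(\<integral>z. D z * (\<zeta> (snd z) * \<psi> (fst z) * p (N z - v (snd z))))
  = - (\<integral>z. \<zeta> (snd z) * \<psi>' (fst z) * j (N z - v (snd z)))"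
proof -
 have c\<psi>: "continuous_on UNIV \<psi>" using \<psi> by (auto intro!: GDERIV_continuous_on)
 have "(\<integral>z. D z * ((\<zeta> (snd z) * \<psi> (fst z)) * p (N z - v (snd z))))
  = - (\<integral>z. ((1, 0) \<bullet> (\<zeta> (snd z) *\<^sub>R (\<psi>' (fst z), 0) + \<psi> (fst z) *\<^sub>R (0, D\<zeta> (snd z)))) * j (N z - v (snd z)))"
 proof (rule weak_chain_rule[OF open_space_time N wd j p])
  show "GDERIV (\<lambda>z::real \<times> 'a. v (snd z)) z :> (0, Dv (snd z))" for z by (intro GDERIV_snd C2_GDERIV[OF v])
  show "GDERIV (\<lambda>z. \<zeta> (snd z) * \<psi> (fst z)) z :> \<zeta> (snd z) *\<^sub>R (\<psi>' (fst z), 0) + \<psi> (fst z) *\<^sub>R (0, D\<zeta> (snd z))" for z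
   by (intro GDERIV_mult GDERIV_fst[OF \<psi>(1)] GDERIV_snd C2_GDERIV[OF \<zeta>])
  show "continuous_on UNIV (\<lambda>z. (1, 0) \<bullet> (\<zeta> (snd z) *\<^sub>R (\<psi>' (fst z), 0) + \<psi> (fst z) *\<^sub>R (0, D\<zeta> (snd z))))"
   by (simp, intro continuous_on_mult continuous_on_snd_comp continuous_on_fst_comp C2_cont0[OF \<zeta>] \<psi>(2))
  show "compact (Kt \<times> Kx)" by (intro compact_Times Kt Kx)
  show "Kt \<times> Kx \<subseteq> space_time" using Kt(3) by (auto simp: space_time_def)
  show "\<zeta> (snd z) * \<psi> (fst z) = 0" if "z \<notin> Kt \<times> Kx" for z using that Kt(2) Kx(2) by (cases z) auto
 qed simp
 then show ?thesis by (simp add: mult.assoc)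
qed

section \<open>Convex smoothing of the positive part\<close>

text \<open>An approximation of the positive part from below. For \<open>a > 0\<close> the
  derivative is \<open>1 - 1 / (1 + (k * a)^2)\<close>; it and the second derivative vanish at 0, so
  the gluing with 0 is C^2, and convexity is visible from the sign of the second derivative.\<close>

definition pos_cut :: "real \<Rightarrow> real \<Rightarrow> real" where
 "pos_cut k a = (if a \<le> 0 then 0 else a - arctan (k * a) / k)"

definition pos_cut' :: "real \<Rightarrow> real \<Rightarrow> real" where
 "pos_cut' k a = (if a \<le> 0 then 0 else 1 - 1 / (1 + (k * a)\<^sup>2))"

definition pos_cut'' :: "real \<Rightarrow> real \<Rightarrow> real" where
 "pos_cut'' k a = (if a \<le> 0 then 0 else 2 * k\<^sup>2 * a / (1 + (k * a)\<^sup>2)\<^sup>2)"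

lemma DERIV_glue_zero:
 fixes g :: "real \<Rightarrow> real"
 assumes g: "\<And>x. (g has_real_derivative g' x) (at x)" and z: "g 0 = 0" "g' 0 = 0"
 shows "((\<lambda>x. if x \<le> 0 then 0 else g x) has_real_derivative (if x \<le> 0 then 0 else g' x)) (at x)"
proof (cases x "0::real" rule: linorder_cases)
 case less
 have "\<forall>\<^sub>F y in nhds x. (if y \<le> 0 then 0 else g y) = 0"
  using eventually_nhds_in_open[of "{..<0}" x] less by (auto elim!: eventually_mono)
 then show ?thesis using less by (subst DERIV_cong_ev[OF refl _ refl, where g = "\<lambda>_. 0"]) auto
next
 case equal
 have "((\<lambda>h. (if h \<le> 0 then 0 else g h) / h) \<longlongrightarrow> 0) (at 0)"
 proof (rule filterlim_split_at_real)
  have "\<forall>\<^sub>F h in at_left 0. 0 = (if h \<le> 0 then 0 else g h) / h" by (simp add: eventually_at_filter)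
  then show "((\<lambda>h. (if h \<le> 0 then 0 else g h) / h) \<longlongrightarrow> 0) (at_left 0)"
   by (rule Lim_transform_eventually[OF tendsto_const])
  have "((\<lambda>h. g h / h) \<longlongrightarrow> 0) (at 0)" using g[of 0] z by (simp add: DERIV_def)
  then have "((\<lambda>h. g h / h) \<longlongrightarrow> 0) (at_right 0)" by (rule filterlim_mono) (auto simp: at_le)
  moreover have "\<forall>\<^sub>F h in at_right 0. g h / h = (if h \<le> 0 then 0 else g h) / h"
   using eventually_at_right_less[of "0::real"] by eventually_elim auto
  ultimately show "((\<lambda>h. (if h \<le> 0 then 0 else g h) / h) \<longlongrightarrow> 0) (at_right 0)" by (rule Lim_transform_eventually)
 qed
 then show ?thesis using equal z(2) by (simp add: DERIV_def cong: if_cong)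
next
 case greater
 have "\<forall>\<^sub>F y in nhds x. (if y \<le> 0 then 0 else g y) = g y"
  using eventually_nhds_in_open[of "{0<..}" x] greater by (auto elim!: eventually_mono)
 then show ?thesis using greater g[of x] by (subst DERIV_cong_ev[OF refl _ refl, where g = g]) auto
qed

lemma one_plus_square_pos: "0 < 1 + (x::real)\<^sup>2"
 by (simp add: add_pos_nonneg)

lemma DERIV_pos_cut: "k > 0 \<Longrightarrow> (pos_cut k has_real_derivative pos_cut' k a) (at a)"
 unfolding pos_cut_def[abs_def] pos_cut'_def
 by (rule DERIV_glue_zero) (auto intro!: derivative_eq_intros simp: field_simps power2_eq_square)

lemma DERIV_pos_cut': "k > 0 \<Longrightarrow> (pos_cut' k has_real_derivative pos_cut'' k a) (at a)"
 unfolding pos_cut'_def[abs_def] pos_cut''_def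
proof (rule DERIV_glue_zero)
 fix x :: real
 have "1 + (k * x)\<^sup>2 \<noteq> 0" using one_plus_square_pos[of "k * x"] by linarith
 then show "((\<lambda>a. 1 - 1 / (1 + (k * a)\<^sup>2)) has_real_derivative 2 * k\<^sup>2 * x / (1 + (k * x)\<^sup>2)\<^sup>2) (at x)"
  by (auto intro!: derivative_eq_intros simp: power2_eq_square field_simps)
qed auto

lemma pos_cut''_nonneg: "0 \<le> pos_cut'' k a"
 by (simp add: pos_cut''_def)

lemma continuous_pos_cut'': "continuous_on UNIV (pos_cut'' k)"
proof -
 have "1 + (k * x)\<^sup>2 \<noteq> 0" for x using one_plus_square_pos[of "k * x"] by linarith
 then have "continuous_on UNIV (\<lambda>a. 2 * k\<^sup>2 * max 0 a / (1 + (k * max 0 a)\<^sup>2)\<^sup>2)"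
  by (intro continuous_intros) auto
 moreover have "(\<lambda>a. 2 * k\<^sup>2 * max 0 a / (1 + (k * max 0 a)\<^sup>2)\<^sup>2) = pos_cut'' k"
  by (auto simp: pos_cut''_def fun_eq_iff)
 ultimately show ?thesis by (simp only:)
qed

lemma pos_cut_bounds:
 assumes "k > 0" shows "0 \<le> pos_cut' k a" "pos_cut' k a \<le> 1" "0 \<le> pos_cut k a" "pos_cut k a \<le> max 0 a"
proof -
 have "1 / (1 + (k * a)\<^sup>2) \<le> 1" using one_plus_square_pos[of "k * a"] by simp
 then show "0 \<le> pos_cut' k a" "pos_cut' k a \<le> 1" by (auto simp: pos_cut'_def)
 have "arctan (k * a) \<le> k * a" if "a > 0" using assms that by (intro arctan_le_self) auto
 then show "0 \<le> pos_cut k a" using assms by (auto simp: pos_cut_def field_simps)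
 show "pos_cut k a \<le> max 0 a" using assms by (auto simp: pos_cut_def)
qed

lemma pos_cut_tendsto: "(\<lambda>m. pos_cut (real m + 1) a) \<longlonglongrightarrow> max 0 a"
proof (cases "a \<le> 0")
 case False
 have f: "filterlim (\<lambda>m. real m + 1) at_top sequentially"
  by (rule filterlim_tendsto_add_at_top[of "\<lambda>_. 1", unfolded add.commute[of 1]]) (auto intro: filterlim_real_sequentially)
 have "(\<lambda>m. arctan ((real m + 1) * a) / (real m + 1)) \<longlonglongrightarrow> 0"
 proof (rule Lim_null_comparison)
  have "\<bar>arctan y\<bar> \<le> pi" for y using arctan_bounded[of y] pi_gt_zero by (simp add: abs_le_iff) 
  then show "\<forall>\<^sub>F m in sequentially. norm (arctan ((real m + 1) * a) / (real m + 1)) \<le> pi / (real m + 1)"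
   by (intro always_eventually allI) (simp add: divide_right_mono)
  show "(\<lambda>m. pi / (real m + 1)) \<longlonglongrightarrow> 0" by (rule tendsto_divide_0[OF tendsto_const filterlim_at_top_imp_at_infinity[OF f]])
 qed
 from tendsto_diff[OF tendsto_const this, of a] show ?thesis using False by (simp add: pos_cut_def)
qed (simp add: pos_cut_def)

lemma pos_cut'_tendsto: "(\<lambda>m. pos_cut' (real m + 1) a) \<longlonglongrightarrow> (if a > 0 then 1 else 0)"
proof (cases "a \<le> 0")
 case False
 have f: "filterlim (\<lambda>m. real m + 1) at_top sequentially"
  by (rule filterlim_tendsto_add_at_top[of "\<lambda>_. 1", unfolded add.commute[of 1]]) (auto intro: filterlim_real_sequentially)
 have "filterlim (\<lambda>m. a * (real m + 1)) at_top sequentially"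
  using False by (intro filterlim_tendsto_pos_mult_at_top[OF tendsto_const _ f]) auto
 then have "filterlim (\<lambda>m. (a * (real m + 1))\<^sup>2) at_top sequentially" by (intro filterlim_pow_at_top) auto
 then have "filterlim (\<lambda>m. 1 + (a * (real m + 1))\<^sup>2) at_top sequentially"
  by (rule filterlim_tendsto_add_at_top[OF tendsto_const])
 then have "(\<lambda>m. 1 / (1 + (a * (real m + 1))\<^sup>2)) \<longlonglongrightarrow> 0"
  by (intro tendsto_divide_0[OF tendsto_const] filterlim_at_top_imp_at_infinity)
 from tendsto_diff[OF tendsto_const this, of 1] show ?thesis using False by (simp add: pos_cut'_def mult.commute)
qed (simp add: pos_cut'_def)

text \<open>One statement for both \<open>pos_cut\<close> and \<open>pos_cut'\<close>: the growth
  bound \<open>1 + \<bar>a\<bar>\<close> covers the linear and the bounded case. \<open>q\<close> is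
  controlled on \<open>K\<close> only, whence the passage through \<open>restr K q\<close>.\<close>

lemma compose_integral_limit:
 fixes G q :: "'a::euclidean_space \<Rightarrow> real" and h :: "nat \<Rightarrow> real \<Rightarrow> real"
 assumes G: "integrable lborel G" "\<And>x. x \<notin> K \<Longrightarrow> G x = 0" and K: "compact K" and q: "continuous_on K q"
  and h: "\<And>m. h m \<in> borel_measurable borel" "\<And>a. (\<lambda>m. h m a) \<longlonglongrightarrow> h' a" "\<And>m a. \<bar>h m a\<bar> \<le> 1 + \<bar>a\<bar>"
 shows "(\<lambda>m. \<integral>x. G x * h m (q x)) \<longlonglongrightarrow> (\<integral>x. G x * h' (q x))"
  and "integrable lborel (\<lambda>x. G x * h' (q x))"
proof -
 have eq: "G x * f (q x) = G x * f (restr K q x)" for f x using G(2)[of x] by (cases "x \<in> K") (auto simp: restr_simps)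
 have rm: "restr K q \<in> borel_measurable borel"
  using borel_measurable_integrable[OF borel_integrable_compact[OF K q]] by (simp add: restr_def[abs_def])
 obtain B where B: "B \<ge> 0" "\<And>x. \<bar>restr K q x\<bar> \<le> B"
 proof -
  have "bounded (q ` K)" using compact_continuous_image[OF q K] by (rule compact_imp_bounded)
  then obtain B where "\<And>x. x \<in> K \<Longrightarrow> \<bar>q x\<bar> \<le> B" unfolding bounded_iff by auto
  then have "\<bar>restr K q x\<bar> \<le> max 0 B" for x by (cases "x \<in> K") (auto simp: restr_simps le_max_iff_disj)
  then show ?thesis using that[of "max 0 B"] by auto
 qed
 have h'm: "h' \<in> borel_measurable borel" by (rule borel_measurable_LIMSEQ_real[OF h(2) h(1)])
 have b: "\<bar>h m (restr K q x)\<bar> \<le> 1 + B" for m x using h(3)[of m "restr K q x"] B(2)[of x] by linarith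
 have b': "\<bar>h' (restr K q x)\<bar> \<le> 1 + B" for x
  by (rule LIMSEQ_le_const2[OF tendsto_rabs[OF h(2)]]) (use b in auto)
 note [measurable] = rm h'm h(1) borel_measurable_integrable[OF G(1)]
 show "(\<lambda>m. \<integral>x. G x * h m (q x)) \<longlonglongrightarrow> (\<integral>x. G x * h' (q x))"
  unfolding eq
 proof (rule integral_dominated_convergence[where w = "\<lambda>x. (1 + B) * \<bar>G x\<bar>"])
  show "AE x in lborel. (\<lambda>m. G x * h m (restr K q x)) \<longlonglongrightarrow> G x * h' (restr K q x)"
   by (intro AE_I2 tendsto_mult tendsto_const h(2))
  show "AE x in lborel. norm (G x * h m (restr K q x)) \<le> (1 + B) * \<bar>G x\<bar>" for m
   using mult_left_mono[OF b[of m], of "\<bar>G _\<bar>"] by (intro AE_I2) (simp add: abs_mult mult.commute)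
 qed (use G in auto)
 show "integrable lborel (\<lambda>x. G x * h' (q x))" unfolding eq
  by (rule integrable_mult_bounded[OF G(1) _ b']) measurable
qed

lemma continuous_on_\<Phi>_comp:
 assumes "\<gamma> > 0" "continuous_on A f" "\<And>x. x \<in> A \<Longrightarrow> f x \<ge> 0"
 shows "continuous_on A (\<lambda>x. \<Phi> \<gamma> (f x))"
 unfolding \<Phi>_def using assms by (intro continuous_intros continuous_on_powr') auto

lemma solution_continuous_\<Phi>:
 "\<gamma> > 0 \<Longrightarrow> strong_solution \<gamma> n\<^sub>0 n \<Longrightarrow> continuous_on space_time (\<lambda>z. \<Phi> \<gamma> (joint n z))"
 by (intro continuous_on_\<Phi>_comp solution_continuous) (auto simp: joint_apply space_time_def intro: solution_nonneg)

text \<open>The space part needs an increasing function of \<open>\<Phi> n - \<Phi> v\<close>, the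
  time part one of \<open>n - v\<close>. As the smoothing parameter grows both tend to the same sign
  function, because \<Phi> is strictly increasing, and the integral of the time derivative against
  that sign links the two.\<close>

lemma kato_inequality:
 fixes n :: "real \<Rightarrow> 'a::euclidean_space \<Rightarrow> real" and v \<zeta> :: "'a \<Rightarrow> real" and \<psi> :: "real \<Rightarrow> real"
 assumes g: "\<gamma> > 0" and sol: "strong_solution \<gamma> n\<^sub>0 n"
  and v: "C2 v Dv Hv" "\<And>x. v x \<ge> 0" and V: "C2 (\<lambda>x. \<Phi> \<gamma> (v x)) DV HV" and \<zeta>: "C2 \<zeta> D\<zeta> H\<zeta>"
  and \<psi>: "\<And>t. (\<psi> has_real_derivative \<psi>' t) (at t)" "continuous_on UNIV \<psi>'"
  and Kt: "compact Kt" "\<And>t. t \<notin> Kt \<Longrightarrow> \<psi> t = 0" "Kt \<subseteq> {0<..}" and Kx: "compact Kx" "\<And>x. x \<notin> Kx \<Longrightarrow> \<zeta> x = 0"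
  and pos: "\<And>t. \<psi> t \<ge> 0" "\<And>x. \<zeta> x \<ge> 0"
 defines "N \<equiv> joint n"
 shows "- (\<integral>z. \<zeta> (snd z) * \<psi>' (fst z) * max 0 (N z - v (snd z)))
  \<le> (\<integral>z. (\<zeta> (snd z) * \<psi> (fst z) * lap HV (snd z)) * (if N z - v (snd z) > 0 then 1 else 0))
   + (\<integral>z. \<psi> (fst z) * lap H\<zeta> (snd z) * max 0 (\<Phi> \<gamma> (N z) - \<Phi> \<gamma> (v (snd z))))"
  and "integrable lborel (\<lambda>z. (\<zeta> (snd z) * \<psi> (fst z) * lap HV (snd z)) * (if N z - v (snd z) > 0 then 1 else 0))"
proof -
 obtain D where wd: "weak_directional_derivative space_time (1, 0) N D"
  and eq: "\<And>\<phi>. \<phi> \<in> test_functions space_time \<Longrightarrow> (\<integral>z. D z * \<phi> z) = (\<integral>z. \<Phi> \<gamma> (N z) * slap \<phi> z)"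
  using weak_pde[OF g sol, folded N_def, of thesis] by blast
 note cN = solution_continuous[OF sol, folded N_def] and cW = solution_continuous_\<Phi>[OF g sol, folded N_def]
 have N0: "N z \<ge> 0" if "z \<in> space_time" for z
  using solution_nonneg[OF sol] that by (auto simp: N_def joint_apply space_time_def)
 have lD: "locally_integrable space_time D" using wd unfolding weak_directional_derivative_def by blast
 let ?K = "Kt \<times> Kx"
 have K: "compact ?K" by (intro compact_Times Kt Kx)
 have Ksub: "?K \<subseteq> space_time" using Kt(3) by (auto simp: space_time_def)
 have c\<psi>: "continuous_on UNIV \<psi>" using \<psi> by (auto intro!: GDERIV_continuous_on)
 define Z where "Z z = \<zeta> (snd z) * \<psi> (fst z)" for z
 have cZ: "continuous_on A Z" for A unfolding Z_def[abs_def]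
  by (intro continuous_intros continuous_on_snd_comp continuous_on_fst_comp C2_cont0[OF \<zeta>] c\<psi>)
 have Z0: "Z z = 0" if "z \<notin> ?K" for z using that Kt(2) Kx(2) unfolding Z_def by (cases z) auto
 obtain BZ where BZ: "\<And>z. \<bar>Z z\<bar> \<le> BZ" using bounded_compact_support[OF cZ K Z0] unfolding real_norm_def by blast
 define G where "G z = restr ?K D z * Z z" for z
 have G: "integrable lborel G" "\<And>z. z \<notin> ?K \<Longrightarrow> G z = 0" unfolding G_def[abs_def]
  using integrable_mult_bounded[OF integrable_restr[OF lD K Ksub] _ BZ] borel_measurable_continuous_onI[OF cZ] Z0 by auto
 have GD: "G z * y = D z * (Z z * y)" for z y
  unfolding G_def using Z0[of z] by (cases "z \<in> ?K") (auto simp: restr_simps)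
 have cqN: "continuous_on ?K (\<lambda>z. N z - v (snd z))" and cqW: "continuous_on ?K (\<lambda>z. \<Phi> \<gamma> (N z) - \<Phi> \<gamma> (v (snd z)))"
  using continuous_on_subset[OF cN Ksub] continuous_on_subset[OF cW Ksub] C2_cont0[OF v(1)] C2_cont0[OF V]
  by (auto intro!: continuous_intros continuous_on_snd_comp[of v] continuous_on_snd_comp[of "\<lambda>x. \<Phi> \<gamma> (v x)"])
 have jm: "pos_cut (real m + 1) \<in> borel_measurable borel" "pos_cut' (real m + 1) \<in> borel_measurable borel" for m
  using DERIV_pos_cut[of "real m + 1"] DERIV_pos_cut'[of "real m + 1"]
  by (auto intro!: borel_measurable_continuous_onI GDERIV_continuous_on)
 have jb: "\<bar>pos_cut (real m + 1) a\<bar> \<le> 1 + \<bar>a\<bar>" "\<bar>pos_cut' (real m + 1) a\<bar> \<le> 1 + \<bar>a\<bar>" for m a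
  using pos_cut_bounds[of "real m + 1" a] by auto
 note lim_p = compose_integral_limit[OF _ _ K _ jm(2) pos_cut'_tendsto jb(2)]
 note lim_j = compose_integral_limit[OF _ _ K _ jm(1) pos_cut_tendsto jb(1)]
 have t\<psi>': "\<psi>' t = 0" if "t \<notin> Kt" for t
  by (rule GDERIV_zero_off[OF compact_imp_closed[OF Kt(1)] Kt(2) that]) (use \<psi> in auto)
 have i0: "integrable lborel (\<lambda>z. \<zeta> (snd z) * \<psi>' (fst z))"
  by (rule integrable_compact_support[OF _ K])
   (use t\<psi>' Kx(2) in \<open>force intro!: continuous_intros continuous_on_snd_comp continuous_on_fst_comp C2_cont0[OF \<zeta>] \<psi>(2)\<close>)+
 have i1: "integrable lborel (\<lambda>z. Z z * lap HV (snd z))"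
  by (rule integrable_compact_support[OF _ K])
   (auto intro!: continuous_intros continuous_on_snd_comp cZ C2_cont_lap[OF V] simp: Z0)
 have i2: "integrable lborel (\<lambda>z. \<psi> (fst z) * lap H\<zeta> (snd z))"
  by (rule integrable_compact_support[OF _ K])
   (use Kt(2) C2_zero_off(3)[OF \<zeta> compact_imp_closed[OF Kx(1)] Kx(2)] in
    \<open>force intro!: continuous_intros continuous_on_snd_comp continuous_on_fst_comp c\<psi> C2_cont_lap[OF \<zeta>]\<close>)+
 have z1: "Z z * lap HV (snd z) = 0" "\<zeta> (snd z) * \<psi>' (fst z) = 0" "\<psi> (fst z) * lap H\<zeta> (snd z) = 0" if "z \<notin> ?K" for z
  using that Z0[OF that] t\<psi>' Kx(2) Kt(2) C2_zero_off(3)[OF \<zeta> compact_imp_closed[OF Kx(1)] Kx(2)] by (cases z; auto)+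
 define S where "S z = (if N z - v (snd z) > 0 then 1 else 0 :: real)" for z
 \<comment> \<open>Outside the compact set the factors vanish; inside it \<open>n\<close> and
   \<open>v\<close> are nonnegative and \<open>\<Phi>_less_iff\<close> identifies the two
   signs.\<close>
 have S_eq: "G z * (if \<Phi> \<gamma> (N z) - \<Phi> \<gamma> (v (snd z)) > 0 then 1 else 0) = G z * S z"
  "Z z * lap HV (snd z) * (if \<Phi> \<gamma> (N z) - \<Phi> \<gamma> (v (snd z)) > 0 then 1 else 0) = Z z * lap HV (snd z) * S z" for z
 proof -
  show "G z * (if \<Phi> \<gamma> (N z) - \<Phi> \<gamma> (v (snd z)) > 0 then 1 else 0) = G z * S z"
   "Z z * lap HV (snd z) * (if \<Phi> \<gamma> (N z) - \<Phi> \<gamma> (v (snd z)) > 0 then 1 else 0) = Z z * lap HV (snd z) * S z"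
   using Z0[of z] G(2)[of z] \<Phi>_less_iff[OF g v(2) N0, of z "snd z"] Ksub unfolding S_def
   by (cases "z \<in> ?K"; auto)+
 qed
 have a1: "(\<lambda>m. \<integral>z. D z * (Z z * pos_cut' (real m + 1) (N z - v (snd z)))) \<longlonglongrightarrow> (\<integral>z. G z * S z)"
  using lim_p(1)[OF G cqN] unfolding GD S_def .
 have a2: "(\<lambda>m. \<integral>z. D z * (Z z * pos_cut' (real m + 1) (\<Phi> \<gamma> (N z) - \<Phi> \<gamma> (v (snd z))))) \<longlonglongrightarrow> (\<integral>z. G z * S z)"
  using lim_p(1)[OF G cqW] unfolding S_eq unfolding GD .
 have a3: "(\<lambda>m. \<integral>z. \<zeta> (snd z) * \<psi>' (fst z) * pos_cut (real m + 1) (N z - v (snd z)))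
   \<longlonglongrightarrow> (\<integral>z. \<zeta> (snd z) * \<psi>' (fst z) * max 0 (N z - v (snd z)))"
  by (rule lim_j(1)[OF i0 z1(2) cqN])
 have a4: "(\<lambda>m. \<integral>z. Z z * lap HV (snd z) * pos_cut' (real m + 1) (\<Phi> \<gamma> (N z) - \<Phi> \<gamma> (v (snd z))))
   \<longlonglongrightarrow> (\<integral>z. Z z * lap HV (snd z) * S z)"
  using lim_p(1)[OF i1 z1(1) cqW] unfolding S_eq .
 have a5: "(\<lambda>m. \<integral>z. \<psi> (fst z) * lap H\<zeta> (snd z) * pos_cut (real m + 1) (\<Phi> \<gamma> (N z) - \<Phi> \<gamma> (v (snd z))))
   \<longlonglongrightarrow> (\<integral>z. \<psi> (fst z) * lap H\<zeta> (snd z) * max 0 (\<Phi> \<gamma> (N z) - \<Phi> \<gamma> (v (snd z))))"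
  by (rule lim_j(1)[OF i2 z1(3) cqW])
 have k1: "(\<integral>z. D z * (Z z * pos_cut' (real m + 1) (N z - v (snd z))))
   = - (\<integral>z. \<zeta> (snd z) * \<psi>' (fst z) * pos_cut (real m + 1) (N z - v (snd z)))" for m
  unfolding Z_def
  by (rule kato_time[OF cN wd v(1) \<zeta> \<psi> Kt Kx]) (auto intro!: DERIV_pos_cut GDERIV_continuous_on[OF gderiv_deriv[THEN iffD2, OF DERIV_pos_cut']])
 have k2: "(\<integral>z. D z * (Z z * pos_cut' (real m + 1) (\<Phi> \<gamma> (N z) - \<Phi> \<gamma> (v (snd z)))))
   \<le> (\<integral>z. Z z * lap HV (snd z) * pos_cut' (real m + 1) (\<Phi> \<gamma> (N z) - \<Phi> \<gamma> (v (snd z))))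
    + (\<integral>z. \<psi> (fst z) * lap H\<zeta> (snd z) * pos_cut (real m + 1) (\<Phi> \<gamma> (N z) - \<Phi> \<gamma> (v (snd z))))" for m
  using kato_space[OF cW lD eq V \<zeta> \<psi>(1) Kt Kx pos DERIV_pos_cut DERIV_pos_cut' continuous_pos_cut'' pos_cut''_nonneg, of "real m + 1"]
  by (simp add: Z_def mult_ac)
 \<comment> \<open>Two sequences with the common limit \<open>\<integral> G S\<close>: the first is
   evaluated by the chain rule in time, the second is estimated by the equation in space.\<close>
 have "(\<integral>z. G z * S z) = - (\<integral>z. \<zeta> (snd z) * \<psi>' (fst z) * max 0 (N z - v (snd z)))"
  by (rule LIMSEQ_unique[OF a1]) (use tendsto_minus[OF a3] in \<open>simp add: k1\<close>)
 moreover have "(\<integral>z. G z * S z) \<le> (\<integral>z. Z z * lap HV (snd z) * S z)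
   + (\<integral>z. \<psi> (fst z) * lap H\<zeta> (snd z) * max 0 (\<Phi> \<gamma> (N z) - \<Phi> \<gamma> (v (snd z))))"
  by (rule LIMSEQ_le[OF a2 tendsto_add[OF a4 a5]]) (use k2 in auto)
 ultimately show "- (\<integral>z. \<zeta> (snd z) * \<psi>' (fst z) * max 0 (N z - v (snd z)))
  \<le> (\<integral>z. (\<zeta> (snd z) * \<psi> (fst z) * lap HV (snd z)) * (if N z - v (snd z) > 0 then 1 else 0))
   + (\<integral>z. \<psi> (fst z) * lap H\<zeta> (snd z) * max 0 (\<Phi> \<gamma> (N z) - \<Phi> \<gamma> (v (snd z))))"
  unfolding S_def Z_def by simp
 show "integrable lborel (\<lambda>z. (\<zeta> (snd z) * \<psi> (fst z) * lap HV (snd z)) * (if N z - v (snd z) > 0 then 1 else 0))"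
  using lim_p(2)[OF i1 z1(1) cqW] unfolding S_eq unfolding S_def Z_def .
qed

section \<open>From space-time test functions to integrated inequalities in time\<close>

lemma indicator_integral_eq:
 fixes f :: "real \<Rightarrow> real"
 assumes "continuous_on {a..b} f"
 shows "integrable lborel (\<lambda>t. indicator {a..b} t * f t)" "(\<integral>t. indicator {a..b} t * f t) = integral {a..b} f"
proof -
 have "set_integrable lborel {a..b} f"
  unfolding set_integrable_def by (rule borel_integrable_compact[OF compact_Icc assms])
 then show "integrable lborel (\<lambda>t. indicator {a..b} t * f t)" "(\<integral>t. indicator {a..b} t * f t) = integral {a..b} f"
  using set_borel_integral_eq_integral(2)[of "{a..b}" f] by (simp_all add: set_integrable_def set_lebesgue_integral_def)
qed

text \<open>Test with the mollified indicator of \<open>{a..b}\<close> and move the mollifier to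
  \<open>A\<close> and \<open>B\<close>. For the smooth mollified \<open>A\<close> the left side is
  exactly an increment, by the fundamental theorem; then the mollification is removed by uniform
  convergence on the interval.\<close>

lemma distributional_le_imp:
 fixes A B :: "real \<Rightarrow> real"
 assumes A: "continuous_on {0<..} A" and B: "continuous_on {0<..} B"
  and ineq: "\<And>\<psi> \<psi>' Kt. (\<And>t. (\<psi> has_real_derivative \<psi>' t) (at t)) \<Longrightarrow> continuous_on UNIV \<psi>' \<Longrightarrow> compact Kt \<Longrightarrow>
   (\<And>t. t \<notin> Kt \<Longrightarrow> \<psi> t = 0) \<Longrightarrow> Kt \<subseteq> {0<..} \<Longrightarrow> (\<And>t. \<psi> t \<ge> 0) \<Longrightarrow>
   - (\<integral>t. \<psi>' t * A t) \<le> (\<integral>t. \<psi> t * B t)"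
  and ab: "0 < a" "a \<le> b"
 shows "A b - A a \<le> integral {a..b} B"
proof -
 let ?K = "{a..b}"
 have sub0: "?K \<subseteq> {0<..}" using ab by auto
 obtain e0 where e0: "e0 > 0" and sub: "fatten e0 ?K \<subseteq> {0<..}"
  by (rule fatten_subset_open[OF compact_Icc _ sub0]) auto
 define e where "e k = e0 / (real k + 1)" for k
 note e = mollifier_sequence[OF e0, folded e_def]
 let ?F = "fatten e0 ?K"
 define I where "I = (indicator ?K :: real \<Rightarrow> real)"
 have I: "integrable lborel I" unfolding I_def using borel_integrable_compact[OF compact_Icc, of a b "\<lambda>_. 1::real"] by simp
 have I0: "I t = 0" if "t \<notin> ?K" for t using that by (simp add: I_def)
 have cF: "continuous_on ?F A" "continuous_on ?F B" using A B sub continuous_on_subset by blast+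
 have iA: "integrable lborel (restr ?F A)" and iB: "integrable lborel (restr ?F B)"
  using borel_integrable_compact[OF compact_fatten[OF compact_Icc] cF(1)] borel_integrable_compact[OF compact_fatten[OF compact_Icc] cF(2)]
  by (simp_all add: restr_def[abs_def])
 have aK: "a \<in> ?K" "b \<in> ?K" using ab by auto
 have \<kappa>: "smooth_cpt (moll (e k) :: real \<Rightarrow> real)" for k by (rule smooth_cpt_moll[OF e(1)])
 define Ak where "Ak k = conv (moll (e k)) (restr ?F A)" for k
 define Bk where "Bk k = conv (moll (e k)) (restr ?F B)" for k
 \<comment> \<open>Smooth, nonnegative and supported in a compact subset of the positive half-line,
   hence admissible for every \<open>k\<close>.\<close>
 define \<psi> where "\<psi> k = conv (moll (e k)) I" for k
 have s: "smooth (Ak k)" "smooth (Bk k)" "smooth (\<psi> k)" for k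
  unfolding Ak_def Bk_def \<psi>_def by (auto intro!: conv_smooth \<kappa> iA iB I)
 have der: "(f has_real_derivative dird 1 f t) (at t)" if "smooth f" for f :: "real \<Rightarrow> real" and t
  using smooth_GDERIV[OF that, of t] by (simp add: grad_def)
 have \<psi>0: "\<psi> k t = 0" if "t \<notin> ?F" for k t
 proof -
  have "t \<notin> fatten (e k) ?K" using that fatten_mono[OF e(2)[of k], of ?K] by blast
  from conv_zero_off[of "e k" "moll (e k)" ?K I t, OF e(1) moll_zero[OF e(1)] I0 this]
  show ?thesis unfolding \<psi>_def .
 qed
 have d\<psi>0: "dird 1 (\<psi> k) t = 0" if "t \<notin> ?F" for k t
  by (rule dird_zero_off[OF compact_imp_closed[OF compact_fatten[OF compact_Icc]] \<psi>0 that])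
 have uA: "uniform_limit ?K Ak A sequentially" and uB: "uniform_limit ?K Bk B sequentially"
  unfolding Ak_def Bk_def by (rule conv_moll_uniform_limit[OF compact_Icc e0 cF(1) e], rule conv_moll_uniform_limit[OF compact_Icc e0 cF(2) e])
 have main: "Ak k b - Ak k a \<le> (\<integral>t. I t * Bk k t)" for k
 proof -
  have "- (\<integral>t. dird 1 (\<psi> k) t * A t) \<le> (\<integral>t. \<psi> k t * B t)"
  proof (rule ineq[OF der[OF s(3)] smooth_continuous[OF smooth_dird[OF s(3)]] compact_fatten[OF compact_Icc] \<psi>0 sub])
   show "0 \<le> \<psi> k t" for t
    unfolding \<psi>_def conv_def I_def by (intro integral_nonneg mult_nonneg_nonneg moll_nonneg e) auto
  qed auto
  moreover have "(\<integral>t. dird 1 (\<psi> k) t * A t) = - (Ak k b - Ak k a)"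
  proof -
   have "(\<integral>t. dird 1 (\<psi> k) t * A t) = (\<integral>t. restr ?F A t * dird 1 (\<psi> k) t)"
    using integral_restr[of ?F "dird 1 (\<psi> k)" A, OF d\<psi>0] by (simp add: mult.commute)
   also have "\<dots> = (\<integral>t. restr ?F A t * conv (dird 1 (moll (e k))) I t)"
    unfolding \<psi>_def conv_dird[OF \<kappa> I] ..
   also have "\<dots> = - (\<integral>y. I y * conv (dird 1 (moll (e k))) (restr ?F A) y)"
    by (subst integral_conv_swap[OF smooth_cpt_dird[OF \<kappa>] I iA]) (simp add: dird_moll_minus conv_def)
   also have "(\<integral>y. I y * conv (dird 1 (moll (e k))) (restr ?F A) y) = (\<integral>y. dird 1 (Ak k) y * indicator {a..b} y)"
    unfolding Ak_def conv_dird[OF \<kappa> iA] I_def by (simp add: mult.commute)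
   also have "\<dots> = Ak k b - Ak k a"
    by (rule integral_FTC_Icc_real[OF ab(2) der[OF s(1)]])
     (use smooth_continuous[OF smooth_dird[OF s(1)]] in \<open>auto simp: continuous_on_eq_continuous_at\<close>)
   finally show ?thesis .
  qed
  moreover have "(\<integral>t. \<psi> k t * B t) = (\<integral>t. I t * Bk k t)"
  proof -
   have "(\<integral>t. \<psi> k t * B t) = (\<integral>t. restr ?F B t * \<psi> k t)"
    using integral_restr[of ?F "\<psi> k" B, OF \<psi>0] by (simp add: mult.commute)
   also have "\<dots> = (\<integral>t. I t * Bk k t)"
    unfolding \<psi>_def Bk_def by (subst integral_conv_swap[OF \<kappa> I iB]) (simp add: moll_minus)
   finally show ?thesis .
  qed
  ultimately show ?thesis by simp
 qed
 have cBK: "continuous_on ?K B" using B sub0 continuous_on_subset by blast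
 have L1: "(\<lambda>k. Ak k b - Ak k a) \<longlonglongrightarrow> A b - A a"
  by (intro tendsto_diff tendsto_uniform_limitI[OF uA] aK)
 have eqI: "I t * restr ?F B t = I t * B t" for t
  using subset_fatten[of e0 ?K] e0 by (cases "t \<in> ?K") (auto simp: I0 restr_simps)
 have L2: "(\<lambda>k. \<integral>t. I t * Bk k t) \<longlonglongrightarrow> (\<integral>t. I t * restr ?F B t)"
 proof (rule integral_uniform_limit[OF I _ _ _ I0])
  show "Bk k \<in> borel_measurable borel" for k by (intro borel_measurable_continuous_onI smooth_continuous s)
  show "restr ?F B \<in> borel_measurable borel" using borel_measurable_integrable[OF iB] by simp
  show "uniform_limit ?K Bk (restr ?F B) sequentially"
   by (rule uniform_limit_cong'[THEN iffD1, OF _ _ uB]) (use subset_fatten[of e0 ?K] e0 in \<open>auto simp: restr_simps\<close>)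
  show "integrable lborel (\<lambda>x. I x * restr ?F B x)" unfolding eqI using indicator_integral_eq(1)[OF cBK] by (simp add: I_def)
 qed
 have "A b - A a \<le> (\<integral>t. I t * restr ?F B t)"
  by (rule LIMSEQ_le[OF L1 L2]) (use main in auto)
 then show ?thesis unfolding eqI using indicator_integral_eq(2)[OF cBK] by (simp add: I_def)
qed

lemma slice_continuous:
 fixes z :: "'a::euclidean_space \<Rightarrow> real" and g :: "real \<times> 'a \<Rightarrow> real"
 assumes z: "continuous_on UNIV z" "compact Kx" "\<And>x. x \<notin> Kx \<Longrightarrow> z x = 0" and g: "continuous_on space_time g"
 shows "continuous_on {0<..} (\<lambda>t. \<integral>x. z x * g (t, x))"
proof -
 have "isCont (\<lambda>t. \<integral>x. z x * g (t, x)) t0" if t0: "t0 > 0" for t0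
 proof -
  let ?C = "{t0 / 2..2 * t0} \<times> Kx"
  have sub: "?C \<subseteq> space_time" using t0 by (auto simp: space_time_def)
  have "bounded (g ` ?C)"
   by (rule compact_imp_bounded[OF compact_continuous_image[OF continuous_on_subset[OF g sub] compact_Times]]) (use z in auto)
  then obtain B where B: "\<And>y. y \<in> ?C \<Longrightarrow> \<bar>g y\<bar> \<le> B" unfolding bounded_iff by auto
  have iz: "integrable lborel z" by (rule integrable_compact_support[OF z])
  have ball: "t \<in> {t0 / 2..2 * t0}" if "t \<in> ball t0 (t0 / 2)" for t
   using that t0 unfolding mem_ball dist_real_def atLeastAtMost_iff by arith
  have cx: "continuous_on UNIV (\<lambda>x. z x * g (t, x))" if "t > 0" for t
   by (intro continuous_intros z continuous_on_compose2[OF g]) (use that in \<open>auto simp: space_time_def\<close>)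
  show ?thesis
  proof (rule isCont_under_integral[where e = "t0 / 2" and D = "\<lambda>x. B * \<bar>z x\<bar>"])
   show "isCont (\<lambda>t. z x * g (t, x)) t0" for x
   proof -
    have "continuous_on {0<..} (\<lambda>t. z x * g (t, x))"
     by (intro continuous_intros continuous_on_compose2[OF g]) (auto simp: space_time_def)
    then show ?thesis using t0 by (simp add: continuous_on_eq_continuous_at)
   qed
   show "(\<lambda>x. z x * g (t, x)) \<in> borel_measurable lborel" if "t \<in> ball t0 (t0 / 2)" for t
    using borel_measurable_continuous_onI[OF cx[of t]] ball[OF that] t0 by simp
   show "norm (z x * g (t, x)) \<le> B * \<bar>z x\<bar>" if "t \<in> ball t0 (t0 / 2)" for t x
   proof (cases "x \<in> Kx")
    case True
    then have "\<bar>g (t, x)\<bar> \<le> B" using ball[OF that] by (intro B) auto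
    then show ?thesis using mult_right_mono[of "\<bar>g (t, x)\<bar>" B "\<bar>z x\<bar>"] by (simp add: abs_mult mult.commute)
   qed (simp add: z)
  qed (use t0 iz in auto)
 qed
 then show ?thesis by (simp add: continuous_at_imp_continuous_on)
qed

lemma slice_fubini:
 fixes z :: "'a::euclidean_space \<Rightarrow> real" and g :: "real \<times> 'a \<Rightarrow> real" and \<psi> :: "real \<Rightarrow> real"
 assumes z: "continuous_on UNIV z" "compact Kx" "\<And>x. x \<notin> Kx \<Longrightarrow> z x = 0" and g: "continuous_on space_time g"
  and \<psi>: "continuous_on UNIV \<psi>" "compact Kt" "\<And>t. t \<notin> Kt \<Longrightarrow> \<psi> t = 0" "Kt \<subseteq> {0<..}"
 shows "integrable lborel (\<lambda>y. \<psi> (fst y) * (z (snd y) * g y))"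
  and "(\<integral>y. \<psi> (fst y) * (z (snd y) * g y)) = (\<integral>t. \<psi> t * (\<integral>x. z x * g (t, x)))"
proof -
 have K: "compact (Kt \<times> Kx)" by (intro compact_Times \<psi> z)
 have sub: "Kt \<times> Kx \<subseteq> space_time" using \<psi>(4) by (auto simp: space_time_def)
 have zero: "\<psi> (fst y) * (z (snd y) * g y) = 0" if "y \<notin> Kt \<times> Kx" for y
  using that \<psi>(3) z(3) by (cases y) auto
 have "continuous_on space_time (\<lambda>y. \<psi> (fst y) * (z (snd y) * g y))"
  by (intro continuous_intros continuous_on_fst_comp continuous_on_snd_comp \<psi> z g)
 then have "continuous_on UNIV (\<lambda>y. \<psi> (fst y) * (z (snd y) * g y))"
  by (rule continuous_on_UNIV_support[OF open_space_time compact_imp_closed[OF K] sub _ zero])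
 then show i: "integrable lborel (\<lambda>y. \<psi> (fst y) * (z (snd y) * g y))"
  by (rule integrable_compact_support[OF _ K zero])
 then have i': "integrable (lborel \<Otimes>\<^sub>M lborel) (\<lambda>y. \<psi> (fst y) * (z (snd y) * g y))" by (simp add: lborel_prod)
 show "(\<integral>y. \<psi> (fst y) * (z (snd y) * g y)) = (\<integral>t. \<psi> t * (\<integral>x. z x * g (t, x)))"
  using lborel_pair.integral_fst'[OF i'] by (simp add: lborel_prod)
qed

text \<open>The Euler equation replaces the Laplacian of the potential by the difference quotient
  \<open>(v - v0) / h\<close>. This gives the differential inequality
  \<open>A v' \<le> (A v0 - A v) / h + e\<close> in integrated form, where \<open>e\<close> is the
  error caused by the cutoff \<zeta>.\<close>

lemma kato_time_step:
 fixes n :: "real \<Rightarrow> 'a::euclidean_space \<Rightarrow> real" and v v0 \<zeta> :: "'a \<Rightarrow> real"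
 assumes g: "\<gamma> > 0" and sol: "strong_solution \<gamma> n\<^sub>0 n"
  and v: "C2 v Dv Hv" "\<And>x. v x \<ge> 0" and V: "C2 (\<lambda>x. \<Phi> \<gamma> (v x)) DV HV" and \<zeta>: "C2 \<zeta> D\<zeta> H\<zeta>"
  and Kx: "compact Kx" "\<And>x. x \<notin> Kx \<Longrightarrow> \<zeta> x = 0" and pos: "\<And>x. \<zeta> x \<ge> 0"
  and h: "h > 0" "\<And>x. v x - h * lap HV x = v0 x" and v0: "continuous_on UNIV v0"
  and ab: "0 < a" "a \<le> b"
 defines "A \<equiv> \<lambda>u t. \<integral>x. \<zeta> x * max 0 (n t x - u x)"
  and "e \<equiv> \<lambda>t. \<integral>x. \<bar>lap H\<zeta> x\<bar> * \<Phi> \<gamma> (n t x)"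
 shows "A v b - A v a \<le> integral {a..b} (\<lambda>t. (A v0 t - A v t) / h + e t)"
proof -
 define N where "N = joint n"
 note cN = solution_continuous[OF sol, folded N_def] and cW = solution_continuous_\<Phi>[OF g sol, folded N_def]
 have c\<zeta>: "continuous_on UNIV \<zeta>" by (rule C2_cont0[OF \<zeta>])
 have cL: "continuous_on UNIV (\<lambda>x. \<bar>lap H\<zeta> x\<bar>)" by (intro continuous_intros C2_cont_lap[OF \<zeta>])
 have L0: "\<bar>lap H\<zeta> x\<bar> = 0" if "x \<notin> Kx" for x using C2_zero_off(3)[OF \<zeta> compact_imp_closed[OF Kx(1)] Kx(2) that] by simp
 have cp: "continuous_on space_time (\<lambda>z. max 0 (N z - u (snd z)))" if "continuous_on UNIV u" for u
  by (intro continuous_intros cN continuous_on_snd_comp that)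
 have cv: "continuous_on UNIV v" by (rule C2_cont0[OF v(1)])
 have Aeq: "A u t = (\<integral>x. \<zeta> x * max 0 (N (t, x) - u (snd (t, x))))" for u t by (simp add: A_def N_def joint_apply)
 have eeq: "e t = (\<integral>x. \<bar>lap H\<zeta> x\<bar> * \<Phi> \<gamma> (N (t, x)))" for t by (simp add: e_def N_def joint_apply)
 have cA: "continuous_on {0<..} (A u)" if "continuous_on UNIV u" for u
  unfolding Aeq[abs_def] by (rule slice_continuous[OF c\<zeta> Kx cp[OF that]])
 have ce: "continuous_on {0<..} e"
  unfolding eeq[abs_def] by (rule slice_continuous[OF cL Kx(1) L0 cW])
 show ?thesis
 proof (rule distributional_le_imp[OF cA[OF cv] _ _ ab])
  show "continuous_on {0<..} (\<lambda>t. (A v0 t - A v t) / h + e t)"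
   using h(1) by (intro continuous_intros cA ce cv v0) auto
  fix \<psi> \<psi>' :: "real \<Rightarrow> real" and Kt
  assume \<psi>: "\<And>t. (\<psi> has_real_derivative \<psi>' t) (at t)" "continuous_on UNIV \<psi>'"
   and Kt: "compact Kt" "\<And>t. t \<notin> Kt \<Longrightarrow> \<psi> t = 0" "Kt \<subseteq> {0<..}" and \<psi>p: "\<And>t. \<psi> t \<ge> 0"
  have c\<psi>: "continuous_on UNIV \<psi>" using \<psi> by (auto intro!: GDERIV_continuous_on)
  have t\<psi>': "\<psi>' t = 0" if "t \<notin> Kt" for t
   by (rule GDERIV_zero_off[OF compact_imp_closed[OF Kt(1)] Kt(2) that]) (use \<psi> in auto)
  note kato = kato_inequality[OF g sol v V \<zeta> \<psi> Kt Kx \<psi>p pos, folded N_def]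
  note f1 = slice_fubini[OF c\<zeta> Kx cp[OF cv] \<psi>(2) Kt(1) t\<psi>' Kt(3)]
  note f2 = slice_fubini[OF c\<zeta> Kx cp[OF cv] c\<psi> Kt]
  note f3 = slice_fubini[OF c\<zeta> Kx cp[OF v0] c\<psi> Kt]
  note f4 = slice_fubini[OF cL Kx(1) L0 cW c\<psi> Kt]
  define RHS where "RHS z = (\<psi> (fst z) * (\<zeta> (snd z) * max 0 (N z - v0 (snd z))) - \<psi> (fst z) * (\<zeta> (snd z) * max 0 (N z - v (snd z)))) / h" for z
  have iR: "integrable lborel RHS" unfolding RHS_def[abs_def] using f2(1) f3(1) by simp
  have c1: "- (\<integral>t. \<psi>' t * A v t) = - (\<integral>z. \<zeta> (snd z) * \<psi>' (fst z) * max 0 (N z - v (snd z)))"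
   using f1(2) by (simp add: Aeq mult_ac)
  have c2: "(\<integral>z. (\<zeta> (snd z) * \<psi> (fst z) * lap HV (snd z)) * (if N z - v (snd z) > 0 then 1 else 0)) \<le> (\<integral>z. RHS z)"
  proof (rule integral_mono[OF kato(2) iR])
   fix z
   \<comment> \<open>Where \<open>n > v\<close> the quotient is
     \<open>((n - v0) - (n - v)) / h\<close>, and \<open>n - v0\<close> is at most its positive
     part; where \<open>n \<le> v\<close> the left side is 0 and the positive part of
     \<open>n - v\<close> vanishes.\<close>
   have "lap HV (snd z) * (if N z - v (snd z) > 0 then 1 else 0) \<le> (max 0 (N z - v0 (snd z)) - max 0 (N z - v (snd z))) / h"
   proof -
    have "h * lap HV (snd z) = v (snd z) - v0 (snd z)" using h(2)[of "snd z"] by simp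
    then have "lap HV (snd z) = (v (snd z) - v0 (snd z)) / h" using h(1) by (simp add: field_simps)
    then show ?thesis using h(1) by (auto simp: divide_right_mono max_def)
   qed
   then have "(\<zeta> (snd z) * \<psi> (fst z)) * (lap HV (snd z) * (if N z - v (snd z) > 0 then 1 else 0))
     \<le> (\<zeta> (snd z) * \<psi> (fst z)) * ((max 0 (N z - v0 (snd z)) - max 0 (N z - v (snd z))) / h)"
    by (intro mult_left_mono mult_nonneg_nonneg pos \<psi>p)
   then show "(\<zeta> (snd z) * \<psi> (fst z) * lap HV (snd z)) * (if N z - v (snd z) > 0 then 1 else 0) \<le> RHS z"
    by (simp add: RHS_def diff_divide_distrib algebra_simps)
  qed
  have c3: "(\<integral>z. \<psi> (fst z) * lap H\<zeta> (snd z) * max 0 (\<Phi> \<gamma> (N z) - \<Phi> \<gamma> (v (snd z))))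
   \<le> (\<integral>z. \<psi> (fst z) * (\<bar>lap H\<zeta> (snd z)\<bar> * \<Phi> \<gamma> (N z)))"
  proof (rule integral_mono'[OF f4(1)])
   fix z :: "real \<times> 'a"
   have "lap H\<zeta> (snd z) * max 0 (\<Phi> \<gamma> (N z) - \<Phi> \<gamma> (v (snd z))) \<le> \<bar>lap H\<zeta> (snd z)\<bar> * \<Phi> \<gamma> (N z)"
    using \<Phi>_nonneg[OF g] by (intro mult_mono) auto
   then show "\<psi> (fst z) * lap H\<zeta> (snd z) * max 0 (\<Phi> \<gamma> (N z) - \<Phi> \<gamma> (v (snd z))) \<le> \<psi> (fst z) * (\<bar>lap H\<zeta> (snd z)\<bar> * \<Phi> \<gamma> (N z))"
    using mult_left_mono[OF _ \<psi>p[of "fst z"]] by (simp add: mult.assoc)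
   show "0 \<le> \<psi> (fst z) * (\<bar>lap H\<zeta> (snd z)\<bar> * \<Phi> \<gamma> (N z))"
    by (intro mult_nonneg_nonneg \<psi>p \<Phi>_nonneg[OF g]) auto
  qed
  have "(\<integral>z. RHS z) + (\<integral>z. \<psi> (fst z) * (\<bar>lap H\<zeta> (snd z)\<bar> * \<Phi> \<gamma> (N z)))
   = (\<integral>t. \<psi> t * A v0 t) / h - (\<integral>t. \<psi> t * A v t) / h + (\<integral>t. \<psi> t * e t)"
  proof -
   have "(\<integral>z. RHS z) = ((\<integral>t. \<psi> t * A v0 t) - (\<integral>t. \<psi> t * A v t)) / h"
    using f2 f3 by (simp add: RHS_def[abs_def] Aeq)
   then show ?thesis using f4(2) by (simp add: eeq diff_divide_distrib)
  qed
  also have "\<dots> = (\<integral>t. \<psi> t * ((A v0 t - A v t) / h + e t))"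
  proof -
   have i: "integrable lborel (\<lambda>t. \<psi> t * f t)" if "continuous_on {0<..} f" for f
   proof (rule integrable_compact_support[OF _ Kt(1)])
    show "continuous_on UNIV (\<lambda>t. \<psi> t * f t)"
     by (rule continuous_on_UNIV_support[OF _ compact_imp_closed[OF Kt(1)] Kt(3)])
      (auto intro!: continuous_intros that continuous_on_subset[OF c\<psi>] simp: Kt(2))
   qed (simp add: Kt(2))
   have "(\<lambda>t. \<psi> t * ((A v0 t - A v t) / h + e t)) = (\<lambda>t. (\<psi> t * A v0 t) / h - (\<psi> t * A v t) / h + \<psi> t * e t)"
    using h(1) by (auto simp: fun_eq_iff field_simps)
   then show ?thesis using i[OF cA[OF v0]] i[OF cA[OF cv]] i[OF ce] by simp
  qed
  finally show "- (\<integral>t. \<psi>' t * A v t) \<le> (\<integral>t. \<psi> t * ((A v0 t - A v t) / h + e t))"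
   using c1 c2 c3 kato(1) by linarith
 qed
qed

text \<open>The right-hand side of the conclusion solves \<open>B\<^sub>k' = (B\<^sub>k\<^sub>-\<^sub>1 - B\<^sub>k) / h + e\<close> exactly.\<close>

lemma kobayashi_estimate:
 fixes A :: "nat \<Rightarrow> real \<Rightarrow> real"
 assumes cA: "\<And>k. continuous_on {s..T} (A k)" and e: "continuous_on {s..T} e" "\<And>t. t \<in> {s..T} \<Longrightarrow> e t \<ge> 0"
  and h: "h > 0"
  and step: "\<And>k a b. s \<le> a \<Longrightarrow> a \<le> b \<Longrightarrow> b \<le> T \<Longrightarrow> A (Suc k) b - A (Suc k) a \<le> integral {a..b} (\<lambda>t. (A k t - A (Suc k) t) / h + e t)"
  and zero: "\<And>t. t \<in> {s..T} \<Longrightarrow> A 0 t \<le> E + C * (t - s)\<^sup>2"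
  and init: "\<And>k. k \<le> M \<Longrightarrow> A k s \<le> E + C * (real k * h)\<^sup>2" and C: "C \<ge> 0"
  and k: "k \<le> M" and t: "t \<in> {s..T}"
 shows "A k t \<le> E + C * ((t - s - real k * h)\<^sup>2 + h * (t - s)) + integral {s..t} e"
 using k t
proof (induction k arbitrary: t)
 case 0
 have "integral {s..t} e \<ge> 0"
 proof (rule Henstock_Kurzweil_Integration.integral_nonneg)
  show "e integrable_on {s..t}"
   by (intro integrable_continuous_real continuous_on_subset[OF e(1)]) (use 0 in auto)
  show "0 \<le> e r" if "r \<in> {s..t}" for r using e(2)[of r] that 0(2) by simp
 qed
 moreover have "C * (h * (t - s)) \<ge> 0" using C h 0 by (intro mult_nonneg_nonneg) auto
 moreover have "C * ((t - s - real 0 * h)\<^sup>2 + h * (t - s)) = C * (t - s)\<^sup>2 + C * (h * (t - s))"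
  by (simp add: distrib_left)
 ultimately show ?case using zero[OF 0(2)] by linarith
next
 case (Suc k)
 define B where "B k t = E + C * ((t - s - real k * h)\<^sup>2 + h * (t - s)) + integral {s..t} e" for k t
 define X where "X t = A (Suc k) t - B (Suc k) t" for t
 have dB: "(B (Suc k) has_real_derivative ((B k t - B (Suc k) t) / h + e t)) (at t within {s..T})" if "t \<in> {s..T}" for t
 proof -
  have eq: "(B k t - B (Suc k) t) / h + e t = C * (2 * (t - s - real (Suc k) * h) + h) + e t"
   using h unfolding B_def by (simp add: field_simps power2_eq_square)
  show ?thesis unfolding eq unfolding B_def[abs_def]
   by (auto intro!: derivative_eq_intros integral_has_real_derivative e that simp: field_simps)
 qed
 have cB: "continuous_on {s..T} (B (Suc k))" for k
  unfolding B_def[abs_def] by (intro continuous_intros indefinite_integral_continuous_1 integrable_continuous_real e)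
 have cB': "continuous_on {s..T} (B k)" for k
  unfolding B_def[abs_def] by (intro continuous_intros indefinite_integral_continuous_1 integrable_continuous_real e)
 have cX: "continuous_on {s..T} X" unfolding X_def[abs_def] by (intro continuous_intros cA cB')
 have IH: "A k t \<le> B k t" if "t \<in> {s..T}" for t using Suc.IH[of t] Suc.prems that by (simp add: B_def)
 \<comment> \<open>Subtracting the exact relation for \<open>B\<close> and discarding
   \<open>A k - B k \<le> 0\<close> by the induction hypothesis leaves
   \<open>X' \<le> - X / h\<close> in integrated form.\<close>
 have stepX: "X b - X a \<le> integral {a..b} (\<lambda>t. - X t / h)" if "s \<le> a" "a \<le> b" "b \<le> T" for a b
 proof -
  have sub: "{a..b} \<subseteq> {s..T}" using that by auto
  have "((\<lambda>t. (B k t - B (Suc k) t) / h + e t) has_integral (B (Suc k) b - B (Suc k) a)) {a..b}"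
  proof (rule fundamental_theorem_of_calculus[OF that(2)])
   show "(B (Suc k) has_vector_derivative ((B k t - B (Suc k) t) / h + e t)) (at t within {a..b})" if "t \<in> {a..b}" for t
    using has_field_derivative_subset[OF dB sub] that sub
    by (auto simp: has_real_derivative_iff_has_vector_derivative)
  qed
  then have "B (Suc k) b - B (Suc k) a = integral {a..b} (\<lambda>t. (B k t - B (Suc k) t) / h + e t)" by (rule integral_unique[symmetric])
  then have "X b - X a \<le> integral {a..b} (\<lambda>t. (A k t - A (Suc k) t) / h + e t) - integral {a..b} (\<lambda>t. (B k t - B (Suc k) t) / h + e t)"
   using step[OF that, of k] unfolding X_def by linarith
  also have "\<dots> = integral {a..b} (\<lambda>t. ((A k t - A (Suc k) t) / h + e t) - ((B k t - B (Suc k) t) / h + e t))"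
   using h by (intro Henstock_Kurzweil_Integration.integral_diff[symmetric] integrable_continuous_real continuous_intros continuous_on_subset[OF cA sub]
     continuous_on_subset[OF cB' sub] continuous_on_subset[OF e(1) sub]) auto
  also have "\<dots> \<le> integral {a..b} (\<lambda>t. - X t / h)"
  proof (rule integral_le)
   show "(\<lambda>t. ((A k t - A (Suc k) t) / h + e t) - ((B k t - B (Suc k) t) / h + e t)) integrable_on {a..b}"
    using h by (intro integrable_continuous_real continuous_intros continuous_on_subset[OF cA sub]
     continuous_on_subset[OF cB' sub] continuous_on_subset[OF e(1) sub]) auto
   show "(\<lambda>t. - X t / h) integrable_on {a..b}"
    using h by (intro integrable_continuous_real continuous_intros continuous_on_subset[OF cX sub]) auto
   show "((A k t - A (Suc k) t) / h + e t) - ((B k t - B (Suc k) t) / h + e t) \<le> - X t / h" if "t \<in> {a..b}" for t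
   proof -
    have "A k t \<le> B k t" using that sub by (intro IH) auto
    then have "(A k t - B k t) / h \<le> 0" using h by (simp add: divide_nonpos_pos)
    then show ?thesis unfolding X_def by (simp add: diff_divide_distrib)
   qed
  qed
  finally show ?thesis .
 qed
 have Xs: "X s \<le> 0"
  using init[OF Suc.prems(1)] unfolding X_def B_def by simp
 have "X t \<le> 0"
 proof (rule ccontr)
  assume pos: "\<not> X t \<le> 0"
  \<comment> \<open>If \<open>X\<close> were positive at \<open>t\<close>, take the last time
    \<open>r\<close> before \<open>t\<close> at which it is not. After \<open>r\<close> it is
    nonnegative, so by \<open>stepX\<close> it cannot increase, which contradicts
    \<open>X r \<le> 0 < X t\<close>.\<close>
  define S where "S = {r \<in> {s..t}. X r \<le> 0}"
  have st: "{s..t} \<subseteq> {s..T}" using Suc.prems(2) by auto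
  have "closed S" unfolding S_def
   using continuous_closed_preimage[OF continuous_on_subset[OF cX st] closed_atLeastAtMost, of "{..0}"]
   by (simp add: vimage_def Int_def)
  moreover have "bounded S" unfolding S_def by (rule bounded_subset[of "{s..t}"]) auto
  ultimately have cS: "compact S" by (simp add: compact_eq_bounded_closed)
  have sS: "s \<in> S" using Xs Suc.prems(2) by (auto simp: S_def)
  obtain r where r: "r \<in> S" "\<And>q. q \<in> S \<Longrightarrow> q \<le> r" using compact_attains_sup[OF cS] sS by blast
  have rt: "s \<le> r" "r \<le> t" "X r \<le> 0" using r(1) by (auto simp: S_def)
  have Xq: "X q \<ge> 0" if "q \<in> {r..t}" for q
  proof (cases "q = r")
   case False
   then have "q \<notin> S" using r(2) that by force
   then show ?thesis using that rt by (auto simp: S_def)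
  next
   case True
   have "X r \<ge> 0"
   proof (rule ccontr)
    assume "\<not> X r \<ge> 0"
    then have "X r \<le> 0 \<and> 0 \<le> X t" using pos by simp
    moreover have "continuous_on {r..t} X" by (rule continuous_on_subset[OF cX]) (use rt Suc.prems(2) in auto)
    ultimately obtain q where q: "r \<le> q" "q \<le> t" "X q = 0" using IVT'[of X r 0 t] rt by auto
    then have "q \<in> S" using rt by (auto simp: S_def)
    then have "q = r" using r(2) q by force
    then show False using q \<open>\<not> X r \<ge> 0\<close> by simp
   qed
   then show ?thesis using True by simp
  qed
  have "X t - X r \<le> integral {r..t} (\<lambda>t. - X t / h)" using rt Suc.prems(2) by (intro stepX) auto
  also have "\<dots> \<le> integral {r..t} (\<lambda>t. 0)"
  proof (rule integral_le)
   show "(\<lambda>t. - X t / h) integrable_on {r..t}"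
    using h rt Suc.prems(2) by (intro integrable_continuous_real continuous_intros continuous_on_subset[OF cX]) auto
   show "- X q / h \<le> 0" if "q \<in> {r..t}" for q using Xq[OF that] h by simp
  qed auto
  finally show False using pos rt by simp
 qed
 then show ?case unfolding X_def B_def by simp
qed

section \<open>The linear resolvent\<close>

definition gauss :: "'a::euclidean_space \<Rightarrow> real" where
 "gauss z = exp (- (z \<bullet> z))"

lemma gauss_pos: "0 < gauss z" by (simp add: gauss_def)

lemma continuous_gauss: "continuous_on A gauss"
 unfolding gauss_def by (intro continuous_intros)

lemma borel_gauss [measurable]: "gauss \<in> borel_measurable borel"
 by (rule borel_measurable_continuous_onI[OF continuous_gauss])

lemma integrable_gauss: "integrable lborel (gauss :: 'a::euclidean_space \<Rightarrow> real)"
proof (rule integrableI_bounded)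
 have fin: "(\<integral>\<^sup>+x. ennreal (exp (- x\<^sup>2)) \<partial>lborel) < \<infinity>"
 proof -
  \<comment> \<open>The normal density of variance \<open>1/2\<close> is
    \<open>exp (- x\<^sup>2)\<close> up to the factor \<open>sqrt pi\<close>.\<close>
  have "integrable lborel (\<lambda>x::real. normal_density 0 (sqrt (1/2)) x * sqrt pi)" by simp
  moreover have "normal_density 0 (sqrt (1/2)) x * sqrt pi = exp (- x\<^sup>2)" for x
  proof -
   have s: "(sqrt (1/2))\<^sup>2 = (1/2::real)" by (rule real_sqrt_pow2) simp
   show ?thesis unfolding normal_density_def s by simp
  qed
  ultimately have "integrable lborel (\<lambda>x::real. exp (- x\<^sup>2))" by simp
  then show ?thesis unfolding integrable_iff_bounded by simp
 qed
 have "ennreal (norm (gauss z)) = (\<Prod>b\<in>Basis. ennreal (exp (- (z \<bullet> b)\<^sup>2)))" for z :: 'a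
  unfolding gauss_def
  by (subst euclidean_inner) (simp add: prod_ennreal exp_sum sum_negf[symmetric] power2_eq_square abs_prod)
 then have "(\<integral>\<^sup>+z. ennreal (norm (gauss (z::'a))) \<partial>lborel) = (\<Prod>b\<in>(Basis::'a set). \<integral>\<^sup>+x. ennreal (exp (- x\<^sup>2)) \<partial>lborel)"
  by (simp only:) (subst nn_integral_lborel_prod, auto)
 also have "\<dots> < \<infinity>" using fin by (simp add: power_less_top_ennreal)
 finally show "(\<integral>\<^sup>+z. ennreal (norm (gauss (z::'a))) \<partial>lborel) < \<infinity>" .
qed simp

text \<open>The normalising constant is kept abstract; its positivity is what the estimates
  use.\<close>

definition gauss_mass :: "'a::euclidean_space itself \<Rightarrow> real" where
 "gauss_mass _ = (\<integral>z. gauss (z::'a))"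

lemma gauss_mass_pos: "0 < gauss_mass TYPE('a::euclidean_space)"
proof -
 have "(\<integral>z. gauss (z::'a)) \<noteq> 0"
 proof
  assume "(\<integral>z. gauss (z::'a)) = 0"
  then have "AE z in lborel. gauss (z::'a) = 0"
   using integral_nonneg_eq_0_iff_AE[of lborel "gauss :: 'a \<Rightarrow> real"] by (simp add: integrable_gauss gauss_pos less_imp_le)
  then have "AE z in (lborel :: 'a measure). False" by eventually_elim (simp add: gauss_def)
  then show False by (simp add: eventually_False ae_filter_eq_bot_iff)
 qed
 moreover have "(\<integral>z. gauss (z::'a)) \<ge> 0" using gauss_pos less_imp_le by (intro integral_nonneg) blast
 ultimately show ?thesis unfolding gauss_mass_def by simp
qed

lemma le_exp_square: fixes t :: real shows "t + 1 \<le> 2 * exp (t\<^sup>2 / 4)"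
proof -
 have "0 \<le> (t - 1)\<^sup>2" by simp
 then have "t + 1 \<le> 2 * (1 + t\<^sup>2 / 4)" by (simp add: power2_eq_square algebra_simps)
 also have "\<dots> \<le> 2 * exp (t\<^sup>2 / 4)" using exp_ge_add_one_self[of "t\<^sup>2 / 4"] by (intro mult_left_mono) auto
 finally show ?thesis .
qed

lemma integrable_gauss_moment:
 assumes "c > 0" shows "integrable lborel (\<lambda>z::'a::euclidean_space. (norm (c *\<^sub>R z + t) + 1) * exp (- ((c *\<^sub>R z + t) \<bullet> (c *\<^sub>R z + t)) / 2))"
proof -
 have "integrable lborel (\<lambda>z::'a. (norm z + 1) * exp (- (z \<bullet> z) / 2))"
 proof (rule integrable_bound[where f = "\<lambda>z. 2 * gauss ((1/2) *\<^sub>R z)"])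
  show "integrable lborel (\<lambda>z::'a. 2 * gauss ((1/2) *\<^sub>R z))"
   using lborel_integrable_affine[of "1/2" gauss 0, OF _ integrable_gauss] by simp
  show "AE z in lborel. norm ((norm (z::'a) + 1) * exp (- (z \<bullet> z) / 2)) \<le> norm (2 * gauss ((1/2) *\<^sub>R z))"
  proof (intro AE_I2)
   fix z :: 'a
   have "(norm z + 1) * exp (- (z \<bullet> z) / 2) \<le> (2 * exp ((norm z)\<^sup>2 / 4)) * exp (- (z \<bullet> z) / 2)"
    by (intro mult_right_mono le_exp_square) auto
   also have "\<dots> = 2 * gauss ((1/2) *\<^sub>R z)"
    by (simp add: gauss_def dot_square_norm mult_exp_exp field_simps)
   finally show "norm ((norm z + 1) * exp (- (z \<bullet> z) / 2)) \<le> norm (2 * gauss ((1/2) *\<^sub>R z))" by (simp add: abs_mult)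
  qed
 qed measurable
 from lborel_integrable_affine[of c, OF _ this, of t] assms show ?thesis by (simp add: add.commute)
qed

lemma integrable_norm_gauss: "integrable lborel (\<lambda>z::'a::euclidean_space. norm z * gauss z)"
proof (rule integrable_bound[OF integrable_gauss_moment[of 1 0, OF zero_less_one]])
 show "AE z in lborel. norm (norm (z::'a) * gauss z) \<le> norm ((norm (1 *\<^sub>R z + 0) + 1) * exp (- ((1 *\<^sub>R z + 0) \<bullet> (1 *\<^sub>R z + 0)) / 2))"
  by (intro AE_I2) (auto simp: gauss_def abs_mult intro!: mult_mono)
qed measurable

text \<open>The substitution \<open>y = x + \<rho> *\<^sub>R z\<close> moves \<open>x\<close> into
  the Gaussian, so that a merely bounded measurable \<open>g\<close> can be smoothed; the opposite
  substitution returns to the variable \<open>z\<close>.\<close>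

lemma gauss_conv_GDERIV:
 fixes g :: "'a::euclidean_space \<Rightarrow> real"
 assumes \<rho>: "\<rho> > 0" and g[measurable]: "g \<in> borel_measurable borel" and B: "\<And>x. \<bar>g x\<bar> \<le> B"
 shows "GDERIV (\<lambda>x. \<integral>z. g (x + \<rho> *\<^sub>R z) * gauss z) x0 :> (\<integral>z. (g (x0 + \<rho> *\<^sub>R z) * (2 / \<rho>) * gauss z) *\<^sub>R z)"
proof -
 define f where "f x y = g y * gauss ((1/\<rho>) *\<^sub>R (y - x))" for x y
 define f' where "f' x y = (g y * (2 / \<rho>) * gauss ((1/\<rho>) *\<^sub>R (y - x))) *\<^sub>R ((1/\<rho>) *\<^sub>R (y - x))" for x y
 \<comment> \<open>A majorant uniform for \<open>x\<close> within \<rho> of \<open>x0\<close>: the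
   rescaled points then differ by at most 1, and
   \<open>(norm w0)\<^sup>2 \<le> 2 * (norm w)\<^sup>2 + 2\<close> trades half of the Gaussian
   exponent and a factor \<open>exp 1\<close> for the change of centre.\<close>
 define D where "D y = B * (2 / \<rho>) * exp 1 * ((norm ((1/\<rho>) *\<^sub>R y + - (1/\<rho>) *\<^sub>R x0) + 1) *
   exp (- (((1/\<rho>) *\<^sub>R y + - (1/\<rho>) *\<^sub>R x0) \<bullet> ((1/\<rho>) *\<^sub>R y + - (1/\<rho>) *\<^sub>R x0)) / 2))" for y
 have B0: "B \<ge> 0" using B[of 0] by linarith
 have dg: "GDERIV gauss w :> (- 2 * gauss w) *\<^sub>R w" for w :: 'a
  unfolding gderiv_def gauss_def[abs_def] by (auto intro!: derivative_eq_intros simp: inner_commute)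
 have der: "GDERIV (\<lambda>x. f x y) x :> f' x y" for x y
 proof -
  have "((\<lambda>x. gauss ((1/\<rho>) *\<^sub>R (y - x))) has_derivative (\<lambda>h. ((1/\<rho>) *\<^sub>R (- h)) \<bullet> ((- 2 * gauss ((1/\<rho>) *\<^sub>R (y - x))) *\<^sub>R ((1/\<rho>) *\<^sub>R (y - x))))) (at x)"
   by (rule has_derivative_compose[where g = gauss, OF _ dg[unfolded gderiv_def]]) (auto intro!: derivative_eq_intros)
  from has_derivative_mult_right[OF this, of "g y"] show ?thesis unfolding gderiv_def f_def f'_def
   by (rule has_derivative_eq_rhs) (simp add: fun_eq_iff)
 qed
 have int: "integrable lborel (f x)" for x
 proof -
  have "integrable lborel (\<lambda>y. gauss (- (1/\<rho>) *\<^sub>R x + (1/\<rho>) *\<^sub>R y) * g y)"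
   by (rule integrable_mult_bounded[OF lborel_integrable_affine[OF _ integrable_gauss] _ B]) (use \<rho> in auto)
  then show ?thesis by (simp add: f_def[abs_def] scaleR_diff_right mult.commute)
 qed
 have dom: "norm (f' x y) \<le> D y" if "x \<in> ball x0 \<rho>" for x y
 proof -
  define w w0 where "w = (1/\<rho>) *\<^sub>R (y - x)" and "w0 = (1/\<rho>) *\<^sub>R (y - x0)"
  have "norm (w - w0) = norm (x0 - x) / \<rho>" using \<rho> by (simp add: w_def w0_def flip: scaleR_diff_right)
  also have "\<dots> \<le> 1" using that \<rho> by (simp add: dist_norm)
  finally have ww: "norm (w - w0) \<le> 1" .
  have n1: "norm w \<le> norm w0 + 1" using norm_triangle_ineq2[of w w0] ww by linarith
  have n2: "norm w0 \<le> norm w + 1" using norm_triangle_ineq2[of w0 w] ww by (simp add: norm_minus_commute)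
  have "(norm w0)\<^sup>2 \<le> (norm w + 1)\<^sup>2" using n2 by (intro power_mono) auto
  also have "\<dots> \<le> 2 * (norm w)\<^sup>2 + 2" using sum_squares_ge_zero[of "norm w - 1" 0] by (simp add: power2_eq_square algebra_simps)
  finally have "- (w \<bullet> w) \<le> 1 + - (w0 \<bullet> w0) / 2" by (simp add: dot_square_norm)
  then have "gauss w \<le> exp 1 * exp (- (w0 \<bullet> w0) / 2)" unfolding gauss_def exp_add[symmetric] by simp
  then have 1: "gauss w * norm w \<le> (exp 1 * exp (- (w0 \<bullet> w0) / 2)) * (norm w0 + 1)"
   using n1 by (intro mult_mono) auto
  have "norm (f' x y) = (\<bar>g y\<bar> * (2 / \<rho>)) * (gauss w * norm w)"
   unfolding f'_def w_def[symmetric] using \<rho> gauss_pos[of w] by (simp add: abs_mult)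
  also have "\<dots> \<le> (B * (2 / \<rho>)) * ((exp 1 * exp (- (w0 \<bullet> w0) / 2)) * (norm w0 + 1))"
  proof (rule mult_mono[OF _ 1])
   show "\<bar>g y\<bar> * (2 / \<rho>) \<le> B * (2 / \<rho>)" using B \<rho> by (intro mult_right_mono) auto
  qed (use B0 \<rho> gauss_pos[of w] in auto)
  also have "\<dots> = D y" unfolding D_def w0_def by (simp add: scaleR_diff_right mult_ac)
  finally show ?thesis .
 qed
 have iD: "integrable lborel D" unfolding D_def[abs_def]
  by (intro integrable_mult_right integrable_gauss_moment) (use \<rho> in auto)
 have m: "f' x \<in> borel_measurable lborel" for x unfolding f'_def[abs_def] by measurable
 have G: "GDERIV (\<lambda>x. \<integral>y. f x y) x0 :> (\<integral>y. f' x0 y)"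
  by (rule GDERIV_under_integral(2)[OF \<rho> der int m iD dom])
 have c1: "(\<integral>z. g (x + \<rho> *\<^sub>R z) * gauss z) = \<bar>1/\<rho>\<bar> ^ DIM('a) * (\<integral>y. f x y)" for x
  using lborel_integral_affine[of "1/\<rho>" "\<lambda>z. g (x + \<rho> *\<^sub>R z) * gauss z" "- (1/\<rho>) *\<^sub>R x"] \<rho>
  by (simp add: f_def scaleR_diff_right scaleR_add_right)
 have c2: "(\<integral>z. (g (x0 + \<rho> *\<^sub>R z) * (2 / \<rho>) * gauss z) *\<^sub>R z) = \<bar>1/\<rho>\<bar> ^ DIM('a) *\<^sub>R (\<integral>y. f' x0 y)"
  using lborel_integral_affine[of "1/\<rho>" "\<lambda>z. (g (x0 + \<rho> *\<^sub>R z) * (2 / \<rho>) * gauss z) *\<^sub>R z" "- (1/\<rho>) *\<^sub>R x0"] \<rho>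
  by (simp add: f'_def scaleR_diff_right scaleR_add_right)
 show ?thesis unfolding c1 c2
  using GDERIV_mult[OF GDERIV_const G, of "\<bar>1/\<rho>\<bar> ^ DIM('a)"] by simp
qed

section \<open>The resolvent of the Laplacian as an average\<close>

text \<open>With \<open>s = r^2\<close> the radial factor is the exponential law of
  \<open>s\<close>, and for fixed \<open>r\<close> the shift by
  \<open>(\<kappa> * r) *\<^sub>R z\<close> is distributed by the heat kernel at time
  \<open>\<kappa>^2 * s / 4\<close>. Averaging is thus the Laplace transform of the heat semigroup,
  that is, the resolvent of \<open>\<kappa>^2 / 4\<close> times the Laplacian, in a form common to
  all dimensions.\<close>

definition wres :: "real \<times> 'a::euclidean_space \<Rightarrow> real" where
 "wres y = indicator {0<..} (fst y) * (2 * fst y * exp (- (fst y)\<^sup>2)) * (gauss (snd y) / gauss_mass TYPE('a))"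

abbreviation shift :: "real \<Rightarrow> 'a::euclidean_space \<Rightarrow> real \<times> 'a \<Rightarrow> 'a" where
 "shift \<kappa> x y \<equiv> x + (\<kappa> * fst y) *\<^sub>R snd y"

definition res :: "real \<Rightarrow> ('a::euclidean_space \<Rightarrow> real) \<Rightarrow> 'a \<Rightarrow> real" where
 "res \<kappa> g x = (\<integral>y. wres y * g (shift \<kappa> x y))"

text \<open>The gradient of \<open>res\<close> with the derivative resting on the Gaussian, so that
  it makes sense without any regularity of \<open>g\<close>. The singular factor
  \<open>1 / fst y\<close> is cancelled by the factor \<open>fst y\<close> in
  \<open>wres\<close>.\<close>

definition Dres :: "real \<Rightarrow> ('a::euclidean_space \<Rightarrow> real) \<Rightarrow> 'a \<Rightarrow> 'a" where
 "Dres \<kappa> g x = (\<integral>y. (wres y * g (shift \<kappa> x y) * (2 / (\<kappa> * fst y))) *\<^sub>R snd y)"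

lemma wres_nonneg: "0 \<le> wres (y :: real \<times> 'a::euclidean_space)"
 using gauss_mass_pos[where 'a = 'a] gauss_pos[of "snd y"] by (simp add: wres_def indicator_def)

lemma borel_wres [measurable]: "wres \<in> borel_measurable borel"
 unfolding wres_def[abs_def] borel_prod[symmetric] by measurable

definition rad :: "real \<Rightarrow> real" where
 "rad r = indicator {0<..} r * (2 * r * exp (- r\<^sup>2))"

lemma borel_rad [measurable]: "rad \<in> borel_measurable borel"
 unfolding rad_def[abs_def] by measurable

lemma rad_integral: "integrable lborel rad" "(\<integral>r. rad r) = 1"
proof -
 have h: "has_bochner_integral lborel (\<lambda>x::real. 2 * (indicator {0..} x *\<^sub>R (exp (- x\<^sup>2) * x))) (2 * (1 / 2))"
  by (intro has_bochner_integral_mult_right gaussian_moment_1)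
 have eq: "(\<lambda>x::real. 2 * (indicator {0..} x *\<^sub>R (exp (- x\<^sup>2) * x))) = rad"
  by (auto simp: rad_def indicator_def fun_eq_iff)
 show "integrable lborel rad" "(\<integral>r. rad r) = 1"
  using h[unfolded eq] by (simp_all add: has_bochner_integral_iff)
qed

lemma exp_square_half_line: "integrable lborel (\<lambda>r::real. indicator {0<..} r * exp (- r\<^sup>2))"
proof -
 have "integrable lborel (\<lambda>r::real. indicator {0..} r *\<^sub>R exp (- r\<^sup>2))"
  using gaussian_moment_0 by (simp add: has_bochner_integral_iff)
 then show ?thesis
  by (rule integrable_bound) (auto simp: indicator_def)
qed

lemma wres_split: "wres y = rad (fst y) * (gauss (snd (y :: real \<times> 'a::euclidean_space)) / gauss_mass TYPE('a))"
 by (simp add: wres_def rad_def)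

lemma wres_integral:
 shows "integrable lborel (wres :: real \<times> 'a::euclidean_space \<Rightarrow> real)"
  and "(\<integral>y. wres (y :: real \<times> 'a)) = 1"
proof -
 have i: "integrable (lborel \<Otimes>\<^sub>M lborel) (\<lambda>(r, z::'a). rad r * (gauss z / gauss_mass TYPE('a)))"
  by (intro integrable_times_pair rad_integral integrable_divide integrable_gauss)
 have eq: "(\<lambda>(r, z::'a). rad r * (gauss z / gauss_mass TYPE('a))) = wres" by (auto simp: wres_split fun_eq_iff)
 show i': "integrable lborel (wres :: real \<times> 'a \<Rightarrow> real)" using i unfolding eq lborel_prod .
 have "(\<integral>y. wres (y :: real \<times> 'a) \<partial>(lborel \<Otimes>\<^sub>M lborel)) = (\<integral>r. \<integral>z. wres (r, z::'a))"
  by (rule lborel_pair.integral_fst'[symmetric]) (use i' in \<open>simp add: lborel_prod\<close>)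
 also have "\<dots> = 1" using gauss_mass_pos[where 'a = 'a] rad_integral(2)
  by (simp add: wres_split gauss_mass_def)
 finally show "(\<integral>y. wres (y :: real \<times> 'a)) = 1" by (simp add: lborel_prod)
qed

lemma shift_measurable [measurable]: "(\<lambda>y :: real \<times> 'a::euclidean_space. shift \<kappa> x y) \<in> borel_measurable borel"
 unfolding borel_prod[symmetric] by measurable

lemma res_integrable:
 assumes g[measurable]: "g \<in> borel_measurable borel" and B: "\<And>x. \<bar>g x\<bar> \<le> B"
 shows "integrable lborel (\<lambda>y. wres y * g (shift \<kappa> x y))"
 by (rule integrable_mult_bounded[OF wres_integral(1) _ B]) measurable

lemma res_mono:
 assumes "g \<in> borel_measurable borel" "\<And>x. \<bar>g x\<bar> \<le> B" "g' \<in> borel_measurable borel" "\<And>x. \<bar>g' x\<bar> \<le> B'" "\<And>x. g x \<le> g' x"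
 shows "res \<kappa> g x \<le> res \<kappa> g' x"
 unfolding res_def
 by (intro integral_mono res_integrable[OF assms(1,2)] res_integrable[OF assms(3,4)] mult_left_mono assms wres_nonneg)

lemma res_const: "res \<kappa> (\<lambda>_. c) (x::'a::euclidean_space) = c"
 by (simp add: res_def wres_integral(2))

lemma res_bounds:
 assumes "g \<in> borel_measurable borel" "\<And>x. a \<le> g x" "\<And>x. g x \<le> b"
 shows "a \<le> res \<kappa> g x" "res \<kappa> g x \<le> b"
proof -
 have B: "\<bar>g x\<bar> \<le> max \<bar>a\<bar> \<bar>b\<bar>" for x using assms(2)[of x] assms(3)[of x] by auto
 show "a \<le> res \<kappa> g x" using res_mono[of "\<lambda>_. a" "\<bar>a\<bar>" g, OF _ _ assms(1) B assms(2)] by (simp add: res_const)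
 show "res \<kappa> g x \<le> b" using res_mono[of g _ "\<lambda>_. b" "\<bar>b\<bar>", OF assms(1) B _ _ assms(3)] by (simp add: res_const)
qed

text \<open>An average over translates, so Fubini and translation invariance preserve the mass. This
  is the source of mass conservation in the Euler scheme.\<close>

lemma res_integral:
 fixes g :: "'a::euclidean_space \<Rightarrow> real"
 assumes g: "integrable lborel g" and B: "\<And>x. \<bar>g x\<bar> \<le> B"
 shows "integrable lborel (res \<kappa> g)" "(\<integral>x. res \<kappa> g x) = (\<integral>x. g x)"
proof -
 have gm[measurable]: "g \<in> borel_measurable borel" using borel_measurable_integrable[OF g] by simp
 let ?F = "\<lambda>(y, x). wres y * g (x + (\<kappa> * fst y) *\<^sub>R snd (y :: real \<times> 'a))"
 have tr: "integrable lborel (\<lambda>x. g (x + c))" "(\<integral>x. g (x + c)) = (\<integral>x. g x)" for c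
  using integrable_translate[OF g, of c] integral_translate[of g c] gm by (simp_all add: add.commute)
 have i: "integrable (lborel \<Otimes>\<^sub>M lborel) ?F"
 proof (rule lborel_pair.Fubini_integrable)
  have [measurable]: "wres \<in> borel_measurable (borel \<Otimes>\<^sub>M borel)" using borel_wres by (simp add: borel_prod)
  show "?F \<in> borel_measurable (lborel \<Otimes>\<^sub>M lborel)" unfolding lborel_prod[symmetric] by measurable
  have "(\<integral>x. norm (case (y, x) of (y, x) \<Rightarrow> wres y * g (shift \<kappa> x y))) = wres y * (\<integral>x. \<bar>g x\<bar>)" for y :: "real \<times> 'a"
   using integral_translate[of "\<lambda>x. \<bar>g x\<bar>" "(\<kappa> * fst y) *\<^sub>R snd y"] wres_nonneg[of y] by (simp add: abs_mult add.commute)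
  then show "integrable lborel (\<lambda>y :: real \<times> 'a. \<integral>x. norm (case (y, x) of (y, x) \<Rightarrow> wres y * g (shift \<kappa> x y)))"
   using integrable_mult_left[OF wres_integral(1)[where 'a = 'a]] by presburger
  show "AE y in lborel. integrable lborel (\<lambda>x. case (y, x) of (y, x) \<Rightarrow> wres y * g (shift \<kappa> x y))"
   using tr by simp
 qed
 have eq: "(\<lambda>x. \<integral>y. wres y * g (shift \<kappa> x y)) = res \<kappa> g" by (simp add: res_def fun_eq_iff)
 show "integrable lborel (res \<kappa> g)" using lborel_pair.integrable_snd[OF i] unfolding eq .
 have "(\<integral>x. res \<kappa> g x) = (\<integral>y. \<integral>x. wres y * g (shift \<kappa> x y))"
  unfolding res_def by (rule lborel_pair.Fubini_integral[OF i])
 also have "\<dots> = (\<integral>x. g x)" by (simp add: tr wres_integral(2))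
 finally show "(\<integral>x. res \<kappa> g x) = (\<integral>x. g x)" .
qed

text \<open>The boundary term at 0 matters: along the rays of the kernel \<open>\<phi> 0\<close> is
  the value \<open>g x\<close>, the right-hand side of the resolvent equation.\<close>

lemma half_line_by_parts:
 fixes \<phi> \<phi>' :: "real \<Rightarrow> real"
 assumes d: "\<And>r. (\<phi> has_real_derivative \<phi>' r) (at r)" and c: "continuous_on UNIV \<phi>'"
  and B: "\<And>r. \<bar>\<phi> r\<bar> \<le> B" "\<And>r. \<bar>\<phi>' r\<bar> \<le> L"
 shows "(\<integral>r. indicator {0<..} r * exp (- r\<^sup>2) * \<phi>' r) = - \<phi> 0 + (\<integral>r. rad r * \<phi> r)"
proof -
 define F where "F r = exp (- r\<^sup>2) * \<phi> r" for r
 define F' where "F' r = exp (- r\<^sup>2) * \<phi>' r - 2 * r * exp (- r\<^sup>2) * \<phi> r" for r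
 have c\<phi>: "continuous_on UNIV \<phi>" using d by (intro GDERIV_continuous_on) auto
 have [measurable]: "\<phi> \<in> borel_measurable borel" "\<phi>' \<in> borel_measurable borel"
  using c c\<phi> by (auto intro: borel_measurable_continuous_onI)
 have dF: "(F has_real_derivative F' r) (at r)" for r
  unfolding F_def[abs_def] F'_def by (auto intro!: derivative_eq_intros d simp: algebra_simps)
 have cF': "continuous_on UNIV F'" unfolding F'_def[abs_def] by (intro continuous_intros c c\<phi>)
 have i1: "integrable lborel (\<lambda>r. indicator {0<..} r * exp (- r\<^sup>2) * \<phi>' r)"
  by (rule integrable_mult_bounded[OF exp_square_half_line _ B(2)]) measurable
 have i2: "integrable lborel (\<lambda>r. rad r * \<phi> r)"
  by (rule integrable_mult_bounded[OF rad_integral(1) _ B(1)]) measurable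
 have eq: "indicator {0<..} r * F' r = indicator {0<..} r * exp (- r\<^sup>2) * \<phi>' r - rad r * \<phi> r" for r
  by (simp add: F'_def rad_def indicator_def)
 have i3: "integrable lborel (\<lambda>r. indicator {0<..} r * F' r)" unfolding eq using i1 i2 by simp
 have ae: "AE r in lborel. indicator {0<..} r * F' r = indicator {0..} r * F' r"
  using AE_lborel_singleton[of "0::real"] by eventually_elim (auto simp: indicator_def)
 have [measurable]: "F' \<in> borel_measurable borel" by (rule borel_measurable_continuous_onI[OF cF'])
 have i4: "integrable lborel (\<lambda>r. indicator {0..} r * F' r)"
  by (rule integrable_cong_AE[THEN iffD1, OF _ _ ae i3]) measurable
 have "((\<lambda>y. \<integral>r. indicator {..y} r *\<^sub>R (indicator {0..} r * F' r)) \<longlongrightarrow> (\<integral>r. indicator {0..} r * F' r)) at_top"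
  by (rule tendsto_integral_at_top[OF _ i4]) simp
 moreover have "\<forall>\<^sub>F y in at_top. (\<integral>r. indicator {..y} r *\<^sub>R (indicator {0..} r * F' r)) = F y - F 0"
  using eventually_ge_at_top[of 0]
 proof eventually_elim
  case (elim y)
  have "(\<integral>r. indicator {..y} r *\<^sub>R (indicator {0..} r * F' r)) = (\<integral>r. F' r * indicator {0..y} r)"
   by (rule integral_cong) (auto simp: indicator_def)
  also have "\<dots> = F y - F 0"
   by (rule integral_FTC_Icc_real[OF elim dF]) (use cF' in \<open>auto simp: continuous_on_eq_continuous_at\<close>)
  finally show ?case .
 qed
 ultimately have l1: "((\<lambda>y. F y - F 0) \<longlongrightarrow> (\<integral>r. indicator {0..} r * F' r)) at_top"
  by (rule Lim_transform_eventually)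
 have l2: "((\<lambda>y. F y - F 0) \<longlongrightarrow> 0 - F 0) at_top"
 proof (intro tendsto_diff tendsto_const)
  have "((\<lambda>y::real. y^0 / exp y) \<longlongrightarrow> 0) at_top" by (rule tendsto_power_div_exp_0)
  then have "((\<lambda>y::real. B * exp (- y)) \<longlongrightarrow> B * 0) at_top"
   by (intro tendsto_mult tendsto_const) (simp add: exp_minus divide_inverse)
  then have lim: "((\<lambda>y::real. B * exp (- y)) \<longlongrightarrow> 0) at_top" by simp
  show "(F \<longlongrightarrow> 0) at_top"
  proof (rule Lim_null_comparison[OF _ lim])
   show "\<forall>\<^sub>F y in at_top. norm (F y) \<le> B * exp (- y)"
    using eventually_ge_at_top[of 1]
   proof eventually_elim
    case (elim y)
    then have "y \<le> y\<^sup>2" by (simp add: power2_eq_square)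
    then have "exp (- y\<^sup>2) * \<bar>\<phi> y\<bar> \<le> exp (- y) * B" using B(1)[of y] by (intro mult_mono) auto
    then show ?case by (simp add: F_def abs_mult mult.commute)
   qed
  qed
 qed
 have "(\<integral>r. indicator {0..} r * F' r) = - \<phi> 0"
  using tendsto_unique[OF _ l1 l2] by (simp add: F_def)
 moreover have "(\<integral>r. indicator {0..} r * F' r) = (\<integral>r. indicator {0<..} r * F' r)"
  by (rule integral_cong_AE[symmetric, OF _ _ ae]) measurable
 moreover have "\<dots> = (\<integral>r. indicator {0<..} r * exp (- r\<^sup>2) * \<phi>' r) - (\<integral>r. rad r * \<phi> r)"
  unfolding eq using i1 i2 by simp
 ultimately show ?thesis by simp
qed

text \<open>What is left, up to constants, of the weight in \<open>Dres\<close> after the radial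
  factor has cancelled the singularity: one integrable majorant for all bounded
  \<open>g\<close>.\<close>

definition wder :: "real \<times> 'a::euclidean_space \<Rightarrow> real" where
 "wder y = (indicator {0<..} (fst y) * exp (- (fst y)\<^sup>2)) * (norm (snd y) * gauss (snd y))"

lemma wder_nonneg: "0 \<le> wder y"
 using gauss_pos[of "snd y"] by (simp add: wder_def)

lemma integrable_wder: "integrable lborel (wder :: real \<times> 'a::euclidean_space \<Rightarrow> real)"
proof -
 have "integrable (lborel \<Otimes>\<^sub>M lborel) (\<lambda>(r, z::'a). (indicator {0<..} r * exp (- r\<^sup>2)) * (norm z * gauss z))"
  by (intro integrable_times_pair exp_square_half_line integrable_norm_gauss)
 moreover have "(\<lambda>(r, z::'a). (indicator {0<..} r * exp (- r\<^sup>2)) * (norm z * gauss z)) = wder" by (auto simp: wder_def fun_eq_iff)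
 ultimately show ?thesis unfolding lborel_prod by metis
qed

lemma Dres_integrand_bound:
 fixes g :: "'a::euclidean_space \<Rightarrow> real"
 assumes \<kappa>: "\<kappa> > 0" and B: "\<And>x. \<bar>g x\<bar> \<le> B"
 shows "norm ((wres y * g (shift \<kappa> x y) * (2 / (\<kappa> * fst y))) *\<^sub>R snd y)
  \<le> (4 * B / (\<kappa> * gauss_mass TYPE('a))) * wder y"
proof (cases "fst y > 0")
 case True
 let ?G = "g (shift \<kappa> x y)"
 have "norm ((wres y * ?G * (2 / (\<kappa> * fst y))) *\<^sub>R snd y) = \<bar>?G\<bar> * (4 / (\<kappa> * gauss_mass TYPE('a)) * wder y)"
  using True \<kappa> gauss_mass_pos[where 'a = 'a] gauss_pos[of "snd y"]
  by (simp add: wres_def wder_def abs_mult mult_ac)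
 also have "\<dots> \<le> B * (4 / (\<kappa> * gauss_mass TYPE('a)) * wder y)"
  using \<kappa> gauss_mass_pos[where 'a = 'a] wder_nonneg[of y] by (intro mult_right_mono B) auto
 finally show ?thesis by (simp add: mult_ac)
qed (simp add: wres_def wder_def)

lemma Dres_integrable:
 fixes g :: "'a::euclidean_space \<Rightarrow> real"
 assumes \<kappa>: "\<kappa> > 0" and g[measurable]: "g \<in> borel_measurable borel" and B: "\<And>x. \<bar>g x\<bar> \<le> B"
 shows "integrable lborel (\<lambda>y. (wres y * g (shift \<kappa> x y) * (2 / (\<kappa> * fst y))) *\<^sub>R snd y)"
proof (rule integrable_bound)
 show "integrable lborel (\<lambda>y :: real \<times> 'a. (4 * B / (\<kappa> * gauss_mass TYPE('a))) * wder y)"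
  by (intro integrable_mult_right integrable_wder)
 show "AE y in lborel. norm ((wres y * g (shift \<kappa> x y) * (2 / (\<kappa> * fst y))) *\<^sub>R snd y)
   \<le> norm ((4 * B / (\<kappa> * gauss_mass TYPE('a))) * wder y)"
  by (intro AE_I2 order_trans[OF Dres_integrand_bound[OF \<kappa> B]]) (simp only: real_norm_def abs_ge_self)
 have [measurable]: "wres \<in> borel_measurable (borel \<Otimes>\<^sub>M borel)" using borel_wres by (simp add: borel_prod)
 have "(\<lambda>y. (wres y * g (shift \<kappa> x y) * (2 / (\<kappa> * fst y))) *\<^sub>R snd y) \<in> borel_measurable (borel \<Otimes>\<^sub>M borel)"
  by measurable
 then show "(\<lambda>y. (wres y * g (shift \<kappa> x y) * (2 / (\<kappa> * fst y))) *\<^sub>R snd y) \<in> borel_measurable lborel"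
  by (simp add: borel_prod)
qed

lemma Dres_bound:
 fixes g :: "'a::euclidean_space \<Rightarrow> real"
 assumes \<kappa>: "\<kappa> > 0" and g: "g \<in> borel_measurable borel" and B: "\<And>x. \<bar>g x\<bar> \<le> B"
 shows "norm (Dres \<kappa> g x) \<le> (4 * B / (\<kappa> * gauss_mass TYPE('a))) * (\<integral>y. wder (y :: real \<times> 'a))"
proof -
 have "norm (Dres \<kappa> g x) \<le> (\<integral>y. (4 * B / (\<kappa> * gauss_mass TYPE('a))) * wder (y :: real \<times> 'a))"
  unfolding Dres_def
  by (intro integral_norm_bound_integral Dres_integrable[OF assms] integrable_mult_right integrable_wder
    Dres_integrand_bound[OF \<kappa> B])
 then show ?thesis by simp
qed

text \<open>For fixed radius \<open>r\<close> the average is a Gaussian convolution of width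
  \<open>\<kappa> * r\<close>, differentiated by \<open>gauss_conv_GDERIV\<close>; the radial
  integral is then differentiated with the majorant \<open>wder\<close>.\<close>

lemma res_GDERIV:
 fixes g :: "'a::euclidean_space \<Rightarrow> real"
 assumes \<kappa>: "\<kappa> > 0" and g: "g \<in> borel_measurable borel" and B: "\<And>x. \<bar>g x\<bar> \<le> B"
 shows "GDERIV (res \<kappa> g) x0 :> Dres \<kappa> g x0"
proof -
 define m where "m = gauss_mass TYPE('a)"
 have m: "m > 0" unfolding m_def by (rule gauss_mass_pos)
 have ip: "integrable (lborel \<Otimes>\<^sub>M lborel) (\<lambda>y. wres y * g (shift \<kappa> x y))" for x
  using res_integrable[OF g B] by (simp add: lborel_prod)
 have iD: "integrable (lborel \<Otimes>\<^sub>M lborel) (\<lambda>y. (wres y * g (shift \<kappa> x y) * (2 / (\<kappa> * fst y))) *\<^sub>R snd y)" for x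
  using Dres_integrable[OF assms] by (simp add: lborel_prod)
 define f where "f x r = (\<integral>z. wres (r, z) * g (x + (\<kappa> * r) *\<^sub>R z))" for x r
 define f' where "f' x r = (\<integral>z. (wres (r, z) * g (x + (\<kappa> * r) *\<^sub>R z) * (2 / (\<kappa> * r))) *\<^sub>R z)" for x r
 define C where "C = (4 * B / (\<kappa> * m)) * (\<integral>z. norm (z::'a) * gauss z)"
 have feq: "f x r = (rad r / m) * (\<integral>z. g (x + (\<kappa> * r) *\<^sub>R z) * gauss z)" for x r
  unfolding f_def wres_split m_def by (subst integral_mult_right_zero[symmetric]) (simp add: mult_ac)
 have f'eq: "f' x r = (rad r / m) *\<^sub>R (\<integral>z. (g (x + (\<kappa> * r) *\<^sub>R z) * (2 / (\<kappa> * r)) * gauss z) *\<^sub>R z)" for x r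
  unfolding f'_def wres_split m_def by (subst integral_scaleR_right[symmetric]) (simp add: mult_ac)
 have der: "GDERIV (\<lambda>x. f x r) x :> f' x r" for x r
 proof (cases "r > 0")
  case True
  then have "\<kappa> * r > 0" using \<kappa> by simp
  from GDERIV_mult[OF GDERIV_const gauss_conv_GDERIV[OF this g B], of "rad r / m"] show ?thesis
   unfolding feq f'eq by simp
 next
  case False
  then have "rad r = 0" by (simp add: rad_def)
  then show ?thesis unfolding feq f'eq by (simp add: GDERIV_const)
 qed
 have dom: "norm (f' x r) \<le> C * (indicator {0<..} r * exp (- r\<^sup>2))" for x r
 proof -
  have "norm (f' x r) \<le> (\<integral>z. (4 * B / (\<kappa> * m)) * (indicator {0<..} r * exp (- r\<^sup>2)) * (norm (z::'a) * gauss z))"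
  proof -
   have b: "norm ((wres (r, z) * g (x + (\<kappa> * r) *\<^sub>R z) * (2 / (\<kappa> * r))) *\<^sub>R z)
      \<le> (4 * B / (\<kappa> * m)) * (indicator {0<..} r * exp (- r\<^sup>2)) * (norm z * gauss z)" for z
    using Dres_integrand_bound[of \<kappa> g B "(r, z)" x, OF \<kappa> B] by (simp only: wder_def m_def mult.assoc fst_conv snd_conv)
   have i: "integrable lborel (\<lambda>z::'a. (4 * B / (\<kappa> * m)) * (indicator {0<..} r * exp (- r\<^sup>2)) * (norm z * gauss z))"
    by (intro integrable_mult_right integrable_norm_gauss)
   have "(\<lambda>z. (wres (r, z) * g (x + (\<kappa> * r) *\<^sub>R z) * (2 / (\<kappa> * r))) *\<^sub>R z) \<in> borel_measurable lborel"
    unfolding wres_split using g by simp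
   then have "integrable lborel (\<lambda>z. (wres (r, z) * g (x + (\<kappa> * r) *\<^sub>R z) * (2 / (\<kappa> * r))) *\<^sub>R z)"
    by (rule integrable_bound[OF i]) (intro AE_I2 order_trans[OF b], simp only: real_norm_def abs_ge_self)
   from integral_norm_bound_integral[OF this i b] show ?thesis unfolding f'_def .
  qed
  also have "\<dots> = C * (indicator {0<..} r * exp (- r\<^sup>2))" unfolding C_def
   by (simp only: integral_mult_right_zero) (simp only: mult_ac)
  finally show ?thesis .
 qed
 have "GDERIV (\<lambda>x. \<integral>r. f x r) x0 :> (\<integral>r. f' x0 r)"
 proof (rule GDERIV_under_integral(2)[OF zero_less_one der _ _ _ dom])
  show "integrable lborel (f x)" for x using lborel_pair.integrable_fst'[OF ip] by (simp add: f_def[abs_def])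
  show "f' x0 \<in> borel_measurable lborel" using borel_measurable_integrable[OF lborel_pair.integrable_fst'[OF iD[of x0]]] by (simp add: f'_def[abs_def])
  show "integrable lborel (\<lambda>r. C * (indicator {0<..} r * exp (- r\<^sup>2)))" by (intro integrable_mult_right exp_square_half_line)
 qed
 moreover have "(\<integral>r. f x r) = res \<kappa> g x" for x
  using lborel_pair.integral_fst'[OF ip] by (simp add: f_def res_def lborel_prod)
 moreover have "(\<integral>r. f' x0 r) = Dres \<kappa> g x0"
  using lborel_pair.integral_fst'[OF iD] by (simp add: f'_def Dres_def lborel_prod)
 ultimately show ?thesis by simp
qed

lemma Dres_continuous:
 fixes g :: "'a::euclidean_space \<Rightarrow> real"
 assumes \<kappa>: "\<kappa> > 0" and g: "continuous_on UNIV g" and B: "\<And>x. \<bar>g x\<bar> \<le> B"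
 shows "continuous_on UNIV (Dres \<kappa> g)"
proof -
 have gm: "g \<in> borel_measurable borel" by (rule borel_measurable_continuous_onI[OF g])
 have "isCont (Dres \<kappa> g) x" for x
  unfolding Dres_def
 proof (rule isCont_under_integral[OF zero_less_one])
  show "isCont (\<lambda>x. (wres y * g (shift \<kappa> x y) * (2 / (\<kappa> * fst y))) *\<^sub>R snd y) x" for y
  proof -
   have "continuous_on UNIV (\<lambda>x. (wres y * g (shift \<kappa> x y) * (2 / (\<kappa> * fst y))) *\<^sub>R snd y)"
    by (intro continuous_intros continuous_on_compose2[OF g]) auto
   then show ?thesis by (simp add: continuous_on_eq_continuous_at)
  qed
  show "(\<lambda>y. (wres y * g (shift \<kappa> x y) * (2 / (\<kappa> * fst y))) *\<^sub>R snd y) \<in> borel_measurable lborel" for x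
   by (rule borel_measurable_integrable[OF Dres_integrable[OF \<kappa> gm B]])
  show "integrable lborel (\<lambda>y :: real \<times> 'a. (4 * B / (\<kappa> * gauss_mass TYPE('a))) * wder y)"
   by (intro integrable_mult_right integrable_wder)
 qed (rule Dres_integrand_bound[OF \<kappa> B])
 then show ?thesis by (simp add: continuous_at_imp_continuous_on)
qed

text \<open>If \<open>g\<close> is C^1, the derivative may instead be taken on \<open>g\<close>.
  Uniqueness of the gradient identifies the two expressions, so a component of \<open>Dres\<close>
  is again an average of the form \<open>res\<close>.\<close>

lemma Dres_inner:
 fixes g :: "'a::euclidean_space \<Rightarrow> real"
 assumes \<kappa>: "\<kappa> > 0" and g: "\<And>x. GDERIV g x :> Dg x" and c: "continuous_on UNIV Dg"
  and B: "\<And>x. \<bar>g x\<bar> \<le> B" "\<And>x. norm (Dg x) \<le> L"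
 shows "Dres \<kappa> g x \<bullet> b = res \<kappa> (\<lambda>x. Dg x \<bullet> b) x"
proof -
 have gm: "g \<in> borel_measurable borel" by (rule borel_measurable_continuous_onI[OF GDERIV_continuous_on[OF g]])
 have Dm[measurable]: "Dg \<in> borel_measurable borel" by (rule borel_measurable_continuous_onI[OF c])
 have m: "(\<lambda>y. wres y *\<^sub>R Dg (shift \<kappa> x y)) \<in> borel_measurable lborel" by measurable
 have der: "GDERIV (\<lambda>x. wres y * g (shift \<kappa> x y)) x :> wres y *\<^sub>R Dg (shift \<kappa> x y)" for x y
 proof -
  have "((\<lambda>x. g (shift \<kappa> x y)) has_derivative (\<lambda>h. h \<bullet> Dg (shift \<kappa> x y))) (at x)"
   by (rule has_derivative_compose[where g = g and f' = "\<lambda>h. h", OF _ g[unfolded gderiv_def]]) (auto intro!: derivative_eq_intros)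
  then show ?thesis unfolding gderiv_def by (auto intro!: derivative_eq_intros)
 qed
 have dom: "norm (wres y *\<^sub>R Dg (shift \<kappa> x y)) \<le> L * wres y" for x y
  using mult_right_mono[OF B(2) wres_nonneg[of y]] wres_nonneg[of y] by (simp add: mult.commute)
 note * = GDERIV_under_integral[OF zero_less_one der res_integrable[OF gm B(1)] m integrable_mult_right[OF wres_integral(1)] dom]
 have "GDERIV (res \<kappa> g) x :> (\<integral>y. wres y *\<^sub>R Dg (shift \<kappa> x y))"
  using *(2) by (simp add: res_def[abs_def])
 from GDERIV_unique[OF res_GDERIV[OF \<kappa> gm B(1)] this]
 have "Dres \<kappa> g x \<bullet> b = (\<integral>y. wres y *\<^sub>R Dg (shift \<kappa> x y)) \<bullet> b" by simp
 also have "\<dots> = res \<kappa> (\<lambda>x. Dg x \<bullet> b) x"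
  unfolding res_def using *(1) by (subst integral_inner_left[symmetric]) auto
 finally show ?thesis .
qed

text \<open>The factor \<open>1/4\<close> is half the variance \<open>1/2\<close> of each coordinate of the weight.\<close>

lemma res_equation:
 fixes g :: "'a::euclidean_space \<Rightarrow> real"
 assumes \<kappa>: "\<kappa> > 0" and g: "\<And>x. GDERIV g x :> Dg x" and c: "continuous_on UNIV Dg"
  and B: "\<And>x. \<bar>g x\<bar> \<le> B" "\<And>x. norm (Dg x) \<le> L"
 shows "res \<kappa> g x - \<kappa>\<^sup>2 / 4 * (\<Sum>b\<in>Basis. Dres \<kappa> (\<lambda>x. Dg x \<bullet> b) x \<bullet> b) = g x"
proof -
 define m where "m = gauss_mass TYPE('a)"
 have m: "m > 0" unfolding m_def by (rule gauss_mass_pos)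
 have cg: "continuous_on UNIV g" by (rule GDERIV_continuous_on[OF g])
 have gm[measurable]: "g \<in> borel_measurable borel" by (rule borel_measurable_continuous_onI[OF cg])
 have [measurable]: "wres \<in> borel_measurable (borel \<Otimes>\<^sub>M borel)" using borel_wres by (simp add: borel_prod)
 have Db: "\<bar>Dg x \<bullet> b\<bar> \<le> L" if "b \<in> Basis" for x b
  using Basis_le_norm[OF that, of "Dg x"] B(2)[of x] by linarith
 have Dm: "(\<lambda>x. Dg x \<bullet> b) \<in> borel_measurable borel" for b
  by (intro borel_measurable_continuous_onI continuous_intros c)
 \<comment> \<open>The sum over the basis collapses to \<open>Dg \<bullet> snd y\<close>, which is
   the derivative of \<open>g\<close> along the ray
   \<open>r \<mapsto> x + (\<kappa> * r) *\<^sub>R z\<close> divided by \<kappa>. For fixed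
   \<open>z\<close> this is the situation of \<open>half_line_by_parts\<close>.\<close>
 define P where "P y = wres y * (Dg (shift \<kappa> x y) \<bullet> snd y) * (2 / (\<kappa> * fst y))" for y
 have Peq: "P y = (\<Sum>b\<in>Basis. ((wres y * (Dg (shift \<kappa> x y) \<bullet> b) * (2 / (\<kappa> * fst y))) *\<^sub>R snd y) \<bullet> b)" for y
  unfolding P_def by (subst euclidean_inner) (simp add: sum_distrib_left sum_distrib_right mult_ac)
 have iP0: "integrable lborel (\<lambda>y. ((wres y * (Dg (shift \<kappa> x y) \<bullet> b) * (2 / (\<kappa> * fst y))) *\<^sub>R snd y) \<bullet> b)"
  if "b \<in> Basis" for b
  using Dres_integrable[OF \<kappa> Dm Db[OF that]] by (rule integrable_inner_left)
 have iP: "integrable lborel P" unfolding Peq[abs_def] by (intro Bochner_Integration.integrable_sum iP0)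
 have "(\<Sum>b\<in>Basis. Dres \<kappa> (\<lambda>x. Dg x \<bullet> b) x \<bullet> b) = (\<Sum>b\<in>Basis. \<integral>y. ((wres y * (Dg (shift \<kappa> x y) \<bullet> b) * (2 / (\<kappa> * fst y))) *\<^sub>R snd y) \<bullet> b)"
  unfolding Dres_def by (intro sum.cong refl integral_inner_left[symmetric] Dres_integrable[OF \<kappa> Dm Db])
 also have "\<dots> = (\<integral>y. P y)"
  unfolding Peq[abs_def] by (intro integral_sum[symmetric] iP0)
 also have "\<dots> = (\<integral>z. \<integral>r. P (r, z))"
  using lborel_pair.integral_snd[of "\<lambda>r z. P (r, z)"] iP by (simp add: lborel_prod)
 also have "\<dots> = (\<integral>z. 4 / \<kappa>\<^sup>2 * (gauss z / m * (\<integral>r. rad r * g (x + (\<kappa> * r) *\<^sub>R z)) - gauss z / m * g x))"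
 proof (rule integral_cong[OF refl])
  fix z :: 'a
  let ?\<phi>' = "\<lambda>r. \<kappa> * (Dg (x + (\<kappa> * r) *\<^sub>R z) \<bullet> z)"
  have d: "((\<lambda>r. g (x + (\<kappa> * r) *\<^sub>R z)) has_real_derivative ?\<phi>' r) (at r)" for r
  proof -
   have "((\<lambda>r. g (x + (\<kappa> * r) *\<^sub>R z)) has_derivative (\<lambda>h. ((\<kappa> * h) *\<^sub>R z) \<bullet> Dg (x + (\<kappa> * r) *\<^sub>R z))) (at r)"
    by (rule has_derivative_compose[where g = g, OF _ g[unfolded gderiv_def]]) (auto intro!: derivative_eq_intros)
   then show ?thesis by (simp add: has_field_derivative_def inner_commute mult_commute_abs mult_ac)
  qed
  have "(\<integral>r. P (r, z)) = (\<integral>r. (4 / \<kappa>\<^sup>2 * (gauss z / m)) * (indicator {0<..} r * exp (- r\<^sup>2) * ?\<phi>' r))"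
  proof (rule integral_cong[OF refl])
   fix r :: real
   show "P (r, z) = (4 / \<kappa>\<^sup>2 * (gauss z / m)) * (indicator {0<..} r * exp (- r\<^sup>2) * ?\<phi>' r)"
    using \<kappa> m by (cases "r > 0") (simp_all add: P_def wres_def m_def power2_eq_square mult_ac)
  qed
  also have "\<dots> = (4 / \<kappa>\<^sup>2 * (gauss z / m)) * (- g (x + (\<kappa> * 0) *\<^sub>R z) + (\<integral>r. rad r * g (x + (\<kappa> * r) *\<^sub>R z)))"
  proof (subst half_line_by_parts[OF d, symmetric])
   show "continuous_on UNIV ?\<phi>'" by (intro continuous_intros continuous_on_compose2[OF c]) auto
   show "\<bar>g (x + (\<kappa> * r) *\<^sub>R z)\<bar> \<le> B" for r by (rule B)
   show "\<bar>?\<phi>' r\<bar> \<le> \<kappa> * (L * norm z)" for r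
   proof -
    have "\<bar>Dg (x + (\<kappa> * r) *\<^sub>R z) \<bullet> z\<bar> \<le> L * norm z"
     using Cauchy_Schwarz_ineq2[of "Dg (x + (\<kappa> * r) *\<^sub>R z)" z] mult_right_mono[OF B(2)[of "x + (\<kappa> * r) *\<^sub>R z"], of "norm z"] by simp
    then show ?thesis using \<kappa> by (simp add: abs_mult)
   qed
  qed simp
  finally show "(\<integral>r. P (r, z)) = 4 / \<kappa>\<^sup>2 * (gauss z / m * (\<integral>r. rad r * g (x + (\<kappa> * r) *\<^sub>R z)) - gauss z / m * g x)"
   by (simp add: algebra_simps)
 qed
 also have "\<dots> = 4 / \<kappa>\<^sup>2 * (res \<kappa> g x - g x)"
 proof -
  have ip: "integrable (lborel \<Otimes>\<^sub>M lborel) (\<lambda>(r, z). wres (r, z) * g (x + (\<kappa> * r) *\<^sub>R z))"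
   using res_integrable[OF gm B(1), of x \<kappa>] by (simp add: lborel_prod case_prod_unfold)
  have eq: "(\<integral>r. wres (r, z) * g (x + (\<kappa> * r) *\<^sub>R z)) = gauss z / m * (\<integral>r. rad r * g (x + (\<kappa> * r) *\<^sub>R z))" for z
   unfolding wres_split m_def by (subst integral_mult_right_zero[symmetric]) (simp add: mult_ac)
  have i: "integrable lborel (\<lambda>z. gauss z / m * (\<integral>r. rad r * g (x + (\<kappa> * r) *\<^sub>R z)))"
   using lborel_pair.integrable_snd[OF ip] unfolding eq .
  have "(\<integral>z. gauss z / m * (\<integral>r. rad r * g (x + (\<kappa> * r) *\<^sub>R z))) = res \<kappa> g x"
   using lborel_pair.integral_snd[OF ip] unfolding eq by (simp add: res_def lborel_prod case_prod_unfold)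
  moreover have "(\<integral>z. gauss (z::'a) / m * g x) = g x"
  proof -
   have "(\<integral>z. gauss (z::'a)) = m" by (simp add: m_def gauss_mass_def)
   then show ?thesis using m by simp
  qed
  moreover have i': "integrable lborel (\<lambda>z::'a. gauss z / m * g x)"
   by (intro integrable_mult_left integrable_divide integrable_gauss)
  ultimately show ?thesis using integral_diff[OF i i'] by (simp only: integral_mult_right_zero)
 qed
 finally have "(\<Sum>b\<in>Basis. Dres \<kappa> (\<lambda>x. Dg x \<bullet> b) x \<bullet> b) = 4 / \<kappa>\<^sup>2 * (res \<kappa> g x - g x)" .
 moreover have "\<kappa>\<^sup>2 / 4 * (4 / \<kappa>\<^sup>2 * y) = y" for y using \<kappa> by simp
 ultimately show ?thesis by (simp only: diff_diff_eq2) (simp only: diff_add_eq add_diff_cancel_left' add.commute)?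
qed

text \<open>One derivative falls on \<open>g\<close> and the other on the kernel, so a C^1 function
  with bounded value and gradient already has a C^2 resolvent.\<close>

lemma res_C2:
 fixes g :: "'a::euclidean_space \<Rightarrow> real"
 assumes \<kappa>: "\<kappa> > 0" and g: "\<And>x. GDERIV g x :> Dg x" and c: "continuous_on UNIV Dg"
  and B: "\<And>x. \<bar>g x\<bar> \<le> B" "\<And>x. norm (Dg x) \<le> L"
 shows "C2 (res \<kappa> g) (Dres \<kappa> g) (\<lambda>b. Dres \<kappa> (\<lambda>x. Dg x \<bullet> b))"
  and "res \<kappa> g x - \<kappa>\<^sup>2 / 4 * lap (\<lambda>b. Dres \<kappa> (\<lambda>x. Dg x \<bullet> b)) x = g x"
proof -
 have gm: "g \<in> borel_measurable borel" by (rule borel_measurable_continuous_onI[OF GDERIV_continuous_on[OF g]])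
 show "C2 (res \<kappa> g) (Dres \<kappa> g) (\<lambda>b. Dres \<kappa> (\<lambda>x. Dg x \<bullet> b))"
  unfolding C2_def
 proof (intro conjI ballI allI)
  show "GDERIV (res \<kappa> g) x :> Dres \<kappa> g x" for x by (rule res_GDERIV[OF \<kappa> gm B(1)])
  fix b :: 'a assume b: "b \<in> Basis"
  have cb: "continuous_on UNIV (\<lambda>x. Dg x \<bullet> b)" by (intro continuous_intros c)
  have Db: "\<bar>Dg x \<bullet> b\<bar> \<le> L" for x using Basis_le_norm[OF b, of "Dg x"] B(2)[of x] by linarith
  show "continuous_on UNIV (Dres \<kappa> (\<lambda>x. Dg x \<bullet> b))" by (rule Dres_continuous[OF \<kappa> cb Db])
  have "(\<lambda>x. Dres \<kappa> g x \<bullet> b) = res \<kappa> (\<lambda>x. Dg x \<bullet> b)" by (rule ext) (rule Dres_inner[OF \<kappa> g c B])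
  then show "GDERIV (\<lambda>x. Dres \<kappa> g x \<bullet> b) x :> Dres \<kappa> (\<lambda>x. Dg x \<bullet> b) x" for x
   using res_GDERIV[OF \<kappa> borel_measurable_continuous_onI[OF cb] Db] by simp
 qed
 show "res \<kappa> g x - \<kappa>\<^sup>2 / 4 * lap (\<lambda>b. Dres \<kappa> (\<lambda>x. Dg x \<bullet> b)) x = g x"
  unfolding lap_def by (rule res_equation[OF assms])
qed

section \<open>The nonlinear resolvent\<close>

text \<open>The inverse of \<Phi> on the nonnegative half-line.\<close>

definition \<Psi> :: "real \<Rightarrow> real \<Rightarrow> real" where
 "\<Psi> \<gamma> y = ((\<gamma> + 1) / \<gamma> * y) powr (1 / (\<gamma> + 1))"

lemma \<Psi>_\<Phi>: "\<gamma> > 0 \<Longrightarrow> s \<ge> 0 \<Longrightarrow> \<Psi> \<gamma> (\<Phi> \<gamma> s) = s"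
 by (simp add: \<Psi>_def \<Phi>_def powr_powr)

lemma \<Phi>_\<Psi>:
 assumes "\<gamma> > 0" "y \<ge> 0"
 shows "\<Phi> \<gamma> (\<Psi> \<gamma> y) = y"
proof -
 have "\<gamma> / (\<gamma> + 1) * ((\<gamma> + 1) / \<gamma>) = 1" using assms by simp
 then have "\<gamma> / (\<gamma> + 1) * ((\<gamma> + 1) / \<gamma> * y) = y" by (simp only: mult.assoc[symmetric] mult_1)
 then show ?thesis using assms by (simp add: \<Psi>_def \<Phi>_def powr_powr)
qed

lemma DERIV_\<Phi>:
 assumes "\<gamma> > 0" "s > 0"
 shows "(\<Phi> \<gamma> has_real_derivative \<gamma> * s powr \<gamma>) (at s)"
proof -
 have "(\<Phi> \<gamma> has_real_derivative \<gamma> / (\<gamma> + 1) * ((\<gamma> + 1) * s powr (\<gamma> + 1 - 1))) (at s)"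
  unfolding \<Phi>_def[abs_def] by (intro DERIV_cmult has_real_derivative_powr assms)
 then show ?thesis using assms by simp
qed

lemma \<Phi>_diff_bounds:
 assumes g: "\<gamma> > 0" and d: "0 < d" "d \<le> s" "s \<le> t" "t \<le> M"
 shows "\<gamma> * d powr \<gamma> * (t - s) \<le> \<Phi> \<gamma> t - \<Phi> \<gamma> s" "\<Phi> \<gamma> t - \<Phi> \<gamma> s \<le> \<gamma> * M powr \<gamma> * (t - s)"
proof -
 have "\<exists>z. s \<le> z \<and> z \<le> t \<and> \<Phi> \<gamma> t - \<Phi> \<gamma> s = (t - s) * (\<gamma> * z powr \<gamma>)"
 proof (cases "s = t")
  case False
  then obtain z where "s < z" "z < t" "\<Phi> \<gamma> t - \<Phi> \<gamma> s = (t - s) * (\<gamma> * z powr \<gamma>)"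
   using MVT2[of s t "\<Phi> \<gamma>" "\<lambda>z. \<gamma> * z powr \<gamma>"] DERIV_\<Phi>[OF g] d by auto
  then show ?thesis by (intro exI[of _ z]) auto
 qed auto
 then obtain z where z: "s \<le> z" "z \<le> t" "\<Phi> \<gamma> t - \<Phi> \<gamma> s = (t - s) * (\<gamma> * z powr \<gamma>)" by blast
 have "d powr \<gamma> \<le> z powr \<gamma>" "z powr \<gamma> \<le> M powr \<gamma>" using g d z by (auto intro!: powr_mono2)
 then have "(t - s) * (\<gamma> * d powr \<gamma>) \<le> (t - s) * (\<gamma> * z powr \<gamma>)" "(t - s) * (\<gamma> * z powr \<gamma>) \<le> (t - s) * (\<gamma> * M powr \<gamma>)"
  using g d by (auto intro!: mult_left_mono)
 then show "\<gamma> * d powr \<gamma> * (t - s) \<le> \<Phi> \<gamma> t - \<Phi> \<gamma> s" "\<Phi> \<gamma> t - \<Phi> \<gamma> s \<le> \<gamma> * M powr \<gamma> * (t - s)"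
  unfolding z(3) by (simp_all add: mult_ac)
qed

lemma \<Psi>_mono: "\<gamma> > 0 \<Longrightarrow> 0 \<le> y \<Longrightarrow> y \<le> z \<Longrightarrow> \<Psi> \<gamma> y \<le> \<Psi> \<gamma> z"
 unfolding \<Psi>_def by (intro powr_mono2 mult_left_mono) auto

lemma DERIV_\<Psi>:
 assumes g: "\<gamma> > 0" and y: "y > 0"
 shows "(\<Psi> \<gamma> has_real_derivative \<Psi> \<gamma> y powr (- \<gamma>) / \<gamma>) (at y)"
proof -
 have p: "(\<gamma> + 1) / \<gamma> * y > 0" using g y by simp
 have "(\<Psi> \<gamma> has_real_derivative (1 / (\<gamma> + 1)) * ((\<gamma> + 1) / \<gamma> * y) powr (1 / (\<gamma> + 1) - 1) * ((\<gamma> + 1) / \<gamma>)) (at y)"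
  unfolding \<Psi>_def[abs_def]
  by (rule DERIV_chain2[where f = "\<lambda>z. z powr (1 / (\<gamma> + 1))" and g = "\<lambda>y. (\<gamma> + 1) / \<gamma> * y", OF has_real_derivative_powr[OF p]])
   (use g in \<open>auto intro!: derivative_eq_intros\<close>)
 moreover have "((\<gamma> + 1) / \<gamma> * y) powr (1 / (\<gamma> + 1) - 1) = \<Psi> \<gamma> y powr (- \<gamma>)"
 proof -
  have "1 / (\<gamma> + 1) - 1 = 1 / (\<gamma> + 1) * (- \<gamma>)" using g by (simp add: field_simps)
  then show ?thesis unfolding \<Psi>_def powr_powr by simp
 qed
 moreover have "(1 / (\<gamma> + 1)) * z * ((\<gamma> + 1) / \<gamma>) = z / \<gamma>" for z
 proof -
  have "(\<gamma> + 1) / (\<gamma> + 1) = 1" using g by simp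
  then have "(\<gamma> + 1) / (\<gamma> + 1) * (z / \<gamma>) = z / \<gamma>" by (simp only: mult_1)
  then show ?thesis by (simp only: times_divide_eq_left times_divide_eq_right divide_divide_eq_left mult_1 mult.commute)
 qed
 ultimately show ?thesis by (simp only:)
qed

text \<open>Monotone iteration from the constant subsolution; \<open>K\<close> dominates the slope of \<open>\<Psi>\<close> on the range.\<close>

lemma resolvent_fixed_point:
 fixes f :: "'a::euclidean_space \<Rightarrow> real"
 assumes g: "\<gamma> > 0" and d: "0 < d" and f: "\<And>x. d \<le> f x" "\<And>x. f x \<le> M"
  and fi: "integrable lborel (\<lambda>x. f x - d)"
 defines "K \<equiv> 1 / (\<gamma> * d powr \<gamma>)"
 obtains P where "P \<in> borel_measurable borel" "\<And>x. \<Phi> \<gamma> d \<le> P x" "\<And>x. P x \<le> \<Phi> \<gamma> M"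
  "\<And>x. P x = res \<kappa> (\<lambda>x. P x + (f x - \<Psi> \<gamma> (P x)) / K) x"
  "integrable lborel (\<lambda>x. P x - \<Phi> \<gamma> d)"
proof -
 have K: "K > 0" unfolding K_def using g d by simp
 have dM: "d \<le> M" using f[of 0] by linarith
 have fm[measurable]: "f \<in> borel_measurable borel"
 proof -
  have "(\<lambda>x. (f x - d) + d) \<in> borel_measurable borel" using borel_measurable_integrable[OF fi] by (intro borel_measurable_add) auto
  then show ?thesis by simp
 qed
 \<comment> \<open>Increasing in \<open>p\<close>: on the range in question the slope of the term
   \<open>- \<Psi> \<gamma> p / K\<close> is at least -1, because \<open>K\<close> dominates the
   slope of \<Psi>. The constants \<open>\<Phi> \<gamma> d\<close> and
   \<open>\<Phi> \<gamma> M\<close> are a sub- and a supersolution.\<close>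
 define \<Theta> where "\<Theta> p y = p + (y - \<Psi> \<gamma> p) / K" for p y
 have \<Psi>m[measurable]: "\<Psi> \<gamma> \<in> borel_measurable borel" unfolding \<Psi>_def[abs_def] by measurable
 have \<Psi>b: "d \<le> \<Psi> \<gamma> p" "\<Psi> \<gamma> p \<le> M" if "\<Phi> \<gamma> d \<le> p" "p \<le> \<Phi> \<gamma> M" for p
  using \<Psi>_mono[OF g \<Phi>_nonneg[OF g] that(1)] \<Psi>_mono[OF g _ that(2)] \<Psi>_\<Phi>[OF g, of d] \<Psi>_\<Phi>[OF g, of M] d dM \<Phi>_nonneg[OF g, of d] that
  by auto
 have \<Psi>d: "(\<Psi> \<gamma> p' - \<Psi> \<gamma> p) / K \<le> p' - p" "(p' - p) / (\<gamma> * M powr \<gamma>) \<le> \<Psi> \<gamma> p' - \<Psi> \<gamma> p"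
  if "\<Phi> \<gamma> d \<le> p" "p \<le> p'" "p' \<le> \<Phi> \<gamma> M" for p p'
 proof -
  have p0: "0 \<le> p" "0 \<le> p'" using that \<Phi>_nonneg[OF g, of d] by auto
  have *: "0 < d" "d \<le> \<Psi> \<gamma> p" "\<Psi> \<gamma> p \<le> \<Psi> \<gamma> p'" "\<Psi> \<gamma> p' \<le> M" using \<Psi>b[of p] \<Psi>b[of p'] \<Psi>_mono[OF g p0(1) that(2)] that d by auto
  show "(\<Psi> \<gamma> p' - \<Psi> \<gamma> p) / K \<le> p' - p"
   using \<Phi>_diff_bounds(1)[OF g *] unfolding \<Phi>_\<Psi>[OF g p0(1)] \<Phi>_\<Psi>[OF g p0(2)] K_def by (simp add: mult_ac)
  have "\<gamma> * M powr \<gamma> > 0" using g d dM by simp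
  then show "(p' - p) / (\<gamma> * M powr \<gamma>) \<le> \<Psi> \<gamma> p' - \<Psi> \<gamma> p"
   using \<Phi>_diff_bounds(2)[OF g *] unfolding \<Phi>_\<Psi>[OF g p0(1)] \<Phi>_\<Psi>[OF g p0(2)]
   by (simp only: pos_divide_le_eq mult.commute)
 qed
 have \<Theta>_mono: "\<Theta> p y \<le> \<Theta> p' y" if "\<Phi> \<gamma> d \<le> p" "p \<le> p'" "p' \<le> \<Phi> \<gamma> M" for p p' y
  using \<Psi>d(1)[OF that] unfolding \<Theta>_def by (simp add: diff_divide_distrib)
 have \<Theta>_range: "\<Phi> \<gamma> d \<le> \<Theta> p y" "\<Theta> p y \<le> \<Phi> \<gamma> M" if "\<Phi> \<gamma> d \<le> p" "p \<le> \<Phi> \<gamma> M" "d \<le> y" "y \<le> M" for p y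
 proof -
  have "\<Phi> \<gamma> d \<le> \<Theta> (\<Phi> \<gamma> d) y" unfolding \<Theta>_def using that K d by (simp add: \<Psi>_\<Phi>[OF g])
  also have "\<dots> \<le> \<Theta> p y" by (rule \<Theta>_mono) (use that in auto)
  finally show "\<Phi> \<gamma> d \<le> \<Theta> p y" .
  have "\<Theta> p y \<le> \<Theta> (\<Phi> \<gamma> M) y" by (rule \<Theta>_mono) (use that in auto)
  also have "\<dots> \<le> \<Phi> \<gamma> M" unfolding \<Theta>_def using that K d dM by (simp add: \<Psi>_\<Phi>[OF g] divide_nonpos_pos)
  finally show "\<Theta> p y \<le> \<Phi> \<gamma> M" .
 qed
 define B where "B = \<Phi> \<gamma> M"
 have Bb: "\<bar>y\<bar> \<le> B" if "\<Phi> \<gamma> d \<le> y" "y \<le> \<Phi> \<gamma> M" for y using that \<Phi>_nonneg[OF g, of d] by (simp add: B_def)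
 define Q where "Q = rec_nat (\<lambda>x. \<Phi> \<gamma> d) (\<lambda>_ q. res \<kappa> (\<lambda>x. \<Theta> (q x) (f x)))"
 have Q0: "Q 0 = (\<lambda>x. \<Phi> \<gamma> d)" and QS: "Q (Suc k) = res \<kappa> (\<lambda>x. \<Theta> (Q k x) (f x))" for k
  by (simp_all add: Q_def)
 have Qall: "Q k \<in> borel_measurable borel \<and> (\<forall>x. \<Phi> \<gamma> d \<le> Q k x \<and> Q k x \<le> \<Phi> \<gamma> M)" for k
 proof (induction k)
  case 0
  then show ?case using \<Phi>_mono[OF g _ dM] d by (simp add: Q0)
 next
  case (Suc k)
  then have [measurable]: "Q k \<in> borel_measurable borel" by blast
  have m: "(\<lambda>x. \<Theta> (Q k x) (f x)) \<in> borel_measurable borel" unfolding \<Theta>_def by measurable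
  have r: "\<Phi> \<gamma> d \<le> \<Theta> (Q k x) (f x)" "\<Theta> (Q k x) (f x) \<le> \<Phi> \<gamma> M" for x using Suc f by (auto intro!: \<Theta>_range)
  have "res \<kappa> (\<lambda>x. \<Theta> (Q k x) (f x)) \<in> borel_measurable borel"
  proof -
   have "(\<lambda>(x, y). wres y * \<Theta> (Q k (shift \<kappa> x y)) (f (shift \<kappa> x y))) \<in> borel_measurable (borel \<Otimes>\<^sub>M lborel)"
   proof -
    have [measurable]: "wres \<in> borel_measurable (borel \<Otimes>\<^sub>M borel)" using borel_wres by (simp add: borel_prod)
    have "(\<lambda>(x, y). wres y * \<Theta> (Q k (shift \<kappa> x y)) (f (shift \<kappa> x y))) \<in> borel_measurable (borel \<Otimes>\<^sub>M (borel \<Otimes>\<^sub>M borel))"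
     unfolding \<Theta>_def by measurable
    moreover have "sets (borel \<Otimes>\<^sub>M (lborel :: (real \<times> 'a) measure)) = sets (borel \<Otimes>\<^sub>M (borel \<Otimes>\<^sub>M borel) :: ('a \<times> real \<times> 'a) measure)"
     by (intro sets_pair_measure_cong refl) (simp only: sets_lborel borel_prod)
    ultimately show ?thesis by (subst measurable_cong_sets[OF _ refl])
   qed
   then show ?thesis unfolding res_def[abs_def] by (rule lborel.borel_measurable_lebesgue_integral)
  qed
  then show ?case using res_bounds[OF m r] by (simp add: QS)
 qed
 have Qm[measurable]: "Q k \<in> borel_measurable borel" and Qr: "\<Phi> \<gamma> d \<le> Q k x" "Q k x \<le> \<Phi> \<gamma> M" for k x
  using Qall by auto
 have Tm: "(\<lambda>x. \<Theta> (Q k x) (f x)) \<in> borel_measurable borel" for k unfolding \<Theta>_def by measurable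
 have Tb: "\<bar>\<Theta> (Q k x) (f x)\<bar> \<le> B" for k x by (intro Bb \<Theta>_range Qr f)
 have inc: "Q k x \<le> Q (Suc k) x" for k x
 proof (induction k arbitrary: x)
  case 0
  then show ?case using Qr[where k = 1] by (simp add: Q0)
 next
  case (Suc k)
  have "res \<kappa> (\<lambda>x. \<Theta> (Q k x) (f x)) x \<le> res \<kappa> (\<lambda>x. \<Theta> (Q (Suc k) x) (f x)) x"
   by (rule res_mono[OF Tm Tb Tm Tb]) (rule \<Theta>_mono[OF Qr(1) Suc.IH Qr(2)])
  then show ?case by (simp only: QS)
 qed
 define P where "P x = (SUP k. Q k x)" for x
 have bdd: "bdd_above (range (\<lambda>k. Q k x))" for x using Qr(2) by (intro bdd_aboveI2)
 have lim: "(\<lambda>k. Q k x) \<longlonglongrightarrow> P x" for x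
  unfolding P_def by (rule LIMSEQ_incseq_SUP[OF bdd]) (rule incseq_SucI, rule inc)
 have Pm: "P \<in> borel_measurable borel" by (rule borel_measurable_LIMSEQ_real[OF lim Qm])
 have Pr: "\<Phi> \<gamma> d \<le> P x" "P x \<le> \<Phi> \<gamma> M" for x
  using LIMSEQ_le_const[OF lim] LIMSEQ_le_const2[OF lim] Qr by blast+
 have QP: "Q k x \<le> P x" for k x unfolding P_def by (rule cSUP_upper[OF UNIV_I bdd])
 have \<Theta>lim: "(\<lambda>k. \<Theta> (Q k x) y) \<longlonglongrightarrow> \<Theta> (P x) y" for x y
 proof -
  have "P x > 0" using Pr(1)[of x] g d by (smt (verit) \<Phi>_def divide_pos_pos mult_pos_pos powr_gt_zero)
  then have "isCont (\<Psi> \<gamma>) (P x)" using DERIV_\<Psi>[OF g] DERIV_isCont by blast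
  then show ?thesis unfolding \<Theta>_def using K by (intro tendsto_intros lim isCont_tendsto_compose[of _ "\<Psi> \<gamma>"]) auto
 qed
 have fixp: "P x = res \<kappa> (\<lambda>x. \<Theta> (P x) (f x)) x" for x
 proof -
  have [measurable]: "P \<in> borel_measurable borel" by (rule Pm)
  have "(\<lambda>k. res \<kappa> (\<lambda>x. \<Theta> (Q k x) (f x)) x) \<longlonglongrightarrow> res \<kappa> (\<lambda>x. \<Theta> (P x) (f x)) x"
   unfolding res_def
  proof (rule integral_dominated_convergence[where w = "\<lambda>y. B * wres y"])
   have TP: "(\<lambda>x. \<Theta> (P x) (f x)) \<in> borel_measurable borel" unfolding \<Theta>_def by measurable
   have "\<bar>\<Theta> (P x) (f x)\<bar> \<le> B" for x by (intro Bb \<Theta>_range Pr f)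
   from borel_measurable_integrable[OF res_integrable[OF TP this]]
   show "(\<lambda>y. wres y * \<Theta> (P (shift \<kappa> x y)) (f (shift \<kappa> x y))) \<in> borel_measurable lborel" .
   show "(\<lambda>y. wres y * \<Theta> (Q k (shift \<kappa> x y)) (f (shift \<kappa> x y))) \<in> borel_measurable lborel" for k
    by (rule borel_measurable_integrable[OF res_integrable[OF Tm Tb]])
   show "integrable lborel (\<lambda>y :: real \<times> 'a. B * wres y)" by (intro integrable_mult_right wres_integral)
   show "AE y in lborel. (\<lambda>k. wres y * \<Theta> (Q k (shift \<kappa> x y)) (f (shift \<kappa> x y)))
     \<longlonglongrightarrow> wres y * \<Theta> (P (shift \<kappa> x y)) (f (shift \<kappa> x y))"
    by (intro AE_I2 tendsto_mult tendsto_const \<Theta>lim)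
   show "AE y in lborel. norm (wres y * \<Theta> (Q k (shift \<kappa> x y)) (f (shift \<kappa> x y))) \<le> B * wres y" for k
   proof (intro AE_I2)
    fix y :: "real \<times> 'a"
    have "\<bar>wres y\<bar> * \<bar>\<Theta> (Q k (shift \<kappa> x y)) (f (shift \<kappa> x y))\<bar> \<le> wres y * B"
     using wres_nonneg[of y] Tb by (intro mult_mono) auto
    then show "norm (wres y * \<Theta> (Q k (shift \<kappa> x y)) (f (shift \<kappa> x y))) \<le> B * wres y"
     by (simp add: abs_mult mult.commute)
   qed
  qed
  then have "(\<lambda>k. Q (Suc k) x) \<longlonglongrightarrow> res \<kappa> (\<lambda>x. \<Theta> (P x) (f x)) x" by (simp add: QS)
  then show ?thesis by (rule LIMSEQ_unique[OF LIMSEQ_Suc[OF lim]])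
 qed
 \<comment> \<open>A lower bound for the slope of \<Psi> on the range. It makes the excess mass obey
   an affine recursion with factor \<open>1 - k0 / K < 1\<close>, whose fixed point
   \<open>I / k0\<close> bounds all iterates and gives integrability in the limit.\<close>
 define k0 where "k0 = 1 / (\<gamma> * M powr \<gamma>)"
 have k0: "k0 > 0" unfolding k0_def using g d dM by simp
 define I where "I = (\<integral>x. f x - d)"
 have Qi: "integrable lborel (\<lambda>x. Q k x - \<Phi> \<gamma> d) \<and> (\<integral>x. Q k x - \<Phi> \<gamma> d) \<le> I / k0" for k
 proof (induction k)
  case 0
  have "I \<ge> 0" unfolding I_def using f by (intro integral_nonneg) auto
  then show ?case using k0 by (simp add: Q0)
 next
  case (Suc k)
  define G where "G x = \<Theta> (Q k x) (f x) - \<Phi> \<gamma> d" for x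
  have G1: "0 \<le> G x" "\<bar>G x\<bar> \<le> B" for x
   using \<Theta>_range[OF Qr[of k x] f(1)[of x] f(2)[of x]] \<Phi>_nonneg[OF g, of d] unfolding G_def B_def by auto
  have G2: "G x \<le> (f x - d) / K + (1 - k0 / K) * (Q k x - \<Phi> \<gamma> d)" for x
  proof -
   have "(Q k x - \<Phi> \<gamma> d) * k0 \<le> \<Psi> \<gamma> (Q k x) - d"
    using \<Psi>d(2)[OF order_refl Qr[of k x]] d unfolding \<Psi>_\<Phi>[OF g less_imp_le[OF d]] k0_def by simp
   then have "(Q k x - \<Phi> \<gamma> d) * k0 / K \<le> (\<Psi> \<gamma> (Q k x) - d) / K" using K by (intro divide_right_mono) auto
   then show ?thesis unfolding G_def \<Theta>_def by (simp add: field_simps add_divide_distrib diff_divide_distrib)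
  qed
  have i: "integrable lborel (\<lambda>x. (f x - d) / K + (1 - k0 / K) * (Q k x - \<Phi> \<gamma> d))"
   using fi Suc by (intro Bochner_Integration.integrable_add integrable_mult_right integrable_divide) auto
  have Gm: "G \<in> borel_measurable borel" unfolding G_def[abs_def] using Tm[of k] by simp
  have iG: "integrable lborel G"
   by (rule integrable_bound[OF i])
    (use Gm G1(1) G2 in \<open>auto intro!: AE_I2 order_trans[OF G2] abs_ge_self\<close>)
  have eq: "Q (Suc k) x - \<Phi> \<gamma> d = res \<kappa> G x" for x
  proof -
   have "res \<kappa> G x = (\<integral>y. wres y * \<Theta> (Q k (shift \<kappa> x y)) (f (shift \<kappa> x y)) - wres y * \<Phi> \<gamma> d)"
    unfolding res_def G_def by (simp add: right_diff_distrib)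
   also have "\<dots> = res \<kappa> (\<lambda>x. \<Theta> (Q k x) (f x)) x - \<Phi> \<gamma> d"
    unfolding res_def using res_integrable[OF Tm Tb, of k x \<kappa>] wres_integral[where 'a = 'a]
    by (subst integral_diff) auto
   finally show ?thesis by (simp add: QS)
  qed
  have "(\<integral>x. Q (Suc k) x - \<Phi> \<gamma> d) = (\<integral>x. G x)"
   unfolding eq by (rule res_integral(2)[OF iG G1(2)])
  also have "\<dots> \<le> (\<integral>x. (f x - d) / K + (1 - k0 / K) * (Q k x - \<Phi> \<gamma> d))"
   by (rule integral_mono[OF iG i G2])
  also have "\<dots> = I / K + (1 - k0 / K) * (\<integral>x. Q k x - \<Phi> \<gamma> d)"
   using fi Suc unfolding I_def
   by (subst Bochner_Integration.integral_add) (auto intro: integrable_mult_right integrable_divide)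
  also have "\<dots> \<le> I / K + (1 - k0 / K) * (I / k0)"
  proof (intro add_left_mono mult_left_mono)
   show "0 \<le> 1 - k0 / K"
   proof -
    have "d powr \<gamma> \<le> M powr \<gamma>" using g d dM by (intro powr_mono2) auto
    then have "k0 \<le> K" unfolding k0_def K_def using g d dM by (simp add: frac_le)
    then show ?thesis using K by simp
   qed
  qed (use Suc in auto)
  also have "\<dots> = I / k0" using k0 K by (simp add: field_simps)
  finally show ?case unfolding eq[abs_def] using res_integral(1)[OF iG G1(2)] eq by simp
 qed
 have Pi: "integrable lborel (\<lambda>x. P x - \<Phi> \<gamma> d)"
 proof -
  have L: "convergent (\<lambda>k. \<integral>x. Q k x - \<Phi> \<gamma> d)"
  proof (rule Bseq_monoseq_convergent)
   have "0 \<le> (\<integral>x. Q k x - \<Phi> \<gamma> d)" for k using Qr by (intro integral_nonneg) auto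
   then show "Bseq (\<lambda>k. \<integral>x. Q k x - \<Phi> \<gamma> d)" using Qi by (intro BseqI'[of _ "I / k0"]) auto
   show "monoseq (\<lambda>k. \<integral>x. Q k x - \<Phi> \<gamma> d)"
    using Qi lift_Suc_mono_le[of "\<lambda>k. Q k _", OF inc]
    by (intro monoI1 allI impI integral_mono) auto
  qed
  then obtain l where l: "(\<lambda>k. \<integral>x. Q k x - \<Phi> \<gamma> d) \<longlonglongrightarrow> l" unfolding convergent_def by blast
  show ?thesis
  proof (rule integrable_monotone_convergence[where f = "\<lambda>k x. Q k x - \<Phi> \<gamma> d"])
   show "AE x in lborel. mono (\<lambda>k. Q k x - \<Phi> \<gamma> d)"
    using inc by (intro AE_I2 incseq_SucI) auto
   show "AE x in lborel. (\<lambda>k. Q k x - \<Phi> \<gamma> d) \<longlonglongrightarrow> P x - \<Phi> \<gamma> d" by (intro AE_I2 tendsto_diff lim tendsto_const)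
  qed (use Qi l Pm in auto)
 qed
 show ?thesis by (rule that[OF Pm Pr fixp[unfolded \<Theta>_def] Pi])
qed

lemma GDERIV_cmult: "GDERIV f x :> D \<Longrightarrow> GDERIV (\<lambda>x. c * f x) x :> c *\<^sub>R D"
 using GDERIV_mult[OF GDERIV_const, of f x D c] by simp

text \<open>In terms of \<open>P = \<Phi> \<gamma> (v x)\<close> the Euler step is
  \<open>P - (h / K) \<Delta>P = P + (f - \<Psi> P) / K\<close>, a fixed point equation for the
  linear resolvent. The lower bound \<open>d > 0\<close> keeps \<Psi> smooth on the range. The last
  conclusion expands the Laplacian of the potential in terms of \<open>v\<close>, the form in which
  the maximum principle uses it.\<close>

theorem resolvent_exists:
 fixes f :: "'a::euclidean_space \<Rightarrow> real"
 assumes g: "\<gamma> > 0" and h: "h > 0" and d: "0 < d" and f: "\<And>x. d \<le> f x" "\<And>x. f x \<le> M"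
  and fi: "integrable lborel (\<lambda>x. f x - d)"
  and Df: "\<And>x. GDERIV f x :> Df x" "continuous_on UNIV Df" "\<And>x. norm (Df x) \<le> L"
 obtains v Dv Hv DV HV L' where "C2 v Dv Hv" "C2 (\<lambda>x. \<Phi> \<gamma> (v x)) DV HV" "\<And>x. d \<le> v x" "\<And>x. v x \<le> M"
  "integrable lborel (\<lambda>x. v x - d)" "(\<integral>x. v x - d) = (\<integral>x. f x - d)" "\<And>x. norm (Dv x) \<le> L'"
  "\<And>x. v x - h * lap HV x = f x"
  "\<And>x. lap HV x = \<gamma> * v x powr \<gamma> * lap Hv x + \<gamma>\<^sup>2 * v x powr (\<gamma> - 1) * (Dv x \<bullet> Dv x)"
proof -
 define K where "K = 1 / (\<gamma> * d powr \<gamma>)"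
 have K: "K > 0" unfolding K_def using g d by simp
 \<comment> \<open>Chosen so that \<open>\<kappa>\<^sup>2 / 4 = h / K\<close>.\<close>
 define \<kappa> where "\<kappa> = 2 * sqrt (h / K)"
 have \<kappa>: "\<kappa> > 0" "\<kappa>\<^sup>2 / 4 = h / K" unfolding \<kappa>_def using h K by (auto simp: power_mult_distrib)
 have dM: "d \<le> M" using f[of 0] by linarith
 obtain P where Pm[measurable]: "P \<in> borel_measurable borel" and P: "\<And>x. \<Phi> \<gamma> d \<le> P x" "\<And>x. P x \<le> \<Phi> \<gamma> M"
  and fixp: "\<And>x. P x = res \<kappa> (\<lambda>x. P x + (f x - \<Psi> \<gamma> (P x)) / K) x"
  and Pi: "integrable lborel (\<lambda>x. P x - \<Phi> \<gamma> d)"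
  by (rule resolvent_fixed_point[OF g d f fi, folded K_def]) blast
 define v where "v x = \<Psi> \<gamma> (P x)" for x
 have \<Phi>d: "\<Phi> \<gamma> d > 0" unfolding \<Phi>_def using g d by simp
 have P0: "P x > 0" for x using P(1)[of x] \<Phi>d by linarith
 have V: "\<Phi> \<gamma> (v x) = P x" for x unfolding v_def using P0[of x] by (simp add: \<Phi>_\<Psi>[OF g])
 have v: "d \<le> v x" "v x \<le> M" for x
  using \<Psi>_mono[OF g _ P(1)[of x]] \<Psi>_mono[OF g _ P(2)[of x]] \<Psi>_\<Phi>[OF g, of d] \<Psi>_\<Phi>[OF g, of M] d dM \<Phi>d P0[of x]
  by (auto simp: v_def)
 have v0: "v x > 0" for x using v(1)[of x] d by linarith
 define G where "G x = P x + (f x - v x) / K" for x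
 have P_res: "P = res \<kappa> G" by (rule ext) (simp add: G_def[abs_def] v_def fixp[symmetric])
 have cf: "continuous_on UNIV f" by (rule GDERIV_continuous_on[OF Df(1)])
 have [measurable]: "\<Psi> \<gamma> \<in> borel_measurable borel" unfolding \<Psi>_def[abs_def] by measurable
 have fm[measurable]: "f \<in> borel_measurable borel" by (rule borel_measurable_continuous_onI[OF cf])
 have Gm: "G \<in> borel_measurable borel" unfolding G_def[abs_def] v_def by measurable
 define BG where "BG = \<Phi> \<gamma> M + 2 * M / K"
 have GB: "\<bar>G x\<bar> \<le> BG" for x
 proof -
  have "\<bar>(f x - v x) / K\<bar> \<le> 2 * M / K" using f[of x] v[of x] d K by (simp add: divide_right_mono abs_le_iff)
  moreover have "\<bar>P x\<bar> \<le> \<Phi> \<gamma> M" using P(2)[of x] P0[of x] by simp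
  ultimately show ?thesis unfolding G_def BG_def by linarith
 qed
 \<comment> \<open>Bootstrap: \<open>G\<close> is bounded and measurable, so \<open>P\<close> is
   differentiable; hence \<open>v\<close> and \<open>G\<close> are continuous and so is
   \<open>DP\<close>; hence \<open>v\<close> and \<open>G\<close> are C^1, and \<open>res_C2\<close>
   makes \<open>P\<close> C^2.\<close>
 define DP where "DP = Dres \<kappa> G"
 have gP: "GDERIV P x :> DP x" for x unfolding P_res DP_def by (rule res_GDERIV[OF \<kappa>(1) Gm GB])
 define LP where "LP = (4 * BG / (\<kappa> * gauss_mass TYPE('a))) * (\<integral>y. wder (y :: real \<times> 'a))"
 have LP: "norm (DP x) \<le> LP" for x unfolding DP_def LP_def by (rule Dres_bound[OF \<kappa>(1) Gm GB])
 have cP: "continuous_on UNIV P" by (rule GDERIV_continuous_on[OF gP])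
 have gv: "GDERIV v x :> (v x powr (- \<gamma>) / \<gamma>) *\<^sub>R DP x" for x
  unfolding v_def[abs_def] by (rule GDERIV_DERIV_compose[OF gP DERIV_\<Psi>[OF g P0]])
 have cv: "continuous_on UNIV v" by (rule GDERIV_continuous_on[OF gv])
 have cG: "continuous_on UNIV G" unfolding G_def[abs_def] using K by (intro continuous_intros cP cf cv) auto
 have cDP: "continuous_on UNIV DP" unfolding DP_def by (rule Dres_continuous[OF \<kappa>(1) cG GB])
 have cpow: "continuous_on UNIV (\<lambda>x. v x powr r)" for r
 proof (intro continuous_on_powr cv continuous_on_const ballI)
  show "v x \<noteq> 0" for x using v0[of x] by simp
 qed
 define Dv where "Dv x = (v x powr (- \<gamma>) / \<gamma>) *\<^sub>R DP x" for x
 have cDv: "continuous_on UNIV Dv" unfolding Dv_def[abs_def] using g by (intro continuous_intros cpow cDP) auto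
 define L' where "L' = d powr (- \<gamma>) / \<gamma> * LP"
 have L': "norm (Dv x) \<le> L'" for x
 proof -
  have "v x powr (- \<gamma>) \<le> d powr (- \<gamma>)" using g d v(1) by (intro powr_mono2') auto
  then have "v x powr (- \<gamma>) / \<gamma> \<le> d powr (- \<gamma>) / \<gamma>" using g by (intro divide_right_mono) auto
  then have "\<bar>v x powr (- \<gamma>) / \<gamma>\<bar> * norm (DP x) \<le> (d powr (- \<gamma>) / \<gamma>) * LP"
   using g LP[of x] by (intro mult_mono) auto
  then show ?thesis unfolding Dv_def L'_def by simp
 qed
 define DG where "DG x = DP x + (1 / K) *\<^sub>R (Df x - Dv x)" for x
 have gG: "GDERIV G x :> DG x" for x
 proof -
  have "GDERIV (\<lambda>x. P x + (1 / K) * (f x - v x)) x :> DP x + (1 / K) *\<^sub>R (Df x - Dv x)"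
   unfolding Dv_def by (intro GDERIV_add GDERIV_cmult GDERIV_diff gP Df gv)
  then show ?thesis by (simp add: G_def[abs_def] DG_def)
 qed
 have cDG: "continuous_on UNIV DG" unfolding DG_def[abs_def] by (intro continuous_intros cDP Df cDv)
 have LG: "norm (DG x) \<le> LP + 1 / K * (L + L')" for x
 proof -
  have "norm ((1 / K) *\<^sub>R (Df x - Dv x)) \<le> 1 / K * (L + L')"
   using norm_triangle_ineq4[of "Df x" "Dv x"] Df(3)[of x] L'[of x] K by (simp add: divide_right_mono)
  then show ?thesis unfolding DG_def using norm_triangle_ineq[of "DP x" "(1 / K) *\<^sub>R (Df x - Dv x)"] LP[of x] by linarith
 qed
 define HP where "HP b = Dres \<kappa> (\<lambda>x. DG x \<bullet> b)" for b
 have C2P: "C2 P DP HP" and eqP: "P x - \<kappa>\<^sup>2 / 4 * lap HP x = G x" for x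
  using res_C2[OF \<kappa>(1) gG cDG GB LG] unfolding P_res[symmetric] DP_def[symmetric] HP_def by auto
 have C2V: "C2 (\<lambda>x. \<Phi> \<gamma> (v x)) DP HP" unfolding V using C2P by simp
 have eq: "v x - h * lap HP x = f x" for x
 proof -
  have "h / K * lap HP x = (v x - f x) / K" using eqP[of x] \<kappa>(2) unfolding G_def by (simp add: diff_divide_distrib)
  then show ?thesis using K by (simp add: field_simps)
 qed
 define Hv where "Hv b x = (v x powr (- \<gamma>) / \<gamma>) *\<^sub>R HP b x + (DP x \<bullet> b) *\<^sub>R ((- (v x powr (- \<gamma> - 1))) *\<^sub>R Dv x)" for b x
 have C2v: "C2 v Dv Hv"
  unfolding C2_def
 proof (intro conjI ballI allI)
  show "GDERIV v x :> Dv x" for x unfolding Dv_def by (rule gv)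
  fix b :: 'a assume b: "b \<in> Basis"
  show "continuous_on UNIV (Hv b)" unfolding Hv_def[abs_def] using g
   by (intro continuous_intros cpow cDv cDP C2_cont2[OF C2P b]) auto
  show "GDERIV (\<lambda>x. Dv x \<bullet> b) x :> Hv b x" for x
  proof -
   have gv': "GDERIV v x :> Dv x" unfolding Dv_def by (rule gv)
   have "((\<lambda>y. y powr (- \<gamma>) / \<gamma>) has_real_derivative - (v x powr (- \<gamma> - 1))) (at (v x))"
    using DERIV_cdivide[OF has_real_derivative_powr[of "v x" "- \<gamma>", OF v0], of \<gamma>] g by simp
   from GDERIV_mult[OF GDERIV_DERIV_compose[OF gv' this] C2_GDERIV2[OF C2P b]]
   show ?thesis unfolding Dv_def Hv_def by (simp add: mult.commute)
  qed
 qed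
 have lapeq: "lap HP x = \<gamma> * v x powr \<gamma> * lap Hv x + \<gamma>\<^sup>2 * v x powr (\<gamma> - 1) * (Dv x \<bullet> Dv x)" for x
 proof -
  have p1: "v x powr \<gamma> * v x powr (- \<gamma>) = 1" using v0[of x] by (simp flip: powr_add)
  have p2: "v x powr \<gamma> * v x powr (- \<gamma> - 1) = v x powr (-1)" "v x powr (\<gamma> - 1) = v x powr \<gamma> * v x powr (-1)"
   by (subst powr_add[symmetric], simp)+
  have DPv: "DP x = (\<gamma> * v x powr \<gamma>) *\<^sub>R Dv x"
  proof -
   have "\<gamma> * v x powr \<gamma> * (v x powr (- \<gamma>) / \<gamma>) = 1" using p1 g by simp
   then show ?thesis unfolding Dv_def by simp
  qed
  have "lap Hv x = (v x powr (- \<gamma>) / \<gamma>) * lap HP x - v x powr (- \<gamma> - 1) * (\<Sum>b\<in>Basis. (DP x \<bullet> b) * (Dv x \<bullet> b))"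
   unfolding lap_def Hv_def by (simp add: inner_add_left inner_diff_left sum.distrib sum_subtractf sum_distrib_left mult_ac)
  also have "(\<Sum>b\<in>Basis. (DP x \<bullet> b) * (Dv x \<bullet> b)) = (\<gamma> * v x powr \<gamma>) * (Dv x \<bullet> Dv x)"
   unfolding euclidean_inner[of "DP x" "Dv x", symmetric] unfolding DPv by simp
  finally have "\<gamma> * v x powr \<gamma> * lap Hv x = (v x powr \<gamma> * v x powr (- \<gamma>)) * lap HP x
    - \<gamma>\<^sup>2 * (v x powr \<gamma> * (v x powr \<gamma> * v x powr (- \<gamma> - 1))) * (Dv x \<bullet> Dv x)"
   using g by (simp add: right_diff_distrib power2_eq_square mult_ac)
  then show ?thesis unfolding p1 p2 by simp
 qed
 have vi: "integrable lborel (\<lambda>x. v x - d)"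
 proof (rule integrable_bound[where f = "\<lambda>x. K * (P x - \<Phi> \<gamma> d)"])
  show "AE x in lborel. norm (v x - d) \<le> norm (K * (P x - \<Phi> \<gamma> d))"
  proof (intro AE_I2)
   fix x
   have "\<gamma> * d powr \<gamma> * (v x - d) \<le> P x - \<Phi> \<gamma> d"
    using \<Phi>_diff_bounds(1)[OF g d order_refl v(1)[of x] v(2)] V[of x] by simp
   then have "v x - d \<le> K * (P x - \<Phi> \<gamma> d)" unfolding K_def using g d by (simp add: field_simps)
   then show "norm (v x - d) \<le> norm (K * (P x - \<Phi> \<gamma> d))" using v(1)[of x] P(1)[of x] K by (simp add: abs_mult)
  qed
  show "(\<lambda>x. v x - d) \<in> borel_measurable lborel" using borel_measurable_continuous_onI[OF cv] by simp
 qed (use Pi in simp)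
 have "(\<integral>x. v x - d) = (\<integral>x. f x - d)"
 proof -
  \<comment> \<open>Subtracting the constants makes all terms integrable. Since the resolvent
    preserves mass, the integral of \<open>P - \<Phi> \<gamma> d\<close> cancels and the masses of
    \<open>f - d\<close> and \<open>v - d\<close> agree.\<close>
  define G0 where "G0 x = (P x - \<Phi> \<gamma> d) + ((f x - d) - (v x - d)) / K" for x
  have G0i: "integrable lborel G0" unfolding G0_def[abs_def]
   by (intro Bochner_Integration.integrable_add integrable_divide integrable_diff Pi fi vi)
  have G0G: "G0 x = G x - \<Phi> \<gamma> d" for x unfolding G0_def G_def by simp
  have G0b: "\<bar>G0 x\<bar> \<le> BG + \<Phi> \<gamma> d" for x using GB[of x] \<Phi>d unfolding G0G by linarith
  have "res \<kappa> G0 x = P x - \<Phi> \<gamma> d" for x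
  proof -
   have "res \<kappa> G0 x = (\<integral>y. wres y * G (shift \<kappa> x y) - wres y * \<Phi> \<gamma> d)"
    unfolding res_def G0G by (simp add: right_diff_distrib)
   also have "\<dots> = res \<kappa> G x - \<Phi> \<gamma> d"
    unfolding res_def using res_integrable[OF Gm GB, of x \<kappa>] wres_integral[where 'a = 'a]
    by (subst integral_diff) auto
   finally show ?thesis by (simp add: P_res)
  qed
  then have "(\<integral>x. P x - \<Phi> \<gamma> d) = (\<integral>x. G0 x)"
   using res_integral(2)[OF G0i G0b, of \<kappa>] by simp
  also have "\<dots> = (\<integral>x. P x - \<Phi> \<gamma> d) + ((\<integral>x. f x - d) - (\<integral>x. v x - d)) / K"
  proof -
   have i1: "integrable lborel (\<lambda>x. ((f x - d) - (v x - d)) / K)"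
    by (intro integrable_divide integrable_diff fi vi)
   have "(\<integral>x. ((f x - d) - (v x - d)) / K) = ((\<integral>x. f x - d) - (\<integral>x. v x - d)) / K"
    using integral_diff[OF fi vi] by (simp only: integral_divide_zero)
   then show ?thesis unfolding G0_def using Bochner_Integration.integral_add[OF Pi i1] by (simp only:)
  qed
  finally show ?thesis using K by simp
 qed
 from that[OF C2v C2V v vi this L' eq lapeq] show ?thesis .
qed

section \<open>The two-point maximum principle\<close>

text \<open>A positive second derivative at 0 makes the first derivative, which vanishes at the
  maximum, positive just to the right of 0; by the mean value theorem the function would then exceed
  its maximum.\<close>

lemma second_derivative_at_max:
 fixes \<phi> \<phi>' :: "real \<Rightarrow> real"
 assumes e: "e > 0" and d: "\<And>t. \<bar>t\<bar> < e \<Longrightarrow> (\<phi> has_real_derivative \<phi>' t) (at t)"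
  and d2: "(\<phi>' has_real_derivative \<phi>'') (at 0)" and max: "\<And>t. \<bar>t\<bar> < e \<Longrightarrow> \<phi> t \<le> \<phi> 0"
 shows "\<phi>'' \<le> 0"
proof (rule ccontr)
 assume "\<not> \<phi>'' \<le> 0"
 then obtain r where r: "r > 0" "\<And>h. 0 < h \<Longrightarrow> h < r \<Longrightarrow> \<phi>' 0 < \<phi>' (0 + h)"
  using DERIV_pos_inc_right[OF d2] by auto
 have z: "\<phi>' 0 = 0"
  by (rule DERIV_local_max[OF d[of 0] e]) (use e max in auto)
 define t where "t = min (e / 2) (r / 2)"
 have t: "0 < t" "t < e" "t < r" using e r by (auto simp: t_def)
 obtain s where s: "0 < s" "s < t" "\<phi> t - \<phi> 0 = (t - 0) * \<phi>' s"
  using MVT2[OF t(1), of \<phi> \<phi>'] d t by auto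
 have "\<phi>' s > 0" using r(2)[of s] s t z by simp
 then have "\<phi> t - \<phi> 0 > 0" using s t by simp
 moreover have "\<phi> t \<le> \<phi> 0" using max[of t] t by simp
 ultimately show False by simp
qed

lemma GDERIV_line:
 assumes "GDERIV f (x + s *\<^sub>R b) :> D"
 shows "((\<lambda>t. f (x + t *\<^sub>R b)) has_real_derivative D \<bullet> b) (at s)"
proof -
 have "((\<lambda>t. f (x + t *\<^sub>R b)) has_derivative (\<lambda>h. (h *\<^sub>R b) \<bullet> D)) (at s)"
  by (rule has_derivative_compose[where g = f and f = "\<lambda>t. x + t *\<^sub>R b", OF _ assms[unfolded gderiv_def]]) (auto intro!: derivative_eq_intros)
 then show ?thesis by (simp add: has_field_derivative_def inner_commute mult_commute_abs)
qed

lemma norm_line_derivs: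
 fixes w b :: "'a::euclidean_space" and s :: real
 assumes w: "w \<noteq> 0" and b: "norm b = 1"
 defines "e \<equiv> norm w / (\<bar>s\<bar> + 1)"
 shows "e > 0"
  and "\<And>t. \<bar>t\<bar> < e \<Longrightarrow> ((\<lambda>t. norm (w + (t * s) *\<^sub>R b)) has_real_derivative (s * (w \<bullet> b) + t * s\<^sup>2) / norm (w + (t * s) *\<^sub>R b)) (at t)"
  and "((\<lambda>t. (s * (w \<bullet> b) + t * s\<^sup>2) / norm (w + (t * s) *\<^sub>R b)) has_real_derivative s\<^sup>2 * (1 / norm w - (w \<bullet> b)\<^sup>2 / norm w ^ 3)) (at 0)"
proof -
 show e: "e > 0" unfolding e_def using w by simp
 show d: "((\<lambda>t. norm (w + (t * s) *\<^sub>R b)) has_real_derivative (s * (w \<bullet> b) + t * s\<^sup>2) / norm (w + (t * s) *\<^sub>R b)) (at t)"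
  if t: "\<bar>t\<bar> < e" for t
 proof -
  have "\<bar>t\<bar> * (\<bar>s\<bar> + 1) < norm w" using t by (simp add: e_def field_simps)
  then have "norm ((t * s) *\<^sub>R b) < norm w" using b by (simp add: abs_mult algebra_simps)
  then have nz: "w + (t * s) *\<^sub>R b \<noteq> 0" using norm_minus_cancel[of w] by (metis add_eq_0_iff2 norm_minus_cancel order_less_irrefl)
  have "((\<lambda>t. w + (t * s) *\<^sub>R b) has_derivative (\<lambda>h. (h * s) *\<^sub>R b)) (at t)" by (auto intro!: derivative_eq_intros)
  from has_derivative_compose[OF this has_derivative_norm[OF nz]]
  have "((\<lambda>t. norm (w + (t * s) *\<^sub>R b)) has_derivative (\<lambda>h. ((h * s) *\<^sub>R b) \<bullet> sgn (w + (t * s) *\<^sub>R b))) (at t)" .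
  moreover have "(\<lambda>h. ((h * s) *\<^sub>R b) \<bullet> sgn (w + (t * s) *\<^sub>R b)) = (*) ((s * (w \<bullet> b) + t * s\<^sup>2) / norm (w + (t * s) *\<^sub>R b))"
  proof -
   have "b \<bullet> b = 1" using b by (simp add: norm_eq_1)
   then show ?thesis by (simp add: fun_eq_iff sgn_div_norm inner_add_right inner_commute[of b w] power2_eq_square field_simps add_divide_distrib)
  qed
  ultimately show ?thesis by (simp add: has_field_derivative_def)
 qed
 have "((\<lambda>t. (s * (w \<bullet> b) + t * s\<^sup>2) / norm (w + (t * s) *\<^sub>R b)) has_real_derivative
   (s\<^sup>2 * norm (w + (0 * s) *\<^sub>R b) - (s * (w \<bullet> b) + 0 * s\<^sup>2) * ((s * (w \<bullet> b) + 0 * s\<^sup>2) / norm (w + (0 * s) *\<^sub>R b)))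
    / (norm (w + (0 * s) *\<^sub>R b) * norm (w + (0 * s) *\<^sub>R b))) (at 0)"
  by (intro DERIV_divide d) (use e w in \<open>auto intro!: derivative_eq_intros\<close>)
 moreover have "(s\<^sup>2 * norm (w + (0 * s) *\<^sub>R b) - (s * (w \<bullet> b) + 0 * s\<^sup>2) * ((s * (w \<bullet> b) + 0 * s\<^sup>2) / norm (w + (0 * s) *\<^sub>R b)))
    / (norm (w + (0 * s) *\<^sub>R b) * norm (w + (0 * s) *\<^sub>R b)) = s\<^sup>2 * (1 / norm w - (w \<bullet> b)\<^sup>2 / norm w ^ 3)"
  using w by (simp add: field_simps power2_eq_square power3_eq_cube)
 ultimately show "((\<lambda>t. (s * (w \<bullet> b) + t * s\<^sup>2) / norm (w + (t * s) *\<^sub>R b)) has_real_derivative s\<^sup>2 * (1 / norm w - (w \<bullet> b)\<^sup>2 / norm w ^ 3)) (at 0)"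
  by simp
qed

text \<open>Both points move in the same direction, at speeds \<open>p\<close> and \<open>q\<close>. Only the \<open>d - 1\<close> directions
 orthogonal to \<open>x - y\<close> contribute to the second variation of the distance.\<close>

lemma two_point_second_order:
 fixes v :: "'a::euclidean_space \<Rightarrow> real"
 assumes v: "C2 v Dv Hv" and l: "l \<ge> 0" and xy: "x \<noteq> y"
  and max: "\<And>x' y'. v x' - v y' - l * norm (x' - y') \<le> v x - v y - l * norm (x - y)"
 shows "p\<^sup>2 * lap Hv x - q\<^sup>2 * lap Hv y \<le> l * (p - q)\<^sup>2 * (real DIM('a) - 1) / norm (x - y)"
  and "Dv x \<bullet> Dv x = l\<^sup>2" and "Dv y \<bullet> Dv y = l\<^sup>2"
proof -
 define w where "w = x - y"
 have w: "w \<noteq> 0" using xy by (simp add: w_def)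
 define r where "r = norm w"
 have r: "r > 0" using w by (simp add: r_def)
 have main: "p\<^sup>2 * (Hv b x \<bullet> b) - q\<^sup>2 * (Hv b y \<bullet> b) \<le> l * ((p - q)\<^sup>2 * (1 / r - (w \<bullet> b)\<^sup>2 / r ^ 3))" if b: "b \<in> Basis" for b
 proof -
  have nb: "norm b = 1" using b by simp
  define e where "e = norm w / (\<bar>p - q\<bar> + 1)"
  note N = norm_line_derivs[OF w nb, where s = "p - q", folded e_def]
  define \<phi> where "\<phi> t = v (x + t *\<^sub>R (p *\<^sub>R b)) - v (y + t *\<^sub>R (q *\<^sub>R b)) - l * norm (w + (t * (p - q)) *\<^sub>R b)" for t
  define \<phi>' where "\<phi>' t = p * (Dv (x + t *\<^sub>R (p *\<^sub>R b)) \<bullet> b) - q * (Dv (y + t *\<^sub>R (q *\<^sub>R b)) \<bullet> b)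
   - l * (((p - q) * (w \<bullet> b) + t * (p - q)\<^sup>2) / norm (w + (t * (p - q)) *\<^sub>R b))" for t
  have d: "(\<phi> has_real_derivative \<phi>' t) (at t)" if "\<bar>t\<bar> < e" for t
  proof -
   have "((\<lambda>t. v (x + t *\<^sub>R (p *\<^sub>R b))) has_real_derivative Dv (x + t *\<^sub>R (p *\<^sub>R b)) \<bullet> (p *\<^sub>R b)) (at t)"
    "((\<lambda>t. v (y + t *\<^sub>R (q *\<^sub>R b))) has_real_derivative Dv (y + t *\<^sub>R (q *\<^sub>R b)) \<bullet> (q *\<^sub>R b)) (at t)"
    by (intro GDERIV_line C2_GDERIV[OF v])+
   from DERIV_diff[OF DERIV_diff[OF this] DERIV_cmult[OF N(2)[OF that], of l]]
   show ?thesis unfolding \<phi>_def[abs_def] \<phi>'_def by simp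
  qed
  have d2: "(\<phi>' has_real_derivative p * (Hv b x \<bullet> (p *\<^sub>R b)) - q * (Hv b y \<bullet> (q *\<^sub>R b)) - l * ((p - q)\<^sup>2 * (1 / norm w - (w \<bullet> b)\<^sup>2 / norm w ^ 3))) (at 0)"
  proof -
   have "((\<lambda>t. Dv (x + t *\<^sub>R (p *\<^sub>R b)) \<bullet> b) has_real_derivative Hv b x \<bullet> (p *\<^sub>R b)) (at 0)"
    "((\<lambda>t. Dv (y + t *\<^sub>R (q *\<^sub>R b)) \<bullet> b) has_real_derivative Hv b y \<bullet> (q *\<^sub>R b)) (at 0)"
    using GDERIV_line[of "\<lambda>x. Dv x \<bullet> b" x 0 "p *\<^sub>R b" "Hv b x"] GDERIV_line[of "\<lambda>x. Dv x \<bullet> b" y 0 "q *\<^sub>R b" "Hv b y"]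
     C2_GDERIV2[OF v b] by simp_all
   from DERIV_diff[OF DERIV_diff[OF DERIV_cmult[OF this(1), of p] DERIV_cmult[OF this(2), of q]] DERIV_cmult[OF N(3), of l]]
   show ?thesis unfolding \<phi>'_def[abs_def] by simp
  qed
  have "\<phi> t \<le> \<phi> 0" for t
   using max[of "x + t *\<^sub>R (p *\<^sub>R b)" "y + t *\<^sub>R (q *\<^sub>R b)"] by (simp add: \<phi>_def w_def algebra_simps)
  from second_derivative_at_max[OF N(1) d d2 this]
  show ?thesis by (simp add: r_def power2_eq_square algebra_simps)
 qed
 have "p\<^sup>2 * lap Hv x - q\<^sup>2 * lap Hv y = (\<Sum>b\<in>Basis. p\<^sup>2 * (Hv b x \<bullet> b) - q\<^sup>2 * (Hv b y \<bullet> b))"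
  by (simp add: lap_def sum_subtractf sum_distrib_left)
 also have "\<dots> \<le> (\<Sum>b\<in>Basis. l * ((p - q)\<^sup>2 * (1 / r - (w \<bullet> b)\<^sup>2 / r ^ 3)))" by (rule sum_mono[OF main])
 also have "\<dots> = l * (p - q)\<^sup>2 * (\<Sum>b\<in>(Basis::'a set). (1 / r - (w \<bullet> b)\<^sup>2 / r ^ 3))" by (simp add: sum_distrib_left mult.assoc)
 also have "(\<Sum>b\<in>(Basis::'a set). (1 / r - (w \<bullet> b)\<^sup>2 / r ^ 3)) = real DIM('a) / r - (\<Sum>b\<in>Basis. (w \<bullet> b)\<^sup>2) / r ^ 3"
  by (simp add: sum_subtractf sum_divide_distrib)
 also have "(\<Sum>b\<in>Basis. (w \<bullet> b)\<^sup>2) = r\<^sup>2"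
  unfolding r_def power2_norm_eq_inner by (subst euclidean_inner) (simp add: power2_eq_square)
 also have "real DIM('a) / r - r\<^sup>2 / r ^ 3 = (real DIM('a) - 1) / r" using r by (simp add: field_simps power2_eq_square power3_eq_cube)
 finally show "p\<^sup>2 * lap Hv x - q\<^sup>2 * lap Hv y \<le> l * (p - q)\<^sup>2 * (real DIM('a) - 1) / norm (x - y)"
  by (simp add: r_def w_def)
 \<comment> \<open>First-order conditions, moving one point at a time: both gradients equal
   \<open>(l / r) *\<^sub>R w\<close>. The opposite signs of \<open>v x\<close> and
   \<open>v y\<close> in the functional compensate the opposite dependence of
   \<open>x - y\<close>.\<close>
 have grad: "Dv x \<bullet> u = l * (w \<bullet> u) / r" "Dv y \<bullet> u = l * (w \<bullet> u) / r" if u: "norm u = 1" for u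
 proof -
  have n1: "((\<lambda>t. norm (w + (t * s) *\<^sub>R u)) has_real_derivative s * (w \<bullet> u) / r) (at 0)" for s
   using norm_line_derivs(2)[OF w u, where t = 0 and s = s] norm_line_derivs(1)[OF w u, where s = s] by (simp add: r_def)
  have gx: "((\<lambda>t. v (x + t *\<^sub>R u)) has_real_derivative Dv x \<bullet> u) (at 0)" "((\<lambda>t. v (y + t *\<^sub>R u)) has_real_derivative Dv y \<bullet> u) (at 0)"
   using GDERIV_line[of v x 0 u "Dv x"] GDERIV_line[of v y 0 u "Dv y"] C2_GDERIV[OF v] by simp_all
  have "((\<lambda>t. v (x + t *\<^sub>R u) - v y - l * norm (w + (t * 1) *\<^sub>R u)) has_real_derivative Dv x \<bullet> u - 0 - l * (1 * (w \<bullet> u) / r)) (at 0)"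
   by (intro DERIV_diff gx DERIV_const DERIV_cmult n1)
  then have "Dv x \<bullet> u - 0 - l * (1 * (w \<bullet> u) / r) = 0"
   by (rule DERIV_local_max[OF _ zero_less_one]) (use max[of "x + _ *\<^sub>R u" y] in \<open>auto simp: w_def algebra_simps\<close>)
  then show "Dv x \<bullet> u = l * (w \<bullet> u) / r" by simp
  have "((\<lambda>t. v x - v (y + t *\<^sub>R u) - l * norm (w + (t * (-1)) *\<^sub>R u)) has_real_derivative 0 - Dv y \<bullet> u - l * ((-1) * (w \<bullet> u) / r)) (at 0)"
   by (intro DERIV_diff gx DERIV_const DERIV_cmult n1)
  then have "0 - Dv y \<bullet> u - l * ((-1) * (w \<bullet> u) / r) = 0"
   by (rule DERIV_local_max[OF _ zero_less_one]) (use max[of x "y + _ *\<^sub>R u"] in \<open>auto simp: w_def algebra_simps\<close>)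
  then show "Dv y \<bullet> u = l * (w \<bullet> u) / r" by simp
 qed
 have sq: "D \<bullet> D = l\<^sup>2" if D: "\<And>u. norm u = 1 \<Longrightarrow> D \<bullet> u = l * (w \<bullet> u) / r" for D
 proof -
  have "D = (l / r) *\<^sub>R w"
  proof (rule euclidean_eqI)
   fix b :: 'a assume "b \<in> Basis"
   then show "D \<bullet> b = ((l / r) *\<^sub>R w) \<bullet> b" using D[of b] by simp
  qed
  moreover have "w \<bullet> w = r\<^sup>2" by (simp add: r_def power2_norm_eq_inner)
  ultimately show ?thesis using r by (simp add: power2_eq_square)
 qed
 show "Dv x \<bullet> Dv x = l\<^sup>2" "Dv y \<bullet> Dv y = l\<^sup>2" using grad by (auto intro: sq)
qed

section \<open>Two elementary inequalities for powers\<close>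

text \<open>Mean value theorem, with the derivative of \<open>z powr (\<gamma> - 1)\<close>
  estimated at the ends \<open>d\<close> and \<open>M\<close>. The lower bound becomes the decay
  rate; the upper one only has to be finite, for an error term that disappears in a limit.\<close>

lemma powr_slope_bounds:
 fixes s :: real
 assumes g: "0 < \<gamma>" "\<gamma> < 1" and s: "0 < d" "d \<le> s" "s < S" "S \<le> M"
 shows "(1 - \<gamma>) * M powr (\<gamma> - 2) * (S - s) \<le> s powr (\<gamma> - 1) - S powr (\<gamma> - 1)"
  and "s powr (\<gamma> - 1) - S powr (\<gamma> - 1) \<le> (1 - \<gamma>) * d powr (\<gamma> - 2) * (S - s)"
proof -
 have "((\<lambda>z. z powr (\<gamma> - 1)) has_real_derivative (\<gamma> - 1) * z powr (\<gamma> - 2)) (at z)" if "s \<le> z" for z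
  using has_real_derivative_powr[of z "\<gamma> - 1"] that s by simp
 then obtain z where z: "s < z" "z < S" "S powr (\<gamma> - 1) - s powr (\<gamma> - 1) = (S - s) * ((\<gamma> - 1) * z powr (\<gamma> - 2))"
  using MVT2[OF s(3), of "\<lambda>z. z powr (\<gamma> - 1)" "\<lambda>z. (\<gamma> - 1) * z powr (\<gamma> - 2)"] by blast
 have eq: "s powr (\<gamma> - 1) - S powr (\<gamma> - 1) = (1 - \<gamma>) * z powr (\<gamma> - 2) * (S - s)" using z(3) by (simp add: algebra_simps)
 have "M powr (\<gamma> - 2) \<le> z powr (\<gamma> - 2)" "z powr (\<gamma> - 2) \<le> d powr (\<gamma> - 2)" using g s z by (auto intro!: powr_mono2')
 then show "(1 - \<gamma>) * M powr (\<gamma> - 2) * (S - s) \<le> s powr (\<gamma> - 1) - S powr (\<gamma> - 1)"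
  "s powr (\<gamma> - 1) - S powr (\<gamma> - 1) \<le> (1 - \<gamma>) * d powr (\<gamma> - 2) * (S - s)"
  unfolding eq using g s by (auto intro!: mult_right_mono mult_left_mono)
qed

text \<open>Cauchy--Schwarz for \<open>\<integral>\<^bsub>s\<^esub>\<^bsup>S\<^esup> (\<gamma>/2) z\<^bsup>\<gamma>/2 - 1\<^esup> dz\<close>; it is here that \<open>\<gamma> \<le> 4/(d + 3)\<close> comes from.\<close>

lemma powr_cauchy_schwarz:
 fixes s :: real
 assumes g: "0 < \<gamma>" "\<gamma> < 1" and s: "0 < s" "s < S"
 shows "(S powr (\<gamma> / 2) - s powr (\<gamma> / 2))\<^sup>2 \<le> \<gamma>\<^sup>2 / (4 * (1 - \<gamma>)) * (S - s) * (s powr (\<gamma> - 1) - S powr (\<gamma> - 1))"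
proof -
 define c where "c = (S powr (\<gamma> / 2) - s powr (\<gamma> / 2)) / (S - s)"
 \<comment> \<open>An antiderivative of
   \<open>(\<gamma> / 2 * z powr (\<gamma> / 2 - 1) - c)\<^sup>2\<close>, where \<open>c\<close> is
   the mean of the first term over the interval. That \<open>E\<close> increases is the
   Cauchy-Schwarz inequality without integrals.\<close>
 define E where "E z = (\<gamma>\<^sup>2 / 4) * (z powr (\<gamma> - 1) / (\<gamma> - 1)) - 2 * c * z powr (\<gamma> / 2) + c\<^sup>2 * z" for z
 have "E s \<le> E S"
 proof (rule DERIV_nonneg_imp_nondecreasing[OF less_imp_le[OF s(2)]])
  fix z assume z: "s \<le> z" "z \<le> S"
  have zp: "z > 0" using z s by simp
  have d1: "((\<lambda>z. z powr (\<gamma> - 1)) has_real_derivative (\<gamma> - 1) * z powr (\<gamma> - 1 - 1)) (at z)"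
   "((\<lambda>z. z powr (\<gamma> / 2)) has_real_derivative \<gamma> / 2 * z powr (\<gamma> / 2 - 1)) (at z)"
   by (intro has_real_derivative_powr zp)+
  have "(E has_real_derivative (\<gamma>\<^sup>2 / 4) * ((\<gamma> - 1) * z powr (\<gamma> - 1 - 1) / (\<gamma> - 1)) - 2 * c * (\<gamma> / 2 * z powr (\<gamma> / 2 - 1)) + c\<^sup>2 * 1) (at z)"
   unfolding E_def[abs_def] by (intro DERIV_add DERIV_diff DERIV_cmult DERIV_cdivide d1 DERIV_ident)
  moreover have "(\<gamma>\<^sup>2 / 4) * ((\<gamma> - 1) * z powr (\<gamma> - 1 - 1) / (\<gamma> - 1)) - 2 * c * (\<gamma> / 2 * z powr (\<gamma> / 2 - 1)) + c\<^sup>2 * 1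
    = (\<gamma> / 2 * z powr (\<gamma> / 2 - 1) - c)\<^sup>2"
  proof -
   have "z powr (\<gamma> / 2 - 1) * z powr (\<gamma> / 2 - 1) = z powr (\<gamma> - 1 - 1)" by (simp flip: powr_add)
   then have "(\<gamma> / 2 * z powr (\<gamma> / 2 - 1) - c)\<^sup>2 = (\<gamma>\<^sup>2 / 4) * z powr (\<gamma> - 1 - 1) - 2 * c * (\<gamma> / 2 * z powr (\<gamma> / 2 - 1)) + c\<^sup>2"
    by (simp add: power2_eq_square algebra_simps)
   then show ?thesis using g by simp
  qed
  ultimately show "\<exists>y. (E has_real_derivative y) (at z) \<and> 0 \<le> y" by (metis zero_le_power2)
 qed
 then have 1: "0 \<le> E S - E s" by simp
 have cS: "c * (S - s) = S powr (\<gamma> / 2) - s powr (\<gamma> / 2)" using s by (simp add: c_def)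
 have "E S - E s = (\<gamma>\<^sup>2 / 4) * ((S powr (\<gamma> - 1) - s powr (\<gamma> - 1)) / (\<gamma> - 1)) - 2 * c * (S powr (\<gamma> / 2) - s powr (\<gamma> / 2)) + c\<^sup>2 * (S - s)"
  unfolding E_def by (simp add: diff_divide_distrib algebra_simps)
 also have "\<dots> = (\<gamma>\<^sup>2 / 4) * ((s powr (\<gamma> - 1) - S powr (\<gamma> - 1)) / (1 - \<gamma>)) - c\<^sup>2 * (S - s)"
  unfolding cS[symmetric] using minus_divide_divide[of "S powr (\<gamma> - 1) - s powr (\<gamma> - 1)" "\<gamma> - 1"] by (simp add: power2_eq_square)
 finally have "c\<^sup>2 * (S - s) \<le> (\<gamma>\<^sup>2 / 4) * ((s powr (\<gamma> - 1) - S powr (\<gamma> - 1)) / (1 - \<gamma>))" using 1 by simp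
 from mult_right_mono[OF this, of "S - s"] s
 have "(c * (S - s))\<^sup>2 \<le> (\<gamma>\<^sup>2 / 4) * ((s powr (\<gamma> - 1) - S powr (\<gamma> - 1)) / (1 - \<gamma>)) * (S - s)"
  by (simp add: power2_eq_square mult_ac)
 then show ?thesis unfolding cS by (simp add: mult_ac)
qed

section \<open>Existence of a maximising pair\<close>

lemma content_ball_translate: "measure lborel (ball (x::'a::euclidean_space) r) = measure lborel (ball (0::'a) r)"
proof -
 have "measure lborel (ball x r) = measure (distr lborel borel ((+) x)) (ball x r)" by (simp add: lborel_distr_plus)
 also have "\<dots> = measure lborel ((+) x -` ball x r \<inter> space lborel)" by (rule measure_distr) auto
 also have "(+) x -` ball x r \<inter> space lborel = ball 0 r" by (auto simp: dist_norm)
 finally show ?thesis .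
qed

lemma dominated_integral_small:
 fixes F :: "nat \<Rightarrow> 'a::euclidean_space \<Rightarrow> real"
 assumes w: "integrable lborel w" and F: "\<And>k. F k \<in> borel_measurable borel" "\<And>k x. \<bar>F k x\<bar> \<le> w x" "\<And>x. (\<lambda>k. F k x) \<longlonglongrightarrow> 0" and e: "e > 0"
 obtains k where "(\<integral>x. F k x) < e"
proof -
 have "(\<lambda>k. \<integral>x. F k x) \<longlonglongrightarrow> integral\<^sup>L lborel (\<lambda>x::'a. 0::real)"
  by (rule integral_dominated_convergence[OF _ _ w]) (use F in auto)
 then have "\<forall>\<^sub>F k in sequentially. (\<integral>x. F k x) < e" using e by (intro order_tendstoD) auto
 then show ?thesis using that eventually_happens'[OF sequentially_bot] by blast
qed

text \<open>A point with \<open>u x \<ge> e\<close> carries mass at least \<open>c\<close> in a ball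
  of fixed radius \<open>r\<close>, since \<open>u\<close> stays above \<open>e / 2\<close> there.
  Far out this exceeds the tail of the integral.\<close>

lemma lipschitz_integrable_vanishes:
 fixes u :: "'a::euclidean_space \<Rightarrow> real"
 assumes i: "integrable lborel u" and u: "\<And>x. u x \<ge> 0" and L: "L-lipschitz_on UNIV u" and e: "e > 0"
 shows "\<exists>R. \<forall>x. e \<le> u x \<longrightarrow> norm x \<le> R"
proof -
 have L0: "L \<ge> 0" using L lipschitz_on_nonneg by blast
 define r where "r = e / (2 * (L + 1))"
 have r: "r > 0" "L * r \<le> e / 2" using e L0 by (auto simp: r_def field_simps)
 define c where "c = e / 2 * measure lborel (ball (0::'a) r)"
 have c: "c > 0" unfolding c_def using e content_ball_pos[OF r(1), of "0::'a"] by simp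
 obtain n where n: "(\<integral>x. indicator (- cball 0 (real n)) x * u x) < c"
 proof (rule dominated_integral_small[OF i _ _ _ c, of "\<lambda>n x. indicator (- cball 0 (real n)) x * u x"])
  fix x :: 'a
  obtain N where N: "norm x \<le> real N" using real_arch_simple by blast
  have "\<forall>\<^sub>F n in sequentially. indicator (- cball 0 (real n)) x * u x = 0"
   using eventually_ge_at_top[of N] by eventually_elim (use N in \<open>auto simp: indicator_def\<close>)
  then show "(\<lambda>n. indicator (- cball 0 (real n)) x * u x) \<longlonglongrightarrow> 0" by (rule tendsto_eventually)
 qed (use i u in \<open>auto simp: indicator_def\<close>)
 have "norm x \<le> real n + r" if x: "e \<le> u x" for x
 proof (rule ccontr)
  assume nx: "\<not> norm x \<le> real n + r"
  have "c = (\<integral>y. (e / 2) * indicator (ball x r) y)"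
   using content_ball_translate[of x r] by (simp add: c_def)
  also have "\<dots> \<le> (\<integral>x. indicator (- cball 0 (real n)) x * u x)"
  proof (rule integral_mono)
   show "integrable lborel (\<lambda>y. (e / 2) * indicator (ball x r) y)"
    using emeasure_lborel_ball_finite[of x r] by (intro integrable_mult_right integrable_real_indicator) auto
   show "integrable lborel (\<lambda>x. indicator (- cball 0 (real n)) x * u x)"
    using integrable_mult_indicator[of "- cball 0 (real n)" lborel u] i by simp
   fix y
   show "(e / 2) * indicator (ball x r) y \<le> indicator (- cball 0 (real n)) y * u y"
   proof (cases "y \<in> ball x r")
    case True
    have "norm (x - y) < r" using True by (simp add: dist_norm)
    then have "real n < norm y" using nx norm_triangle_ineq2[of x y] by linarith
    moreover have "u x - u y \<le> L * r"
    proof -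
     have "u x - u y \<le> L * norm (x - y)" using lipschitz_onD[OF L, of x y] by (simp add: dist_norm)
     also have "\<dots> \<le> L * r" using True L0 by (intro mult_left_mono) (auto simp: dist_norm)
     finally show ?thesis .
    qed
    ultimately show ?thesis using True x r(2) by (simp add: indicator_def)
   qed (use u in \<open>simp add: indicator_def\<close>)
  qed
  finally show False using n by simp
 qed
 then show ?thesis by blast
qed

text \<open>The pairs at least as good as the given violating one form a compact set: the first
  point is confined because \<open>v - d\<close> vanishes at infinity, and the second by the linear
  penalty, since \<open>v\<close> has bounded oscillation.\<close>

lemma two_point_max_exists:
 fixes v :: "'a::euclidean_space \<Rightarrow> real"
 assumes v: "continuous_on UNIV v" "\<And>x. d \<le> v x" "\<And>x. v x \<le> M"
  and vanish: "\<And>e. e > 0 \<Longrightarrow> \<exists>R. \<forall>x. e \<le> v x - d \<longrightarrow> norm x \<le> R"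
  and l: "l > 0" and viol: "l * norm (x0 - y0) < v x0 - v y0"
 obtains x y where "l * norm (x - y) < v x - v y" "\<And>x' y'. v x' - v y' - l * norm (x' - y') \<le> v x - v y - l * norm (x - y)"
proof -
 define Z where "Z z = v (fst z) - v (snd z) - l * norm (fst z - snd z)" for z
 have cZ: "continuous_on UNIV Z" unfolding Z_def[abs_def]
  by (intro continuous_intros continuous_on_fst_comp continuous_on_snd_comp)
   (auto intro!: continuous_on_compose2[OF v(1)] continuous_intros)
 define c where "c = Z (x0, y0)"
 have c: "c > 0" using viol by (simp add: c_def Z_def)
 obtain R where R: "\<And>x. c \<le> v x - d \<Longrightarrow> norm x \<le> R" using vanish[OF c] by blast
 define S where "S = {z. c \<le> Z z}"
 have "closed S" unfolding S_def using cZ by (intro closed_Collect_le) auto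
 moreover have "bounded S"
 proof (rule boundedI)
  fix z assume z: "z \<in> S"
  have "0 \<le> l * norm (fst z - snd z)" using l by simp
  then have "c \<le> v (fst z) - d" using z v(2)[of "snd z"] by (simp add: S_def Z_def)
  then have 1: "norm (fst z) \<le> R" by (rule R)
  have "l * norm (fst z - snd z) \<le> M - d" using z c v(2)[of "snd z"] v(3)[of "fst z"] by (simp add: S_def Z_def)
  then have "norm (fst z - snd z) \<le> (M - d) / l" using l by (simp add: field_simps)
  then have 2: "norm (snd z) \<le> R + (M - d) / l" using 1 norm_triangle_ineq3[of "fst z" "snd z"] by linarith
  show "norm z \<le> R + (R + (M - d) / l)"
   using norm_Pair_le[of "fst z" "snd z"] 1 2 by simp
 qed
 ultimately have "compact S" by (simp add: compact_eq_bounded_closed)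
 moreover have "S \<noteq> {}" using c_def by (auto simp: S_def)
 ultimately obtain z where z: "z \<in> S" "\<And>z'. z' \<in> S \<Longrightarrow> Z z' \<le> Z z"
  using continuous_attains_sup[of S Z] continuous_on_subset[OF cZ] by blast
 show ?thesis
 proof (rule that[of "fst z" "snd z"])
  show "l * norm (fst z - snd z) < v (fst z) - v (snd z)" using z(1) c by (simp add: S_def Z_def)
  fix x' y'
  have "Z (x', y') \<le> Z z" using z(2)[of "(x', y')"] z(1) by (cases "(x', y') \<in> S") (auto simp: S_def)
  then show "v x' - v y' - l * norm (x' - y') \<le> v (fst z) - v (snd z) - l * norm (fst z - snd z)"
   by (simp add: Z_def)
 qed
qed

lemma GDERIV_bounded_lipschitz:
 fixes f :: "'a::euclidean_space \<Rightarrow> real"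
 assumes "\<And>x. GDERIV f x :> Df x" "\<And>x. norm (Df x) \<le> K"
 shows "K-lipschitz_on UNIV f"
proof (rule lipschitz_onI)
 fix x y
 have "norm (f x - f y) \<le> K * norm (x - y)"
 proof (rule differentiable_bound[of UNIV f "\<lambda>x h. h \<bullet> Df x"])
  show "onorm (\<lambda>h. h \<bullet> Df x) \<le> K" for x
  proof (rule onorm_bound)
   show "norm (h \<bullet> Df x) \<le> K * norm h" for h
    using mult_right_mono[OF assms(2)[of x], of "norm h"] Cauchy_Schwarz_ineq2[of h "Df x"] by (simp add: mult.commute)
  qed (use norm_ge_zero[of "Df x"] assms(2)[of x] in linarith)
 qed (use assms(1) in \<open>auto simp: gderiv_def\<close>)
 then show "dist (f x) (f y) \<le> K * dist x y" by (simp add: dist_norm)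
qed (use norm_ge_zero[of "Df 0"] assms(2)[of 0] in linarith)

section \<open>The Lipschitz constant over one Euler step\<close>

text \<open>The infimum of the admissible constants is admissible, and anything smaller is violated
  by some pair, which is the starting point of the maximum principle.\<close>

lemma optimal_lipschitz_constant:
 fixes v :: "'a::metric_space \<Rightarrow> real"
 assumes "L-lipschitz_on UNIV v"
 obtains l where "l-lipschitz_on UNIV v" "\<And>k. 0 \<le> k \<Longrightarrow> k < l \<Longrightarrow> \<exists>x y. k * dist x y < v x - v y"
proof -
 define S where "S = {k. k-lipschitz_on UNIV v}"
 have S: "S \<noteq> {}" "bdd_below S" using assms lipschitz_on_nonneg unfolding S_def by (auto intro!: bdd_belowI[of _ 0])
 have S0: "0 \<le> k" if "k \<in> S" for k using that lipschitz_on_nonneg unfolding S_def by blast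
 define l where "l = Inf S"
 have "l-lipschitz_on UNIV v"
 proof (rule lipschitz_onI)
  show "0 \<le> l" unfolding l_def using S(1) S0 by (intro cInf_greatest) auto
  fix x y :: 'a
  show "dist (v x) (v y) \<le> l * dist x y"
  proof (cases "dist x y = 0")
   case False
   then have p: "dist x y > 0" by (metis zero_le_dist order_le_less)
   have "dist (v x) (v y) / dist x y \<le> l" unfolding l_def
   proof (rule cInf_greatest[OF S(1)])
    fix k assume "k \<in> S"
    then have "dist (v x) (v y) \<le> k * dist x y" unfolding S_def by (auto intro: lipschitz_onD)
    then show "dist (v x) (v y) / dist x y \<le> k" using p by (simp add: field_simps)
   qed
   then show ?thesis using p by (simp add: field_simps)
  qed simp
 qed
 moreover have "\<exists>x y. k * dist x y < v x - v y" if k: "0 \<le> k" "k < l" for k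
 proof (rule ccontr)
  assume n: "\<not> (\<exists>x y. k * dist x y < v x - v y)"
  have "k-lipschitz_on UNIV v"
  proof (rule lipschitz_onI)
   fix x y
   show "dist (v x) (v y) \<le> k * dist x y"
   proof -
    have "v x - v y \<le> k * dist x y" "v y - v x \<le> k * dist y x" using n by (auto simp: not_less)
    then show ?thesis by (simp add: dist_real_def dist_commute abs_le_iff)
   qed
  qed (use k in simp)
  then have "l \<le> k" unfolding l_def S_def[symmetric] using S(2) by (intro cInf_lower) (auto simp: S_def)
  then show False using k by simp
 qed
 ultimately show ?thesis by (rule that)
qed

text \<open>\<open>D\<close> is the dimension. The factor
  \<open>\<gamma>\<^sup>2 * (1 - \<gamma>)\<close> comes from the slope of
  \<open>\<gamma>\<^sup>2 * v powr (\<gamma> - 1)\<close>, and the last factor is the share of the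
  first-order term that is left once it has absorbed the second-order terms; for
  \<open>\<gamma> < 1\<close> it is nonnegative iff
  \<open>(D + 3) * \<gamma> \<le> 4\<close>.\<close>

definition lip_rate :: "real \<Rightarrow> real \<Rightarrow> real" where
 "lip_rate \<gamma> D = \<gamma>\<^sup>2 * (1 - \<gamma>) * (1 - (D - 1) * \<gamma> / (4 * (1 - \<gamma>)))"

lemma gamma_less_1: "D \<ge> 2 \<Longrightarrow> \<gamma> \<le> 4 / (D + 3) \<Longrightarrow> \<gamma> < (1::real)"
 using frac_less2[of 4 4 4 "D + 3"] by (smt (verit) divide_less_eq_1_pos)

lemma lip_rate_nonneg:
 assumes "D \<ge> 2" "0 < \<gamma>" "\<gamma> \<le> 4 / (D + 3)" shows "0 \<le> lip_rate \<gamma> D"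
proof -
 have g1: "\<gamma> < 1" using gamma_less_1 assms by blast
 have "(D + 3) * \<gamma> \<le> 4" using assms by (simp add: field_simps)
 then have "(D - 1) * \<gamma> \<le> 4 * (1 - \<gamma>)" by (simp add: algebra_simps)
 then have "(D - 1) * \<gamma> / (4 * (1 - \<gamma>)) \<le> 1" using g1 by simp
 then show ?thesis unfolding lip_rate_def using g1 by simp
qed

lemma lip_rate_pos:
 assumes "D \<ge> 2" "0 < \<gamma>" "\<gamma> < 4 / (D + 3)" shows "0 < lip_rate \<gamma> D"
proof -
 have g1: "\<gamma> < 1" using gamma_less_1 assms by (meson less_imp_le)
 have "(D + 3) * \<gamma> < 4" using assms by (simp add: field_simps)
 then have "(D - 1) * \<gamma> < 4 * (1 - \<gamma>)" by (simp add: algebra_simps)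
 then have "(D - 1) * \<gamma> / (4 * (1 - \<gamma>)) < 1" using g1 by simp
 then show ?thesis unfolding lip_rate_def using g1 assms by simp
qed

text \<open>Subtract the equations at a maximising pair. Both gradients have norm \<open>k\<close>,
  so the first-order terms contribute \<open>- A * k\<^sup>2\<close>, while the second-order terms
  are at most \<open>k * \<theta> * l * A\<close> by Cauchy-Schwarz. For
  \<open>\<theta> \<le> 1\<close> the sum is nonpositive up to an error of order
  \<open>l - k\<close>, and the surplus \<open>1 - \<theta>\<close> is the rate.\<close>

lemma resolvent_lipschitz:
 fixes v f :: "'a::euclidean_space \<Rightarrow> real"
 assumes D: "DIM('a) \<ge> 2" and g: "0 < \<gamma>" "\<gamma> \<le> 4 / (real DIM('a) + 3)" and h: "h > 0"
  and d: "0 < d" and v: "C2 v Dv Hv" "\<And>x. d \<le> v x" "\<And>x. v x \<le> M" and vi: "integrable lborel (\<lambda>x. v x - d)"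
  and Dv: "\<And>x. norm (Dv x) \<le> L'"
  and eq: "\<And>x. v x - h * (\<gamma> * v x powr \<gamma> * lap Hv x + \<gamma>\<^sup>2 * v x powr (\<gamma> - 1) * (Dv x \<bullet> Dv x)) = f x"
  and f: "L-lipschitz_on UNIV f"
 obtains l where "l-lipschitz_on UNIV v" "l + h * (lip_rate \<gamma> (real DIM('a)) * M powr (\<gamma> - 2)) * l ^ 3 \<le> L"
proof -
 have g1: "\<gamma> < 1" using gamma_less_1[of "real DIM('a)" \<gamma>] D g by simp
 define \<theta> where "\<theta> = (real DIM('a) - 1) * \<gamma> / (4 * (1 - \<gamma>))"
 have L0: "L \<ge> 0" using f lipschitz_on_nonneg by blast
 have "L'-lipschitz_on UNIV v" by (rule GDERIV_bounded_lipschitz[OF C2_GDERIV[OF v(1)] Dv])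
 then obtain l where l: "l-lipschitz_on UNIV v" and opt: "\<And>k. 0 \<le> k \<Longrightarrow> k < l \<Longrightarrow> \<exists>x y. k * dist x y < v x - v y"
  by (rule optimal_lipschitz_constant) blast
 have l0: "l \<ge> 0" using l lipschitz_on_nonneg by blast
 have "l-lipschitz_on UNIV (\<lambda>x. v x - d)" using l unfolding lipschitz_on_def by (simp add: dist_real_def)
 then have vanish: "\<exists>R. \<forall>x. e \<le> v x - d \<longrightarrow> norm x \<le> R" if "e > 0" for e
  using lipschitz_integrable_vanishes[OF vi _ _ that, of l] v(2) by simp
 define cM where "cM = \<gamma>\<^sup>2 * (1 - \<gamma>) * M powr (\<gamma> - 2)"
 define cd where "cd = \<gamma>\<^sup>2 * (1 - \<gamma>) * d powr (\<gamma> - 2)"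
 have cc: "0 \<le> cM" "0 \<le> cd" unfolding cM_def cd_def using g1 by auto
 have th1: "\<theta> \<le> 1" "0 \<le> \<theta>"
 proof -
  have "(real DIM('a) + 3) * \<gamma> \<le> 4" using g by (simp add: field_simps)
  then have "(real DIM('a) - 1) * \<gamma> \<le> 4 * (1 - \<gamma>)" by (simp add: algebra_simps)
  then show "\<theta> \<le> 1" unfolding \<theta>_def using g1 by simp
  show "0 \<le> \<theta>" unfolding \<theta>_def using g1 g D by simp
 qed
 \<comment> \<open>No pair need violate the optimal constant \<open>l\<close>, so the argument runs
   with \<open>k < l\<close>. The price is that \<open>S - s\<close> is only known to lie between
   \<open>k * r\<close> and \<open>l * r\<close>; the mismatch produces the term with
   \<open>l - k\<close>.\<close>
 have key: "k + h * (k\<^sup>2 * cM * (1 - \<theta>) * l) \<le> L + h * (k * cd * l * (l - k))" if k: "0 < k" "k < l" for k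
 proof -
  obtain x0 y0 where "k * norm (x0 - y0) < v x0 - v y0" using opt[of k] k by (auto simp: dist_norm)
  from two_point_max_exists[OF C2_cont0[OF v(1)] v(2,3) vanish k(1) this]
  obtain x y where xy: "k * norm (x - y) < v x - v y"
   and max: "\<And>x' y'. v x' - v y' - k * norm (x' - y') \<le> v x - v y - k * norm (x - y)" by blast
  have ne: "x \<noteq> y" using xy by auto
  define r where "r = norm (x - y)"
  have r: "r > 0" using ne by (simp add: r_def)
  define S s where "S = v x" and "s = v y"
  have Ss: "k * r < S - s" "S - s \<le> l * r"
   using xy lipschitz_onD[OF l, of x y] by (auto simp: S_def s_def r_def dist_norm)
  have "0 < k * r" using k(1) r by simp
  then have sS: "0 < d" "d \<le> s" "s < S" "S \<le> M" using d v(2)[of y] v(3)[of x] Ss(1) unfolding S_def s_def by linarith+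
  have s0: "0 < s" "0 < S" using sS by auto
  define A where "A = \<gamma>\<^sup>2 * (s powr (\<gamma> - 1) - S powr (\<gamma> - 1))"
  have A: "cM * (S - s) \<le> A" "A \<le> cd * (S - s)"
   using mult_left_mono[OF powr_slope_bounds(1)[OF g(1) g1 sS], of "\<gamma>\<^sup>2"] mult_left_mono[OF powr_slope_bounds(2)[OF g(1) g1 sS], of "\<gamma>\<^sup>2"]
   by (auto simp: A_def cM_def cd_def mult.assoc)
  \<comment> \<open>Speeds whose squares are the diffusion coefficients at the two points, so that
    \<open>two_point_second_order\<close> estimates exactly the second-order terms of the two
    equations.\<close>
  define p q where "p = sqrt \<gamma> * S powr (\<gamma> / 2)" and "q = sqrt \<gamma> * s powr (\<gamma> / 2)"
  have pq: "p\<^sup>2 = \<gamma> * S powr \<gamma>" "q\<^sup>2 = \<gamma> * s powr \<gamma>"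
   unfolding p_def q_def using g(1) by (simp_all add: power_mult_distrib power2_eq_square[of "_ powr _"] powr_add[symmetric])
  have CS: "(p - q)\<^sup>2 * (real DIM('a) - 1) \<le> \<theta> * (S - s) * A"
  proof -
   have "(p - q)\<^sup>2 = \<gamma> * (S powr (\<gamma> / 2) - s powr (\<gamma> / 2))\<^sup>2"
    unfolding p_def q_def using g(1) by (simp add: right_diff_distrib[symmetric] power_mult_distrib)
   then have "(p - q)\<^sup>2 * (real DIM('a) - 1) = ((real DIM('a) - 1) * \<gamma>) * (S powr (\<gamma> / 2) - s powr (\<gamma> / 2))\<^sup>2" by simp
   also have "\<dots> \<le> ((real DIM('a) - 1) * \<gamma>) * (\<gamma>\<^sup>2 / (4 * (1 - \<gamma>)) * (S - s) * (s powr (\<gamma> - 1) - S powr (\<gamma> - 1)))"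
    using powr_cauchy_schwarz[OF g(1) g1 s0(1) sS(3)] g D by (intro mult_left_mono) auto
   also have "\<dots> = \<theta> * (S - s) * A" unfolding \<theta>_def A_def by simp
   finally show ?thesis .
  qed
  note so = two_point_second_order[OF v(1) less_imp_le[OF k(1)] ne max]
  have "p\<^sup>2 * lap Hv x - q\<^sup>2 * lap Hv y \<le> k * ((p - q)\<^sup>2 * (real DIM('a) - 1)) / r"
   using so(1)[of p q] by (simp add: r_def mult.assoc)
  also have "\<dots> \<le> k * (\<theta> * (S - s) * A) / r" using CS k r by (intro divide_right_mono mult_left_mono) auto
  also have "\<dots> \<le> k * (\<theta> * (l * r) * A) / r"
  proof -
   have "0 \<le> cM * (S - s)" using cc sS by simp
   then have "0 \<le> A" using A by linarith
   then show ?thesis using Ss(2) k r th1 by (intro divide_right_mono mult_left_mono mult_right_mono) auto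
  qed
  also have "\<dots> = k * \<theta> * l * A" using r by simp
  finally have lapb: "\<gamma> * S powr \<gamma> * lap Hv x - \<gamma> * s powr \<gamma> * lap Hv y \<le> k * \<theta> * l * A" unfolding pq .
  have "S - s = (f x - f y) + h * ((\<gamma> * S powr \<gamma> * lap Hv x - \<gamma> * s powr \<gamma> * lap Hv y) - A * k\<^sup>2)"
   using eq[of x] eq[of y] unfolding so(2,3) S_def s_def A_def by (simp add: algebra_simps)
  also have "f x - f y \<le> L * r" using lipschitz_onD[OF f, of x y] by (simp add: r_def dist_norm)
  finally have "S - s \<le> L * r + h * ((\<gamma> * S powr \<gamma> * lap Hv x - \<gamma> * s powr \<gamma> * lap Hv y) - A * k\<^sup>2)" by simp
  moreover have "h * ((\<gamma> * S powr \<gamma> * lap Hv x - \<gamma> * s powr \<gamma> * lap Hv y) - A * k\<^sup>2) \<le> h * (k * \<theta> * l * A - A * k\<^sup>2)"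
   using lapb h by (intro mult_left_mono) auto
  ultimately have fin1: "k * r < L * r + h * (k * \<theta> * l * A - A * k\<^sup>2)" using Ss(1) by linarith
  have fin2: "k * \<theta> * l * A - A * k\<^sup>2 = - (k * l * (1 - \<theta>)) * A + k * (l - k) * A" by (simp add: power2_eq_square algebra_simps)
  have A1: "cM * (k * r) \<le> A" using A(1) Ss(1) mult_left_mono[of "k * r" "S - s" cM] cc by linarith
  have A2: "A \<le> cd * (l * r)" using A(2) Ss(2) mult_left_mono[of "S - s" "l * r" cd] cc by linarith
  have "(k * l * (1 - \<theta>)) * (cM * (k * r)) \<le> (k * l * (1 - \<theta>)) * A" using A1 k l0 th1 by (intro mult_left_mono) auto
  moreover have "k * (l - k) * A \<le> k * (l - k) * (cd * (l * r))" using A2 k by (intro mult_left_mono) auto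
  ultimately have "k * \<theta> * l * A - A * k\<^sup>2 \<le> - ((k * l * (1 - \<theta>)) * (cM * (k * r))) + k * (l - k) * (cd * (l * r))"
   unfolding fin2 by simp
  then have "h * (k * \<theta> * l * A - A * k\<^sup>2) \<le> h * (- ((k * l * (1 - \<theta>)) * (cM * (k * r))) + k * (l - k) * (cd * (l * r)))"
   using h by (intro mult_left_mono) auto
  with fin1 have "k * r \<le> L * r + h * (- ((k * l * (1 - \<theta>)) * (cM * (k * r))) + k * (l - k) * (cd * (l * r)))" by linarith
  also have "\<dots> = (L + h * (k * cd * l * (l - k)) - h * (k\<^sup>2 * cM * (1 - \<theta>) * l)) * r"
   by (simp add: power2_eq_square algebra_simps)
  finally have "k \<le> L + h * (k * cd * l * (l - k)) - h * (k\<^sup>2 * cM * (1 - \<theta>) * l)" using r by simp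
  then show ?thesis by simp
 qed
 have "l + h * (lip_rate \<gamma> (real DIM('a)) * M powr (\<gamma> - 2)) * l ^ 3 \<le> L"
 proof (cases "l = 0")
  case False
  then have lp: "l > 0" using l0 by simp
  \<comment> \<open>Letting \<open>k\<close> tend to \<open>l\<close> from the left removes the
    error term; \<open>0 < l\<close> leaves room for positive \<open>k\<close>.\<close>
  have "l + h * (l\<^sup>2 * cM * (1 - \<theta>) * l) \<le> L + h * (l * cd * l * (l - l))"
  proof (rule tendsto_le[of "at_left l"])
   show "((\<lambda>k. L + h * (k * cd * l * (l - k))) \<longlongrightarrow> L + h * (l * cd * l * (l - l))) (at_left l)" by (intro tendsto_intros)
   show "((\<lambda>k. k + h * (k\<^sup>2 * cM * (1 - \<theta>) * l)) \<longlongrightarrow> l + h * (l\<^sup>2 * cM * (1 - \<theta>) * l)) (at_left l)" by (intro tendsto_intros)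
   show "\<forall>\<^sub>F k in at_left l. k + h * (k\<^sup>2 * cM * (1 - \<theta>) * l) \<le> L + h * (k * cd * l * (l - k))"
    using eventually_at_left_real[OF lp] by eventually_elim (use key in auto)
  qed simp
  then show ?thesis unfolding lip_rate_def cM_def \<theta>_def by (simp add: power2_eq_square power3_eq_cube mult_ac)
 qed (use L0 in simp)
 with l show ?thesis by (rule that)
qed

section \<open>Decay of the Lipschitz constant\<close>

text \<open>On the ball of radius \<open>u x / (2 * L)\<close> around \<open>x\<close> the function
  stays above \<open>u x / 2\<close>, so the mass is at least half the height times the volume of
  that ball.\<close>

lemma lipschitz_sup_bound:
 fixes u :: "'a::euclidean_space \<Rightarrow> real"
 assumes i: "integrable lborel u" and u: "\<And>x. u x \<ge> 0" and L: "L-lipschitz_on UNIV u" "L > 0"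
 shows "measure lborel (ball (0::'a) 1) * u x ^ (DIM('a) + 1) \<le> 2 ^ (DIM('a) + 1) * L ^ DIM('a) * (\<integral>x. u x)"
proof (cases "u x = 0")
 case True
 then show ?thesis using L(2) integral_nonneg[of lborel u] u by simp
next
 case False
 then have p: "u x > 0" using u[of x] by simp
 define r where "r = u x / (2 * L)"
 have r: "r > 0" "L * r = u x / 2" using p L by (auto simp: r_def)
 have "(u x / 2) * (measure lborel (ball (0::'a) 1) * r ^ DIM('a)) = (\<integral>y. (u x / 2) * indicator (ball x r) y)"
  using content_ball_conv_unit_ball[of r x] r(1) by (simp add: mult.commute)
 also have "\<dots> \<le> (\<integral>x. u x)"
 proof (rule integral_mono[OF _ i])
  show "integrable lborel (\<lambda>y. (u x / 2) * indicator (ball x r) y)"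
   using emeasure_lborel_ball_finite[of x r] by (intro integrable_mult_right integrable_real_indicator) auto
  fix y
  show "(u x / 2) * indicator (ball x r) y \<le> u y"
  proof (cases "y \<in> ball x r")
   case True
   have "u x - u y \<le> L * norm (x - y)" using lipschitz_onD[OF L(1), of x y] by (simp add: dist_norm)
   also have "\<dots> \<le> L * r" using True L(2) by (intro mult_left_mono) (auto simp: dist_norm)
   finally show ?thesis using True r(2) by simp
  qed (use u in simp)
 qed
 finally have "(u x / 2) * (measure lborel (ball (0::'a) 1) * r ^ DIM('a)) * (2 * (2 * L) ^ DIM('a)) \<le> (\<integral>x. u x) * (2 * (2 * L) ^ DIM('a))"
  using L(2) by (intro mult_right_mono) auto
 moreover have "(u x / 2) * (measure lborel (ball (0::'a) 1) * r ^ DIM('a)) * (2 * (2 * L) ^ DIM('a))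
   = measure lborel (ball (0::'a) 1) * u x ^ (DIM('a) + 1)"
 proof -
  have "r ^ DIM('a) * (2 * L) ^ DIM('a) = u x ^ DIM('a)" using L(2) by (subst power_mult_distrib[symmetric]) (simp add: r_def)
  then have "(u x / 2) * (measure lborel (ball (0::'a) 1) * (r ^ DIM('a) * (2 * L) ^ DIM('a))) * 2 = measure lborel (ball (0::'a) 1) * (u x * u x ^ DIM('a))" by simp
  then show ?thesis by (simp only: mult_ac power_add power_one_right)
 qed
 ultimately have "measure lborel (ball (0::'a) 1) * u x ^ (DIM('a) + 1) \<le> (\<integral>x. u x) * (2 * (2 * L) ^ DIM('a))" by (rule order_trans[OF eq_refl, rotated, OF _ sym])
 also have "\<dots> = 2 ^ (DIM('a) + 1) * L ^ DIM('a) * (\<integral>x. u x)" by (simp add: power_mult_distrib)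
 finally show ?thesis .
qed

definition sup_const :: "'a::euclidean_space itself \<Rightarrow> real" where
 "sup_const _ = 2 ^ (DIM('a) + 1) / measure lborel (ball (0::'a) 1)"

text \<open>The inequality of \<open>lipschitz_sup_bound\<close> solved for the height, with
  \<open>m\<close> in place of the mass and \<open>l\<close> in place of the Lipschitz
  constant.\<close>

definition sup_bound :: "'a::euclidean_space itself \<Rightarrow> real \<Rightarrow> real \<Rightarrow> real" where
 "sup_bound T m l = (sup_const T * m * l ^ DIM('a)) powr (1 / (real DIM('a) + 1))"

lemma sup_const_pos: "0 < sup_const TYPE('a::euclidean_space)"
 unfolding sup_const_def using content_ball_pos[of 1 "0::'a"] by simp

lemma lipschitz_le_sup_bound:
 fixes u :: "'a::euclidean_space \<Rightarrow> real"
 assumes i: "integrable lborel u" and u: "\<And>x. u x \<ge> 0" and L: "L-lipschitz_on UNIV u" "L > 0"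
  and m: "(\<integral>x. u x) \<le> m"
 shows "u x \<le> sup_bound TYPE('a) m L"
proof -
 have w: "measure lborel (ball (0::'a) 1) > 0" using content_ball_pos[of 1 "0::'a"] by simp
 have "u x ^ (DIM('a) + 1) \<le> 2 ^ (DIM('a) + 1) * L ^ DIM('a) * (\<integral>x. u x) / measure lborel (ball (0::'a) 1)"
  using lipschitz_sup_bound[OF i u L, of x] w by (simp add: field_simps)
 also have "\<dots> \<le> 2 ^ (DIM('a) + 1) * L ^ DIM('a) * m / measure lborel (ball (0::'a) 1)"
  using m L by (intro divide_right_mono mult_left_mono) auto
 also have "\<dots> = sup_const TYPE('a) * m * L ^ DIM('a)" by (simp add: sup_const_def)
 finally have le: "u x ^ (DIM('a) + 1) \<le> sup_const TYPE('a) * m * L ^ DIM('a)" .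
 show ?thesis
 proof (cases "u x = 0")
  case False
  then have p: "u x > 0" using u[of x] by simp
  have "u x = (u x powr (real DIM('a) + 1)) powr (1 / (real DIM('a) + 1))" using p by (simp add: powr_powr)
  also have "u x powr (real DIM('a) + 1) = u x ^ (DIM('a) + 1)" using p powr_realpow[of "u x" "DIM('a) + 1"] by (simp add: add.commute)
  also have "(u x ^ (DIM('a) + 1)) powr (1 / (real DIM('a) + 1)) \<le> sup_bound TYPE('a) m L"
   unfolding sup_bound_def using le u by (intro powr_mono2) auto
  finally show ?thesis .
 qed (simp add: sup_bound_def)
qed

section \<open>Iterating the Euler step\<close>

text \<open>For the equation \<open>l' = - c * l powr (1 + \<mu>)\<close> the quantity
  \<open>l powr - \<mu>\<close> grows at rate \<open>\<mu> * c\<close>. The step is implicit, so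
  \<open>l k\<close> may be much larger than \<open>l (Suc k)\<close>. If it is at most twice as
  large, the mean value theorem loses only the factor \<open>2 powr (- 1 - \<mu>)\<close>; otherwise
  one step is a jump that is large anyway.\<close>

lemma discrete_decay:
 fixes l :: "nat \<Rightarrow> real"
 assumes mu: "\<mu> > 0" and c: "c > 0" and h: "h > 0" and L: "l 0 \<le> L" and l: "\<And>k. k \<le> N \<Longrightarrow> 0 < l k"
  and step: "\<And>k. k < N \<Longrightarrow> l (Suc k) + h * c * l (Suc k) powr (1 + \<mu>) \<le> l k"
  and small: "\<mu> * c * 2 powr (- 1 - \<mu>) * h \<le> (2 powr \<mu> - 1) * L powr - \<mu>"
 shows "\<mu> * c * 2 powr (- 1 - \<mu>) * (real N * h) \<le> l N powr - \<mu>"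
proof -
 let ?c = "\<mu> * c * 2 powr (- 1 - \<mu>) * h"
 have inc: "l k powr - \<mu> + ?c \<le> l (Suc k) powr - \<mu>" if k: "k < N" and kL: "l k \<le> L" for k
 proof -
  define a b where "a = l (Suc k)" and "b = l k"
  have ab: "0 < a" "0 < b" using l[of k] l[of "Suc k"] k by (auto simp: a_def b_def)
  have st: "a + h * c * a powr (1 + \<mu>) \<le> b" using step[OF k] by (simp add: a_def b_def)
  have "0 < h * c * a powr (1 + \<mu>)" using h c ab by simp
  then have lt: "a < b" using st by linarith
  show ?thesis
  proof (cases "b \<le> 2 * a")
   case True
   obtain z where z: "a < z" "z < b" "b powr - \<mu> - a powr - \<mu> = (b - a) * (- \<mu> * z powr (- \<mu> - 1))"
   proof -
    have "((\<lambda>s. s powr - \<mu>) has_real_derivative - \<mu> * x powr (- \<mu> - 1)) (at x)" if "a \<le> x" for x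
     by (rule has_real_derivative_powr) (use that ab in auto)
    then show ?thesis using MVT2[OF lt, of "\<lambda>s. s powr - \<mu>" "\<lambda>z. - \<mu> * z powr (- \<mu> - 1)"] that by blast
   qed
   have "(2 * a) powr (- \<mu> - 1) \<le> z powr (- \<mu> - 1)" using z ab True mu by (intro powr_mono2') auto
   then have q: "(h * c * a powr (1 + \<mu>)) * (\<mu> * (2 * a) powr (- \<mu> - 1)) \<le> (b - a) * (\<mu> * z powr (- \<mu> - 1))"
    using st mu ab h c z by (intro mult_mono) auto
   have q1: "(2 * a) powr (- \<mu> - 1) = 2 powr (- 1 - \<mu>) * a powr (- (1 + \<mu>))"
    using ab by (simp add: powr_mult minus_diff_commute diff_minus_eq_add[symmetric] del: diff_minus_eq_add)
   have "a powr (1 + \<mu>) * a powr (- (1 + \<mu>)) = 1" using ab by (simp only: powr_add[symmetric]) simp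
   then have "(h * c * a powr (1 + \<mu>)) * (\<mu> * (2 powr (- 1 - \<mu>) * a powr (- (1 + \<mu>)))) = ?c" by (simp add: mult_ac)
   then have "?c \<le> (b - a) * (\<mu> * z powr (- \<mu> - 1))" using q unfolding q1 by (simp only:)
   then show ?thesis using z(3) unfolding a_def[symmetric] b_def[symmetric] by simp
  next
   case False
   \<comment> \<open>Halving \<open>l\<close> multiplies \<open>l powr - \<mu>\<close> by
     \<open>2 powr \<mu>\<close>. Since \<open>l k \<le> L\<close>, the gain is at least
     \<open>(2 powr \<mu> - 1) * L powr - \<mu>\<close>, which \<open>small\<close> compares with
     the required increment.\<close>
   have "2 powr \<mu> * b powr - \<mu> = (b / 2) powr - \<mu>" using ab by (simp add: powr_divide powr_minus field_simps)
   also have "\<dots> \<le> a powr - \<mu>" using False ab mu by (intro powr_mono2') auto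
   finally have 1: "2 powr \<mu> * b powr - \<mu> \<le> a powr - \<mu>" .
   have "(1::real) \<le> 2 powr \<mu>" using mu by (intro ge_one_powr_ge_zero) auto
   moreover have "L powr - \<mu> \<le> b powr - \<mu>" using kL ab mu by (intro powr_mono2') (auto simp: b_def)
   ultimately have "(2 powr \<mu> - 1) * L powr - \<mu> \<le> (2 powr \<mu> - 1) * b powr - \<mu>" by (intro mult_left_mono) auto
   with small 1 show ?thesis unfolding a_def[symmetric] b_def[symmetric] by (simp add: algebra_simps)
  qed
 qed
 have dec: "l k \<le> L" if "k \<le> N" for k
  using that
 proof (induction k)
  case (Suc k)
  have "0 \<le> h * c * l (Suc k) powr (1 + \<mu>)" using h c by simp
  then show ?case using step[of k] Suc by simp
 qed (use L in simp)
 have "real k * ?c \<le> l k powr - \<mu>" if "k \<le> N" for k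
  using that
 proof (induction k)
  case (Suc k)
  then have "real k * ?c \<le> l k powr - \<mu>" "l k powr - \<mu> + ?c \<le> l (Suc k) powr - \<mu>" using inc[of k] dec[of k] by auto
  moreover have "real (Suc k) * ?c = real k * ?c + ?c" by (simp add: algebra_simps)
  ultimately show ?case by linarith
 qed simp
 from this[of N] show ?thesis by (simp add: mult_ac)
qed

text \<open>Dependent choice over pairs of an iterate and a Lipschitz constant for it. The mass of
  \<open>v k - d\<close> is conserved, so the bound of the supremum by \<open>sup_bound\<close> uses
  the same \<open>m\<close> at every step.\<close>

lemma implicit_euler:
 fixes f :: "'a::euclidean_space \<Rightarrow> real"
 assumes D: "DIM('a) \<ge> 2" and g: "0 < \<gamma>" "\<gamma> \<le> 4 / (real DIM('a) + 3)" and h: "h > 0" and d: "0 < d"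
  and f: "\<And>x. 0 \<le> f x" "\<And>x. f x \<le> M" "integrable lborel f" and m: "(\<integral>x. f x) \<le> m"
  and Df: "\<And>x. GDERIV f x :> Df x" "continuous_on UNIV Df" "\<And>x. norm (Df x) \<le> L'" and L: "L-lipschitz_on UNIV f"
 obtains v :: "nat \<Rightarrow> 'a \<Rightarrow> real" and l :: "nat \<Rightarrow> real"
 where "v 0 = (\<lambda>x. f x + d)" "l 0 = L" "\<And>k x. d \<le> v k x" "\<And>k x. v k x \<le> M + d"
  "\<And>k. integrable lborel (\<lambda>x. v k x - d)" "\<And>k. (\<integral>x. v k x - d) = (\<integral>x. f x)"
  "\<And>k. continuous_on UNIV (v k)" "\<And>k. (l k)-lipschitz_on UNIV (v k)"
  "\<And>k. \<exists>Dv Hv DV HV. C2 (v (Suc k)) Dv Hv \<and> C2 (\<lambda>x. \<Phi> \<gamma> (v (Suc k) x)) DV HV \<and> (\<forall>x. v (Suc k) x - h * lap HV x = v k x)"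
  "\<And>k. l (Suc k) + h * (lip_rate \<gamma> (real DIM('a)) * (d + sup_bound TYPE('a) m (l (Suc k))) powr (\<gamma> - 2)) * l (Suc k) ^ 3 \<le> l k"
proof -
 define G where "G v \<longleftrightarrow> (\<exists>Dv L'. (\<forall>x. GDERIV v x :> Dv x) \<and> continuous_on UNIV Dv \<and> (\<forall>x. norm (Dv x) \<le> L'))" for v :: "'a \<Rightarrow> real"
 define S where "S v \<longleftrightarrow> (\<forall>x. d \<le> v x \<and> v x \<le> M + d) \<and> integrable lborel (\<lambda>x. v x - d) \<and> (\<integral>x. v x - d) = (\<integral>x. f x)"
  for v :: "'a \<Rightarrow> real"
 define E where "E w v \<longleftrightarrow> (\<exists>Dv Hv DV HV. C2 v Dv Hv \<and> C2 (\<lambda>x. \<Phi> \<gamma> (v x)) DV HV \<and> (\<forall>x. v x - h * lap HV x = w x))"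
  for w v :: "'a \<Rightarrow> real"
 define R where "R l' l \<longleftrightarrow> l + h * (lip_rate \<gamma> (real DIM('a)) * (d + sup_bound TYPE('a) m l) powr (\<gamma> - 2)) * l ^ 3 \<le> l'" for l' l
 define I where "I p \<longleftrightarrow> G (fst p) \<and> S (fst p) \<and> (snd p)-lipschitz_on UNIV (fst p)" for p :: "('a \<Rightarrow> real) \<times> real"
 let ?f = "\<lambda>x. f x + d"
 have base: "I (?f, L)"
 proof -
  have "GDERIV ?f x :> Df x" for x using GDERIV_add[OF Df(1) GDERIV_const[of d]] by simp
  then have "G ?f" unfolding G_def using Df by blast
  moreover have "S ?f" unfolding S_def using f by simp
  moreover have "L-lipschitz_on UNIV ?f" using L unfolding lipschitz_on_def by (simp add: dist_real_def)
  ultimately show ?thesis unfolding I_def by simp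
 qed
 have step: "\<exists>q. I q \<and> E (fst p) (fst q) \<and> R (snd p) (snd q)" if Ip: "I p" for p
 proof -
  obtain w l where p: "p = (w, l)" by (cases p)
  obtain Dw L' where Dw: "\<And>x. GDERIV w x :> Dw x" "continuous_on UNIV Dw" "\<And>x. norm (Dw x) \<le> L'"
   using Ip unfolding I_def G_def p by auto
  have w: "\<And>x. d \<le> w x" "\<And>x. w x \<le> M + d" "integrable lborel (\<lambda>x. w x - d)" "(\<integral>x. w x - d) = (\<integral>x. f x)"
   "l-lipschitz_on UNIV w"
   using Ip unfolding I_def S_def p by auto
  obtain v Dv Hv DV HV L'' where v: "C2 v Dv Hv" "C2 (\<lambda>x. \<Phi> \<gamma> (v x)) DV HV" "\<And>x. d \<le> v x" "\<And>x. v x \<le> M + d"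
   "integrable lborel (\<lambda>x. v x - d)" "(\<integral>x. v x - d) = (\<integral>x. w x - d)" "\<And>x. norm (Dv x) \<le> L''"
   "\<And>x. v x - h * lap HV x = w x"
   "\<And>x. lap HV x = \<gamma> * v x powr \<gamma> * lap Hv x + \<gamma>\<^sup>2 * v x powr (\<gamma> - 1) * (Dv x \<bullet> Dv x)"
   by (rule resolvent_exists[OF g(1) h d w(1-3) Dw]) blast
  \<comment> \<open>\<open>resolvent_lipschitz\<close> needs an upper bound of \<open>v\<close>
    before it delivers the Lipschitz constant \<open>k\<close>, but \<open>sup_bound\<close> depends
    on \<open>k\<close>. The exact supremum is used first and estimated by \<open>sup_bound\<close>
    afterwards.\<close>
  define M' where "M' = (SUP x. v x)"
  have bdd: "bdd_above (range v)" using v(4) by (intro bdd_aboveI[of _ "M + d"]) auto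
  have vM: "v x \<le> M'" for x unfolding M'_def by (rule cSUP_upper[OF _ bdd]) simp
  have M'0: "M' > 0" using vM[of 0] v(3)[of 0] d by linarith
  obtain k where k: "k-lipschitz_on UNIV v" "k + h * (lip_rate \<gamma> (real DIM('a)) * M' powr (\<gamma> - 2)) * k ^ 3 \<le> l"
   by (rule resolvent_lipschitz[OF D g h d v(1,3) vM v(5,7) _ w(5)]) (use v(8,9) in auto)
  have k0: "k \<ge> 0" using k(1) lipschitz_on_nonneg by blast
  have "R l k"
  proof (cases "k = 0")
   case True
   then show ?thesis using k(2) by (simp add: R_def)
  next
   case False
   have g1: "\<gamma> < 1" using gamma_less_1[of "real DIM('a)" \<gamma>] D g by simp
   have "k-lipschitz_on UNIV (\<lambda>x. v x - d)" using k(1) unfolding lipschitz_on_def by (simp add: dist_real_def)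
   then have "v x - d \<le> sup_bound TYPE('a) m k" for x
    using lipschitz_le_sup_bound[OF v(5), of k m x] v(3,6) w(4) m False k0 by simp
   then have "v x \<le> d + sup_bound TYPE('a) m k" for x by (simp add: algebra_simps)
   then have "M' \<le> d + sup_bound TYPE('a) m k" unfolding M'_def by (intro cSUP_least) auto
   then have "(d + sup_bound TYPE('a) m k) powr (\<gamma> - 2) \<le> M' powr (\<gamma> - 2)" using M'0 g1 by (intro powr_mono2') auto
   then have "h * (lip_rate \<gamma> (real DIM('a)) * (d + sup_bound TYPE('a) m k) powr (\<gamma> - 2)) * k ^ 3
     \<le> h * (lip_rate \<gamma> (real DIM('a)) * M' powr (\<gamma> - 2)) * k ^ 3"
    using h k0 lip_rate_nonneg[of "real DIM('a)" \<gamma>] D g by (intro mult_right_mono mult_left_mono) auto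
   then show ?thesis using k(2) unfolding R_def by linarith
  qed
  moreover have "I (v, k)"
  proof -
   have "G v" unfolding G_def using C2_GDERIV[OF v(1)] C2_cont1[OF v(1)] v(7) by blast
   moreover have "S v" unfolding S_def using v(3-6) w(4) by simp
   ultimately show ?thesis using k(1) by (simp add: I_def)
  qed
  moreover have "E w v" unfolding E_def using v(1,2,8) by blast
  ultimately show ?thesis unfolding p by (intro exI[of _ "(v, k)"]) simp
 qed
 \<comment> \<open>Dependent choice does not prescribe the first element; the clause for
   \<open>k = 0\<close> in the invariant does.\<close>
 have "\<exists>q. \<forall>k. (I (q k) \<and> (k = 0 \<longrightarrow> q k = (?f, L))) \<and> (E (fst (q k)) (fst (q (Suc k))) \<and> R (snd (q k)) (snd (q (Suc k))))"
 proof (rule dependent_nat_choice)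
  show "\<exists>p. I p \<and> (0 = (0::nat) \<longrightarrow> p = (?f, L))" using base by blast
  show "\<exists>q. (I q \<and> (Suc k = 0 \<longrightarrow> q = (?f, L))) \<and> E (fst p) (fst q) \<and> R (snd p) (snd q)"
   if "I p \<and> (k = 0 \<longrightarrow> p = (?f, L))" for p k using step[of p] that by simp
 qed
 then obtain q where q: "\<And>k. I (q k)" "q 0 = (?f, L)" "\<And>k. E (fst (q k)) (fst (q (Suc k)))" "\<And>k. R (snd (q k)) (snd (q (Suc k)))"
  by blast
 show ?thesis
 proof (rule that[of "\<lambda>k. fst (q k)" "\<lambda>k. snd (q k)"])
  show "continuous_on UNIV (fst (q k))" for k
   using q(1)[of k] lipschitz_on_continuous_on unfolding I_def by blast
 qed (use q[unfolded I_def S_def E_def R_def] in \<open>simp_all\<close>)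
qed

text \<open>The constant \<open>\<mu> * c * 2 powr (- 1 - \<mu>)\<close> of
  \<open>discrete_decay\<close>, where \<open>c\<close> results from inserting
  \<open>sup_bound\<close> into the rate of one step. The factor
  \<open>2 powr (\<gamma> - 2)\<close> pays for replacing \<open>d + sup_bound\<close> by
  \<open>2 * sup_bound\<close>.\<close>

definition decay_const :: "'a::euclidean_space itself \<Rightarrow> real \<Rightarrow> real \<Rightarrow> real" where
 "decay_const T \<gamma> m = (let D = real DIM('a); \<mu> = (\<gamma> * D + 2) / (D + 1)
  in \<mu> * (lip_rate \<gamma> D * 2 powr (\<gamma> - 2) * (sup_const T * m) powr ((\<gamma> - 2) / (D + 1))) * 2 powr (- 1 - \<mu>))"

lemma decay_const_pos:
 assumes "DIM('a::euclidean_space) \<ge> 2" "0 < \<gamma>" "\<gamma> < 4 / (real DIM('a) + 3)" "m > 0"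
 shows "0 < decay_const TYPE('a) \<gamma> m"
proof -
 have "0 < (sup_const TYPE('a) * m) powr ((\<gamma> - 2) / (real DIM('a) + 1))"
  using sup_const_pos[where 'a = 'a] assms by simp
 moreover have "0 < lip_rate \<gamma> (real DIM('a))" using assms by (intro lip_rate_pos) auto
 moreover have "0 < (\<gamma> * real DIM('a) + 2) / (real DIM('a) + 1)" using assms by (intro divide_pos_pos add_nonneg_pos) auto
 ultimately show ?thesis unfolding decay_const_def Let_def by (intro mult_pos_pos) auto
qed

text \<open>The shift \<open>d\<close> can be absorbed into \<open>sup_bound\<close> only while the
  Lipschitz constant is above the threshold \<open>B\<close>. Hence the argument by contradiction:
  if the last constant exceeded \<open>B\<close>, so would all earlier ones, and the power law would
  hold at every step.\<close>

lemma euler_lipschitz_decay: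
 fixes l :: "nat \<Rightarrow> real"
 assumes D: "DIM('a::euclidean_space) \<ge> 2" and g: "0 < \<gamma>" "\<gamma> < 4 / (real DIM('a) + 3)" and h: "h > 0" and d: "0 < d" and m: "m > 0"
  and step: "\<And>k. l (Suc k) + h * (lip_rate \<gamma> (real DIM('a)) * (d + sup_bound TYPE('a) m (l (Suc k))) powr (\<gamma> - 2)) * l (Suc k) ^ 3 \<le> l k"
  and l0: "\<And>k. 0 \<le> l k"
 defines "\<mu> \<equiv> (\<gamma> * real DIM('a) + 2) / (real DIM('a) + 1)"
 assumes small: "decay_const TYPE('a) \<gamma> m * h \<le> (2 powr \<mu> - 1) * l 0 powr - \<mu>"
  and B: "B > 0" "d \<le> sup_bound TYPE('a) m B" "B powr - \<mu> \<le> decay_const TYPE('a) \<gamma> m * (real N * h)"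
 shows "l N \<le> B"
proof (rule ccontr)
 assume "\<not> l N \<le> B"
 then have lN: "B < l N" by simp
 let ?D = "real DIM('a)"
 have g1: "\<gamma> < 1" using gamma_less_1[of ?D \<gamma>] D g by simp
 have rate: "0 < lip_rate \<gamma> ?D" using D g by (intro lip_rate_pos) auto
 have mono: "l (Suc k) \<le> l k" for k
 proof -
  have "0 \<le> h * (lip_rate \<gamma> ?D * (d + sup_bound TYPE('a) m (l (Suc k))) powr (\<gamma> - 2)) * l (Suc k) ^ 3"
   using h rate l0[of "Suc k"] by (intro mult_nonneg_nonneg) auto
  then show ?thesis using step[of k] by linarith
 qed
 have lB: "B < l k" if "k \<le> N" for k using lift_Suc_antimono_le[of l, OF mono that] lN by linarith
 have lp: "0 < l k" if "k \<le> N" for k using lB[OF that] B(1) by linarith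
 have mu: "\<mu> > 0" unfolding \<mu>_def using g(1) by (intro divide_pos_pos add_nonneg_pos) auto
 let ?s = "sup_const TYPE('a) * m"
 have s: "?s > 0" using sup_const_pos[where 'a = 'a] m by simp
 define c where "c = lip_rate \<gamma> ?D * 2 powr (\<gamma> - 2) * ?s powr ((\<gamma> - 2) / (?D + 1))"
 have c: "c > 0" unfolding c_def by (intro mult_pos_pos rate) (use s in \<open>auto simp: powr_gt_zero less_imp_neq[symmetric] simp del: mult_eq_0_iff\<close>)
 have dc: "decay_const TYPE('a) \<gamma> m = \<mu> * c * 2 powr (- 1 - \<mu>)" unfolding decay_const_def Let_def c_def \<mu>_def by simp
 have "decay_const TYPE('a) \<gamma> m * (real N * h) \<le> l N powr - \<mu>"
  unfolding dc
 proof (rule discrete_decay[OF mu c h _ lp, where L = "l 0"])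
  show "\<mu> * c * 2 powr (- 1 - \<mu>) * h \<le> (2 powr \<mu> - 1) * l 0 powr - \<mu>" using small unfolding dc .
  fix k assume k: "k < N"
  let ?b = "l (Suc k)"
  have b: "0 < ?b" "B < ?b" using lp[of "Suc k"] lB[of "Suc k"] k by auto
  have sb: "sup_bound TYPE('a) m x = ?s powr (1 / (?D + 1)) * x powr (?D / (?D + 1))" if "x > 0" for x
   unfolding sup_bound_def using that s by (simp add: powr_mult powr_powr powr_realpow[symmetric])
  have "d \<le> sup_bound TYPE('a) m ?b"
  proof -
   have "B powr (?D / (?D + 1)) \<le> ?b powr (?D / (?D + 1))" using b B(1) by (intro powr_mono2) auto
   then have "sup_bound TYPE('a) m B \<le> sup_bound TYPE('a) m ?b" using sb[OF b(1)] sb[OF B(1)] by (simp add: mult_left_mono)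
   then show ?thesis using B(2) by linarith
  qed
  then have "(2 * sup_bound TYPE('a) m ?b) powr (\<gamma> - 2) \<le> (d + sup_bound TYPE('a) m ?b) powr (\<gamma> - 2)"
   using g1 d by (intro powr_mono2') auto
  then have "h * (lip_rate \<gamma> ?D * (2 * sup_bound TYPE('a) m ?b) powr (\<gamma> - 2)) * ?b ^ 3
    \<le> h * (lip_rate \<gamma> ?D * (d + sup_bound TYPE('a) m ?b) powr (\<gamma> - 2)) * ?b ^ 3"
   using h rate b by (intro mult_right_mono mult_left_mono) auto
  moreover have "h * (lip_rate \<gamma> ?D * (2 * sup_bound TYPE('a) m ?b) powr (\<gamma> - 2)) * ?b ^ 3 = h * c * ?b powr (1 + \<mu>)"
  proof -
   \<comment> \<open>Exponent count: \<open>sup_bound\<close> scales like the power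
     \<open>D / (D + 1)\<close> of the Lipschitz constant, and together with the cube this gives
     \<open>1 + \<mu>\<close>.\<close>
   have ex: "?D / (?D + 1) * (\<gamma> - 2) + 3 = 1 + \<mu>" unfolding \<mu>_def by (simp add: field_simps)
   have "(2 * sup_bound TYPE('a) m ?b) powr (\<gamma> - 2)
     = 2 powr (\<gamma> - 2) * (?s powr (1 / (?D + 1) * (\<gamma> - 2)) * ?b powr (?D / (?D + 1) * (\<gamma> - 2)))"
    unfolding sb[OF b(1)] using s b by (simp add: powr_mult powr_powr)
   moreover have "?b powr (?D / (?D + 1) * (\<gamma> - 2)) * ?b ^ 3 = ?b powr (1 + \<mu>)"
    using b unfolding ex[symmetric] powr_add by (simp add: powr_numeral)
   ultimately show ?thesis unfolding c_def by (simp add: mult_ac)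
  qed
  ultimately show "?b + h * c * ?b powr (1 + \<mu>) \<le> l k" using step[of k] by linarith
 qed auto
 moreover have "l N powr - \<mu> < B powr - \<mu>" using lN B(1) mu by (intro powr_less_mono2_neg) auto
 ultimately show False using B(3) by linarith
qed

section \<open>Comparison of the solution with the Euler scheme\<close>

lemma smooth_C2: "smooth f \<Longrightarrow> C2 f (grad f) (\<lambda>b. grad (dird b f))"
proof -
 assume s: "smooth f"
 have "(\<lambda>x. grad f x \<bullet> b) = dird b f" for b
  by (rule ext) (simp add: dird_eq_grad[OF smooth_differentiable[OF s]] inner_commute)
 then show ?thesis unfolding C2_def using s by (simp add: smooth_GDERIV smooth_dird smooth_grad_continuous)
qed

lemma GDERIV_scale: "GDERIV f (c *\<^sub>R x) :> D \<Longrightarrow> GDERIV (\<lambda>x. f (c *\<^sub>R x)) x :> c *\<^sub>R D"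
 using has_derivative_compose[of "\<lambda>x. c *\<^sub>R x" "\<lambda>h. c *\<^sub>R h" x UNIV f "\<lambda>h. h \<bullet> D"]
 by (simp add: gderiv_def has_derivative_scaleR_right)

lemma C2_scale:
 assumes "C2 f Df Hf"
 shows "C2 (\<lambda>x. f (c *\<^sub>R x)) (\<lambda>x. c *\<^sub>R Df (c *\<^sub>R x)) (\<lambda>b x. c\<^sup>2 *\<^sub>R Hf b (c *\<^sub>R x))"
 unfolding C2_def
proof (intro conjI ballI allI)
 show "GDERIV (\<lambda>x. f (c *\<^sub>R x)) x :> c *\<^sub>R Df (c *\<^sub>R x)" for x
  using assms by (intro GDERIV_scale) (simp add: C2_def)
 fix b :: 'a assume b: "b \<in> Basis"
 have "GDERIV (\<lambda>x. Df (c *\<^sub>R x) \<bullet> b) x :> c *\<^sub>R Hf b (c *\<^sub>R x)" for x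
  using assms b by (intro GDERIV_scale[of "\<lambda>x. Df x \<bullet> b"]) (simp add: C2_def)
 from GDERIV_cmult[OF this, of c]
 show "GDERIV (\<lambda>x. c *\<^sub>R Df (c *\<^sub>R x) \<bullet> b) x :> c\<^sup>2 *\<^sub>R Hf b (c *\<^sub>R x)" for x
  by (simp add: power2_eq_square)
 have "continuous_on UNIV (Hf b)" using assms b by (simp add: C2_def)
 then have "continuous_on UNIV (\<lambda>x. Hf b (c *\<^sub>R x))"
  by (rule continuous_on_compose2) (auto intro!: continuous_on_scaleR continuous_on_const continuous_on_id)
 then show "continuous_on UNIV (\<lambda>x. c\<^sup>2 *\<^sub>R Hf b (c *\<^sub>R x))"
  by (rule continuous_on_scaleR[OF continuous_on_const])
qed

text \<open>Dilations of a single bump function, which \<open>exp 1\<close> normalises to 1 at the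
  origin. Each derivative of a dilation costs a factor \<open>1 / real (Suc R)\<close>, hence the
  size of the Laplacian; \<open>Suc\<close> avoids the division by zero at
  \<open>R = 0\<close>.\<close>

lemma cutoff_exists:
 obtains \<zeta> :: "nat \<Rightarrow> 'a::euclidean_space \<Rightarrow> real" and D\<zeta> H\<zeta> C where "\<And>R. C2 (\<zeta> R) (D\<zeta> R) (H\<zeta> R)"
  "\<And>R x. x \<notin> cball 0 (real (Suc R)) \<Longrightarrow> \<zeta> R x = 0" "\<And>R x. 0 \<le> \<zeta> R x" "\<And>R x. \<zeta> R x \<le> 1"
  "\<And>x. (\<lambda>R. \<zeta> R x) \<longlonglongrightarrow> 1" "\<And>R x. \<bar>lap (H\<zeta> R) x\<bar> \<le> C * (1 / real (Suc R))\<^sup>2"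
proof -
 define b where "b x = exp 1 * bump 1 x" for x :: 'a
 have s: "smooth b"
  using bump_span_smooth[OF bump_span.scale[OF bump_span.base[of 1 0]], of "exp 1"] by (simp add: b_def[abs_def] bump_def)
 note C2b = smooth_C2[OF s]
 have b0: "b x = 0" if "x \<notin> cball 0 1" for x using bump_zero[of 1 x] that by (simp add: b_def)
 have bp: "0 \<le> b x" for x by (simp add: b_def bump_def flat_exp_nonneg)
 have b1: "b x \<le> 1" for x
 proof (cases "1 - x \<bullet> x > 0")
  case True
  then have "1 \<le> 1 / (1 - x \<bullet> x)" by simp
  then have "exp (- 1 / (1 - x \<bullet> x)) \<le> exp (- 1)" unfolding minus_divide_left[symmetric] by simp
  then show ?thesis using True by (simp add: b_def bump_def flat_exp_def exp_minus field_simps)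
 qed (simp add: b_def bump_def flat_exp_def)
 have b10: "b 0 = 1" by (simp add: b_def bump_def flat_exp_def exp_minus)
 have cb: "continuous_on UNIV b" by (rule smooth_continuous[OF s])
 obtain C where C: "\<And>x. norm (lap (\<lambda>c. grad (dird c b)) x) \<le> C"
  using bounded_compact_support[OF C2_cont_lap[OF C2b] compact_cball[of 0 1] C2_zero_off(3)[OF C2b closed_cball[of 0 1] b0]] by blast
 define c where "c R = 1 / real (Suc R)" for R
 show ?thesis
 proof (rule that[OF C2_scale[OF C2b]])
  show "b (c R *\<^sub>R x) = 0" if "x \<notin> cball 0 (real (Suc R))" for R x
   using that by (intro b0) (simp add: c_def field_simps)
  show "(\<lambda>R. b (c R *\<^sub>R x)) \<longlonglongrightarrow> 1" for x
  proof -
   have "c \<longlonglongrightarrow> 0" unfolding c_def[abs_def] using LIMSEQ_Suc[OF lim_1_over_n] .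
   then have "(\<lambda>R. c R *\<^sub>R x) \<longlonglongrightarrow> 0 *\<^sub>R x" by (intro tendsto_intros)
   then have "(\<lambda>R. b (c R *\<^sub>R x)) \<longlonglongrightarrow> b (0 *\<^sub>R x)"
    by (rule isCont_tendsto_compose[rotated]) (use cb in \<open>simp add: continuous_on_eq_continuous_at\<close>)
   then show ?thesis using b10 by simp
  qed
  have "lap (\<lambda>d x. (c R)\<^sup>2 *\<^sub>R grad (dird d b) (c R *\<^sub>R x)) x = (c R)\<^sup>2 * lap (\<lambda>d. grad (dird d b)) (c R *\<^sub>R x)" for R x
   by (simp add: lap_def sum_distrib_left)
  then show "\<bar>lap (\<lambda>d x. (c R)\<^sup>2 *\<^sub>R grad (dird d b) (c R *\<^sub>R x)) x\<bar> \<le> C * (1 / real (Suc R))\<^sup>2" for R x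
   using mult_left_mono[OF C[of "c R *\<^sub>R x"], of "(c R)\<^sup>2"] by (simp add: abs_mult c_def mult.commute)
 qed (auto simp: bp b1)
qed

text \<open>The Kato argument with the linear function \<open>j a = c * a\<close> and comparison
  function 0; for linear \<open>j\<close> the discarded term is zero. Taking \<open>c\<close> of
  either sign later gives equality of masses.\<close>

lemma cutoff_mass:
 fixes n :: "real \<Rightarrow> 'a::euclidean_space \<Rightarrow> real" and \<zeta> :: "'a \<Rightarrow> real"
 assumes g: "\<gamma> > 0" and sol: "strong_solution \<gamma> n\<^sub>0 n" and \<zeta>: "C2 \<zeta> D\<zeta> H\<zeta>"
  and Kx: "compact Kx" "\<And>x. x \<notin> Kx \<Longrightarrow> \<zeta> x = 0" and pos: "\<And>x. \<zeta> x \<ge> 0" and ab: "0 < a" "a \<le> b" and c: "\<bar>c\<bar> \<le> 1"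
 defines "A \<equiv> \<lambda>t. c * (\<integral>x. \<zeta> x * n t x)" and "e \<equiv> \<lambda>t. \<integral>x. \<bar>lap H\<zeta> x\<bar> * \<Phi> \<gamma> (n t x)"
 shows "A b - A a \<le> integral {a..b} e"
proof -
 define N where "N = joint n"
 note cN = solution_continuous[OF sol, folded N_def] and cW = solution_continuous_\<Phi>[OF g sol, folded N_def]
 have c\<zeta>: "continuous_on UNIV \<zeta>" by (rule C2_cont0[OF \<zeta>])
 have cL: "continuous_on UNIV (\<lambda>x. \<bar>lap H\<zeta> x\<bar>)" by (intro continuous_intros C2_cont_lap[OF \<zeta>])
 have L0: "\<bar>lap H\<zeta> x\<bar> = 0" if "x \<notin> Kx" for x using C2_zero_off(3)[OF \<zeta> compact_imp_closed[OF Kx(1)] Kx(2) that] by simp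
 have Aeq: "A t = c * (\<integral>x. \<zeta> x * N (t, x))" for t by (simp add: A_def N_def joint_apply)
 have eeq: "e t = (\<integral>x. \<bar>lap H\<zeta> x\<bar> * \<Phi> \<gamma> (N (t, x)))" for t by (simp add: e_def N_def joint_apply)
 obtain D where wd: "weak_directional_derivative space_time (1, 0) N D"
  and eq: "\<And>\<phi>. \<phi> \<in> test_functions space_time \<Longrightarrow> (\<integral>z. D z * \<phi> z) = (\<integral>z. \<Phi> \<gamma> (N z) * slap \<phi> z)"
  using weak_pde[OF g sol, folded N_def, of thesis] by blast
 have D: "locally_integrable space_time D" using wd unfolding weak_directional_derivative_def by blast
 have Z: "C2 (\<lambda>_. 0) (\<lambda>_. 0) (\<lambda>_ _. 0)" unfolding C2_def by (simp add: GDERIV_const)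
 show ?thesis
 proof (rule distributional_le_imp[OF _ _ _ ab])
  show "continuous_on {0<..} A" unfolding Aeq[abs_def] by (intro continuous_intros slice_continuous[OF c\<zeta> Kx cN])
  show "continuous_on {0<..} e" unfolding eeq[abs_def] by (rule slice_continuous[OF cL Kx(1) L0 cW])
  fix \<psi> \<psi>' :: "real \<Rightarrow> real" and Kt
  assume \<psi>: "\<And>t. (\<psi> has_real_derivative \<psi>' t) (at t)" "continuous_on UNIV \<psi>'"
   and Kt: "compact Kt" "\<And>t. t \<notin> Kt \<Longrightarrow> \<psi> t = 0" "Kt \<subseteq> {0<..}" and \<psi>p: "\<And>t. \<psi> t \<ge> 0"
  have c\<psi>: "continuous_on UNIV \<psi>" using \<psi> by (auto intro!: GDERIV_continuous_on)
  have t\<psi>': "\<psi>' t = 0" if "t \<notin> Kt" for t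
   by (rule GDERIV_zero_off[OF compact_imp_closed[OF Kt(1)] Kt(2) that]) (use \<psi> in auto)
  have j: "((\<lambda>a. c * a) has_real_derivative c) (at a)" "((\<lambda>_. c) has_real_derivative 0) (at a)" for a
   by (auto intro!: derivative_eq_intros)
  note f1 = slice_fubini[OF c\<zeta> Kx cN \<psi>(2) Kt(1) t\<psi>' Kt(3)]
  note f4 = slice_fubini[OF cL Kx(1) L0 cW c\<psi> Kt]
  have "(\<integral>z. D z * (\<zeta> (snd z) * \<psi> (fst z) * c)) = - (\<integral>z. \<zeta> (snd z) * \<psi>' (fst z) * (c * (N z - 0)))"
   by (rule kato_time[OF cN wd Z \<zeta> \<psi> Kt Kx j(1) continuous_on_const])
  moreover have "(\<integral>z. D z * (\<zeta> (snd z) * \<psi> (fst z) * c))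
    \<le> (\<integral>z. (\<zeta> (snd z) * \<psi> (fst z) * c) * lap (\<lambda>_ _. 0) (snd z))
     + (\<integral>z. \<psi> (fst z) * (c * (\<Phi> \<gamma> (N z) - 0)) * lap H\<zeta> (snd z))"
   by (rule kato_space[OF cW D eq Z \<zeta> \<psi>(1) Kt Kx \<psi>p pos j]) auto
  moreover have "(\<integral>z. \<psi> (fst z) * (c * (\<Phi> \<gamma> (N z) - 0)) * lap H\<zeta> (snd z))
    \<le> (\<integral>z. \<psi> (fst z) * (\<bar>lap H\<zeta> (snd z)\<bar> * \<Phi> \<gamma> (N z)))"
  proof (rule integral_mono'[OF f4(1)])
   fix z :: "real \<times> 'a"
   have "c * lap H\<zeta> (snd z) \<le> 1 * \<bar>lap H\<zeta> (snd z)\<bar>"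
    using c abs_ge_self[of "c * lap H\<zeta> (snd z)"] mult_right_mono[OF c, of "\<bar>lap H\<zeta> (snd z)\<bar>"] by (simp add: abs_mult)
   then have "(c * lap H\<zeta> (snd z)) * (\<psi> (fst z) * \<Phi> \<gamma> (N z)) \<le> \<bar>lap H\<zeta> (snd z)\<bar> * (\<psi> (fst z) * \<Phi> \<gamma> (N z))"
    using \<psi>p \<Phi>_nonneg[OF g] by (intro mult_right_mono) auto
   then show "\<psi> (fst z) * (c * (\<Phi> \<gamma> (N z) - 0)) * lap H\<zeta> (snd z) \<le> \<psi> (fst z) * (\<bar>lap H\<zeta> (snd z)\<bar> * \<Phi> \<gamma> (N z))"
    by (simp add: mult_ac)
   show "0 \<le> \<psi> (fst z) * (\<bar>lap H\<zeta> (snd z)\<bar> * \<Phi> \<gamma> (N z))"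
    by (intro mult_nonneg_nonneg \<psi>p \<Phi>_nonneg[OF g]) auto
  qed
  moreover have "(\<integral>t. \<psi>' t * A t) = (\<integral>z. \<zeta> (snd z) * \<psi>' (fst z) * (c * (N z - 0)))"
  proof -
   have "(\<integral>t. \<psi>' t * A t) = c * (\<integral>t. \<psi>' t * (\<integral>x. \<zeta> x * N (t, x)))"
    by (simp add: Aeq mult.left_commute)
   also have "\<dots> = c * (\<integral>z. \<psi>' (fst z) * (\<zeta> (snd z) * N z))" using f1(2) by simp
   also have "\<dots> = (\<integral>z. c * (\<psi>' (fst z) * (\<zeta> (snd z) * N z)))" by simp
   also have "(\<lambda>z. c * (\<psi>' (fst z) * (\<zeta> (snd z) * N z))) = (\<lambda>z. \<zeta> (snd z) * \<psi>' (fst z) * (c * (N z - 0)))" by (simp add: mult_ac)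
   finally show ?thesis .
  qed
  ultimately show "- (\<integral>t. \<psi>' t * A t) \<le> (\<integral>t. \<psi> t * e t)"
   using f4(2) by (simp add: eeq lap_def)
 qed
qed

text \<open>\<open>I\<close> is the integral of \<open>\<Phi> \<gamma> n\<close> over the time slab,
  finite by the integrability of \<open>n powr (\<gamma> + 1)\<close> in the definition of a
  solution. It is chosen before the weight \<open>l\<close>, so errors with the Laplacians of the
  cutoffs tend to 0.\<close>

lemma cutoff_error:
 fixes n :: "real \<Rightarrow> 'a::euclidean_space \<Rightarrow> real"
 assumes g: "\<gamma> > 0" and sol: "strong_solution \<gamma> n\<^sub>0 n" and ab: "0 < a" "a < b"
 shows "\<exists>I. \<forall>(l :: 'a \<Rightarrow> real) K B. continuous_on UNIV l \<longrightarrow> compact K \<longrightarrow> (\<forall>x. x \<notin> K \<longrightarrow> l x = 0) \<longrightarrow> (\<forall>x. \<bar>l x\<bar> \<le> B) \<longrightarrow>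
   continuous_on {0<..} (\<lambda>t. \<integral>x. \<bar>l x\<bar> * \<Phi> \<gamma> (n t x)) \<and>
   integral {a..b} (\<lambda>t. \<integral>x. \<bar>l x\<bar> * \<Phi> \<gamma> (n t x)) \<le> B * I"
proof -
 define N where "N = joint n"
 note cN = solution_continuous[OF sol, folded N_def] and cW = solution_continuous_\<Phi>[OF g sol, folded N_def]
 define W where "W z = indicator ({a..b} \<times> UNIV) z * \<Phi> \<gamma> (N z)" for z
 have "set_integrable lborel ({a..b} \<times> UNIV) (\<lambda>(t, x). n t x powr (\<gamma> + 1))"
  using sol ab unfolding strong_solution_def by blast
 then have "integrable lborel (\<lambda>z. \<gamma> / (\<gamma> + 1) * (indicator ({a..b} \<times> UNIV) z *\<^sub>R (case z of (t, x) \<Rightarrow> n t x powr (\<gamma> + 1))))"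
  unfolding set_integrable_def by (rule integrable_mult_right)
 moreover have "(\<lambda>z. \<gamma> / (\<gamma> + 1) * (indicator ({a..b} \<times> UNIV) z *\<^sub>R (case z of (t, x) \<Rightarrow> n t x powr (\<gamma> + 1)))) = W"
  by (simp add: W_def[abs_def] \<Phi>_def N_def joint_apply case_prod_unfold mult_ac)
 ultimately have iW: "integrable lborel W" by simp
 have W0: "W z \<ge> 0" for z unfolding W_def by (intro mult_nonneg_nonneg \<Phi>_nonneg[OF g]) auto
 show ?thesis
 proof (intro exI[of _ "\<integral>z. W z"] allI impI)
  fix l :: "'a \<Rightarrow> real" and K B
  assume l: "continuous_on UNIV l" and K: "compact K" "\<forall>x. x \<notin> K \<longrightarrow> l x = 0" and B: "\<forall>x. \<bar>l x\<bar> \<le> B"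
  let ?e = "\<lambda>t. \<integral>x. \<bar>l x\<bar> * \<Phi> \<gamma> (n t x)"
  have cl: "continuous_on UNIV (\<lambda>x. \<bar>l x\<bar>)" by (intro continuous_intros l)
  have "continuous_on {0<..} (\<lambda>t. \<integral>x. \<bar>l x\<bar> * \<Phi> \<gamma> (N (t, x)))"
   by (rule slice_continuous[OF cl K(1) _ cW]) (simp add: K(2))
  then have ce: "continuous_on {0<..} ?e" by (simp add: N_def joint_apply)
  have "continuous_on {a..b} ?e" by (rule continuous_on_subset[OF ce]) (use ab in auto)
  then have "integral {a..b} ?e = (\<integral>t. indicator {a..b} t * ?e t)" by (simp add: indicator_integral_eq(2))
  also have "\<dots> = (\<integral>t. (\<integral>x. \<bar>l x\<bar> * W (t, x)))"
  proof (rule integral_cong[OF refl])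
   fix t
   have "(\<integral>x. \<bar>l x\<bar> * W (t, x)) = (\<integral>x. indicator {a..b} t * (\<bar>l x\<bar> * \<Phi> \<gamma> (n t x)))"
    by (rule integral_cong) (auto simp: W_def N_def joint_apply indicator_def)
   then show "indicator {a..b} t * ?e t = (\<integral>x. \<bar>l x\<bar> * W (t, x))" by simp
  qed
  finally have eq: "integral {a..b} ?e = (\<integral>t. (\<integral>x. \<bar>l x\<bar> * W (t, x)))" .
  have eq2: "(\<integral>t. (\<integral>x. \<bar>l x\<bar> * W (t, x))) = (\<integral>z. \<bar>l (snd z)\<bar> * W z)"
   and i: "integrable lborel (\<lambda>z. \<bar>l (snd z)\<bar> * W z)"
  proof -
   have "(\<lambda>z::real \<times> 'a. \<bar>l (snd z)\<bar>) \<in> borel_measurable borel"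
    by (intro borel_measurable_continuous_onI continuous_on_snd_comp cl)
   then have i: "integrable lborel (\<lambda>z. \<bar>l (snd z)\<bar> * W z)"
    using integrable_mult_bounded[OF iW, of "\<lambda>z. \<bar>l (snd z)\<bar>" B] B by (simp add: mult.commute)
   then have i': "integrable (lborel \<Otimes>\<^sub>M lborel) (\<lambda>z. \<bar>l (snd z)\<bar> * W z)" by (simp add: lborel_prod)
   show "(\<integral>t. (\<integral>x. \<bar>l x\<bar> * W (t, x))) = (\<integral>z. \<bar>l (snd z)\<bar> * W z)"
    using lborel_pair.integral_fst'[OF i'] by (simp add: lborel_prod)
   show "integrable lborel (\<lambda>z. \<bar>l (snd z)\<bar> * W z)" by (rule i)
  qed
  have "(\<integral>z. \<bar>l (snd z)\<bar> * W z) \<le> (\<integral>z. B * W z)"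
   by (rule integral_mono[OF i]) (use iW B W0 in \<open>auto intro!: mult_right_mono\<close>)
  then show "continuous_on {0<..} ?e \<and> integral {a..b} ?e \<le> B * (\<integral>z. W z)" using ce eq eq2 by simp
 qed
qed

lemma cutoff_limit:
 assumes z: "\<And>R x. 0 \<le> \<zeta> R x" "\<And>R x. \<zeta> R x \<le> (1::real)" "\<And>x. (\<lambda>R::nat. \<zeta> R x) \<longlonglongrightarrow> 1" "\<And>R. continuous_on UNIV (\<zeta> R)"
  and f: "integrable lborel (f :: 'a::euclidean_space \<Rightarrow> real)"
 shows "(\<lambda>R. \<integral>x. \<zeta> R x * f x) \<longlonglongrightarrow> (\<integral>x. f x)" "\<And>R. integrable lborel (\<lambda>x. \<zeta> R x * f x)"
proof -
 have m: "\<zeta> R \<in> borel_measurable lborel" for R using borel_measurable_continuous_onI[OF z(4)] by simp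
 have b: "norm (\<zeta> R x * f x) \<le> norm (f x)" for R x
  using mult_right_mono[of "\<zeta> R x" 1 "\<bar>f x\<bar>"] z(1,2)[of R x] by (simp add: abs_mult)
 show "(\<lambda>R. \<integral>x. \<zeta> R x * f x) \<longlonglongrightarrow> (\<integral>x. f x)"
 proof (rule integral_dominated_convergence[where w = "\<lambda>x. norm (f x)"])
  show "AE x in lborel. (\<lambda>R. \<zeta> R x * f x) \<longlonglongrightarrow> f x"
   by (intro AE_I2) (use tendsto_mult_right[OF z(3)] in simp)
 qed (use f m b in auto)
 show "integrable lborel (\<lambda>x. \<zeta> R x * f x)" for R
  by (rule integrable_bound[OF f]) (use f m b in auto)
qed

lemma error_tendsto_0: "(\<lambda>R. C * (1 / real (Suc R))\<^sup>2 * I) \<longlonglongrightarrow> 0"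
proof -
 have "(\<lambda>R. C * (1 / real (Suc R))\<^sup>2 * I) \<longlonglongrightarrow> C * 0\<^sup>2 * I"
  by (intro tendsto_intros) (use LIMSEQ_Suc[OF lim_1_over_n] in simp)
 then show ?thesis by simp
qed

lemma mass_conserved:
 fixes n :: "real \<Rightarrow> 'a::euclidean_space \<Rightarrow> real"
 assumes g: "\<gamma> > 0" and sol: "strong_solution \<gamma> n\<^sub>0 n" and ab: "0 < a" "a < b"
 shows "(\<integral>x. n b x) = (\<integral>x. n a x)"
proof -
 obtain \<zeta> :: "nat \<Rightarrow> 'a \<Rightarrow> real" and D\<zeta> H\<zeta> C where z: "\<And>R. C2 (\<zeta> R) (D\<zeta> R) (H\<zeta> R)"
  "\<And>R x. x \<notin> cball 0 (real (Suc R)) \<Longrightarrow> \<zeta> R x = 0" "\<And>R x. 0 \<le> \<zeta> R x" "\<And>R x. \<zeta> R x \<le> 1"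
  "\<And>x. (\<lambda>R. \<zeta> R x) \<longlonglongrightarrow> 1" "\<And>R x. \<bar>lap (H\<zeta> R) x\<bar> \<le> C * (1 / real (Suc R))\<^sup>2"
  by (rule cutoff_exists[where 'a = 'a]) (rule that)
 obtain I where "\<forall>(l :: 'a \<Rightarrow> real) K B. continuous_on UNIV l \<longrightarrow> compact K \<longrightarrow> (\<forall>x. x \<notin> K \<longrightarrow> l x = 0) \<longrightarrow> (\<forall>x. \<bar>l x\<bar> \<le> B) \<longrightarrow>
   continuous_on {0<..} (\<lambda>t. \<integral>x. \<bar>l x\<bar> * \<Phi> \<gamma> (n t x)) \<and>
   integral {a..b} (\<lambda>t. \<integral>x. \<bar>l x\<bar> * \<Phi> \<gamma> (n t x)) \<le> B * I"
  using cutoff_error[OF g sol ab] by (elim exE) (rule that)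
 note I = this[rule_format]
 note ni = solution_integrable[OF sol less_imp_le]
 note lim = cutoff_limit(1)[OF z(3,4,5) C2_cont0[OF z(1)] ni]
 have b0: "0 < b" using ab by simp
 have le: "c * (\<integral>x. n b x) - c * (\<integral>x. n a x) \<le> 0" if c: "\<bar>c\<bar> \<le> 1" for c :: real
 proof (rule LIMSEQ_le[OF tendsto_diff[OF tendsto_mult_left[OF lim[OF b0]] tendsto_mult_left[OF lim[OF ab(1)]]] error_tendsto_0[of C I]])
  have "c * (\<integral>x. \<zeta> R x * n b x) - c * (\<integral>x. \<zeta> R x * n a x) \<le> C * (1 / real (Suc R))\<^sup>2 * I" for R
  proof -
   have "integral {a..b} (\<lambda>t. \<integral>x. \<bar>lap (H\<zeta> R) x\<bar> * \<Phi> \<gamma> (n t x)) \<le> C * (1 / real (Suc R))\<^sup>2 * I"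
    using I[OF C2_cont_lap[OF z(1)[of R]] compact_cball[of 0 "real (Suc R)"] C2_zero_off(3)[OF z(1)[of R] closed_cball[of 0 "real (Suc R)"] z(2)[of _ R]] z(6)[of R]] by blast
   with cutoff_mass[OF g sol z(1)[of R] compact_cball[of 0 "real (Suc R)"] z(2)[of _ R] z(3) ab(1) less_imp_le[OF ab(2)] c] show ?thesis by linarith
  qed
  then show "\<exists>N. \<forall>R\<ge>N. c * (\<integral>x. \<zeta> R x * n b x) - c * (\<integral>x. \<zeta> R x * n a x) \<le> C * (1 / real (Suc R))\<^sup>2 * I" by blast
 qed
 show ?thesis using le[of 1] le[of "-1"] by simp
qed

lemma integrable_pos_part_diff:
 fixes f u :: "'a::euclidean_space \<Rightarrow> real"
 assumes "integrable lborel f" "\<And>x. f x \<ge> 0" "u \<in> borel_measurable borel" "\<And>x. u x \<ge> 0"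
 shows "integrable lborel (\<lambda>x. max 0 (f x - u x))"
 by (rule integrable_bound[OF assms(1)]) (use assms in \<open>auto simp: max_def intro!: AE_I2\<close>)

text \<open>\<open>kobayashi_estimate\<close> is applied to the integrals with a cutoff, which are
  continuous in time and satisfy the differential inequality up to \<open>e\<close>; then the radius
  of the cutoff tends to infinity and the integral of \<open>e\<close> to 0.\<close>

lemma euler_comparison:
 fixes n :: "real \<Rightarrow> 'a::euclidean_space \<Rightarrow> real" and v :: "nat \<Rightarrow> 'a \<Rightarrow> real"
 assumes g: "\<gamma> > 0" and sol: "strong_solution \<gamma> n\<^sub>0 n" and sT: "0 < s" "s < T" and h: "h > 0"
  and v: "\<And>k x. v k x \<ge> 0" "\<And>k. continuous_on UNIV (v k)"
   "\<And>k. \<exists>Dv Hv DV HV. C2 (v (Suc k)) Dv Hv \<and> C2 (\<lambda>x. \<Phi> \<gamma> (v (Suc k) x)) DV HV \<and> (\<forall>x. v (Suc k) x - h * lap HV x = v k x)"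
  and zero: "\<And>t. t \<in> {s..T} \<Longrightarrow> (\<integral>x. max 0 (n t x - v 0 x)) \<le> E + C * (t - s)\<^sup>2"
  and init: "\<And>k. k \<le> M \<Longrightarrow> (\<integral>x. max 0 (n s x - v k x)) \<le> E + C * (real k * h)\<^sup>2" and C: "C \<ge> 0"
  and k: "k \<le> M" and t: "t \<in> {s..T}"
 shows "(\<integral>x. max 0 (n t x - v k x)) \<le> E + C * ((t - s - real k * h)\<^sup>2 + h * (t - s))"
proof -
 obtain \<zeta> :: "nat \<Rightarrow> 'a \<Rightarrow> real" and D\<zeta> H\<zeta> C' where z: "\<And>R. C2 (\<zeta> R) (D\<zeta> R) (H\<zeta> R)"
  "\<And>R x. x \<notin> cball 0 (real (Suc R)) \<Longrightarrow> \<zeta> R x = 0" "\<And>R x. 0 \<le> \<zeta> R x" "\<And>R x. \<zeta> R x \<le> 1"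
  "\<And>x. (\<lambda>R. \<zeta> R x) \<longlonglongrightarrow> 1" "\<And>R x. \<bar>lap (H\<zeta> R) x\<bar> \<le> C' * (1 / real (Suc R))\<^sup>2"
  by (rule cutoff_exists[where 'a = 'a]) (rule that)
 obtain I where "\<forall>(l :: 'a \<Rightarrow> real) K B. continuous_on UNIV l \<longrightarrow> compact K \<longrightarrow> (\<forall>x. x \<notin> K \<longrightarrow> l x = 0) \<longrightarrow> (\<forall>x. \<bar>l x\<bar> \<le> B) \<longrightarrow>
   continuous_on {0<..} (\<lambda>t. \<integral>x. \<bar>l x\<bar> * \<Phi> \<gamma> (n t x)) \<and>
   integral {s..T} (\<lambda>t. \<integral>x. \<bar>l x\<bar> * \<Phi> \<gamma> (n t x)) \<le> B * I"
  using cutoff_error[OF g sol sT] by (elim exE) (rule that)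
 note I = this[rule_format]
 note n0 = solution_nonneg[OF sol]
 note ni = solution_integrable[OF sol less_imp_le]
 have vm: "v k \<in> borel_measurable borel" for k by (rule borel_measurable_continuous_onI[OF v(2)])
 have int: "integrable lborel (\<lambda>x. max 0 (n t x - v k x))" if "0 < t" for t k
  by (rule integrable_pos_part_diff[OF ni[OF that] n0[OF that] vm v(1)])
 note lim = cutoff_limit[OF z(3,4,5) C2_cont0[OF z(1)] int]
 have pos: "0 < t" if "t \<in> {s..T}" for t using that sT by auto
 have le: "(\<integral>x. \<zeta> R x * max 0 (n t x - v k x)) \<le> (\<integral>x. max 0 (n t x - v k x))" if "0 < t" for R t k
 proof (rule integral_mono[OF lim(2)[OF that] int[OF that]])
  show "\<zeta> R x * max 0 (n t x - v k x) \<le> max 0 (n t x - v k x)" for x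
   using mult_right_mono[OF z(4)[of R x], of "max 0 (n t x - v k x)"] by simp
 qed
 note cN = solution_continuous[OF sol, unfolded joint_apply[abs_def]]
 have main: "(\<integral>x. \<zeta> R x * max 0 (n t x - v k x)) \<le> (E + C * ((t - s - real k * h)\<^sup>2 + h * (t - s))) + C' * (1 / real (Suc R))\<^sup>2 * I" for R
 proof -
  define A where "A k t = (\<integral>x. \<zeta> R x * max 0 (n t x - v k x))" for k t
  define e where "e t = (\<integral>x. \<bar>lap (H\<zeta> R) x\<bar> * \<Phi> \<gamma> (n t x))" for t
  have e: "continuous_on {0<..} e" "integral {s..T} e \<le> C' * (1 / real (Suc R))\<^sup>2 * I"
   unfolding e_def[abs_def]
   using I[OF C2_cont_lap[OF z(1)[of R]] compact_cball[of 0 "real (Suc R)"] C2_zero_off(3)[OF z(1)[of R] closed_cball[of 0 "real (Suc R)"] z(2)[of _ R]] z(6)[of R]] by blast+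
  have sub: "{s..T} \<subseteq> {0<..}" using sT by auto
  have eT: "continuous_on {s..T} e" by (rule continuous_on_subset[OF e(1) sub])
  have e0: "e t \<ge> 0" for t unfolding e_def by (intro integral_nonneg mult_nonneg_nonneg \<Phi>_nonneg[OF g]) auto
  have cA: "continuous_on {s..T} (A k)" for k
  proof -
   have "continuous_on {0<..} (\<lambda>t. \<integral>x. \<zeta> R x * max 0 (n (fst (t, x)) (snd (t, x)) - v k (snd (t, x))))"
    by (rule slice_continuous[OF C2_cont0[OF z(1)[of R]] compact_cball[of 0 "real (Suc R)"] z(2)[of _ R]])
     (auto intro!: continuous_intros cN continuous_on_snd_comp v(2) simp del: mem_cball)
   then show ?thesis unfolding A_def[abs_def] using continuous_on_subset[OF _ sub] by simp
  qed
  have "A k t \<le> E + C * ((t - s - real k * h)\<^sup>2 + h * (t - s)) + integral {s..t} e"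
  proof (rule kobayashi_estimate[OF cA eT e0 h _ _ _ C k t])
   fix k a b assume ab: "s \<le> a" "a \<le> b" "b \<le> T"
   obtain Dv Hv DV HV where w: "C2 (v (Suc k)) Dv Hv" "C2 (\<lambda>x. \<Phi> \<gamma> (v (Suc k) x)) DV HV" "\<And>x. v (Suc k) x - h * lap HV x = v k x"
    using v(3)[of k] by blast
   show "A (Suc k) b - A (Suc k) a \<le> integral {a..b} (\<lambda>t. (A k t - A (Suc k) t) / h + e t)"
    unfolding A_def e_def
    by (rule kato_time_step[OF g sol w(1) v(1) w(2) z(1)[of R] compact_cball[of 0 "real (Suc R)"] z(2)[of _ R] z(3) h w(3) v(2)]) (use ab sT in auto)
  next
   show "A 0 t \<le> E + C * (t - s)\<^sup>2" if "t \<in> {s..T}" for t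
    unfolding A_def using le[OF pos[OF that], of R 0] zero[OF that] by linarith
   show "A k s \<le> E + C * (real k * h)\<^sup>2" if "k \<le> M" for k
    unfolding A_def using le[OF sT(1), of R k] init[OF that] by linarith
  qed
  moreover have "integral {s..t} e \<le> integral {s..T} e"
   by (rule integral_subset_le) (use t e0 in \<open>auto intro!: integrable_continuous_real continuous_on_subset[OF eT]\<close>)
  ultimately show ?thesis using e(2) unfolding A_def by linarith
 qed
 have "(\<lambda>R. (E + C * ((t - s - real k * h)\<^sup>2 + h * (t - s))) + C' * (1 / real (Suc R))\<^sup>2 * I) \<longlonglongrightarrow> (E + C * ((t - s - real k * h)\<^sup>2 + h * (t - s))) + 0"
  by (intro tendsto_add tendsto_const error_tendsto_0)
 then show ?thesis using LIMSEQ_le[OF lim(1)[OF pos[OF t]]] main by auto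
qed

section \<open>Continuity in time of the Euler scheme\<close>

lemma C2_reflect:
 assumes "C2 f Df Hf"
 shows "C2 (\<lambda>y. f (x - y)) (\<lambda>y. - Df (x - y)) (\<lambda>b y. Hf b (x - y))"
proof -
 have r: "GDERIV (\<lambda>y. g (x - y)) y :> - D" if "GDERIV g (x - y) :> D" for g :: "'a \<Rightarrow> real" and y D
 proof -
  have "((\<lambda>y. x - y) has_derivative (\<lambda>h. - h)) (at y)" by (auto intro!: derivative_eq_intros)
  from has_derivative_compose[OF this, of g "\<lambda>h. h \<bullet> D"] that show ?thesis by (simp add: gderiv_def)
 qed
 show ?thesis unfolding C2_def
 proof (intro conjI ballI allI)
  show "GDERIV (\<lambda>y. f (x - y)) y :> - Df (x - y)" for y using assms by (intro r) (simp add: C2_def)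
  fix b :: 'a assume b: "b \<in> Basis"
  have "GDERIV (\<lambda>y. Df (x - y) \<bullet> b) y :> - Hf b (x - y)" for y
   using assms b by (intro r[of "\<lambda>y. Df y \<bullet> b"]) (simp add: C2_def)
  from GDERIV_cmult[OF this, of "-1"] show "GDERIV (\<lambda>y. - Df (x - y) \<bullet> b) y :> Hf b (x - y)" for y by simp
  have "continuous_on UNIV (Hf b)" using assms b by (simp add: C2_def)
  then show "continuous_on UNIV (\<lambda>y. Hf b (x - y))"
   by (rule continuous_on_compose2) (auto intro!: continuous_on_diff continuous_on_const continuous_on_id)
 qed
qed

lemma lap_by_parts:
 fixes F \<eta> :: "'a::euclidean_space \<Rightarrow> real"
 assumes F: "C2 F DF HF" and \<eta>: "C2 \<eta> D\<eta> H\<eta>" and K: "compact K" "\<And>x. x \<notin> K \<Longrightarrow> \<eta> x = 0"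
 shows "(\<integral>x. lap HF x * \<eta> x) = (\<integral>x. F x * lap H\<eta> x)"
proof -
 note z = C2_zero_off[OF \<eta> compact_imp_closed[OF K(1)] K(2)]
 have cH: "continuous_on UNIV (\<lambda>x. Hg b x \<bullet> c)" if "C2 g Dg Hg" "b \<in> Basis" for g :: "'a \<Rightarrow> real" and Dg Hg b c
  using that by (intro continuous_intros) (simp add: C2_def)
 have b: "integrable lborel (\<lambda>x. (HF b x \<bullet> b) * \<eta> x)" "integrable lborel (\<lambda>x. F x * (H\<eta> b x \<bullet> b))"
  "(\<integral>x. (HF b x \<bullet> b) * \<eta> x) = (\<integral>x. F x * (H\<eta> b x \<bullet> b))" if b: "b \<in> Basis" for b
 proof -
  have c1: "continuous_on UNIV (\<lambda>x. (HF b x \<bullet> b) * \<eta> x)" by (intro continuous_on_mult cH[OF F b] C2_cont0[OF \<eta>])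
  have c2: "continuous_on UNIV (\<lambda>x. F x * (H\<eta> b x \<bullet> b))" by (intro continuous_on_mult cH[OF \<eta> b] C2_cont0[OF F])
  show i: "integrable lborel (\<lambda>x. (HF b x \<bullet> b) * \<eta> x)" "integrable lborel (\<lambda>x. F x * (H\<eta> b x \<bullet> b))"
   by (rule integrable_compact_support[OF c1 K(1)], simp add: K)
    (rule integrable_compact_support[OF c2 K(1)], simp add: z(2) b)
  define G where "G x = ((DF x \<bullet> b) *\<^sub>R D\<eta> x + \<eta> x *\<^sub>R HF b x) - (F x *\<^sub>R H\<eta> b x + (D\<eta> x \<bullet> b) *\<^sub>R DF x)" for x
  have G: "GDERIV (\<lambda>x. (DF x \<bullet> b) * \<eta> x - F x * (D\<eta> x \<bullet> b)) x :> G x" for x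
   unfolding G_def
   by (intro GDERIV_diff GDERIV_mult C2_GDERIV[OF F] C2_GDERIV[OF \<eta>] C2_GDERIV2[OF F b] C2_GDERIV2[OF \<eta> b])
  have bG: "b \<bullet> G x = (HF b x \<bullet> b) * \<eta> x - F x * (H\<eta> b x \<bullet> b)" for x
   unfolding G_def by (simp add: inner_add_right inner_diff_right inner_commute)
  have "(\<integral>x. b \<bullet> G x) = 0"
   by (rule integral_GDERIV_eq_0(2)[OF G _ K(1)]) (use c1 c2 in \<open>auto simp: bG K z intro!: continuous_on_diff\<close>)
  then show "(\<integral>x. (HF b x \<bullet> b) * \<eta> x) = (\<integral>x. F x * (H\<eta> b x \<bullet> b))" using i by (simp add: bG)
 qed
 have "(\<integral>x. lap HF x * \<eta> x) = (\<Sum>c\<in>Basis. \<integral>x. (HF c x \<bullet> c) * \<eta> x)"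
  unfolding lap_def sum_distrib_right by (rule integral_sum) (rule b)
 also have "\<dots> = (\<Sum>c\<in>Basis. \<integral>x. F x * (H\<eta> c x \<bullet> c))" by (rule sum.cong[OF refl b(3)])
 also have "\<dots> = (\<integral>x. F x * lap H\<eta> x)"
  unfolding lap_def sum_distrib_left by (rule integral_sum[symmetric]) (rule b)
 finally show ?thesis .
qed

text \<open>A pointwise modulus of continuity in the discrete time \<open>real k * h\<close>,
  independent of \<open>h\<close>. Tested with a mollifier of radius \<open>r\<close>, one step
  moves the value by at most \<open>h\<close> times \<open>\<Phi> \<gamma> M\<close> times the L^1
  norm of the Laplacian of the mollifier; removing the mollifier costs \<open>L * r\<close> at each
  end.\<close>

lemma euler_drift:
 fixes v :: "nat \<Rightarrow> 'a::euclidean_space \<Rightarrow> real"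
 assumes g: "\<gamma> > 0" and h: "h > 0" and r: "r > 0" and d: "0 \<le> d" and v: "\<And>k x. d \<le> v k x" "\<And>k x. v k x \<le> M"
  "\<And>k. L-lipschitz_on UNIV (v k)" "\<And>k. integrable lborel (\<lambda>x. v k x - d)"
  "\<And>k. \<exists>Dv Hv DV HV. C2 (v (Suc k)) Dv Hv \<and> C2 (\<lambda>x. \<Phi> \<gamma> (v (Suc k) x)) DV HV \<and> (\<forall>x. v (Suc k) x - h * lap HV x = v k x)"
 shows "\<bar>v k x - v 0 x\<bar> \<le> 2 * L * r + real k * h * (\<Phi> \<gamma> M * (\<integral>y. \<bar>lap (\<lambda>b. grad (dird b (moll r))) (y::'a)\<bar>))"
proof -
 define I where "I = (\<integral>y. \<bar>lap (\<lambda>b. grad (dird b (moll r))) (y::'a)\<bar>)"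
 define w where "w k y = v k y - d" for k y
 define c where "c k = conv (moll r) (w k) x" for k
 note C = smooth_C2[OF moll_smooth[of r, where ?'a = 'a]]
 note Cx = C2_reflect[OF C, of x]
 have wi: "integrable lborel (w k)" for k unfolding w_def by (rule v(4))
 have K: "compact (cball x r)" by simp
 have K0: "moll r (x - y) = 0" if "y \<notin> cball x r" for y using that by (intro moll_zero r) (simp add: dist_norm norm_minus_commute)
 have cl: "continuous_on UNIV (\<lambda>y. \<bar>lap (\<lambda>b. grad (dird b (moll r))) (y::'a)\<bar>)" by (intro continuous_intros C2_cont_lap[OF C])
 have il: "integrable lborel (\<lambda>y. \<bar>lap (\<lambda>b. grad (dird b (moll r))) (y::'a)\<bar>)"
  by (rule integrable_compact_support[OF cl compact_cball[of 0 r]])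
   (subst C2_zero_off(3)[OF C closed_cball[of 0 r]], auto intro: moll_zero[OF r] simp del: mem_cball)
 have step: "\<bar>c (Suc k) - c k\<bar> \<le> h * (\<Phi> \<gamma> M * I)" for k
 proof -
  obtain Dv Hv DV HV where V: "C2 (v (Suc k)) Dv Hv" "C2 (\<lambda>x. \<Phi> \<gamma> (v (Suc k) x)) DV HV" "\<And>x. v (Suc k) x - h * lap HV x = v k x"
   using v(5)[of k] by blast
  let ?l = "lap (\<lambda>b y. grad (dird b (moll r)) (x - y))"
  have l: "?l y = lap (\<lambda>b. grad (dird b (moll r))) (x - y)" for y by (simp add: lap_def)
  have il': "integrable lborel (\<lambda>y. \<bar>?l y\<bar>)" unfolding l by (rule integrable_reflect[OF il])
  have "c (Suc k) - c k = (\<integral>y. moll r (x - y) * w (Suc k) y - moll r (x - y) * w k y)"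
   unfolding c_def conv_def
   by (rule integral_diff[symmetric]) (rule conv_GDERIV(3)[OF smooth_cpt_moll[OF r] wi])+
  also have "\<dots> = (\<integral>y. h * (lap HV y * moll r (x - y)))"
  proof (rule integral_cong[OF refl])
   fix y
   have "w (Suc k) y - w k y = h * lap HV y" using V(3)[of y] by (simp add: w_def)
   then show "moll r (x - y) * w (Suc k) y - moll r (x - y) * w k y = h * (lap HV y * moll r (x - y))"
    unfolding right_diff_distrib[symmetric] by simp
  qed
  also have "\<dots> = h * (\<integral>y. \<Phi> \<gamma> (v (Suc k) y) * ?l y)" using lap_by_parts[OF V(2) Cx K K0] by simp
  finally have "\<bar>c (Suc k) - c k\<bar> = h * \<bar>\<integral>y. \<Phi> \<gamma> (v (Suc k) y) * ?l y\<bar>" using h by (simp add: abs_mult)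
  also have "\<bar>\<integral>y. \<Phi> \<gamma> (v (Suc k) y) * ?l y\<bar> \<le> (\<integral>y. \<bar>\<Phi> \<gamma> (v (Suc k) y) * ?l y\<bar>)" by (rule integral_abs_bound)
  also have "\<dots> \<le> (\<integral>y. \<Phi> \<gamma> M * \<bar>?l y\<bar>)"
  proof (rule integral_mono')
   show "integrable lborel (\<lambda>y. \<Phi> \<gamma> M * \<bar>?l y\<bar>)" using il' by simp
   fix y
   have "0 \<le> v (Suc k) y" using v(1)[of "Suc k" y] d by linarith
   then have "\<Phi> \<gamma> (v (Suc k) y) \<le> \<Phi> \<gamma> M" using v(2)[of "Suc k" y] g by (intro \<Phi>_mono) auto
   then show "\<bar>\<Phi> \<gamma> (v (Suc k) y) * ?l y\<bar> \<le> \<Phi> \<gamma> M * \<bar>?l y\<bar>"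
    using \<Phi>_nonneg[OF g] by (simp add: abs_mult mult_right_mono)
   show "0 \<le> \<Phi> \<gamma> M * \<bar>?l y\<bar>" using \<Phi>_nonneg[OF g] by simp
  qed
  also have "\<dots> = \<Phi> \<gamma> M * I"
   using integral_reflect[of "\<lambda>y. \<bar>lap (\<lambda>b. grad (dird b (moll r))) (y::'a)\<bar>" x] borel_measurable_continuous_onI[OF cl]
   by (simp add: l I_def)
  finally show ?thesis using h by (simp add: mult_left_mono)
 qed
 have ck: "\<bar>c k - c 0\<bar> \<le> real k * h * (\<Phi> \<gamma> M * I)" for k
 proof (induction k)
  case (Suc k)
  have "\<bar>c (Suc k) - c 0\<bar> \<le> \<bar>c (Suc k) - c k\<bar> + \<bar>c k - c 0\<bar>" by linarith
  also have "\<dots> \<le> h * (\<Phi> \<gamma> M * I) + real k * h * (\<Phi> \<gamma> M * I)" using step[of k] Suc by linarith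
  finally show ?case by (simp add: algebra_simps)
 qed simp
 have close: "\<bar>c k - w k x\<bar> \<le> L * r" for k
  unfolding c_def
 proof (rule conv_moll_close[OF r wi])
  fix y assume y: "y \<in> cball x r"
  have "\<bar>w k y - w k x\<bar> \<le> L * dist y x" using lipschitz_onD[OF v(3), of y x k] by (simp add: w_def dist_real_def)
  also have "\<dots> \<le> L * r" using y lipschitz_on_nonneg[OF v(3)[of k]] by (intro mult_left_mono) (auto simp: dist_commute)
  finally show "\<bar>w k y - w k x\<bar> \<le> L * r" .
 qed
 have "v k x - v 0 x = w k x - w 0 x" by (simp add: w_def)
 then show ?thesis using close[of k] close[of 0] ck[of k] unfolding I_def by linarith
qed

section \<open>Lipschitz approximation of the solution\<close>

text \<open>Constants such as the shift or a uniform drift bound are not integrable over the whole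
  space. Their effect on a positive part is controlled by this truncated integral instead.\<close>

lemma small_min:
 fixes f :: "'a::euclidean_space \<Rightarrow> real"
 assumes f: "integrable lborel f" "\<And>x. f x \<ge> 0" and e: "e > 0"
 obtains \<delta> where "\<delta> > 0" "(\<integral>x. min (f x) \<delta>) \<le> e"
proof -
 obtain k where "(\<integral>x. min (f x) (1 / real (Suc k))) < e"
 proof (rule dominated_integral_small[OF f(1) _ _ _ e, of "\<lambda>k x. min (f x) (1 / real (Suc k))"])
  fix x
  have "(\<lambda>k. min (f x) (1 / real (Suc k))) \<longlonglongrightarrow> min (f x) 0"
   by (intro tendsto_min tendsto_const LIMSEQ_Suc[OF lim_1_over_n])
  then show "(\<lambda>k. min (f x) (1 / real (Suc k))) \<longlonglongrightarrow> 0" using f(2)[of x] by simp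
 qed (use f in \<open>auto simp: min_def\<close>)
 then show ?thesis by (intro that[of "1 / real (Suc k)"]) auto
qed

text \<open>The Kobayashi estimate asks for initial bounds of the form
  \<open>E + C * \<tau>\<^sup>2\<close> in both time variables. For short times they come from L^1
  continuity of \<open>n\<close> at \<open>s\<close> and from \<open>euler_drift\<close>, for longer
  times from the bounded mass at the cost of a large \<open>C\<close>. The step \<open>h\<close> is
  chosen after \<open>C\<close>: at the end discrete and continuous time agree, the quadratic term
  vanishes, and only \<open>C * (h * (t - s))\<close> remains.\<close>

theorem lipschitz_approximation:
 fixes n :: "real \<Rightarrow> 'a::euclidean_space \<Rightarrow> real" and f :: "'a \<Rightarrow> real"
 assumes D: "DIM('a) \<ge> 2" and g: "0 < \<gamma>" "\<gamma> \<le> 4 / (real DIM('a) + 3)" and sol: "strong_solution \<gamma> n\<^sub>0 n"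
  and st: "0 < s" "s < t" and f: "\<And>x. 0 \<le> f x" "\<And>x. f x \<le> M" "integrable lborel f"
  and Df: "\<And>x. GDERIV f x :> Df x" "continuous_on UNIV Df" "\<And>x. norm (Df x) \<le> L'" and L: "L-lipschitz_on UNIV f" "L > 0"
  and m: "(\<integral>x. f x) \<le> m" "m > 0" and e: "\<epsilon> > 0"
 defines "\<mu> \<equiv> (\<gamma> * real DIM('a) + 2) / (real DIM('a) + 1)"
 obtains u l where "integrable lborel u" "l-lipschitz_on UNIV u" "l \<le> L"
  "\<gamma> < 4 / (real DIM('a) + 3) \<Longrightarrow> l \<le> (decay_const TYPE('a) \<gamma> m * (t - s)) powr (- 1 / \<mu>)"
  "(\<integral>x. \<bar>u x - n t x\<bar>) \<le> 2 * (\<integral>x. max 0 (n s x - f x)) + ((\<integral>x. f x) - (\<integral>x. n s x)) + \<epsilon>"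
proof -
 let ?D = "real DIM('a)"
 let ?dc = "decay_const TYPE('a) \<gamma> m"
 \<comment> \<open>Initial bounds, remainder \<open>C * (h * (t - s))\<close> and removal of the
   shift contribute one \<theta> each; the passage to the L^1 distance doubles the sum.\<close>
 define \<theta> where "\<theta> = \<epsilon> / 6"
 have th: "\<theta> > 0" using e by (simp add: \<theta>_def)
 have mu: "\<mu> > 0" unfolding \<mu>_def using g(1) by (intro divide_pos_pos add_nonneg_pos) auto
 note n0 = solution_nonneg[OF sol] and ni = solution_integrable[OF sol less_imp_le]
 have t0: "0 < t" using st by simp
 have fm: "f \<in> borel_measurable borel" using borel_measurable_integrable[OF f(3)] by simp
 have nm: "n t \<in> borel_measurable borel" if "0 < t" for t using borel_measurable_integrable[OF ni[OF that]] by simp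
 have mass: "(\<integral>x. n t' x) = (\<integral>x. n s x)" if "s < t'" for t'
  by (rule mass_conserved[OF g(1) sol st(1) that])
 define E0 where "E0 = (\<integral>x. max 0 (n s x - f x))"
 have iE0: "integrable lborel (\<lambda>x. max 0 (n s x - f x))" by (rule integrable_pos_part_diff[OF ni[OF st(1)] n0[OF st(1)] fm f(1)])
 obtain d1 where d1: "d1 > 0" "(\<integral>x. min (n t x) d1) \<le> \<theta>" by (rule small_min[OF ni[OF t0] n0[OF t0] th])
 obtain \<eta> where eta: "\<eta> > 0" "(\<integral>x. min (f x) \<eta>) \<le> \<theta>" by (rule small_min[OF f(3,1) th])
 \<comment> \<open>The Lipschitz bound to be reached if the inequality for \<gamma> is strict;
   otherwise no decay is claimed and 1 is a dummy.\<close>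
 define B where "B = (if \<gamma> < 4 / (?D + 3) then (?dc * (t - s)) powr (- 1 / \<mu>) else 1)"
 have Bp: "B > 0" using decay_const_pos[OF D g(1) _ m(2)] st unfolding B_def by (auto simp: less_imp_neq[symmetric])
 have sbp: "0 < sup_bound TYPE('a) m B"
  unfolding sup_bound_def using sup_const_pos[where 'a = 'a] m(2) Bp by (simp add: less_imp_neq[symmetric])
 \<comment> \<open>\<open>d1\<close> limits what subtracting the shift costs in L^1; the value of
   \<open>sup_bound\<close> at \<open>B\<close> is the threshold required by
   \<open>euler_lipschitz_decay\<close>.\<close>
 define d where "d = min 1 (min d1 (sup_bound TYPE('a) m B))"
 have d: "d > 0" "d \<le> 1" "d \<le> d1" "d \<le> sup_bound TYPE('a) m B" using d1(1) sbp by (auto simp: d_def)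
 \<comment> \<open>The drift \<eta> is split evenly: \<open>2 * L * r = \<eta> / 2\<close> for the
   mollification and \<open>\<tau>0 * Cr \<le> \<eta> / 2\<close> for the elapsed time.\<close>
 define r where "r = \<eta> / (4 * L)"
 have r: "r > 0" "2 * L * r = \<eta> / 2" using eta L(2) by (auto simp: r_def)
 define Cr where "Cr = \<Phi> \<gamma> (M + d) * (\<integral>y. \<bar>lap (\<lambda>b. grad (dird b (moll r))) (y::'a)\<bar>)"
 have Cr: "Cr \<ge> 0" unfolding Cr_def using \<Phi>_nonneg[OF g(1)] by (intro mult_nonneg_nonneg integral_nonneg) auto
 define \<tau>0 where "\<tau>0 = \<eta> / (2 * (Cr + 1))"
 have tau0: "\<tau>0 > 0" "\<tau>0 * Cr \<le> \<eta> / 2" using eta(1) Cr by (auto simp: \<tau>0_def field_simps)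
 from solution_L1_continuous[OF sol less_imp_le[OF st(1)]] th
 have "\<forall>\<^sub>F s' in at s within {0..}. (\<integral>x. \<bar>n s' x - n s x\<bar>) < \<theta>" by (rule order_tendstoD)
 then obtain \<tau>1 where tau1: "\<tau>1 > 0" "\<And>s'. 0 \<le> s' \<Longrightarrow> s' \<noteq> s \<Longrightarrow> dist s' s < \<tau>1 \<Longrightarrow> (\<integral>x. \<bar>n s' x - n s x\<bar>) < \<theta>"
  unfolding eventually_at by auto
 have If: "0 \<le> (\<integral>x. f x)" and In: "0 \<le> (\<integral>x. n s x)" using f(1) n0[OF st(1)] by auto
 \<comment> \<open>From time \<open>\<tau>0\<close> or \<open>\<tau>1\<close> on, the trivial
   bounds, the mass of \<open>f\<close> and twice the mass of \<open>n s\<close>, are at most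
   \<open>C\<close> times the square of the elapsed time.\<close>
 define C where "C = (\<integral>x. f x) / \<tau>0\<^sup>2 + 2 * (\<integral>x. n s x) / \<tau>1\<^sup>2"
 have C: "C \<ge> 0" "(\<integral>x. f x) / \<tau>0\<^sup>2 \<le> C" "2 * (\<integral>x. n s x) / \<tau>1\<^sup>2 \<le> C"
  using If In by (auto simp: C_def)
 define X where "X = (2 powr \<mu> - 1) * L powr - \<mu>"
 have X: "X > 0" unfolding X_def using mu L(2) by (intro mult_pos_pos) (auto simp: less_imp_neq[symmetric])
 \<comment> \<open>The first bound keeps \<open>C * (h * (t - s))\<close> at most \<theta>, the
   second is the smallness condition of \<open>discrete_decay\<close>; adding 1 makes the
   denominators positive.\<close>
 define h0 where "h0 = min (\<theta> / (C * (t - s) + 1)) (X / (\<bar>?dc\<bar> + 1))"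
 have cts: "0 \<le> C * (t - s)" using C(1) st by simp
 have h0: "h0 > 0" unfolding h0_def using th X cts by (simp add: add_nonneg_pos)
 obtain N :: nat where N: "(t - s) / h0 \<le> real N" using real_arch_simple by blast
 have Np: "real N > 0" using N st h0 by (intro less_le_trans[OF _ N]) simp
 define h where "h = (t - s) / real N"
 have h: "h > 0" "real N * h = t - s" "h \<le> h0" using Np st h0 N by (auto simp: h_def field_simps)
 have hC: "C * (h * (t - s)) \<le> \<theta>"
 proof -
  have "h \<le> \<theta> / (C * (t - s) + 1)" using h(3) by (simp add: h0_def)
  then have "h * (C * (t - s) + 1) \<le> \<theta>" using cts by (simp add: pos_le_divide_eq add_nonneg_pos)
  then show ?thesis using h(1) by (simp add: algebra_simps)
 qed
 have hX: "?dc * h \<le> X"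
 proof -
  have "h \<le> X / (\<bar>?dc\<bar> + 1)" using h(3) by (simp add: h0_def)
  then have "h * (\<bar>?dc\<bar> + 1) \<le> X" by (simp add: pos_le_divide_eq add_nonneg_pos)
  moreover have "?dc * h \<le> \<bar>?dc\<bar> * h" using h(1) by (intro mult_right_mono) auto
  moreover have "h * (\<bar>?dc\<bar> + 1) = \<bar>?dc\<bar> * h + h" by (simp add: algebra_simps)
  ultimately show ?thesis using h(1) by linarith
 qed
 obtain v :: "nat \<Rightarrow> 'a \<Rightarrow> real" and l :: "nat \<Rightarrow> real"
 where v0: "v 0 = (\<lambda>x. f x + d)" and l00: "l 0 = L" and v: "\<And>k x. d \<le> v k x" "\<And>k x. v k x \<le> M + d"
  "\<And>k. integrable lborel (\<lambda>x. v k x - d)" "\<And>k. (\<integral>x. v k x - d) = (\<integral>x. f x)"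
  "\<And>k. continuous_on UNIV (v k)" "\<And>k. (l k)-lipschitz_on UNIV (v k)"
  "\<And>k. \<exists>Dv Hv DV HV. C2 (v (Suc k)) Dv Hv \<and> C2 (\<lambda>x. \<Phi> \<gamma> (v (Suc k) x)) DV HV \<and> (\<forall>x. v (Suc k) x - h * lap HV x = v k x)"
  and lstep: "\<And>k. l (Suc k) + h * (lip_rate \<gamma> ?D * (d + sup_bound TYPE('a) m (l (Suc k))) powr (\<gamma> - 2)) * l (Suc k) ^ 3 \<le> l k"
  by (rule implicit_euler[OF D g h(1) d(1) f m(1) Df L(1)]) (rule that)
 have l0: "0 \<le> l k" for k using v(6) lipschitz_on_nonneg by blast
 have vp: "0 \<le> v k x" for k x using v(1)[of k x] d(1) by linarith
 have vm: "v k \<in> borel_measurable borel" for k by (rule borel_measurable_continuous_onI[OF v(5)])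
 have lL: "l k \<le> L" for k
 proof (induction k)
  case (Suc k)
  have "0 \<le> h * (lip_rate \<gamma> ?D * (d + sup_bound TYPE('a) m (l (Suc k))) powr (\<gamma> - 2)) * l (Suc k) ^ 3"
   using h(1) l0[of "Suc k"] lip_rate_nonneg[of ?D \<gamma>] D g by (intro mult_nonneg_nonneg) auto
  then show ?case using lstep[of k] Suc by linarith
 qed (simp add: l00)
 have vL: "L-lipschitz_on UNIV (v k)" for k by (rule lipschitz_on_mono[OF v(6) _ lL]) simp
 have zero: "(\<integral>x. max 0 (n t' x - v 0 x)) \<le> (E0 + \<theta>) + C * (t' - s)\<^sup>2" if t': "t' \<in> {s..t}" for t'
 proof -
  have t'0: "0 < t'" using t' st by auto
  have i: "integrable lborel (\<lambda>x. \<bar>n t' x - n s x\<bar>)" using ni[OF t'0] ni[OF st(1)] by simp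
  have "(\<integral>x. max 0 (n t' x - v 0 x)) \<le> (\<integral>x. max 0 (n s x - f x) + \<bar>n t' x - n s x\<bar>)"
  proof (rule integral_mono)
   show "integrable lborel (\<lambda>x. max 0 (n t' x - v 0 x))" by (rule integrable_pos_part_diff[OF ni[OF t'0] n0[OF t'0] vm vp])
   show "max 0 (n t' x - v 0 x) \<le> max 0 (n s x - f x) + \<bar>n t' x - n s x\<bar>" for x using d(1) unfolding v0 by linarith
  qed (use iE0 i in auto)
  also have "\<dots> = E0 + (\<integral>x. \<bar>n t' x - n s x\<bar>)" unfolding E0_def using iE0 i by simp
  also have "(\<integral>x. \<bar>n t' x - n s x\<bar>) \<le> \<theta> + C * (t' - s)\<^sup>2"
  proof (cases "t' - s < \<tau>1")
   case True
   have "0 \<le> C * (t' - s)\<^sup>2" using C by simp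
   moreover have "(\<integral>x. \<bar>n t' x - n s x\<bar>) \<le> \<theta>"
    using tau1(2)[of t'] True t' t'0 th by (cases "t' = s") (auto simp: dist_real_def)
   ultimately show ?thesis by linarith
  next
   case False
   have "(\<integral>x. \<bar>n t' x - n s x\<bar>) \<le> (\<integral>x. n t' x + n s x)"
   proof (rule integral_mono[OF i])
    show "\<bar>n t' x - n s x\<bar> \<le> n t' x + n s x" for x using n0[OF t'0, of x] n0[OF st(1), of x] by linarith
   qed (use ni[OF t'0] ni[OF st(1)] in auto)
   also have "\<dots> = 2 * (\<integral>x. n s x)" using ni[OF t'0] ni[OF st(1)] mass[of t'] False tau1(1) by simp
   also have "\<dots> = (2 * (\<integral>x. n s x) / \<tau>1\<^sup>2) * \<tau>1\<^sup>2" using tau1(1) by simp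
   also have "\<dots> \<le> C * (t' - s)\<^sup>2" using C In tau1(1) False by (intro mult_mono power_mono) auto
   finally show ?thesis using th by linarith
  qed
  finally show ?thesis by linarith
 qed
 have init: "(\<integral>x. max 0 (n s x - v k x)) \<le> (E0 + \<theta>) + C * (real k * h)\<^sup>2" for k
 proof -
  have i: "integrable lborel (\<lambda>x. max 0 (f x - v k x))" by (rule integrable_pos_part_diff[OF f(3,1) vm vp])
  have "(\<integral>x. max 0 (n s x - v k x)) \<le> (\<integral>x. max 0 (n s x - f x) + max 0 (f x - v k x))"
  proof (rule integral_mono)
   show "integrable lborel (\<lambda>x. max 0 (n s x - v k x))" by (rule integrable_pos_part_diff[OF ni[OF st(1)] n0[OF st(1)] vm vp])
  qed (use iE0 i in auto)
  also have "\<dots> = E0 + (\<integral>x. max 0 (f x - v k x))" unfolding E0_def using iE0 i by simp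
  also have "(\<integral>x. max 0 (f x - v k x)) \<le> \<theta> + C * (real k * h)\<^sup>2"
  proof (cases "real k * h < \<tau>0")
   case True
   have "\<bar>v k x - v 0 x\<bar> \<le> \<eta>" for x
   proof -
    have "\<bar>v k x - v 0 x\<bar> \<le> 2 * L * r + real k * h * Cr"
     unfolding Cr_def by (rule euler_drift[OF g(1) h(1) r(1) less_imp_le[OF d(1)], where v = v, OF v(1,2) vL v(3,7)])
    moreover have "real k * h * Cr \<le> \<tau>0 * Cr" using True Cr by (intro mult_right_mono) auto
    ultimately show ?thesis using r(2) tau0(2) by linarith
   qed
   then have "max 0 (f x - v k x) \<le> min (f x) \<eta>" for x
    using f(1)[of x] vp[of k x] d(1) eta(1) by (auto simp: v0 abs_le_iff) (smt (verit))
   moreover have "integrable lborel (\<lambda>x. min (f x) \<eta>)"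
    by (rule integrable_bound[OF f(3)]) (use f(1) eta(1) fm in \<open>auto intro!: AE_I2\<close>)
   ultimately have "(\<integral>x. max 0 (f x - v k x)) \<le> (\<integral>x. min (f x) \<eta>)"
    by (intro integral_mono[OF i])
   moreover have "0 \<le> C * (real k * h)\<^sup>2" using C by simp
   ultimately show ?thesis using eta(2) by linarith
  next
   case False
   have "(\<integral>x. max 0 (f x - v k x)) \<le> (\<integral>x. f x)"
    by (rule integral_mono[OF i f(3)]) (use f(1) vp in \<open>simp add: add_increasing2\<close>)
   also have "\<dots> = ((\<integral>x. f x) / \<tau>0\<^sup>2) * \<tau>0\<^sup>2" using tau0(1) by simp
   also have "\<dots> \<le> C * (real k * h)\<^sup>2" using C If tau0(1) False by (intro mult_mono power_mono) auto
   finally show ?thesis using th by linarith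
  qed
  finally show ?thesis by linarith
 qed
 have "(\<integral>x. max 0 (n t x - v N x)) \<le> (E0 + \<theta>) + C * ((t - s - real N * h)\<^sup>2 + h * (t - s))"
  by (rule euler_comparison[OF g(1) sol st h(1) vp v(5,7) zero init C(1) order_refl]) (use st in auto)
 then have main: "(\<integral>x. max 0 (n t x - v N x)) \<le> E0 + 2 * \<theta>" using hC h(2) by simp
 define u where "u x = v N x - d" for x
 have ui: "integrable lborel u" unfolding u_def by (rule v(3))
 have up: "0 \<le> u x" for x using v(1)[of N x] by (simp add: u_def)
 have um: "u \<in> borel_measurable borel" using borel_measurable_integrable[OF ui] by simp
 have i1: "integrable lborel (\<lambda>x. max 0 (n t x - u x))" by (rule integrable_pos_part_diff[OF ni[OF t0] n0[OF t0] um up])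
 have i2: "integrable lborel (\<lambda>x. max 0 (n t x - v N x))" by (rule integrable_pos_part_diff[OF ni[OF t0] n0[OF t0] vm vp])
 have i3: "integrable lborel (\<lambda>x. min (n t x) d1)"
  by (rule integrable_bound[OF ni[OF t0]]) (use n0[OF t0] d1(1) nm[OF t0] in \<open>auto simp: min_def intro!: AE_I2\<close>)
 \<comment> \<open>Lowering \<open>v N\<close> by \<open>d\<close> raises the positive part by at
   most \<open>d\<close>, and by no more than \<open>n t x\<close> where that is smaller.\<close>
 have "(\<integral>x. max 0 (n t x - u x)) \<le> (\<integral>x. max 0 (n t x - v N x) + min (n t x) d1)"
 proof (rule integral_mono[OF i1])
  show "max 0 (n t x - u x) \<le> max 0 (n t x - v N x) + min (n t x) d1" for x
   using n0[OF t0, of x] up[of x] d(1,3) d1(1) unfolding u_def by linarith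
 qed (use i2 i3 in auto)
 also have "\<dots> \<le> E0 + 3 * \<theta>" using i2 i3 main d1(2) by simp
 finally have half: "(\<integral>x. max 0 (n t x - u x)) \<le> E0 + 3 * \<theta>" .
 \<comment> \<open>\<open>\<bar>y\<bar> = 2 * max 0 (- y) + y\<close>: as the masses of
   \<open>u\<close> and \<open>n t\<close> are known, the one-sided estimate controls the full L^1
   distance.\<close>
 have "(\<integral>x. \<bar>u x - n t x\<bar>) = (\<integral>x. 2 * max 0 (n t x - u x) + (u x - n t x))"
  by (rule integral_cong) (auto simp: max_def)
 also have "\<dots> = 2 * (\<integral>x. max 0 (n t x - u x)) + ((\<integral>x. u x) - (\<integral>x. n t x))"
  using i1 ui ni[OF t0] by simp
 also have "(\<integral>x. u x) = (\<integral>x. f x)" unfolding u_def by (rule v(4))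
 also have "(\<integral>x. n t x) = (\<integral>x. n s x)" by (rule mass[OF st(2)])
 finally have fin: "(\<integral>x. \<bar>u x - n t x\<bar>) \<le> 2 * (\<integral>x. max 0 (n s x - f x)) + ((\<integral>x. f x) - (\<integral>x. n s x)) + \<epsilon>"
  using half unfolding E0_def \<theta>_def by simp
 show ?thesis
 proof (rule that[OF ui _ lL _ fin])
  show "(l N)-lipschitz_on UNIV u" using v(6)[of N] unfolding lipschitz_on_def u_def by (simp add: dist_real_def)
  assume gs: "\<gamma> < 4 / (?D + 3)"
  have dcp: "?dc * (t - s) > 0" using decay_const_pos[OF D g(1) gs m(2)] st by simp
  have Beq: "B = (?dc * (t - s)) powr (- 1 / \<mu>)" using gs by (simp add: B_def)
  have "B powr - \<mu> = ?dc * (real N * h)" unfolding Beq powr_powr h(2) using dcp mu by simp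
  then have "l N \<le> B"
   by (intro euler_lipschitz_decay[OF D g(1) gs h(1) d(1) m(2), where l = l, OF lstep l0])
    (use hX Bp d(4) in \<open>simp_all add: l00 X_def \<mu>_def\<close>)
  then show "l N \<le> (?dc * (t - s)) powr (- 1 / \<mu>)" unfolding Beq .
 qed
qed

section \<open>Lipschitz functions and weak gradients\<close>

lemma conv_integral:
 fixes \<kappa> F :: "'a::euclidean_space \<Rightarrow> real"
 assumes \<kappa>: "smooth_cpt \<kappa>" "integrable lborel \<kappa>" and F: "integrable lborel F"
 shows "integrable lborel (conv \<kappa> F)" "(\<integral>z. conv \<kappa> F z) = (\<integral>z. \<kappa> z) * (\<integral>z. F z)"
proof -
 note [measurable] = borel_measurable_integrable[OF F] smooth_cpt_borel[OF \<kappa>(1)]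
 have t: "integrable lborel (\<lambda>z. \<kappa> (z - y))" "(\<integral>z. \<kappa> (z - y)) = (\<integral>z. \<kappa> z)"
  "(\<integral>z. \<bar>\<kappa> (z - y)\<bar>) = (\<integral>z. \<bar>\<kappa> z\<bar>)" for y
  using lborel_integrable_affine[of 1 \<kappa> "- y"] lborel_integral_affine[of 1 \<kappa> "- y"] lborel_integral_affine[of 1 "\<lambda>z. \<bar>\<kappa> z\<bar>" "- y"] \<kappa>(2)
  by simp_all
 have i: "integrable (lborel \<Otimes>\<^sub>M lborel) (\<lambda>(y, z). \<kappa> (z - y) * F y)"
 proof (rule lborel_pair.Fubini_integrable)
  show "(\<lambda>(y, z). \<kappa> (z - y) * F y) \<in> borel_measurable (lborel \<Otimes>\<^sub>M lborel)" by measurable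
  show "integrable lborel (\<lambda>y. \<integral>z. norm (case (y, z) of (y, z) \<Rightarrow> \<kappa> (z - y) * F y))"
   using F by (simp add: abs_mult t)
  show "AE y in lborel. integrable lborel (\<lambda>z. case (y, z) of (y, z) \<Rightarrow> \<kappa> (z - y) * F y)"
   by (intro AE_I2) (simp add: t)
 qed
 show "integrable lborel (conv \<kappa> F)" unfolding conv_def[abs_def] by (rule lborel_pair.integrable_snd[OF i])
 have "(\<integral>z. conv \<kappa> F z) = (\<integral>y. \<integral>z. \<kappa> (z - y) * F y)"
  unfolding conv_def by (rule lborel_pair.Fubini_integral[OF i])
 then show "(\<integral>z. conv \<kappa> F z) = (\<integral>z. \<kappa> z) * (\<integral>z. F z)" by (simp add: t)
qed

lemmas conv_moll_integral = conv_integral[OF smooth_cpt_moll integrable_moll]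

lemma conv_moll_mass: "e > 0 \<Longrightarrow> integrable lborel F \<Longrightarrow> (\<integral>z. conv (moll e) F z) = (\<integral>z. F z)"
 by (simp add: conv_moll_integral integral_moll)

lemma conv_diff:
 assumes "smooth_cpt \<kappa>" "integrable lborel F" "integrable lborel G"
 shows "conv \<kappa> (\<lambda>y. F y - G y) z = conv \<kappa> F z - conv \<kappa> G z"
 unfolding conv_def using conv_GDERIV(3)[OF assms(1,2)] conv_GDERIV(3)[OF assms(1,3)] by (simp add: right_diff_distrib)

lemma conv_moll_L1:
 fixes F :: "'a::euclidean_space \<Rightarrow> real"
 assumes e: "e > 0" and F: "integrable lborel F"
 shows "(\<integral>z. \<bar>conv (moll e) F z\<bar>) \<le> (\<integral>z. \<bar>F z\<bar>)"
proof -
 have Fa: "integrable lborel (\<lambda>z. \<bar>F z\<bar>)" using F by simp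
 have "(\<integral>z. \<bar>conv (moll e) F z\<bar>) \<le> (\<integral>z. conv (moll e) (\<lambda>z. \<bar>F z\<bar>) z)"
 proof (rule integral_mono)
  show "\<bar>conv (moll e) F z\<bar> \<le> conv (moll e) (\<lambda>z. \<bar>F z\<bar>) z" for z
   unfolding conv_def using integral_abs_bound[of lborel "\<lambda>y. moll e (z - y) * F y"] by (simp add: abs_mult abs_of_nonneg[OF moll_nonneg[OF e]])
 qed (use conv_moll_integral(1)[OF e e F] conv_moll_integral(1)[OF e e Fa] in auto)
 also have "\<dots> = (\<integral>z. \<bar>F z\<bar>)" by (rule conv_moll_mass[OF e Fa])
 finally show ?thesis .
qed

lemma conv_lipschitz:
 fixes u :: "'a::euclidean_space \<Rightarrow> real"
 assumes e: "e > 0" and u: "integrable lborel u" and K: "K-lipschitz_on UNIV u"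
 shows "K-lipschitz_on UNIV (conv (moll e) u)"
proof (rule lipschitz_onI)
 note [measurable] = borel_measurable_integrable[OF u] smooth_cpt_borel[OF smooth_cpt_moll[OF e]]
 note k = smooth_cpt_moll[OF e, where ?'a = 'a]
 have c: "conv (moll e) u z = (\<integral>y. moll e y * u (z - y))" for z
  unfolding conv_def using integral_reflect[of "\<lambda>y. moll e (z - y) * u y" z] by simp
 have i: "integrable lborel (\<lambda>y. moll e y * u (z - y))" for z
  using integrable_reflect[OF conv_GDERIV(3)[OF k u, of z], of z] by simp
 fix x y :: 'a
 have "\<bar>conv (moll e) u x - conv (moll e) u y\<bar> = \<bar>\<integral>z. moll e z * (u (x - z) - u (y - z))\<bar>"
  unfolding c using i[of x] i[of y] by (simp add: right_diff_distrib)
 also have "\<dots> \<le> (\<integral>z. \<bar>moll e z * (u (x - z) - u (y - z))\<bar>)" by (rule integral_abs_bound)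
 also have "\<dots> \<le> (\<integral>z. moll e (z::'a) * (K * dist x y))"
 proof (rule integral_mono')
  show "integrable lborel (\<lambda>z::'a. moll e z * (K * dist x y))" by (intro integrable_mult_left integrable_moll e)
  fix z :: 'a
  have "\<bar>u (x - z) - u (y - z)\<bar> \<le> K * dist x y" using lipschitz_onD[OF K, of "x - z" "y - z"] by (simp add: dist_norm)
  then show "\<bar>moll e z * (u (x - z) - u (y - z))\<bar> \<le> moll e z * (K * dist x y)"
   using moll_nonneg[OF e, of z] by (simp add: abs_mult mult_left_mono)
  show "0 \<le> moll e z * (K * dist x y)" using moll_nonneg[OF e, of z] lipschitz_on_nonneg[OF K] by simp
 qed
 also have "\<dots> = K * dist x y" using integral_moll[OF e, where ?'a = 'a] by simp
 finally show "dist (conv (moll e) u x) (conv (moll e) u y) \<le> K * dist x y" by (simp add: dist_real_def)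
qed (rule lipschitz_on_nonneg[OF K])

text \<open>Mollification preserves the Lipschitz constant and turns L^1 closeness into uniform
  closeness, with the supremum \<open>B\<close> of the mollifier as factor. The radius is fixed
  first, by continuity of \<open>w\<close> at the two points; \<epsilon> is chosen afterwards in
  terms of \<open>B\<close>.\<close>

lemma lipschitz_L1_limit:
 fixes w :: "'a::euclidean_space \<Rightarrow> real"
 assumes w: "continuous_on UNIV w" "integrable lborel w" and K: "K \<ge> 0"
  and lim: "\<And>\<epsilon>. \<epsilon> > 0 \<Longrightarrow> \<exists>u. integrable lborel u \<and> K-lipschitz_on UNIV u \<and> (\<integral>x. \<bar>u x - w x\<bar>) \<le> \<epsilon>"
 shows "K-lipschitz_on UNIV w"
proof (rule lipschitz_onI[OF _ K])
 fix x y :: 'a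
 have "dist (w x) (w y) \<le> K * dist x y + \<eta>" if eta: "\<eta> > 0" for \<eta>
 proof -
  have "\<exists>d>0. \<forall>z'. dist z' z < d \<longrightarrow> \<bar>w z' - w z\<bar> < \<eta> / 8" for z
   using w(1)[unfolded continuous_on_iff, rule_format, of z "\<eta> / 8"] eta by (simp add: dist_real_def)
  then obtain dx dy where dx: "dx > 0" "\<And>z. dist z x < dx \<Longrightarrow> \<bar>w z - w x\<bar> < \<eta> / 8"
   and dy: "dy > 0" "\<And>z. dist z y < dy \<Longrightarrow> \<bar>w z - w y\<bar> < \<eta> / 8" by meson
  define e where "e = min dx dy / 2"
  have e: "e > 0" "e < dx" "e < dy" using dx(1) dy(1) by (auto simp: e_def)
  note k = smooth_cpt_moll[OF e(1), where ?'a = 'a]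
  obtain B where B: "B \<ge> 0" "\<And>x::'a. \<bar>moll e x\<bar> \<le> B" using smooth_cpt_bounded[OF k] by blast
  define \<epsilon> where "\<epsilon> = \<eta> / (8 * (B + 1))"
  have ep: "\<epsilon> > 0" "B * \<epsilon> \<le> \<eta> / 8" using eta B(1) by (auto simp: \<epsilon>_def field_simps)
  obtain u where u: "integrable lborel u" "K-lipschitz_on UNIV u" "(\<integral>x. \<bar>u x - w x\<bar>) \<le> \<epsilon>" using lim[OF ep(1)] by blast
  have cu: "\<bar>conv (moll e) u z - conv (moll e) w z\<bar> \<le> \<eta> / 8" for z
  proof -
   have i: "integrable lborel (\<lambda>y. u y - w y)" using u w by simp
   have "\<bar>conv (moll e) u z - conv (moll e) w z\<bar> = \<bar>\<integral>y. moll e (z - y) * (u y - w y)\<bar>"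
    by (subst conv_diff[OF k u(1) w(2), symmetric]) (simp add: conv_def)
   also have "\<dots> \<le> (\<integral>y. B * \<bar>u y - w y\<bar>)"
    using integral_norm_bound_integral[OF conv_GDERIV(3)[OF k i, of z], of "\<lambda>y. B * \<bar>u y - w y\<bar>"] i B
    by (simp add: abs_mult mult_right_mono)
   also have "\<dots> \<le> B * \<epsilon>" using u(3) B(1) by (simp add: mult_left_mono)
   finally show ?thesis using ep(2) by linarith
  qed
  have cw: "\<bar>conv (moll e) w z - w z\<bar> \<le> \<eta> / 8" if "z = x \<or> z = y" for z
  proof (rule conv_moll_close[OF e(1) w(2)])
   fix z' assume "z' \<in> cball z e"
   then have "dist z' z \<le> e" by (simp add: dist_commute)
   then show "\<bar>w z' - w z\<bar> \<le> \<eta> / 8" using that dx(2)[of z'] dy(2)[of z'] e by fastforce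
  qed
  have "\<bar>conv (moll e) u x - conv (moll e) u y\<bar> \<le> K * dist x y"
   using lipschitz_onD[OF conv_lipschitz[OF e(1) u(1,2)], of x y] by (simp add: dist_real_def)
  then show ?thesis using cu[of x] cu[of y] cw[OF disjI1[OF refl]] cw[OF disjI2[OF refl]] eta unfolding dist_real_def by linarith
 qed
 then show "dist (w x) (w y) \<le> K * dist x y" by (rule field_le_epsilon)
qed

lemma lipschitz_GDERIV_norm:
 fixes f :: "'a::euclidean_space \<Rightarrow> real"
 assumes K: "K-lipschitz_on UNIV f" and D: "GDERIV f x :> D"
 shows "norm D \<le> K"
proof (cases "D = 0")
 case False
 have "((\<lambda>t. f (x + t *\<^sub>R D)) has_derivative (\<lambda>t. (t *\<^sub>R D) \<bullet> D)) (at 0)"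
  by (rule has_derivative_compose[of "\<lambda>t. x + t *\<^sub>R D" "\<lambda>t. t *\<^sub>R D"]) (use D in \<open>auto simp: gderiv_def intro!: derivative_eq_intros\<close>)
 then have "((\<lambda>t. f (x + t *\<^sub>R D)) has_real_derivative (norm D)\<^sup>2) (at 0)"
  by (simp add: has_field_derivative_def power2_norm_eq_inner mult.commute[of _ "D \<bullet> D"])
 then have "((\<lambda>t. (f (x + t *\<^sub>R D) - f x) / t) \<longlongrightarrow> (norm D)\<^sup>2) (at 0)" by (simp add: DERIV_def)
 then have "(norm D)\<^sup>2 \<le> K * norm D"
 proof (rule tendsto_upperbound)
  show "\<forall>\<^sub>F t in at 0. (f (x + t *\<^sub>R D) - f x) / t \<le> K * norm D"
   unfolding eventually_at
  proof (intro exI[of _ 1] conjI ballI impI)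
   fix t :: real assume t: "t \<noteq> 0 \<and> dist t 0 < 1"
   have "\<bar>f (x + t *\<^sub>R D) - f x\<bar> \<le> K * (\<bar>t\<bar> * norm D)"
    using lipschitz_onD[OF K, of "x + t *\<^sub>R D" x] by (simp add: dist_norm)
   then have "\<bar>f (x + t *\<^sub>R D) - f x\<bar> / \<bar>t\<bar> \<le> K * norm D" using t by (simp add: field_simps)
   then show "(f (x + t *\<^sub>R D) - f x) / t \<le> K * norm D" by (simp add: abs_divide[symmetric] del: abs_divide)
  qed simp
 qed simp
 then show ?thesis using False by (simp add: power2_eq_square)
qed (use lipschitz_on_nonneg[OF K] in simp)

text \<open>The convolution is nonnegative, so the positive part is at most \<open>w\<close> and
  dominated convergence applies. This one-sided distance is the one in the conclusion of
  \<open>lipschitz_approximation\<close>.\<close>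

lemma conv_moll_deficit:
 fixes w :: "'a::euclidean_space \<Rightarrow> real"
 assumes w: "continuous_on UNIV w" "integrable lborel w" "\<And>x. w x \<ge> 0" and eta: "\<eta> > 0"
 obtains e where "e > 0" "(\<integral>x. max 0 (w x - conv (moll e) w x)) \<le> \<eta>"
proof -
 define e where "e k = 1 / real (Suc k)" for k
 have e: "e k > 0" for k by (simp add: e_def)
 have cm: "conv (moll (e k)) w \<in> borel_measurable borel" for k
  by (intro borel_measurable_continuous_onI smooth_continuous conv_smooth smooth_cpt_moll e w)
 have cp: "0 \<le> conv (moll (e k)) w x" for k x
  unfolding conv_def by (intro integral_nonneg mult_nonneg_nonneg moll_nonneg e w)
 obtain k where "(\<integral>x. max 0 (w x - conv (moll (e k)) w x)) < \<eta>"
 proof (rule dominated_integral_small[OF w(2) _ _ _ eta, of "\<lambda>k x. max 0 (w x - conv (moll (e k)) w x)"])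
  fix x
  have "(\<lambda>k. conv (moll (e k)) w x) \<longlonglongrightarrow> w x"
  proof (rule LIMSEQ_I)
   fix r :: real assume r: "0 < r"
   then obtain d where d: "d > 0" "\<And>z. dist z x < d \<Longrightarrow> \<bar>w z - w x\<bar> < r / 2"
    using w(1)[unfolded continuous_on_iff, rule_format, of x "r / 2"] by (auto simp: dist_real_def)
   have "e \<longlonglongrightarrow> 0" unfolding e_def[abs_def] using LIMSEQ_Suc[OF lim_1_over_n] .
   then have "\<forall>\<^sub>F k in sequentially. e k < d" using d(1) by (rule order_tendstoD)
   then obtain N where N: "\<And>k. k \<ge> N \<Longrightarrow> e k < d" unfolding eventually_sequentially by blast
   have "norm (conv (moll (e k)) w x - w x) < r" if "k \<ge> N" for k
   proof -
    have "\<bar>conv (moll (e k)) w x - w x\<bar> \<le> r / 2"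
    proof (rule conv_moll_close[OF e w(2)])
     fix z assume "z \<in> cball x (e k)"
     then have "dist z x < d" using N[OF that] by (simp add: dist_commute)
     then show "\<bar>w z - w x\<bar> \<le> r / 2" using d(2) by force
    qed
    then show ?thesis using r by simp
   qed
   then show "\<exists>N. \<forall>k\<ge>N. norm (conv (moll (e k)) w x - w x) < r" by blast
  qed
  then have "(\<lambda>k. max 0 (w x - conv (moll (e k)) w x)) \<longlonglongrightarrow> max 0 (w x - w x)"
   by (intro tendsto_max tendsto_diff tendsto_const)
  then show "(\<lambda>k. max 0 (w x - conv (moll (e k)) w x)) \<longlonglongrightarrow> 0" by simp
 qed (use w cm cp in \<open>auto simp: max_def\<close>)
 then show ?thesis by (intro that[OF e[of k]]) simp
qed

text \<open>Test the weak gradient with the mollifier centred at \<open>z\<close>, in the direction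
  of the gradient of the convolution at \<open>z\<close>. The mollifier is a probability density, so
  the bound \<open>K\<close> passes through, and one factor \<open>norm v\<close> cancels.\<close>

lemma weak_gradient_conv_lipschitz:
 fixes u :: "'a::euclidean_space \<Rightarrow> real"
 assumes e: "e > 0" and u: "integrable lborel u" and g: "weak_gradient u G" and K: "K \<ge> 0" "AE x in lborel. norm (G x) \<le> K"
 shows "K-lipschitz_on UNIV (conv (moll e) u)" "\<And>z. norm (grad (conv (moll e) u) z) \<le> K"
proof -
 note k = smooth_cpt_moll[OF e, where ?'a = 'a]
 have s: "smooth (conv (moll e) u)" by (rule conv_smooth[OF k u])
 show n: "norm (grad (conv (moll e) u) z) \<le> K" for z
 proof (cases "grad (conv (moll e) u) z = 0")
  case False
  define v where "v = grad (conv (moll e) u) z"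
  define \<phi> where "\<phi> y = moll e (z - y)" for y
  have C: "C2 \<phi> (\<lambda>y. - grad (moll e) (z - y)) (\<lambda>b y. grad (dird b (moll e)) (z - y))"
   unfolding \<phi>_def[abs_def] by (rule C2_reflect[OF smooth_C2[OF moll_smooth]])
  have d\<phi>: "dird v \<phi> y = - dird v (moll e) (z - y)" for y
   using GDERIV_dird[OF C2_GDERIV[OF C]] dird_eq_grad[OF smooth_differentiable[OF moll_smooth], where v = v and x = "z - y"] by simp
  have s\<phi>: "smooth \<phi>"
  proof (rule smoothI[where P = "\<lambda>\<phi>. \<exists>\<kappa>::'a \<Rightarrow> real. smooth \<kappa> \<and> \<phi> = (\<lambda>y. \<kappa> (z - y))"])
   show "\<exists>\<kappa>. smooth \<kappa> \<and> \<phi> = (\<lambda>y. \<kappa> (z - y))" unfolding \<phi>_def[abs_def] using moll_smooth by blast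
   fix f :: "'a \<Rightarrow> real" and w assume "\<exists>\<kappa>. smooth \<kappa> \<and> f = (\<lambda>y. \<kappa> (z - y))"
   then obtain \<kappa> where \<kappa>: "smooth \<kappa>" "f = (\<lambda>y. \<kappa> (z - y))" by blast
   note G = C2_GDERIV[OF C2_reflect[OF smooth_C2[OF \<kappa>(1)], of z], folded \<kappa>(2)]
   show "f differentiable at x" for x using G by (rule GDERIV_differentiable)
   have "dird w f = (\<lambda>y. dird (- w) \<kappa> (z - y))"
    using GDERIV_dird[OF G] dird_eq_grad[OF smooth_differentiable[OF \<kappa>(1)], where v = "- w"] by (simp add: fun_eq_iff)
   then show "\<exists>\<kappa>. smooth \<kappa> \<and> dird w f = (\<lambda>y. \<kappa> (z - y))" using smooth_dird[OF \<kappa>(1)] by blast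
  qed
  have t: "\<phi> \<in> test_functions UNIV"
   by (rule test_functionI[OF s\<phi> compact_cball[of z e]]) (use e in \<open>auto simp: \<phi>_def dist_norm norm_minus_commute intro!: moll_zero\<close>)
  have ip: "integrable lborel \<phi>" unfolding \<phi>_def[abs_def] by (rule integrable_reflect[OF integrable_moll[OF e]])
  have p0: "0 \<le> \<phi> y" for y by (simp add: \<phi>_def moll_nonneg[OF e])
  have I1: "(\<integral>y. \<phi> y) = 1"
   unfolding \<phi>_def using integral_reflect[of "moll e" z, OF smooth_cpt_borel[OF k]] integral_moll[OF e, where ?'a = 'a] by simp
  have "v \<bullet> v = dird v (conv (moll e) u) z" unfolding v_def using dird_eq_grad[OF smooth_differentiable[OF s]] by simp
  also have "\<dots> = - (\<integral>y. u y * dird v \<phi> y)" unfolding conv_dird[OF k u] conv_def d\<phi> by (simp add: mult.commute)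
  also have "\<dots> = (\<integral>y. (G y \<bullet> v) * \<phi> y)"
   using g t unfolding weak_gradient_def weak_directional_derivative_def by simp
  also have "\<dots> \<le> (\<integral>y. (K * norm v) * \<phi> y)"
  proof (rule integral_mono_AE')
   show "integrable lborel (\<lambda>y. (K * norm v) * \<phi> y)" using ip by simp
   show "AE y in lborel. (G y \<bullet> v) * \<phi> y \<le> (K * norm v) * \<phi> y"
    using K(2)
   proof eventually_elim
    case (elim y)
    then have "norm (G y) * norm v \<le> K * norm v" by (rule mult_right_mono) simp
    then have "G y \<bullet> v \<le> K * norm v" using norm_cauchy_schwarz[of "G y" v] by linarith
    then show ?case using p0 by (rule mult_right_mono)
   qed
   show "AE y in lborel. 0 \<le> (K * norm v) * \<phi> y" using K(1) p0 by simp
  qed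
  also have "\<dots> = K * norm v" using I1 by simp
  finally have "norm v * norm v \<le> K * norm v" by (simp add: dot_square_norm power2_eq_square)
  then show ?thesis using False by (simp add: v_def)
 qed (use K in simp)
 show "K-lipschitz_on UNIV (conv (moll e) u)" by (rule GDERIV_bounded_lipschitz[OF smooth_GDERIV[OF s] n])
qed

section \<open>Bounded weak gradients of Lipschitz functions\<close>

text \<open>Dyadic convex combinations of the tail of a sequence: the least class containing the
  tail that is closed under the midpoints of the parallelogram identity. It stands in for a weak
  compactness argument.\<close>

inductive_set midpoint_hull :: "(nat \<Rightarrow> 'a \<Rightarrow> 'b::real_vector) \<Rightarrow> nat \<Rightarrow> ('a \<Rightarrow> 'b) set" for g k where
 base: "k \<le> j \<Longrightarrow> g j \<in> midpoint_hull g k"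
| mid: "f \<in> midpoint_hull g k \<Longrightarrow> h \<in> midpoint_hull g k \<Longrightarrow> (\<lambda>x. (1 / 2) *\<^sub>R (f x + h x)) \<in> midpoint_hull g k"

lemma midpoint_hull_antimono: "k \<le> l \<Longrightarrow> midpoint_hull g l \<subseteq> midpoint_hull g k"
proof
 fix f assume "k \<le> l" "f \<in> midpoint_hull g l"
 from this(2,1) show "f \<in> midpoint_hull g k" by induction (auto intro: midpoint_hull.intros)
qed

lemma midpoint_hull_bounded:
 fixes g :: "nat \<Rightarrow> 'a::euclidean_space \<Rightarrow> 'b::euclidean_space"
 assumes "f \<in> midpoint_hull g k" and g: "\<And>j. g j \<in> borel_measurable borel" "\<And>j x. norm (g j x) \<le> K"
 shows "f \<in> borel_measurable borel" "norm (f x) \<le> K"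
proof -
 have "f \<in> borel_measurable borel \<and> (\<forall>x. norm (f x) \<le> K)"
  using assms(1)
 proof induction
  case (mid f h)
  have "norm ((1 / 2) *\<^sub>R (f x + h x)) \<le> K" for x
  proof -
   have "norm (f x) \<le> K" "norm (h x) \<le> K" using mid.IH by auto
   then show ?thesis using norm_triangle_ineq[of "f x" "h x"] by simp
  qed
  then show ?case using mid.IH by auto
 qed (use g in auto)
 then show "f \<in> borel_measurable borel" "norm (f x) \<le> K" by auto
qed

lemma parallelogram: "(norm ((1 / 2) *\<^sub>R (a + b)))\<^sup>2 = (norm a)\<^sup>2 / 2 + (norm b)\<^sup>2 / 2 - (norm (a - b :: 'b::real_inner))\<^sup>2 / 4"
 unfolding power2_norm_eq_inner by (simp add: inner_add_left inner_add_right inner_diff_left inner_diff_right inner_commute[of b a] field_simps)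

text \<open>Almost minimal elements of the decreasing sequence of hulls form a Cauchy sequence in \<open>L\<^sup>2\<close>
 with a Gaussian weight, by the parallelogram identity.\<close>

lemma midpoint_hull_converges:
 fixes g :: "nat \<Rightarrow> 'a::euclidean_space \<Rightarrow> 'b::euclidean_space"
 assumes g: "\<And>j. g j \<in> borel_measurable borel" "\<And>j x. norm (g j x) \<le> K"
 obtains h G where "\<And>i. h i \<in> midpoint_hull g i" "G \<in> borel_measurable borel" "AE x in lborel. (\<lambda>i. h i x) \<longlonglongrightarrow> G x"
proof -
 define Q where "Q = (\<integral>x. gauss (x::'a))"
 have Q: "Q > 0" using gauss_mass_pos[where 'a = 'a] by (simp add: Q_def gauss_mass_def)
 define N where "N f = (\<integral>x. gauss x * (norm (f x))\<^sup>2)" for f :: "'a \<Rightarrow> 'b"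
 have i: "integrable lborel (\<lambda>x. gauss x * (norm (f x))\<^sup>2)"
  if "f \<in> borel_measurable borel" "\<And>x. norm (f x) \<le> c" for f :: "'a \<Rightarrow> 'b" and c
 proof (rule integrable_mult_bounded[OF integrable_gauss, where B = "c\<^sup>2"])
  show "\<bar>(norm (f x))\<^sup>2\<bar> \<le> c\<^sup>2" for x using that(2)[of x] by (simp add: power_mono)
 qed (use that in simp)
 note hull = midpoint_hull_bounded[OF _ g]
 have K0: "0 \<le> K" using norm_ge_zero[of "g 0 undefined"] g(2)[of 0 undefined] by linarith
 have N0: "0 \<le> N f" for f unfolding N_def by (intro integral_nonneg) (simp add: less_imp_le[OF gauss_pos])
 have NK: "N f \<le> K\<^sup>2 * Q" if "f \<in> midpoint_hull g k" for f k
 proof -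
  have "N f \<le> (\<integral>x. gauss (x::'a) * K\<^sup>2)" unfolding N_def
   by (rule integral_mono[OF i[OF hull[OF that]]])
    (use integrable_gauss hull(2)[OF that] in \<open>auto intro!: mult_left_mono power_mono less_imp_le[OF gauss_pos]\<close>)
  then show ?thesis by (simp add: Q_def mult.commute)
 qed
 define d where "d k = (INF f\<in>midpoint_hull g k. N f)" for k
 have ne: "midpoint_hull g k \<noteq> {}" for k using midpoint_hull.base[of k k g] by blast
 have bdd: "bdd_below (N ` midpoint_hull g k)" for k using N0 by (intro bdd_belowI[of _ 0]) auto
 have dN: "d k \<le> N f" if "f \<in> midpoint_hull g k" for f k unfolding d_def by (rule cINF_lower[OF bdd that])
 have inc: "incseq d"
  unfolding d_def by (intro monoI cINF_superset_mono ne bdd midpoint_hull_antimono) auto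
 have dK: "d k \<le> K\<^sup>2 * Q" for k using dN[OF midpoint_hull.base[OF order_refl]] NK[OF midpoint_hull.base[OF order_refl]] order_trans by blast
 obtain c where c: "d \<longlonglongrightarrow> c" "\<And>k. d k \<le> c" using incseq_convergent[OF inc, of "K\<^sup>2 * Q"] dK by blast
 have "\<exists>f\<in>midpoint_hull g k. N f < d k + 1 / real (Suc k)" for k
  using cINF_less_iff[OF ne bdd, of k "d k + 1 / real (Suc k)"] by (simp add: d_def)
 then obtain h where h: "\<And>k. h k \<in> midpoint_hull g k" "\<And>k. N (h k) < d k + 1 / real (Suc k)" by metis
 have hm: "h k \<in> borel_measurable borel" and hK: "norm (h k x) \<le> K" for k x using hull[OF h(1)] by auto
 have id: "integrable lborel (\<lambda>x. gauss x * (norm (h a x - h b x))\<^sup>2)" for a b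
 proof (rule i[where c = "2 * K"])
  show "norm (h a x - h b x) \<le> 2 * K" for x using norm_triangle_ineq4[of "h a x" "h b x"] hK[of a x] hK[of b x] by linarith
 qed (use hm in simp)
 have close: "N (\<lambda>x. h a x - h b x) \<le> 4 * (c - d k + 1 / real (Suc k))" if ab: "k \<le> a" "k \<le> b" for a b k
 proof -
  have ha: "h a \<in> midpoint_hull g k" "h b \<in> midpoint_hull g k" using h(1) midpoint_hull_antimono ab by blast+
  have "d k \<le> N (\<lambda>x. (1 / 2) *\<^sub>R (h a x + h b x))" by (rule dN[OF midpoint_hull.mid[OF ha]])
  also have "\<dots> = (\<integral>x. (gauss x * (norm (h a x))\<^sup>2) / 2 + (gauss x * (norm (h b x))\<^sup>2) / 2 - (gauss x * (norm (h a x - h b x))\<^sup>2) / 4)"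
   unfolding N_def parallelogram by (simp add: algebra_simps)
  also have "\<dots> = N (h a) / 2 + N (h b) / 2 - N (\<lambda>x. h a x - h b x) / 4"
   unfolding N_def using i[OF hm hK] id by simp
  finally have "N (\<lambda>x. h a x - h b x) / 4 \<le> N (h a) / 2 + N (h b) / 2 - d k" by linarith
  moreover have "1 / real (Suc a) \<le> 1 / real (Suc k)" "1 / real (Suc b) \<le> 1 / real (Suc k)" using ab by (auto simp: frac_le)
  moreover have "N (h a) \<le> c + 1 / real (Suc k)" "N (h b) \<le> c + 1 / real (Suc k)"
   using h(2)[of a] h(2)[of b] c(2)[of a] c(2)[of b] calculation(2,3) by linarith+
  ultimately show ?thesis unfolding right_diff_distrib distrib_left by linarith
 qed
 obtain r where r: "strict_mono r" "AE x in lborel. Cauchy (\<lambda>j. gauss x *\<^sub>R h (r j) x)"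
 proof (rule cauchy_L1_AE_cauchy_subseq[where s = "\<lambda>j x. gauss x *\<^sub>R h j x" and M = lborel])
  show "integrable lborel (\<lambda>x. gauss x *\<^sub>R h j x)" for j
  proof (rule integrable_bound[where f = "\<lambda>x. gauss x * K"])
   show "AE x in lborel. norm (gauss x *\<^sub>R h j x) \<le> norm (gauss x * K)"
    using hK K0 by (auto simp: abs_mult intro!: AE_I2 mult_left_mono)
  qed (use integrable_gauss hm in auto)
  fix e :: real assume e: "e > 0"
  \<comment> \<open>Closeness in weighted L^2 becomes closeness in weighted L^1 through
    \<open>y \<le> \<tau> + y\<^sup>2 / \<tau>\<close>, with \<tau> such that the first term
    integrates to \<open>e / 4\<close>.\<close>
  define \<tau> where "\<tau> = e / (4 * Q)"
  have tau: "\<tau> > 0" "\<tau> * Q = e / 4" using e Q by (auto simp: \<tau>_def)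
  have "(\<lambda>k. 4 * (c - d k + 1 / real (Suc k))) \<longlonglongrightarrow> 4 * (c - c + 0)"
   by (intro tendsto_intros c(1)) (rule LIMSEQ_Suc[OF lim_1_over_n])
  then have "\<forall>\<^sub>F k in sequentially. 4 * (c - d k + 1 / real (Suc k)) < \<tau> * (e / 4)" using tau e by (intro order_tendstoD) auto
  then obtain k where k: "4 * (c - d k + 1 / real (Suc k)) < \<tau> * (e / 4)" using eventually_happens'[OF sequentially_bot] by blast
  have "(\<integral>x. norm (gauss x *\<^sub>R h a x - gauss x *\<^sub>R h b x)) < e" if ab: "a \<ge> k" "b \<ge> k" for a b
  proof -
   have "(\<integral>x. norm (gauss x *\<^sub>R h a x - gauss x *\<^sub>R h b x)) \<le> (\<integral>x. \<tau> * gauss x + (gauss x * (norm (h a x - h b x))\<^sup>2) / \<tau>)"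
   proof (rule integral_mono')
    show "integrable lborel (\<lambda>x. \<tau> * gauss x + (gauss x * (norm (h a x - h b x))\<^sup>2) / \<tau>)" using id integrable_gauss by auto
    fix x
    let ?y = "norm (h a x - h b x)"
    have "?y \<le> \<tau> + ?y\<^sup>2 / \<tau>"
    proof (cases "?y \<le> \<tau>")
     case False
     then have "?y * \<tau> \<le> ?y\<^sup>2" using tau(1) by (simp add: power2_eq_square mult_left_mono)
     then show ?thesis using tau(1) by (simp add: field_simps add_increasing)
    qed (use tau(1) in \<open>simp add: add_increasing2\<close>)
    then have "gauss x * ?y \<le> gauss x * (\<tau> + ?y\<^sup>2 / \<tau>)" by (intro mult_left_mono less_imp_le[OF gauss_pos])
    then show "norm (gauss x *\<^sub>R h a x - gauss x *\<^sub>R h b x) \<le> \<tau> * gauss x + (gauss x * ?y\<^sup>2) / \<tau>"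
     unfolding scaleR_right_diff_distrib[symmetric] using gauss_pos[of x] by (simp add: distrib_left mult.commute)
    show "0 \<le> \<tau> * gauss x + (gauss x * ?y\<^sup>2) / \<tau>" using tau(1) gauss_pos[of x] by simp
   qed
   also have "\<dots> = \<tau> * Q + N (\<lambda>x. h a x - h b x) / \<tau>" using id integrable_gauss[where 'a = 'a] by (simp add: N_def Q_def)
   also have "N (\<lambda>x. h a x - h b x) / \<tau> \<le> \<tau> * (e / 4) / \<tau>" using close[OF ab] k tau(1) by (intro divide_right_mono) auto
   finally show ?thesis using tau e by simp
  qed
  then show "\<exists>N. \<forall>a\<ge>N. \<forall>b\<ge>N. (\<integral>x. norm (gauss x *\<^sub>R h a x - gauss x *\<^sub>R h b x)) < e" by blast
 qed
 define G where "G x = (1 / gauss x) *\<^sub>R lim (\<lambda>j. gauss x *\<^sub>R h (r j) x)" for x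
 show ?thesis
 proof (rule that[of "\<lambda>j. h (r j)" G])
  show "h (r j) \<in> midpoint_hull g j" for j using h(1)[of "r j"] midpoint_hull_antimono[OF seq_suble[OF r(1), of j]] by blast
  show "G \<in> borel_measurable borel" unfolding G_def[abs_def]
   by (intro borel_measurable_scaleR borel_measurable_lim_metric borel_measurable_divide borel_measurable_const borel_gauss hm)
  show "AE x in lborel. (\<lambda>j. h (r j) x) \<longlonglongrightarrow> G x"
   using r(2)
  proof eventually_elim
   case (elim x)
   then have "(\<lambda>j. gauss x *\<^sub>R h (r j) x) \<longlonglongrightarrow> lim (\<lambda>j. gauss x *\<^sub>R h (r j) x)"
    by (simp add: Cauchy_convergent_iff convergent_LIMSEQ_iff)
   from tendsto_scaleR[OF tendsto_const this, of "1 / gauss x"] show ?case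
    using gauss_pos[of x] by (simp add: G_def)
  qed
 qed
qed

lemma integral_dird_by_parts:
 fixes f :: "'a::euclidean_space \<Rightarrow> real"
 assumes f: "smooth f" and \<phi>: "\<phi> \<in> test_functions UNIV"
 shows "(\<integral>x. dird v f x * \<phi> x) = - (\<integral>x. f x * dird v \<phi> x)"
proof -
 note s = test_function_smooth[OF \<phi>]
 obtain K where K: "compact K" "\<And>x. x \<notin> K \<Longrightarrow> \<phi> x = 0" by (rule test_function_support[OF \<phi>]) (rule that)
 have G: "GDERIV (\<lambda>x. f x * \<phi> x) x :> f x *\<^sub>R grad \<phi> x + \<phi> x *\<^sub>R grad f x" for x
  by (intro GDERIV_mult smooth_GDERIV f s)
 have vG: "v \<bullet> (f x *\<^sub>R grad \<phi> x + \<phi> x *\<^sub>R grad f x) = f x * dird v \<phi> x + dird v f x * \<phi> x" for x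
  by (simp add: inner_add_right dird_eq_grad[OF smooth_differentiable[OF f]] dird_eq_grad[OF smooth_differentiable[OF s]])
 have c: "continuous_on UNIV (\<lambda>x. f x * dird v \<phi> x)" "continuous_on UNIV (\<lambda>x. dird v f x * \<phi> x)"
  by (intro continuous_on_mult smooth_continuous smooth_dird f s)+
 have "integrable lborel (\<lambda>x. f x * dird v \<phi> x)" "integrable lborel (\<lambda>x. dird v f x * \<phi> x)"
  by (rule integrable_compact_support[OF c(1) K(1)], simp add: dird_zero_off[OF compact_imp_closed[OF K(1)] K(2)])
   (rule integrable_compact_support[OF c(2) K(1)], simp add: K(2))
 moreover have "(\<integral>x. v \<bullet> (f x *\<^sub>R grad \<phi> x + \<phi> x *\<^sub>R grad f x)) = 0"
  by (rule integral_GDERIV_eq_0(2)[OF G _ K(1)]) (use c K(2) in \<open>auto simp: vG intro!: continuous_on_add\<close>)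
 ultimately show ?thesis unfolding vG by simp
qed

text \<open>The gradients of the mollifications are bounded by \<open>K\<close>. Their own pointwise
  convergence would amount to differentiability almost everywhere; convex combinations of them
  converge almost everywhere by a Hilbert space argument, and the weak identity, being linear,
  passes to such combinations.\<close>

lemma lipschitz_weak_gradient:
 fixes u :: "'a::euclidean_space \<Rightarrow> real"
 assumes u: "integrable lborel u" and K: "K-lipschitz_on UNIV u"
 obtains G where "weak_gradient u G" "G \<in> borel_measurable borel" "AE x in lborel. norm (G x) \<le> K"
proof -
 define e where "e j = 1 / real (Suc j)" for j
 have e: "e j > 0" for j by (simp add: e_def)
 define g where "g j = grad (conv (moll (e j)) u)" for j
 have s: "smooth (conv (moll (e j)) u)" for j by (intro conv_smooth smooth_cpt_moll e u)
 have gm: "g j \<in> borel_measurable borel" for j unfolding g_def by (intro borel_measurable_continuous_onI smooth_grad_continuous s)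
 have gK: "norm (g j x) \<le> K" for j x
  unfolding g_def by (rule lipschitz_GDERIV_norm[OF conv_lipschitz[OF e u K] smooth_GDERIV[OF s]])
 obtain h G where h: "\<And>i. h i \<in> midpoint_hull g i" and G: "G \<in> borel_measurable borel" and lim: "AE x in lborel. (\<lambda>i. h i x) \<longlonglongrightarrow> G x"
  by (rule midpoint_hull_converges[OF gm gK]) (rule that)
 note hull = midpoint_hull_bounded[OF _ gm gK]
 have K0: "0 \<le> K" by (rule lipschitz_on_nonneg[OF K])
 have GK: "AE x in lborel. norm (G x) \<le> K"
  using lim
 proof eventually_elim
  case (elim x)
  show ?case by (rule tendsto_upperbound[OF tendsto_norm[OF elim]]) (use hull(2)[OF h] in auto)
 qed
 have loc: "locally_integrable UNIV (\<lambda>x. F x)"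
  if "F \<in> borel_measurable borel" "AE x in lborel. norm (F x) \<le> B" for F :: "'a \<Rightarrow> 'c::euclidean_space" and B
  unfolding locally_integrable_def set_integrable_def
 proof (intro allI impI)
  fix C :: "'a set" assume C: "compact C \<and> C \<subseteq> UNIV"
  show "integrable lborel (\<lambda>x. indicator C x *\<^sub>R F x)"
  proof (rule integrable_bound[where f = "\<lambda>x. indicator C x * B"])
   show "integrable lborel (\<lambda>x. indicator C x * B)"
    using C emeasure_compact_finite[of C] by (intro integrable_mult_left integrable_real_indicator) (auto intro: borel_compact)
   show "(\<lambda>x. indicator C x *\<^sub>R F x) \<in> borel_measurable lborel" using that(1) C by (simp add: compact_imp_closed)
   show "AE x in lborel. norm (indicator C x *\<^sub>R F x) \<le> norm (indicator C x * B)"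
    using that(2) by eventually_elim (auto simp: indicator_def)
  qed
 qed
 have cu: "continuous_on UNIV u" by (rule lipschitz_on_continuous_on[OF K])
 have main: "(\<integral>x. u x * dird v \<phi> x) = - (\<integral>x. (G x \<bullet> v) * \<phi> x)" if \<phi>: "\<phi> \<in> test_functions UNIV" for \<phi> v
 proof -
  obtain C where C: "compact C" "\<And>x. x \<notin> C \<Longrightarrow> \<phi> x = 0" by (rule test_function_support[OF \<phi>]) (rule that)
  note sp = test_function_smooth[OF \<phi>]
  have ip: "integrable lborel \<phi>" by (rule integrable_compact_support[OF smooth_continuous[OF sp] C])
  have idp: "integrable lborel (dird v \<phi>)"
   by (rule integrable_compact_support[OF smooth_continuous[OF smooth_dird[OF sp]] C(1)])
    (rule dird_zero_off[OF compact_imp_closed[OF C(1)] C(2)])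
  have vb: "\<bar>y \<bullet> v\<bar> \<le> K * norm v" if "norm y \<le> K" for y
   using Cauchy_Schwarz_ineq2[of y v] mult_right_mono[OF that, of "norm v"] by simp
  have i: "integrable lborel (\<lambda>x. (f x \<bullet> v) * \<phi> x)" if "f \<in> midpoint_hull g k" for f k
   using integrable_mult_bounded[OF ip, of "\<lambda>x. f x \<bullet> v" "K * norm v"] hull(1)[OF that] vb[OF hull(2)[OF that]]
   by (simp add: mult.commute)
  define c where "c = (\<integral>x. \<bar>dird v \<phi> x\<bar>)"
  \<comment> \<open>Induction over the hull. For a mollified gradient, integration by parts leaves
    the distance of the mollification to \<open>u\<close>, at most \<open>K * e j\<close>; the
    average of two such errors obeys the same bound.\<close>
  have bound: "\<bar>(\<integral>x. (f x \<bullet> v) * \<phi> x) + (\<integral>x. u x * dird v \<phi> x)\<bar> \<le> K * e k * c"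
   if "f \<in> midpoint_hull g k" for f k
   using that
  proof induction
   case (base j)
   let ?w = "conv (moll (e j)) u"
   have gv: "g j x \<bullet> v = dird v ?w x" for x by (simp add: g_def dird_eq_grad[OF smooth_differentiable[OF s]] inner_commute)
   have close: "\<bar>?w x - u x\<bar> \<le> K * e j" for x
   proof (rule conv_moll_close[OF e u])
    fix y assume y: "y \<in> cball x (e j)"
    have "\<bar>u y - u x\<bar> \<le> K * dist y x" using lipschitz_onD[OF K, of y x] by (simp add: dist_real_def)
    also have "\<dots> \<le> K * e j" using y K0 by (intro mult_left_mono) (auto simp: dist_commute)
    finally show "\<bar>u y - u x\<bar> \<le> K * e j" .
   qed
   have bd: "integrable lborel (\<lambda>x. q x * dird v \<phi> x)" if "continuous_on UNIV q" for q
    by (rule integrable_compact_support[OF continuous_on_mult[OF that smooth_continuous[OF smooth_dird[OF sp]]] C(1)])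
     (simp add: dird_zero_off[OF compact_imp_closed[OF C(1)] C(2)])
   note bd = bd[OF smooth_continuous[OF s]] bd[OF cu]
   have "(\<integral>x. (g j x \<bullet> v) * \<phi> x) + (\<integral>x. u x * dird v \<phi> x) = - (\<integral>x. (?w x - u x) * dird v \<phi> x)"
    unfolding gv integral_dird_by_parts[OF s \<phi>] using bd by (simp add: left_diff_distrib)
   then have "\<bar>(\<integral>x. (g j x \<bullet> v) * \<phi> x) + (\<integral>x. u x * dird v \<phi> x)\<bar> \<le> (\<integral>x. \<bar>(?w x - u x) * dird v \<phi> x\<bar>)"
    using integral_abs_bound[of lborel "\<lambda>x. (?w x - u x) * dird v \<phi> x"] by simp
   also have "\<dots> \<le> (\<integral>x. (K * e j) * \<bar>dird v \<phi> x\<bar>)"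
    by (rule integral_mono') (use idp close K0 less_imp_le[OF e] in \<open>auto simp: abs_mult mult_right_mono\<close>)
   also have "\<dots> = K * e j * c" by (simp add: c_def)
   also have "\<dots> \<le> K * e k * c"
    using base K0 by (intro mult_right_mono mult_left_mono) (auto simp: e_def frac_le c_def)
   finally show ?case .
  next
   case (mid f h)
   have "(\<integral>x. ((1 / 2) *\<^sub>R (f x + h x) \<bullet> v) * \<phi> x) = (\<integral>x. (f x \<bullet> v) * \<phi> x / 2 + (h x \<bullet> v) * \<phi> x / 2)"
    by (rule integral_cong) (auto simp: inner_add_left field_simps)
   also have "\<dots> = (\<integral>x. (f x \<bullet> v) * \<phi> x) / 2 + (\<integral>x. (h x \<bullet> v) * \<phi> x) / 2"
    using i[OF mid.hyps(1)] i[OF mid.hyps(2)] by simp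
   finally have "(\<integral>x. ((1 / 2) *\<^sub>R (f x + h x) \<bullet> v) * \<phi> x) = (\<integral>x. (f x \<bullet> v) * \<phi> x) / 2 + (\<integral>x. (h x \<bullet> v) * \<phi> x) / 2" .
   with mid.IH show ?case by linarith
  qed
  have l1: "(\<lambda>k. \<integral>x. (h k x \<bullet> v) * \<phi> x) \<longlonglongrightarrow> (\<integral>x. (G x \<bullet> v) * \<phi> x)"
  proof (rule integral_dominated_convergence[where w = "\<lambda>x. (K * norm v) * \<bar>\<phi> x\<bar>"])
   show "AE x in lborel. (\<lambda>k. (h k x \<bullet> v) * \<phi> x) \<longlonglongrightarrow> (G x \<bullet> v) * \<phi> x"
    using lim by eventually_elim (intro tendsto_intros)
   show "AE x in lborel. norm ((h k x \<bullet> v) * \<phi> x) \<le> (K * norm v) * \<bar>\<phi> x\<bar>" for k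
    using vb[OF hull(2)[OF h]] by (auto intro!: AE_I2 mult_right_mono simp: abs_mult)
  qed (use ip G hull(1)[OF h] borel_measurable_integrable[OF ip] in auto)
  have "(\<lambda>k. K * e k * c) \<longlonglongrightarrow> K * 0 * c"
   unfolding e_def by (intro tendsto_intros) (rule LIMSEQ_Suc[OF lim_1_over_n])
  then have "(\<lambda>k. K * e k * c) \<longlonglongrightarrow> 0" by simp
  then have "(\<lambda>k. (\<integral>x. (h k x \<bullet> v) * \<phi> x) + (\<integral>x. u x * dird v \<phi> x)) \<longlonglongrightarrow> 0"
   by (rule Lim_null_comparison[rotated]) (intro always_eventually allI, simp only: real_norm_def, rule bound[OF h])
  from LIMSEQ_unique[OF this tendsto_add[OF l1 tendsto_const]] show ?thesis by simp
 qed
 have "weak_gradient u G"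
  unfolding weak_gradient_def weak_directional_derivative_def
 proof (intro conjI allI ballI)
  show "locally_integrable UNIV G" by (rule loc[OF G GK])
  show "locally_integrable UNIV u"
   unfolding locally_integrable_def set_integrable_def
   by (intro allI impI borel_integrable_compact continuous_on_subset[OF cu]) auto
  fix v
  show "locally_integrable UNIV (\<lambda>x. G x \<bullet> v)"
  proof (rule loc)
   show "AE x in lborel. norm (G x \<bullet> v) \<le> K * norm v"
    using GK
   proof eventually_elim
    case (elim x)
    from mult_right_mono[OF this, of "norm v"] show ?case using Cauchy_Schwarz_ineq2[of "G x" v] by simp
   qed
  qed (use G in simp)
 qed (rule main)
 then show ?thesis using G GK by (rule that)
qed

section \<open>Gradient bounds for the solution\<close>

lemma lipschitz_max_grad_sq:
 fixes w :: "'a::euclidean_space \<Rightarrow> real"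
 assumes "integrable lborel w" "K-lipschitz_on UNIV w"
 shows "max_grad_sq w \<le> ereal (K\<^sup>2)"
proof -
 obtain G where G: "weak_gradient w G" "G \<in> borel_measurable borel" "AE x in lborel. norm (G x) \<le> K"
  by (rule lipschitz_weak_gradient[OF assms])
 have "esssup lborel (\<lambda>x. ereal ((norm (G x))\<^sup>2)) \<le> ereal (K\<^sup>2)"
 proof (rule esssup_I)
  show "(\<lambda>x. ereal ((norm (G x))\<^sup>2)) \<in> borel_measurable lborel" using G(2) by simp
  show "AE x in lborel. ereal ((norm (G x))\<^sup>2) \<le> ereal (K\<^sup>2)" using G(3) by eventually_elim (simp add: power_mono)
 qed
 then show ?thesis unfolding max_grad_sq_def using G(1) by (intro INF_lower2[of G]) auto
qed

text \<open>The infimum selects a gradient only under a strict inequality. If \<open>c\<close> were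
  nonpositive, a squared norm would be negative almost everywhere.\<close>

lemma max_grad_sq_lessD:
 fixes q :: "'a::euclidean_space \<Rightarrow> real"
 assumes "max_grad_sq q < ereal c"
 obtains G where "weak_gradient q G" "AE x in lborel. norm (G x) \<le> sqrt c" "c > 0"
proof -
 obtain G where G: "weak_gradient q G" "esssup lborel (\<lambda>x. ereal ((norm (G x))\<^sup>2)) < ereal c"
  using assms unfolding max_grad_sq_def INF_less_iff by auto
 have lt: "AE x in lborel. (norm (G x))\<^sup>2 < c"
  using esssup_AE[where M = lborel and f = "\<lambda>x. ereal ((norm (G x))\<^sup>2)"]
 proof eventually_elim
  case (elim x)
  then show ?case using G(2) by (simp add: order_le_less_trans[of "ereal ((norm (G x))\<^sup>2)"] flip: ereal_less_eq(3) less_ereal.simps(1))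
 qed
 have "c > 0"
 proof (rule ccontr)
  assume c: "\<not> c > 0"
  have "AE x::'a in lborel. False"
   using lt by eventually_elim (use c zero_le_power2 in \<open>smt (verit)\<close>)
  then show False by (simp add: eventually_False ae_filter_eq_bot_iff)
 qed
 moreover have "AE x in lborel. norm (G x) \<le> sqrt c"
  using lt by eventually_elim (simp add: real_le_rsqrt)
 ultimately show ?thesis using G(1) by (intro that)
qed

lemma solution_slice_continuous:
 assumes "strong_solution \<gamma> n\<^sub>0 n" "0 < t" shows "continuous_on UNIV (n t)"
proof -
 have "continuous_on UNIV (\<lambda>x. joint n (t, x))"
  by (rule continuous_on_compose2[OF solution_continuous[OF assms(1)]])
   (use assms(2) in \<open>auto simp: space_time_def intro!: continuous_intros\<close>)
 then show ?thesis by (simp add: joint_apply)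
qed

lemma conv_moll_gradient_bounded:
 fixes F :: "'a::euclidean_space \<Rightarrow> real"
 assumes e: "e > 0" and F: "integrable lborel F"
 obtains L where "L > 0" "\<And>x. norm (grad (conv (moll e) F) x) \<le> L"
proof -
 note k = smooth_cpt_moll[OF e, where ?'a = 'a]
 have "\<exists>B. \<forall>x. \<bar>dird b (conv (moll e) F) x\<bar> \<le> B" for b
  unfolding conv_dird[OF k F] by (rule conv_bounded[OF smooth_cpt_dird[OF k] F])
 then obtain B where B: "\<And>b x. \<bar>dird b (conv (moll e) F) x\<bar> \<le> B b" by metis
 have B0: "0 \<le> B b" for b using abs_ge_zero[of "dird b (conv (moll e) F) 0"] B[of 0 b] by linarith
 show ?thesis
 proof (rule that[of "(\<Sum>b\<in>Basis. B b) + 1"])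
  show "0 < (\<Sum>b\<in>Basis. B b) + 1" using B0 by (intro add_nonneg_pos sum_nonneg) auto
  show "norm (grad (conv (moll e) F) x) \<le> (\<Sum>b\<in>Basis. B b) + 1" for x
  proof -
   have "norm (grad (conv (moll e) F) x) \<le> (\<Sum>b\<in>Basis. norm (dird b (conv (moll e) F) x *\<^sub>R b))"
    unfolding grad_def by (rule norm_sum)
   also have "\<dots> \<le> (\<Sum>b\<in>Basis. B b)" using B by (intro sum_mono) simp
   finally show ?thesis by simp
  qed
 qed
qed

text \<open>The gradient bound is given at time \<open>s\<close>, possibly 0, while the equation
  holds for positive times only. The scheme is therefore compared with the solution from a slightly
  later time \<open>s'\<close> on, but its datum is the mollification of \<open>n s\<close>: this
  inherits the bound \<open>K\<close>, and L^1 continuity keeps it close to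
  \<open>n s'\<close>.\<close>

lemma lipschitz_constant_preserved:
 fixes n :: "real \<Rightarrow> 'a::euclidean_space \<Rightarrow> real"
 assumes D: "DIM('a) \<ge> 2" and g: "0 < \<gamma>" "\<gamma> \<le> 4 / (real DIM('a) + 3)" and sol: "strong_solution \<gamma> n\<^sub>0 n"
  and n\<^sub>0: "AE x in lborel. n\<^sub>0 x \<ge> 0" and st: "0 \<le> s" "s < t"
  and G: "weak_gradient (n s) G" "AE x in lborel. norm (G x) \<le> K" and K: "K > 0"
 shows "K-lipschitz_on UNIV (n t)"
proof (rule lipschitz_L1_limit)
 have t: "0 < t" using st by simp
 note ni = solution_integrable[OF sol]
 show "continuous_on UNIV (n t)" "integrable lborel (n t)" "0 \<le> K"
  using solution_slice_continuous[OF sol t] ni[of t] t K by auto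
 \<comment> \<open>At time 0 nonnegativity is inherited from the datum and holds almost everywhere
   only.\<close>
 have ns: "AE x in lborel. 0 \<le> n s x"
 proof (cases "s = 0")
  case True
  have "AE x in lborel. n 0 x = n\<^sub>0 x" using sol unfolding strong_solution_def by blast
  then show ?thesis using n\<^sub>0 unfolding True by eventually_elim simp
 next
  case False
  then have "0 < s" using st(1) by simp
  then show ?thesis by (intro AE_I2 solution_nonneg[OF sol])
 qed
 fix \<epsilon> :: real assume e: "\<epsilon> > 0"
 define \<theta> where "\<theta> = \<epsilon> / 6"
 have th: "\<theta> > 0" using e by (simp add: \<theta>_def)
 from solution_L1_continuous[OF sol st(1)] th
 have "\<forall>\<^sub>F s' in at s within {0..}. (\<integral>x. \<bar>n s' x - n s x\<bar>) < \<theta>" by (rule order_tendstoD)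
 then obtain \<tau> where tau: "\<tau> > 0" "\<And>s'. 0 \<le> s' \<Longrightarrow> s' \<noteq> s \<Longrightarrow> dist s' s < \<tau> \<Longrightarrow> (\<integral>x. \<bar>n s' x - n s x\<bar>) < \<theta>"
  unfolding eventually_at by auto
 define s' where "s' = s + min \<tau> (t - s) / 2"
 have s': "s < s'" "s' < t" "0 < s'" "dist s' s < \<tau>"   proof -
  have "0 < min \<tau> (t - s)" using tau(1) st by simp
  then have "0 < min \<tau> (t - s) / 2" "min \<tau> (t - s) / 2 < \<tau>" "min \<tau> (t - s) / 2 < t - s" by (auto simp: min_def split: if_splits)
  then show "s < s'" "s' < t" "0 < s'" "dist s' s < \<tau>" using st unfolding s'_def dist_real_def by linarith+
 qed
 have close: "(\<integral>x. \<bar>n s' x - n s x\<bar>) \<le> \<theta>" using tau(2)[of s'] s' by simp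
 note n's = solution_nonneg[OF sol s'(3)]
 have i: "integrable lborel (n s)" "integrable lborel (n s')" using ni st s' by auto
 obtain r where r: "r > 0" "(\<integral>x. max 0 (n s' x - conv (moll r) (n s') x)) \<le> \<theta>"
  by (rule conv_moll_deficit[OF solution_slice_continuous[OF sol s'(3)] i(2) n's th])
 note k = smooth_cpt_moll[OF r(1), where ?'a = 'a]
 define f where "f = conv (moll r) (n s)"
 have f0: "0 \<le> f x" for x
  unfolding f_def conv_def
  by (rule integral_nonneg_AE) (use ns in \<open>eventually_elim, simp add: moll_nonneg[OF r(1)]\<close>)
 obtain M where M: "\<And>x. \<bar>f x\<bar> \<le> M" unfolding f_def using conv_bounded[OF k i(1)] by blast
 have fM: "f x \<le> M" for x using M[of x] by linarith
 have fi: "integrable lborel f" and fmass: "(\<integral>x. f x) = (\<integral>x. n s x)"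
  unfolding f_def using conv_moll_integral(1)[OF r(1) r(1) i(1)] conv_moll_mass[OF r(1) i(1)] by auto
 have sf: "smooth f" unfolding f_def by (rule conv_smooth[OF k i(1)])
 note wl = weak_gradient_conv_lipschitz[OF r(1) i(1) G(1) less_imp_le[OF K] G(2), folded f_def]
 have If: "0 \<le> (\<integral>x. f x)" using f0 by simp
 obtain u l where u: "integrable lborel u" "l-lipschitz_on UNIV u" "l \<le> K"
  "(\<integral>x. \<bar>u x - n t x\<bar>) \<le> 2 * (\<integral>x. max 0 (n s' x - f x)) + ((\<integral>x. f x) - (\<integral>x. n s' x)) + \<theta>"
  by (rule lipschitz_approximation[OF D g sol s'(3,2) f0 fM fi smooth_GDERIV[OF sf] smooth_grad_continuous[OF sf] wl(2) wl(1) K, of "(\<integral>x. f x) + 1"])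
   (use If th in auto)
 have i1: "integrable lborel (\<lambda>x. max 0 (n s' x - conv (moll r) (n s') x))"
  using i(2) conv_moll_integral(1)[OF r(1) r(1) i(2)] by auto
 have i2: "integrable lborel (\<lambda>x. \<bar>conv (moll r) (\<lambda>y. n s' y - n s y) x\<bar>)"
  by (rule integrable_abs[OF conv_moll_integral(1)[OF r(1) r(1) integrable_diff[OF i(2,1)]]])
 have "(\<integral>x. max 0 (n s' x - f x)) \<le> (\<integral>x. max 0 (n s' x - conv (moll r) (n s') x) + \<bar>conv (moll r) (\<lambda>y. n s' y - n s y) x\<bar>)"
 proof (rule integral_mono)
  show "max 0 (n s' x - f x) \<le> max 0 (n s' x - conv (moll r) (n s') x) + \<bar>conv (moll r) (\<lambda>y. n s' y - n s y) x\<bar>" for x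
   unfolding conv_diff[OF k i(2,1)] f_def by linarith
 qed (use i1 i2 i fi in auto)
 also have "\<dots> = (\<integral>x. max 0 (n s' x - conv (moll r) (n s') x)) + (\<integral>x. \<bar>conv (moll r) (\<lambda>y. n s' y - n s y) x\<bar>)"
  using i1 i2 by simp
 also have "\<dots> \<le> \<theta> + \<theta>"
  using r(2) conv_moll_L1[OF r(1) integrable_diff[OF i(2,1)]] close by linarith
 finally have 1: "(\<integral>x. max 0 (n s' x - f x)) \<le> 2 * \<theta>" by simp
 have "(\<integral>x. f x) - (\<integral>x. n s' x) = - (\<integral>x. n s' x - n s x)" unfolding fmass using i by simp
 also have "\<dots> \<le> (\<integral>x. \<bar>n s' x - n s x\<bar>)" using integral_abs_bound[of lborel "\<lambda>x. n s' x - n s x"] by linarith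
 finally have 2: "(\<integral>x. f x) - (\<integral>x. n s' x) \<le> \<theta>" using close by linarith
 have "(\<integral>x. \<bar>u x - n t x\<bar>) \<le> \<epsilon>" using u(4) 1 2 unfolding \<theta>_def by linarith
 then show "\<exists>u. integrable lborel u \<and> K-lipschitz_on UNIV u \<and> (\<integral>x. \<bar>u x - n t x\<bar>) \<le> \<epsilon>"
  using u(1) lipschitz_on_mono[OF u(2) subset_UNIV u(3)] by blast
qed

text \<open>At time \<open>t / 2\<close> no gradient bound is known. The mollified slice has some
  Lipschitz constant, which influences only how small the Euler step must be and is absent from the
  resulting bound. Mass is conserved, so it may be read off at time 1; adding 1 makes
  \<open>m\<close> positive.\<close>

lemma lipschitz_constant_decay:
 fixes n :: "real \<Rightarrow> 'a::euclidean_space \<Rightarrow> real"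
 assumes D: "DIM('a) \<ge> 2" and g: "0 < \<gamma>" "\<gamma> < 4 / (real DIM('a) + 3)" and sol: "strong_solution \<gamma> n\<^sub>0 n" and t: "0 < t"
 defines "\<mu> \<equiv> (\<gamma> * real DIM('a) + 2) / (real DIM('a) + 1)" and "m \<equiv> (\<integral>x. n 1 x) + 1"
 shows "((decay_const TYPE('a) \<gamma> m * (t / 2)) powr (- 1 / \<mu>))-lipschitz_on UNIV (n t)" (is "?B-lipschitz_on _ _")
proof (rule lipschitz_L1_limit)
 note ni = solution_integrable[OF sol less_imp_le]
 show "continuous_on UNIV (n t)" "integrable lborel (n t)" "0 \<le> ?B"
  using solution_slice_continuous[OF sol t] ni t by auto
 define s where "s = t / 2"
 have s: "0 < s" "s < t" "t - s = t / 2" using t by (auto simp: s_def)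
 note n0 = solution_nonneg[OF sol]
 have mass: "(\<integral>x. n s x) = (\<integral>x. n 1 x)"
  using mass_conserved[OF g(1) sol, of s 1] mass_conserved[OF g(1) sol, of 1 s] s by (cases s "1::real" rule: linorder_cases) auto
 have m: "m > 0" unfolding m_def using n0[of 1] by (intro add_nonneg_pos integral_nonneg) auto
 fix \<epsilon> :: real assume e: "\<epsilon> > 0"
 define \<theta> where "\<theta> = \<epsilon> / 3"
 have th: "\<theta> > 0" using e by (simp add: \<theta>_def)
 obtain r where r: "r > 0" "(\<integral>x. max 0 (n s x - conv (moll r) (n s) x)) \<le> \<theta>"
  by (rule conv_moll_deficit[OF solution_slice_continuous[OF sol s(1)] ni[OF s(1)] n0[OF s(1)] th])
 note k = smooth_cpt_moll[OF r(1), where ?'a = 'a]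
 define f where "f = conv (moll r) (n s)"
 have f0: "0 \<le> f x" for x
  unfolding f_def conv_def by (intro integral_nonneg mult_nonneg_nonneg moll_nonneg r n0 s)
 obtain M where M: "\<And>x. \<bar>f x\<bar> \<le> M" unfolding f_def using conv_bounded[OF k ni[OF s(1)]] by blast
 have fM: "f x \<le> M" for x using M[of x] by linarith
 have fi: "integrable lborel f" and fmass: "(\<integral>x. f x) = (\<integral>x. n s x)"
  unfolding f_def using conv_moll_integral(1)[OF r(1) r(1) ni[OF s(1)]] conv_moll_mass[OF r(1) ni[OF s(1)]] by auto
 have sf: "smooth f" unfolding f_def by (rule conv_smooth[OF k ni[OF s(1)]])
 obtain L where L: "L > 0" "\<And>x. norm (grad f x) \<le> L" by (rule conv_moll_gradient_bounded[OF r(1) ni[OF s(1)], folded f_def]) (rule that)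
 have fm: "(\<integral>x. f x) \<le> m" unfolding fmass mass m_def by simp
 obtain u l where u: "integrable lborel u" "l-lipschitz_on UNIV u"
  "\<gamma> < 4 / (real DIM('a) + 3) \<Longrightarrow> l \<le> (decay_const TYPE('a) \<gamma> m * (t - s)) powr (- 1 / \<mu>)"
  "(\<integral>x. \<bar>u x - n t x\<bar>) \<le> 2 * (\<integral>x. max 0 (n s x - f x)) + ((\<integral>x. f x) - (\<integral>x. n s x)) + \<theta>"
  by (rule lipschitz_approximation[OF D g(1) less_imp_le[OF g(2)] sol s(1,2) f0 fM fi smooth_GDERIV[OF sf] smooth_grad_continuous[OF sf] L(2)
   GDERIV_bounded_lipschitz[OF smooth_GDERIV[OF sf] L(2)] L(1) fm m th, folded \<mu>_def]) (rule that; simp)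
 have "(\<integral>x. \<bar>u x - n t x\<bar>) \<le> \<epsilon>" using u(4) r(2) unfolding fmass f_def[symmetric] \<theta>_def by linarith
 moreover have "?B-lipschitz_on UNIV u" using lipschitz_on_mono[OF u(2) subset_UNIV u(3)[OF g(2)]] unfolding s(3) .
 ultimately show "\<exists>u. integrable lborel u \<and> ?B-lipschitz_on UNIV u \<and> (\<integral>x. \<bar>u x - n t x\<bar>) \<le> \<epsilon>" using u(1) by blast
qed

theorem corollary1p17:
  fixes \<gamma> :: real
    and n\<^sub>0 :: "real ^ 'd \<Rightarrow> real"
    and n :: "real \<Rightarrow> real ^ 'd \<Rightarrow> real"
  assumes "CARD('d) \<ge> 2"
    and "0 < \<gamma>" and "\<gamma> \<le> 4 / (real CARD('d) + 3)"
    and "integrable lborel n\<^sub>0" and "AE x in lborel. n\<^sub>0 x \<ge> 0"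
    and "strong_solution \<gamma> n\<^sub>0 n"
  shows "antimono_on {0..} (\<lambda>t. max_grad_sq (n t)) \<and>
    (\<gamma> < 4 / (real CARD('d) + 3) \<longrightarrow>
      (let d = real CARD('d); \<alpha> = 1 / (d * \<gamma> + 2)
       in \<exists>C>0. \<forall>t>0. max_grad_sq (n t) \<le> ereal (C * t powr (- 1 - \<alpha> * d * (2 - \<gamma>)))))"
proof (intro conjI impI)
 note sol = assms(6)
 have dim: "DIM(real ^ 'd) = CARD('d)" by simp
 have D: "DIM(real ^ 'd) \<ge> 2" and g: "\<gamma> \<le> 4 / (real DIM(real ^ 'd) + 3)" unfolding dim by (fact assms)+
 note ni = solution_integrable[OF sol]
 show "antimono_on {0..} (\<lambda>t. max_grad_sq (n t))"
 proof (rule monotone_onI)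
  fix s t :: real assume "s \<in> {0..}" "t \<in> {0..}" "s \<le> t"
  then have st: "0 \<le> s" "s \<le> t" by auto
  show "max_grad_sq (n t) \<le> max_grad_sq (n s)"
  proof (cases "s = t")
   case False
   then have lt: "s < t" using st by simp
   show ?thesis
   \<comment> \<open>Approximation from above: a value above the gradient bound at time
     \<open>s\<close> is infinite or a real \<open>c\<close>, and in the second case
     \<open>sqrt c\<close> is a Lipschitz constant at time \<open>t\<close>.\<close>
   proof (rule dense_ge)
    fix z assume z: "max_grad_sq (n s) < z"
    show "max_grad_sq (n t) \<le> z"
    proof (cases z)
     case (real c)
     obtain G where G: "weak_gradient (n s) G" "AE x in lborel. norm (G x) \<le> sqrt c" and c: "c > 0"
      by (rule max_grad_sq_lessD[OF z[unfolded real]])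
     have "(sqrt c)-lipschitz_on UNIV (n t)"
      by (rule lipschitz_constant_preserved[OF D assms(2) g sol assms(5) st(1) lt G]) (use c in simp)
     from lipschitz_max_grad_sq[OF ni this] show ?thesis using st c real by simp
    qed (use z in auto)
   qed
  qed simp
 qed
 assume gs: "\<gamma> < 4 / (real CARD('d) + 3)"
 define m where "m = (\<integral>x. n 1 x) + 1"
 define d where "d = real CARD('d)"
 define dc where "dc = decay_const TYPE(real ^ 'd) \<gamma> m"
 define \<mu> where "\<mu> = (\<gamma> * d + 2) / (d + 1)"
 have d: "d \<ge> 2" using assms(1) by (simp add: d_def)
 have gs': "\<gamma> < 4 / (real DIM(real ^ 'd) + 3)" unfolding dim by (fact gs)
 have m: "m > 0" unfolding m_def using sol by (intro add_nonneg_pos integral_nonneg) (auto simp: strong_solution_def)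
 have dc: "dc > 0" unfolding dc_def by (rule decay_const_pos[OF D assms(2) gs' m])
 have gd: "0 < \<gamma> * d + 2" using assms(2) d by (intro add_nonneg_pos) auto
 \<comment> \<open>The bound \<open>l\<close> on the gradient is of order
   \<open>t powr (- 1 / \<mu>)\<close> and gets squared;
   \<open>2 * (d + 1) = (\<gamma> * d + 2) + d * (2 - \<gamma>)\<close> brings the exponent into the
   stated form.\<close>
 have ex: "- 1 / \<mu> * 2 = - 1 - 1 / (d * \<gamma> + 2) * d * (2 - \<gamma>)"
 proof -
  have "- 1 / \<mu> * 2 = - 2 * (d + 1) / (\<gamma> * d + 2)" using gd d by (simp add: \<mu>_def)
  also have "\<dots> = (- (\<gamma> * d + 2) - d * (2 - \<gamma>)) / (\<gamma> * d + 2)" by (simp add: algebra_simps)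
  also have "\<dots> = - ((\<gamma> * d + 2) / (\<gamma> * d + 2)) - d * (2 - \<gamma>) / (\<gamma> * d + 2)" by (simp only: diff_divide_distrib minus_divide_left)
  also have "(\<gamma> * d + 2) / (\<gamma> * d + 2) = 1" by (rule divide_self) (use gd in simp)
  finally show ?thesis by (simp add: mult.commute)
 qed
 have "max_grad_sq (n t) \<le> ereal ((dc / 2) powr (- 1 / \<mu> * 2) * t powr (- 1 / \<mu> * 2))" if t: "t > 0" for t
 proof -
  have "((dc * (t / 2)) powr (- 1 / \<mu>))-lipschitz_on UNIV (n t)"
   using lipschitz_constant_decay[OF D assms(2) gs' sol t] by (simp add: dc_def m_def \<mu>_def d_def)
  from lipschitz_max_grad_sq[OF ni this] have "max_grad_sq (n t) \<le> ereal (((dc * (t / 2)) powr (- 1 / \<mu>))\<^sup>2)" using t by simp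
  also have "((dc * (t / 2)) powr (- 1 / \<mu>))\<^sup>2 = (dc / 2 * t) powr (- 1 / \<mu> * 2)"
   unfolding power2_eq_square powr_add[symmetric] by simp
  also have "\<dots> = (dc / 2) powr (- 1 / \<mu> * 2) * t powr (- 1 / \<mu> * 2)" by (rule powr_mult)
  finally show ?thesis .
 qed
 moreover have "0 < (dc / 2) powr (- 1 / \<mu> * 2)" using dc by simp
 ultimately show "let d = real CARD('d); \<alpha> = 1 / (d * \<gamma> + 2)
    in \<exists>C>0. \<forall>t>0. max_grad_sq (n t) \<le> ereal (C * t powr (- 1 - \<alpha> * d * (2 - \<gamma>)))"
  unfolding Let_def ex d_def[symmetric] by blast
qed

end
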